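(* For every simple matroid $M$ on a finite ground set, the augmented Chow ring $\mathrm{CH}(M)$ has a Koszul filtration. In particular, $R = \mathrm{CH}(M)$ has a rational Poincaré series; that is, $\sum_{i \ge 0} \dim_{\mathbb{Q}} \mathrm{Tor}^R_i(\mathbb{Q},\mathbb{Q})\, t^i$ is a rational function of $t$.
   Context: Let $M$ be a simple matroid (no loops, no parallel elements) on a finite set $E$, with lattice of flats $\mathcal{L}$. The augmented Chow ring of $M$ is the quotient ring $$\mathrm{CH}(M) = \mathbb{Q}[y_i, x_F \mid i \in E,\ F \in \mathcal{L} \setminus \{E\}]\,/\,(I_M + J_M),$$ where $I_M = \left(y_i - \sum_{F \not\ni i} x_F \mid i \in E\right)$ (for each $i$, the sum is over all flats $F$ not containing $i$) and $J_M = (x_F x_G \mid F, G \in \mathcal{L}\setminus\{E\} \text{ incomparable}) + (y_i x_F \mid i \in E,\ F \in \mathcal{L}\setminus\{E\},\ i \notin F)$. It is graded with all $y_i$ and $x_F$ in degree $1$. Let $R = \bigoplus_{i \ge 0} R_i$ be a standard graded algebra over a field $\mathbb{K} = R_0$ (commutative, finitely generated over $\mathbb{K}$ by elements of degree one), and $R_+ = \bigoplus_{i\ge1} R_i$; $\mathbb{K}$ is an $R$-module via $\mathbb{K} = R/R_+$. A family $\mathcal{F}$ of ideals of $R$ is a Koszul filtration of $R$ if: (1) every ideal $I \in \mathcal{F}$ is generated by linear forms (elements of $R_1$); (2) the ideals $(0)$ and $R_+$ are in $\mathcal{F}$; (3) for every nonzero $I \in \mathcal{F}$ there exists $J \in \mathcal{F}$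 such that $J \subsetneq I$, $I/J$ is cyclic, and $(J : I) \in \mathcal{F}$. *)

theory Defs
  imports
    "HOL-Algebra.QuotRing"
    "HOL-Algebra.Subrings"
    "HOL-Algebra.Generated_Rings"
    "HOL-Algebra.Generated_Groups"
    "HOL-Library.Poly_Mapping"
    "HOL-Computational_Algebra.Polynomial_FPS"
    "Jordan_Normal_Form.Missing_VectorSpace"
begin

section \<open>Matroids and their flats\<close>

definition matroid :: "'a set \<Rightarrow> ('a set \<Rightarrow> bool) \<Rightarrow> bool" where
  "matroid E indep \<longleftrightarrow>
     finite E \<and>
     (\<forall>I. indep I \<longrightarrow> I \<subseteq> E) \<and>
     indep {} \<and>
     (\<forall>I J. indep J \<and> I \<subseteq> J \<longrightarrow> indep I) \<and>
     (\<forall>I J. indep I \<and> indep J \<and> card I < card J \<longrightarrow> (\<exists>x\<in>J - I. indep (insert x I)))"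

definition loop :: "'a set \<Rightarrow> ('a set \<Rightarrow> bool) \<Rightarrow> 'a \<Rightarrow> bool" where
  "loop E indep x \<longleftrightarrow> x \<in> E \<and> \<not> indep {x}"

definition parallel_elements :: "'a set \<Rightarrow> ('a set \<Rightarrow> bool) \<Rightarrow> 'a \<Rightarrow> 'a \<Rightarrow> bool" where
  "parallel_elements E indep x y \<longleftrightarrow>
     x \<in> E \<and> y \<in> E \<and> x \<noteq> y \<and> indep {x} \<and> indep {y} \<and> \<not> indep {x, y}"

definition simple_matroid :: "'a set \<Rightarrow> ('a set \<Rightarrow> bool) \<Rightarrow> bool" where
  "simple_matroid E indep \<longleftrightarrow>
     matroid E indep \<and> (\<nexists>x. loop E indep x) \<and> (\<nexists>x y. parallel_elements E indep x y)"

definition matroid_rank :: "('a set \<Rightarrow> bool) \<Rightarrow> 'a set \<Rightarrow> nat" where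
  "matroid_rank indep A = Max (card ` {I. I \<subseteq> A \<and> indep I})"

definition flats :: "'a set \<Rightarrow> ('a set \<Rightarrow> bool) \<Rightarrow> 'a set set" where
  "flats E indep =
     {F. F \<subseteq> E \<and> (\<forall>x\<in>E - F. matroid_rank indep F < matroid_rank indep (insert x F))}"


section \<open>Polynomial rings\<close>

text \<open>A polynomial over \<open>\<rat>\<close> is a finitely supported map from monomials, i.e. finitely
  supported exponent vectors, to \<open>\<rat>\<close>; the carrier of \<open>poly_ring V\<close> consists of the
  polynomials in which only variables from \<open>V\<close> occur.\<close>

type_synonym 'v mpoly = "('v \<Rightarrow>\<^sub>0 nat) \<Rightarrow>\<^sub>0 rat"

definition poly_ring :: "'v set \<Rightarrow> 'v mpoly ring" where
  "poly_ring V =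
     \<lparr>carrier = {p. \<forall>m\<in>Poly_Mapping.keys p. Poly_Mapping.keys m \<subseteq> V},
      monoid.mult = (*), one = 1, zero = 0, add = (+)\<rparr>"

definition var :: "'v \<Rightarrow> 'v mpoly" where
  "var v = Poly_Mapping.single (Poly_Mapping.single v 1) 1"

definition homogeneous :: "nat \<Rightarrow> 'v mpoly \<Rightarrow> bool" where
  "homogeneous k p \<longleftrightarrow>
     (\<forall>m\<in>Poly_Mapping.keys p. (\<Sum>v\<in>Poly_Mapping.keys m. Poly_Mapping.lookup m v) = k)"


section \<open>The augmented Chow ring\<close>

datatype 'a chow_var = Y 'a | X "'a set"

definition chow_vars :: "'a set \<Rightarrow> ('a set \<Rightarrow> bool) \<Rightarrow> 'a chow_var set" where
  "chow_vars E indep = Y ` E \<union> X ` (flats E indep - {E})"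

abbreviation chow_poly_ring :: "'a set \<Rightarrow> ('a set \<Rightarrow> bool) \<Rightarrow> 'a chow_var mpoly ring" where
  "chow_poly_ring E indep \<equiv> poly_ring (chow_vars E indep)"

definition chow_I :: "'a set \<Rightarrow> ('a set \<Rightarrow> bool) \<Rightarrow> 'a chow_var mpoly set" where
  "chow_I E indep =
     Idl\<^bsub>chow_poly_ring E indep\<^esub>
       {var (Y i) - (\<Sum>F\<in>{F \<in> flats E indep. i \<notin> F}. var (X F)) | i. i \<in> E}"

definition chow_J :: "'a set \<Rightarrow> ('a set \<Rightarrow> bool) \<Rightarrow> 'a chow_var mpoly set" where
  "chow_J E indep =
     (Idl\<^bsub>chow_poly_ring E indep\<^esub>
        {var (X F) * var (X G) | F G.
           F \<in> flats E indep - {E} \<and> G \<in> flats E indep - {E} \<and> \<not> F \<subseteq> G \<and> \<not> G \<subseteq> F})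
     <+>\<^bsub>chow_poly_ring E indep\<^esub>
     (Idl\<^bsub>chow_poly_ring E indep\<^esub>
        {var (Y i) * var (X F) | i F. i \<in> E \<and> F \<in> flats E indep - {E} \<and> i \<notin> F})"

definition chow_ideal :: "'a set \<Rightarrow> ('a set \<Rightarrow> bool) \<Rightarrow> 'a chow_var mpoly set" where
  "chow_ideal E indep = chow_I E indep <+>\<^bsub>chow_poly_ring E indep\<^esub> chow_J E indep"

definition augmented_chow_ring ::
    "'a set \<Rightarrow> ('a set \<Rightarrow> bool) \<Rightarrow> 'a chow_var mpoly set ring" where
  "augmented_chow_ring E indep = chow_poly_ring E indep Quot chow_ideal E indep"

definition chow_grading ::
    "'a set \<Rightarrow> ('a set \<Rightarrow> bool) \<Rightarrow> nat \<Rightarrow> 'a chow_var mpoly set set" where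
  "chow_grading E indep k =
     {chow_ideal E indep +>\<^bsub>chow_poly_ring E indep\<^esub> p | p.
        p \<in> carrier (chow_poly_ring E indep) \<and> homogeneous k p}"


section \<open>Standard graded algebras and Koszul filtrations\<close>

text \<open>A grading is given by its family \<open>gr\<close> of graded pieces, the ground field being \<open>gr 0\<close>.\<close>

definition standard_graded :: "('r, 'x) ring_scheme \<Rightarrow> (nat \<Rightarrow> 'r set) \<Rightarrow> bool" where
  "standard_graded R gr \<longleftrightarrow>
     cring R \<and>
     (\<forall>i. additive_subgroup (gr i) R) \<and>
     (\<forall>r\<in>carrier R. \<exists>!f. (\<forall>i. f i \<in> gr i) \<and> finite {i. f i \<noteq> \<zero>\<^bsub>R\<^esub>} \<and>
        r = (\<Oplus>\<^bsub>R\<^esub>i\<in>{i. f i \<noteq> \<zero>\<^bsub>R\<^esub>}. f i)) \<and>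
     (\<forall>i j. \<forall>a\<in>gr i. \<forall>b\<in>gr j. a \<otimes>\<^bsub>R\<^esub> b \<in> gr (i + j)) \<and>
     subfield (gr 0) R \<and>
     (\<exists>S. finite S \<and> S \<subseteq> gr 1 \<and> generate_ring R (gr 0 \<union> S) = carrier R)"

definition irrelevant_ideal :: "('r, 'x) ring_scheme \<Rightarrow> (nat \<Rightarrow> 'r set) \<Rightarrow> 'r set" where
  "irrelevant_ideal R gr = generate (add_monoid R) (\<Union>i\<in>{1..}. gr i)"

definition colon_ideal :: "('r, 'x) ring_scheme \<Rightarrow> 'r set \<Rightarrow> 'r set \<Rightarrow> 'r set" where
  "colon_ideal R J I = {r \<in> carrier R. \<forall>a\<in>I. r \<otimes>\<^bsub>R\<^esub> a \<in> J}"

text \<open>For ideals \<open>J \<subseteq> I\<close>, the module \<open>I/J\<close> is cyclic iff \<open>I = J + (a)\<close> for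
  some \<open>a \<in> I\<close>.\<close>

definition koszul_filtration ::
    "('r, 'x) ring_scheme \<Rightarrow> (nat \<Rightarrow> 'r set) \<Rightarrow> 'r set set \<Rightarrow> bool" where
  "koszul_filtration R gr \<F> \<longleftrightarrow>
     standard_graded R gr \<and>
     (\<forall>I\<in>\<F>. ideal I R \<and> (\<exists>S\<subseteq>gr 1. I = Idl\<^bsub>R\<^esub> S)) \<and>
     {\<zero>\<^bsub>R\<^esub>} \<in> \<F> \<and>
     irrelevant_ideal R gr \<in> \<F> \<and>
     (\<forall>I\<in>\<F>. I \<noteq> {\<zero>\<^bsub>R\<^esub>} \<longrightarrow>
        (\<exists>J\<in>\<F>. J \<subset> I \<and> (\<exists>a\<in>I. I = J <+>\<^bsub>R\<^esub> PIdl\<^bsub>R\<^esub> a) \<and> colon_ideal R J I \<in> \<F>))"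


section \<open>Modules, free resolutions and Tor\<close>

text \<open>The fields \<open>mult\<close> and \<open>one\<close> of a \<open>module\<close> record are not used by the locale
  \<^locale>\<open>Module.module\<close>; below they are filled in arbitrarily.\<close>

definition regular_module :: "('r, 'x) ring_scheme \<Rightarrow> ('r, 'r) module" where
  "regular_module R =
     \<lparr>carrier = carrier R, monoid.mult = monoid.mult R, one = one R, zero = zero R, add = add R,
      module.smult = monoid.mult R\<rparr>"

text \<open>\<open>R/I\<close> as an \<open>R\<close>-module\<close>

definition residue_module :: "('r, 'x) ring_scheme \<Rightarrow> 'r set \<Rightarrow> ('r, 'r set) module" where
  "residue_module R I =
     \<lparr>carrier = carrier (R Quot I), monoid.mult = monoid.mult (R Quot I), one = one (R Quot I),
      zero = zero (R Quot I), add = add (R Quot I),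
      module.smult = (\<lambda>r A. (I +>\<^bsub>R\<^esub> r) \<otimes>\<^bsub>R Quot I\<^esub> A)\<rparr>"

text \<open>The direct sum \<open>N\<^sup>k\<close> of \<open>k\<close> copies of \<open>N\<close>\<close>

definition pow_module :: "('r, 'm) module \<Rightarrow> nat \<Rightarrow> ('r, nat \<Rightarrow> 'm) module" where
  "pow_module N k =
     \<lparr>carrier = {..<k} \<rightarrow>\<^sub>E carrier N,
      monoid.mult = (\<lambda>u v. \<lambda>i\<in>{..<k}. \<zero>\<^bsub>N\<^esub>), one = (\<lambda>i\<in>{..<k}. \<zero>\<^bsub>N\<^esub>),
      zero = (\<lambda>i\<in>{..<k}. \<zero>\<^bsub>N\<^esub>),
      add = (\<lambda>u v. \<lambda>i\<in>{..<k}. u i \<oplus>\<^bsub>N\<^esub> v i),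
      module.smult = (\<lambda>r v. \<lambda>i\<in>{..<k}. r \<odot>\<^bsub>N\<^esub> v i)\<rparr>"

text \<open>\<open>Z/B\<close> for submodules \<open>B \<subseteq> Z\<close> of \<open>M\<close>; the elements are the cosets of \<open>B\<close>, and
  \<open>smult\<close> is defined on them in the same way as \<^const>\<open>rcoset_mult\<close>.\<close>

definition quot_module :: "('r, 'm) module \<Rightarrow> 'm set \<Rightarrow> 'm set \<Rightarrow> ('r, 'm set) module" where
  "quot_module M Z B =
     \<lparr>carrier = {B +>\<^bsub>M\<^esub> z | z. z \<in> Z},
      monoid.mult = (\<lambda>A C. B), one = B, zero = B,
      add = (\<lambda>A C. A <+>\<^bsub>M\<^esub> C),
      module.smult = (\<lambda>r A. \<Union>z\<in>A. B +>\<^bsub>M\<^esub> (r \<odot>\<^bsub>M\<^esub> z))\<rparr>"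

text \<open>The map \<open>N\<^sup>l \<rightarrow> N\<^sup>k\<close> given by a \<open>k \<times> l\<close>-matrix \<open>A\<close> over \<open>R\<close>. For \<open>N = R\<close> these are the
  homomorphisms \<open>R\<^sup>l \<rightarrow> R\<^sup>k\<close>; in general this is \<open>A \<otimes> N\<close> under the canonical
  identification \<open>R\<^sup>k \<otimes>\<^sub>R N = N\<^sup>k\<close>.\<close>

definition mat_map ::
    "('r, 'm) module \<Rightarrow> nat \<Rightarrow> nat \<Rightarrow> (nat \<Rightarrow> nat \<Rightarrow> 'r) \<Rightarrow> (nat \<Rightarrow> 'm) \<Rightarrow> (nat \<Rightarrow> 'm)" where
  "mat_map N k l A v = (\<lambda>i\<in>{..<k}. \<Oplus>\<^bsub>N\<^esub>j\<in>{..<l}. A i j \<odot>\<^bsub>N\<^esub> v j)"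

text \<open>A resolution of \<open>M\<close> by free modules of finite rank,
  \<open>\<dots> \<rightarrow> R\<^bsup>n 2\<^esup> \<rightarrow> R\<^bsup>n 1\<^esup> \<rightarrow> R\<^bsup>n 0\<^esup> \<rightarrow> M \<rightarrow> 0\<close>,
  where \<open>d i\<close> is the matrix of \<open>R\<^bsup>n (i + 1)\<^esup> \<rightarrow> R\<^bsup>n i\<^esup>\<close> (so the index is that of the target)
  and \<open>\<epsilon>\<close> is the augmentation.\<close>

definition free_resolution ::
    "('r, 'x) ring_scheme \<Rightarrow> ('r, 'm) module \<Rightarrow> (nat \<Rightarrow> nat) \<Rightarrow>
     (nat \<Rightarrow> nat \<Rightarrow> nat \<Rightarrow> 'r) \<Rightarrow> ((nat \<Rightarrow> 'r) \<Rightarrow> 'm) \<Rightarrow> bool" where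
  "free_resolution R M n d \<epsilon> \<longleftrightarrow>
     (let F = (\<lambda>i. pow_module (regular_module R) (n i));
          D = (\<lambda>i. mat_map (regular_module R) (n i) (n (Suc i)) (d i))
      in (\<forall>i. \<forall>a<n i. \<forall>b<n (Suc i). d i a b \<in> carrier R) \<and>
         \<epsilon> \<in> module_hom R (F 0) M \<and>
         \<epsilon> ` carrier (F 0) = carrier M \<and>
         D 0 ` carrier (F 1) = {v \<in> carrier (F 0). \<epsilon> v = \<zero>\<^bsub>M\<^esub>} \<and>
         (\<forall>i. D (Suc i) ` carrier (F (Suc (Suc i))) =
              {v \<in> carrier (F (Suc i)). D i v = \<zero>\<^bsub>F i\<^esub>}))"

text \<open>The \<open>i\<close>-th homology module of the complex
  \<open>\<dots> \<rightarrow> N\<^bsup>n 2\<^esup> \<rightarrow> N\<^bsup>n 1\<^esup> \<rightarrow> N\<^bsup>n 0\<^esup> \<rightarrow> 0\<close> obtained by tensoring a free resolution of \<open>M\<close> with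
  \<open>N\<close>, that is, \<open>Tor\<^sub>i(M, N)\<close> as computed by this resolution.\<close>

definition tor_cycles ::
    "('r, 'm) module \<Rightarrow> (nat \<Rightarrow> nat) \<Rightarrow> (nat \<Rightarrow> nat \<Rightarrow> nat \<Rightarrow> 'r) \<Rightarrow> nat \<Rightarrow> (nat \<Rightarrow> 'm) set" where
  "tor_cycles N n d i =
     (case i of
        0 \<Rightarrow> carrier (pow_module N (n 0))
      | Suc j \<Rightarrow> {v \<in> carrier (pow_module N (n (Suc j))).
                    mat_map N (n j) (n (Suc j)) (d j) v = \<zero>\<^bsub>pow_module N (n j)\<^esub>})"

definition tor_boundaries ::
    "('r, 'm) module \<Rightarrow> (nat \<Rightarrow> nat) \<Rightarrow> (nat \<Rightarrow> nat \<Rightarrow> nat \<Rightarrow> 'r) \<Rightarrow> nat \<Rightarrow> (nat \<Rightarrow> 'm) set" where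
  "tor_boundaries N n d i =
     mat_map N (n i) (n (Suc i)) (d i) ` carrier (pow_module N (n (Suc i)))"

definition tor ::
    "('r, 'm) module \<Rightarrow> (nat \<Rightarrow> nat) \<Rightarrow> (nat \<Rightarrow> nat \<Rightarrow> nat \<Rightarrow> 'r) \<Rightarrow> nat \<Rightarrow>
     ('r, (nat \<Rightarrow> 'm) set) module" where
  "tor N n d i =
     quot_module (pow_module N (n i)) (tor_cycles N n d i) (tor_boundaries N n d i)"


section \<open>Poincare series\<close>

text \<open>\<open>P\<close> is the series \<open>\<Sum>i. dim\<^sub>K Tor\<^sub>i\<^sup>R(K, K) t\<^sup>i\<close>, where \<open>K = gr 0\<close> acts on \<open>Tor\<close> by
  restriction of scalars. Instead of choosing a resolution, we require that resolutions of
  \<open>K = R/R\<^sub>+\<close> exist and that each of them yields \<open>P\<close>; so \<open>P\<close> is unique.\<close>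

definition is_poincare_series ::
    "('r, 'x) ring_scheme \<Rightarrow> (nat \<Rightarrow> 'r set) \<Rightarrow> rat fps \<Rightarrow> bool" where
  "is_poincare_series R gr P \<longleftrightarrow>
     (let k = residue_module R (irrelevant_ideal R gr);
          K = R\<lparr>carrier := gr 0\<rparr>
      in (\<exists>n d \<epsilon>. free_resolution R k n d \<epsilon>) \<and>
         (\<forall>n d \<epsilon>. free_resolution R k n d \<epsilon> \<longrightarrow>
            (\<forall>i. vectorspace.fin_dim K (tor k n d i) \<and>
                 fps_nth P i = of_nat (vectorspace.dim K (tor k n d i)))))"

definition rational_fps :: "'k::field fps \<Rightarrow> bool" where
  "rational_fps P \<longleftrightarrow> (\<exists>p q. q \<noteq> 0 \<and> fps_of_poly q * P = fps_of_poly p)"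

end

theory Submission
  imports Defs
begin

text \<open>
  In terms of the generators \<open>h\<^sub>F = \<Sum>\<^bsub>\<not> F \<subseteq> G\<^esub> x\<^sub>G\<close>, where \<open>F\<close> is a nonempty flat (\<open>y\<^sub>i\<close> is the one of the atom
  spanned by \<open>i\<close>), the relations of the augmented Chow ring become
  \<open>(h\<^sub>F - h\<^bsub>F \<or> G\<^esub>) (h\<^sub>G - h\<^bsub>F \<or> G\<^esub>) = 0\<close>, and \<open>h\<^sub>F (h\<^sub>F - h\<^sub>H) = 0\<close> whenever \<open>F\<close> covers \<open>H\<close>, with \<open>h\<close> of
  the empty flat being \<open>0\<close>. The standard monomials of Feichtner and Yuzvinsky span by straightening.
  They are independent because the functional which takes the value \<open>1\<close> on the monomials satisfying
  the Hall--Rado condition, and \<open>0\<close> on all others, vanishes on the relations.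

  The Koszul filtration consists of the ideals \<open>(h\<^sub>G | G \<in> W)\<close> for up-sets \<open>W\<close> of nonempty flats, and of
  the ideals \<open>(h\<^sub>G | \<not> G \<subseteq> F) + (h\<^sub>F - h\<^sub>H | H \<in> S)\<close> for initial sets \<open>S\<close> of coatoms of \<open>F\<close>. For \<open>F\<close>
  minimal in \<open>W\<close>, the colon of \<open>h\<^sub>F\<close> over the first ideal of \<open>W - {F}\<close> is the second ideal with \<open>S\<close> all
  coatoms of \<open>F\<close>; for \<open>H\<close> last in \<open>S\<close>, the colon of \<open>h\<^sub>F - h\<^sub>H\<close> over the ideal of \<open>(F, S - {H})\<close> is the
  ideal of \<open>H\<close> and an initial set of coatoms of \<open>H\<close>. Both follow by comparing standard monomials.

  Since the filtration is finite, the rationality of the Poincare series is a transfer matrix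
  argument: the residue field has a resolution with linear matrices in which every syzygy module is
  filtered by ideals of the family, and the next step replaces each ideal \<open>I\<close> by the colon ideals
  along a chain from \<open>0\<close> to \<open>I\<close>. Such a resolution computes \<open>Tor\<close> since it is minimal.
\<close>

section \<open>Polynomials\<close>

text \<open>In the \<open>h\<close> generators no linear relation is left, and each relation used
  for straightening trades flats for larger ones. So rewriting terminates, and it respects both
  meeting an up-set and lying below a fixed flat; this gives normal forms modulo the ideals of the
  filtration. The second kind of ideal is forced by the first: dividing by \<open>h_F\<close>
  identifies \<open>h_F\<close> with \<open>h_H\<close> for all coatoms \<open>H\<close> of
  \<open>F\<close> at once, and a chain down to 0 has to undo these identifications one by one. When
  none is left, the ideal of the flats not below \<open>F\<close> is again that of an up-set, so the
  family closes up. Undoing one identification leads from \<open>F\<close> to a coatom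
  \<open>H\<close>, and the coatoms of \<open>H\<close> that appear must again form an initial set.
  This is the property of a recursive coatom ordering, and one numbering of the ground set supplies
  it for all flats. The Poincare series has to be the same for every resolution by free modules of
  finite rank, not just for the linear one. Hence the comparison of resolutions up to
  homotopy.\<close>

interpretation ideal: Modules.module "(*) :: 'b::comm_ring_1 \<Rightarrow> 'b \<Rightarrow> 'b"
  by unfold_locales (auto simp: algebra_simps)

text \<open>In this interpretation subspaces are ideals and \<open>ideal.span\<close> is the
  generated ideal. Here \<open>scale_scale\<close> is reassociation of products towards the left,
  which would work against \<open>algebra_simps\<close>.\<close>

declare ideal.scale_scale [simp del]

lemma ideal_mult_right: "ideal.subspace I \<Longrightarrow> x \<in> I \<Longrightarrow> x * y \<in> I"
  for x y :: "'b::comm_ring_1"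
  using ideal.subspace_scale[of I x y] by (simp add: mult.commute)

abbreviation supp :: "('k \<Rightarrow>\<^sub>0 'b::zero) \<Rightarrow> 'k set" where
  "supp \<equiv> Poly_Mapping.keys"

abbreviation coef :: "('k \<Rightarrow>\<^sub>0 'b::zero) \<Rightarrow> 'k \<Rightarrow> 'b" where
  "coef \<equiv> Poly_Mapping.lookup"

abbreviation mon :: "('v \<Rightarrow>\<^sub>0 nat) \<Rightarrow> 'v mpoly" where
  "mon m \<equiv> Poly_Mapping.single m 1"

abbreviation const :: "rat \<Rightarrow> 'v mpoly" where
  "const c \<equiv> Poly_Mapping.single 0 c"

abbreviation vexp :: "'v \<Rightarrow> nat \<Rightarrow> 'v \<Rightarrow>\<^sub>0 nat" where
  "vexp v k \<equiv> Poly_Mapping.single v k"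

lemma const_mult_mon: "const c * mon m = Poly_Mapping.single m c"
  by (simp add: mult_single)

lemma mon_add: "mon (m + n) = mon m * mon n"
  by (simp add: mult_single)

lemma mon_vexp_Suc0: "mon (vexp v (Suc 0)) = var v"
  by (simp add: var_def)

lemma mon_vexp: "mon (vexp v k) = var v ^ k"
proof (induction k)
  case (Suc k)
  have "vexp v (Suc k) = vexp v 1 + vexp v k" by (simp flip: single_add)
  then show ?case using Suc by (simp add: mon_add var_def)
qed simp

lemma poly_sum_monomials: "p = (\<Sum>m\<in>supp p. Poly_Mapping.single m (coef p m))"
  by (rule poly_mapping_eqI)
     (auto simp: lookup_sum lookup_single when_def not_in_keys_iff_lookup_eq_zero)

text \<open>The added term may share its monomial with \<open>q\<close>. The properties proved this
  way are additive, so no bookkeeping of supports is involved.\<close>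

lemma poly_induct [case_names zero add]:
  fixes p :: "'v mpoly"
  assumes "Q 0" and "\<And>c m q. Q q \<Longrightarrow> Q (const c * mon m + q)"
  shows "Q p"
proof -
  have "Q (\<Sum>m\<in>A. Poly_Mapping.single m (f m))" if "finite A" for A and f :: "('v \<Rightarrow>\<^sub>0 nat) \<Rightarrow> rat"
    using that by (induction A) (auto simp: assms(1) assms(2)[unfolded const_mult_mon])
  then show ?thesis using poly_sum_monomials[of p] by (metis finite_keys)
qed

text \<open>Subtraction of exponents is truncated, so divisibility by \<open>m\<close> is tested
  separately; otherwise \<open>k - m\<close> would be read off for non-multiples as well.\<close>

lemma lookup_mon_mult: "coef (mon m * p) k =
    (if \<exists>n. k = m + n then coef p (k - m) else 0)" for p :: "'v mpoly"
proof (induction p rule: poly_induct)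
  case (add c n q)
  have "mon m * (const c * mon n) = Poly_Mapping.single (m + n) c" by (simp add: mult_single)
  moreover have "m + n = k \<longleftrightarrow> (\<exists>n. k = m + n) \<and> n = k - m" by auto
  ultimately show ?case using add by (auto simp: distrib_left lookup_add mult_single lookup_single when_def)
qed auto

lemma lookup_mon_mult_add [simp]:
  "coef (mon m * p) (m + n) = coef p n" for p :: "'v mpoly"
  by (simp add: lookup_mon_mult)

lemma keys_mon_mult: "supp (mon m * p) = (+) m ` supp p" for p :: "'v mpoly"
  by (auto simp: in_keys_iff lookup_mon_mult image_iff split: if_splits)

section \<open>Degrees of monomials with respect to a set of variables\<close>

definition wsum :: "('v \<Rightarrow> bool) \<Rightarrow> ('v \<Rightarrow>\<^sub>0 nat) \<Rightarrow> nat" where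
  "wsum P m = (\<Sum>v\<in>{v \<in> supp m. P v}. coef m v)"

abbreviation tdeg :: "('v \<Rightarrow>\<^sub>0 nat) \<Rightarrow> nat" where
  "tdeg m \<equiv> wsum (\<lambda>_. True) m"

lemma wsum_superset:
  assumes "finite A" "supp m \<subseteq> A"
  shows "wsum P m = (\<Sum>v\<in>{v \<in> A. P v}. coef m v)"
  unfolding wsum_def using assms
  by (intro sum.mono_neutral_left) (auto simp: in_keys_iff)

lemma wsum_add [simp]: "wsum P (m + n) = wsum P m + wsum P n"
proof -
  let ?A = "supp m \<union> supp n"
  have "wsum P (m + n) = (\<Sum>v\<in>{v \<in> ?A. P v}. coef (m + n) v)"
    by (rule wsum_superset) (auto dest: Poly_Mapping.keys_add[THEN subsetD])
  also have "\<dots> = wsum P m + wsum P n"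
    by (simp add: wsum_superset[of ?A m] wsum_superset[of ?A n] lookup_add sum.distrib)
  finally show ?thesis .
qed

lemma wsum_zero [simp]: "wsum P 0 = 0"
  by (simp add: wsum_def)

lemma wsum_vexp [simp]: "wsum P (vexp v k) = (if P v then k else 0)"
proof -
  have "{u. u = v \<and> P u} = (if P v then {v} else {})" by auto
  then show ?thesis by (auto simp: wsum_def)
qed

lemma wsum_mono: "(\<And>v. v \<in> supp m \<Longrightarrow> P v \<Longrightarrow> Q v) \<Longrightarrow> wsum P m \<le> wsum Q m"
  unfolding wsum_def by (rule sum_mono2) auto

lemma wsum_cong: "(\<And>v. v \<in> supp m \<Longrightarrow> P v = Q v) \<Longrightarrow> wsum P m = wsum Q m"
  unfolding wsum_def by (metis (mono_tags, lifting) Collect_cong)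

text \<open>A variable of the support outside \<open>P\<close> adds a positive exponent to the total
  degree and nothing to the left side. This turns an equality of degrees into containment of all
  flats of a monomial in one flat.\<close>

lemma wsum_eq_tdeg_iff: "wsum P m = tdeg m \<longleftrightarrow> (\<forall>v\<in>supp m. P v)"
proof
  assume eq: "wsum P m = tdeg m"
  show "\<forall>v\<in>supp m. P v"
  proof (rule ballI, rule ccontr)
    fix v assume v: "v \<in> supp m" "\<not> P v"
    have "wsum P m < tdeg m"
      unfolding wsum_def by (rule sum_strict_mono2[of _ _ v]) (use v in \<open>auto simp: in_keys_iff\<close>)
    then show False using eq by simp
  qed
qed (auto intro: wsum_cong)

lemma lookup_le_wsum: "P v \<Longrightarrow> coef m v \<le> wsum P m"
proof (cases "v \<in> supp m")
  case True
  assume "P v"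
  then show ?thesis unfolding wsum_def
    by (intro member_le_sum) (use True in auto)
qed (auto simp: in_keys_iff)

lemma homogeneous_iff_tdeg: "homogeneous k p \<longleftrightarrow> (\<forall>m\<in>supp p. tdeg m = k)"
  by (simp add: homogeneous_def wsum_def)

lemma keys_add_nat: "supp (m + n) = supp m \<union> supp n"
  for m n :: "'v \<Rightarrow>\<^sub>0 nat"
  by (auto simp: in_keys_iff lookup_add)

text \<open>The cofactor is \<open>m\<close> with the exponent of \<open>v\<close> set to 0, which
  truncated subtraction yields directly. If \<open>v\<close> does not occur, the power is
  trivial.\<close>

lemma mon_split: "\<exists>n. m = vexp v (coef m v) + n \<and> supp n = supp m - {v}"
proof (intro exI conjI)
  let ?n = "m - vexp v (coef m v)"
  show "m = vexp v (coef m v) + ?n"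
    by (rule poly_mapping_eqI) (simp add: lookup_add lookup_minus lookup_single when_def)
  show "supp ?n = supp m - {v}"
    by (auto simp: in_keys_iff lookup_minus lookup_single when_def split: if_splits)
qed

text \<open>Used with two kinds of \<open>A\<close>: all exponents of one degree, which gives
  homogeneous components, and all exponents below a flat, which splits a polynomial in the proof of
  independence.\<close>

definition prestr :: "('v \<Rightarrow>\<^sub>0 nat) set \<Rightarrow> 'v mpoly \<Rightarrow> 'v mpoly" where
  "prestr A p = (\<Sum>m\<in>supp p \<inter> A. Poly_Mapping.single m (coef p m))"

lemma lookup_prestr: "coef (prestr A p) m = (if m \<in> A then coef p m else 0)"
  by (auto simp: prestr_def lookup_sum lookup_single when_def not_in_keys_iff_lookup_eq_zero)

lemma keys_prestr: "supp (prestr A p) = supp p \<inter> A"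
  by (auto simp: in_keys_iff lookup_prestr split: if_splits)

lemma prestr_add_compl: "p = prestr A p + prestr (- A) p"
  by (rule poly_mapping_eqI) (auto simp: lookup_add lookup_prestr)

section \<open>Linear extension from monomials and substitution\<close>

definition lin :: "(('v \<Rightarrow>\<^sub>0 nat) \<Rightarrow> 'w mpoly) \<Rightarrow> 'v mpoly \<Rightarrow> 'w mpoly" where
  "lin g p = (\<Sum>m\<in>supp p. const (coef p m) * g m)"

lemma lin_superset:
  assumes "finite A" "supp p \<subseteq> A"
  shows "lin g p = (\<Sum>m\<in>A. const (coef p m) * g m)"
  unfolding lin_def using assms
  by (intro sum.mono_neutral_left) (auto simp: in_keys_iff)

lemma lin_add: "lin g (p + q) = lin g p + lin g q"
proof -
  let ?A = "supp p \<union> supp q"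
  have "lin g (p + q) = (\<Sum>m\<in>?A. const (coef (p + q) m) * g m)"
    by (rule lin_superset) (auto dest: Poly_Mapping.keys_add[THEN subsetD])
  also have "\<dots> = lin g p + lin g q"
    by (simp add: lin_superset[of ?A p] lin_superset[of ?A q] lookup_add single_add distrib_right sum.distrib)
  finally show ?thesis .
qed

lemma lin_single [simp]: "lin g (Poly_Mapping.single m c) = const c * g m"
  by (cases "c = 0") (auto simp: lin_def)

lemma lin_zero [simp]: "lin g 0 = 0"
  by (simp add: lin_def)

lemma lookup_const_mult: "coef (const c * p) m = c * coef p m" for p :: "'v mpoly"
proof (induction p rule: poly_induct)
  case (add d n q)
  have "const c * (const d * mon n) = Poly_Mapping.single n (c * d)" by (simp add: mult_single)
  then show ?case using add by (auto simp: distrib_left lookup_add mult_single lookup_single when_def)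
qed auto

lemma lookup_lin: "coef (lin g p) k =
    (\<Sum>m\<in>supp p. coef p m * coef (g m) k)"
  by (simp add: lin_def lookup_sum lookup_const_mult)

lemma lin_cong_ideal:
  assumes "ideal.subspace I" and "\<And>m. m \<in> supp p \<Longrightarrow> g m - f m \<in> I"
  shows "lin g p - lin f p \<in> I"
proof -
  have "lin g p - lin f p = (\<Sum>m\<in>supp p. const (coef p m) * (g m - f m))"
    by (simp add: lin_def sum_subtractf right_diff_distrib)
  then show ?thesis
    using assms by (auto intro!: ideal.subspace_sum ideal.subspace_scale)
qed

lemma lin_mult_left: "lin (\<lambda>m. q * g m) p = q * lin g p"
  unfolding lin_def sum_distrib_left by (rule sum.cong[OF refl], rule mult.left_commute)

lemma lin_mon [simp]: "lin mon p = p"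
  using poly_sum_monomials[of p] by (simp add: lin_def mult_single)

definition subst_mon :: "('v \<Rightarrow> 'w mpoly) \<Rightarrow> ('v \<Rightarrow>\<^sub>0 nat) \<Rightarrow> 'w mpoly" where
  "subst_mon f m = (\<Prod>v\<in>supp m. f v ^ coef m v)"

definition psubst :: "('v \<Rightarrow> 'w mpoly) \<Rightarrow> 'v mpoly \<Rightarrow> 'w mpoly" where
  "psubst f = lin (subst_mon f)"

lemma subst_mon_superset:
  assumes "finite A" "supp m \<subseteq> A"
  shows "subst_mon f m = (\<Prod>v\<in>A. f v ^ coef m v)"
  unfolding subst_mon_def using assms
  by (intro prod.mono_neutral_left) (auto simp: in_keys_iff)

lemma subst_mon_add: "subst_mon f (m + n) = subst_mon f m * subst_mon f n"
proof -
  let ?A = "supp m \<union> supp n"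
  show ?thesis
    by (simp add: subst_mon_superset[of ?A m] subst_mon_superset[of ?A n]
        subst_mon_superset[of ?A "m + n"] keys_add_nat lookup_add power_add prod.distrib)
qed

lemma psubst_add: "psubst f (p + q) = psubst f p + psubst f q"
  by (simp add: psubst_def lin_add)

lemma psubst_zero [simp]: "psubst f 0 = 0"
  by (simp add: psubst_def)

lemma psubst_const [simp]: "psubst f (const c) = const c"
  by (simp add: psubst_def subst_mon_def)

lemma psubst_one [simp]: "psubst f 1 = 1"
  using psubst_const[of f 1] by simp

lemma psubst_var [simp]: "psubst f (var v) = f v"
  by (simp add: psubst_def var_def subst_mon_def)

lemma psubst_mult: "psubst f (p * q) = psubst f p * psubst f q"
proof (induction p rule: poly_induct)
  case (add c m p)
  have "psubst f (const c * (mon m * q)) = const c * subst_mon f m * psubst f q" for q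
  proof (induction q rule: poly_induct)
    case (add d n q)
    have "psubst f (const c * (mon m * (const d * mon n))) = const c * subst_mon f m * psubst f (const d * mon n)"
    proof -
      have *: "const c * (mon m * (const d * mon n)) = Poly_Mapping.single (m + n) (c * d)"
        by (simp add: mult_single)
      have **: "const (c * d) = const c * const d" by (simp add: mult_single)
      have ***: "const d * mon n = Poly_Mapping.single n d" by (rule const_mult_mon)
      show ?thesis
        unfolding * psubst_def unfolding *** lin_single subst_mon_add ** by (simp only: mult_ac)
    qed
    then show ?case using add by (simp add: psubst_add distrib_left)
  qed auto
  then have 1: "psubst f (const c * (mon m * q)) = const c * subst_mon f m * psubst f q" .
  have 2: "psubst f (const c * mon m) = const c * subst_mon f m"
    unfolding psubst_def const_mult_mon by (rule lin_single)
  show ?case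
    by (simp only: psubst_add distrib_right 2 add mult.assoc[of "const c" "mon m" q] 1)
qed simp

lemma psubst_diff: "psubst f (p - q) = psubst f p - psubst f q"
  by (metis add_diff_cancel diff_add_cancel psubst_add)

lemma psubst_sum: "psubst f (\<Sum>i\<in>A. p i) = (\<Sum>i\<in>A. psubst f (p i))"
  by (induction A rule: infinite_finite_induct) (auto simp: psubst_add)

section \<open>Homogeneous polynomials\<close>

lemma homogeneous_add: "homogeneous k p \<Longrightarrow> homogeneous k q \<Longrightarrow> homogeneous k (p + q)"
proof -
  assume "homogeneous k p" "homogeneous k q"
  then show ?thesis
    using Poly_Mapping.keys_add[of p q] unfolding homogeneous_iff_tdeg by (meson Un_iff subsetD)
qed

lemma homogeneous_diff: "homogeneous k p \<Longrightarrow> homogeneous k q \<Longrightarrow> homogeneous k (p - q)"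
proof -
  assume "homogeneous k p" "homogeneous k q"
  moreover have "supp (p - q) \<subseteq> supp p \<union> supp q"
    by (auto simp: in_keys_iff lookup_minus)
  ultimately show ?thesis unfolding homogeneous_iff_tdeg by (meson Un_iff subsetD)
qed

lemma homogeneous_zero [simp]: "homogeneous k 0"
  by (simp add: homogeneous_def)

lemma homogeneous_sum: "(\<And>i. i \<in> A \<Longrightarrow> homogeneous k (p i)) \<Longrightarrow> homogeneous k (\<Sum>i\<in>A. p i)"
  by (induction A rule: infinite_finite_induct) (auto intro: homogeneous_add)

lemma homogeneous_mult: "homogeneous k p \<Longrightarrow> homogeneous l q \<Longrightarrow> homogeneous (k + l) (p * q)"
  unfolding homogeneous_iff_tdeg
proof
  fix m assume *: "\<forall>m\<in>supp p. tdeg m = k" "\<forall>m\<in>supp q. tdeg m = l"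
    and "m \<in> supp (p * q)"
  then obtain a b where "m = a + b" "a \<in> supp p" "b \<in> supp q"
    using keys_mult[of p q] by auto
  then show "tdeg m = k + l" using * by simp
qed

lemma homogeneous_const [simp]: "homogeneous 0 (const c)"
  unfolding homogeneous_iff_tdeg by (metis keys_single emptyE singletonD wsum_zero)

lemma homogeneous_one [simp]: "homogeneous 0 (1 :: 'v mpoly)"
  using homogeneous_const[of 1] by simp

lemma homogeneous_var [simp]: "homogeneous (Suc 0) (var v)"
  by (simp add: homogeneous_iff_tdeg var_def)

lemma homogeneous_power: "homogeneous (Suc 0) p \<Longrightarrow> homogeneous k (p ^ k)"
proof (induction k)
  case (Suc k)
  then show ?case using homogeneous_mult[of "Suc 0" p k "p ^ k"] by simp
qed simp

lemma homogeneous_subst_mon: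
  assumes "\<And>v. homogeneous (Suc 0) (f v)"
  shows "homogeneous (tdeg m) (subst_mon f m)"
proof -
  have "homogeneous (\<Sum>v\<in>A. coef m v) (\<Prod>v\<in>A. f v ^ coef m v)" if "finite A" for A
    using that by (induction A) (auto intro!: homogeneous_mult homogeneous_power assms)
  then show ?thesis by (simp add: subst_mon_def wsum_def)
qed

lemma homogeneous_psubst:
  assumes "\<And>v. homogeneous (Suc 0) (f v)" "homogeneous k p"
  shows "homogeneous k (psubst f p)"
  unfolding psubst_def lin_def
proof (rule homogeneous_sum)
  fix m assume "m \<in> supp p"
  then have "tdeg m = k" using assms(2) by (auto simp: homogeneous_iff_tdeg)
  then show "homogeneous k (const (coef p m) * subst_mon f m)"
    using homogeneous_mult[OF homogeneous_const homogeneous_subst_mon[of f m, OF assms(1)]]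
    by (simp only: add_0)
qed

section \<open>Lattices of flats\<close>

text \<open>Stated outside the locale below because the rank axiom of that locale already speaks of
  closures.\<close>

definition clo :: "'a set set \<Rightarrow> 'a set \<Rightarrow> 'a set" where
  "clo L A = \<Inter>{F \<in> L. A \<subseteq> F}"

lemma wsum_modular: "wsum P m + wsum Q m = wsum (\<lambda>v. P v \<or> Q v) m + wsum (\<lambda>v. P v \<and> Q v) m"
proof -
  have "{v \<in> supp m. P v \<or> Q v} = {v \<in> supp m. P v} \<union> {v \<in> supp m. Q v}"
    "{v \<in> supp m. P v \<and> Q v} = {v \<in> supp m. P v} \<inter> {v \<in> supp m. Q v}" by auto
  then show ?thesis unfolding wsum_def by (simp add: sum.union_inter)
qed

text \<open>Proved in an arbitrary commutative ring, in exactly the shape that arises when monomials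
  are rewritten as products of variables; each expansion of a relation is then one application of a
  rule.\<close>

lemma expand_identities:
  fixes a b c j :: "'b::comm_ring_1"
  shows "(a - j) * (b - j) * c = a * (b * c) - a * (j * c) - (j * (b * c) - j * (j * c))"
    and "a * (a - b) * c = a * (a * c) - a * (b * c)"
    and "a ^ k * (a - b) * c = a ^ Suc k * c - a ^ k * (b * c)"
  by (simp_all add: algebra_simps)

text \<open>A geometric lattice described through closures: adding one element raises the rank by
  exactly one, so covers are rank differences of one. Semimodularity is derived from this in
  \<open>rk_submodular\<close>.\<close>

locale flat_lattice =
  fixes E :: "'a set" and L :: "'a set set" and rk :: "'a set \<Rightarrow> nat"
  assumes finite_E: "finite E"
    and flat_subset: "F \<in> L \<Longrightarrow> F \<subseteq> E"
    and E_flat: "E \<in> L"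
    and empty_flat: "{} \<in> L"
    and flat_Int: "F \<in> L \<Longrightarrow> G \<in> L \<Longrightarrow> F \<inter> G \<in> L"
    and rk_empty: "rk {} = 0"
    and rk_insert: "F \<in> L \<Longrightarrow> e \<in> E \<Longrightarrow> e \<notin> F \<Longrightarrow> rk (clo L (insert e F)) = Suc (rk F)"
begin

abbreviation cl :: "'a set \<Rightarrow> 'a set" where
  "cl \<equiv> clo L"

definition join :: "'a set \<Rightarrow> 'a set \<Rightarrow> 'a set" where
  "join F G = cl (F \<union> G)"

definition coatoms :: "'a set \<Rightarrow> 'a set set" where
  "coatoms F = {H \<in> L. H \<subset> F \<and> rk F = Suc (rk H)}"

lemma finite_L: "finite L"
  by (rule finite_subset[of _ "Pow E"]) (use flat_subset finite_E in auto)

lemma finite_flat: "F \<in> L \<Longrightarrow> finite F"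
  using flat_subset finite_E finite_subset by blast

lemma Inter_flat: "finite S \<Longrightarrow> S \<noteq> {} \<Longrightarrow> S \<subseteq> L \<Longrightarrow> \<Inter>S \<in> L"
  by (induction rule: finite_ne_induct) (auto intro: flat_Int)

lemma cl_flat: "A \<subseteq> E \<Longrightarrow> cl A \<in> L"
  unfolding clo_def using E_flat finite_L by (intro Inter_flat) auto

lemma cl_superset: "A \<subseteq> cl A"
  by (auto simp: clo_def)

lemma cl_least: "F \<in> L \<Longrightarrow> A \<subseteq> F \<Longrightarrow> cl A \<subseteq> F"
  by (auto simp: clo_def)

lemma cl_insert_flat: "F \<in> L \<Longrightarrow> e \<in> E \<Longrightarrow> cl (insert e F) \<in> L"
  using flat_subset by (intro cl_flat) auto

lemma join_flat: "F \<in> L \<Longrightarrow> G \<in> L \<Longrightarrow> join F G \<in> L"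
  unfolding join_def using flat_subset by (intro cl_flat) auto

lemma join_upper: "F \<subseteq> join F G" "G \<subseteq> join F G"
  using cl_superset[of "F \<union> G"] by (auto simp: join_def)

lemma join_least: "K \<in> L \<Longrightarrow> F \<subseteq> K \<Longrightarrow> G \<subseteq> K \<Longrightarrow> join F G \<subseteq> K"
  unfolding join_def by (rule cl_least) auto

text \<open>Weak and strict monotonicity share one induction: adding to \<open>F\<close> an element
  of \<open>G\<close> moves up by one rank while staying inside \<open>G\<close>.\<close>

lemma rk_mono: "F \<in> L \<Longrightarrow> G \<in> L \<Longrightarrow> F \<subseteq> G \<Longrightarrow> rk F + (if F = G then 0 else 1) \<le> rk G"
proof (induction "card (G - F)" arbitrary: F rule: less_induct)
  case less
  show ?case
  proof (cases "F = G")
    case False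
    then obtain e where e: "e \<in> G" "e \<notin> F" using less.prems by auto
    let ?K = "cl (insert e F)"
    have "e \<in> E" using e less.prems flat_subset by auto
    then have K: "?K \<in> L" "?K \<subseteq> G" "rk ?K = Suc (rk F)" "insert e F \<subseteq> ?K"
      using e less.prems cl_insert_flat rk_insert cl_least[of G "insert e F"] cl_superset[of "insert e F"] by auto
    have "card (G - ?K) < card (G - F)"
      using K e finite_flat less.prems by (intro psubset_card_mono) auto
    then have "rk ?K \<le> rk G" using less.hyps[of ?K] K less.prems by (auto split: if_splits)
    then show ?thesis using K by (simp add: False)
  qed simp
qed

lemma rk_le: "F \<in> L \<Longrightarrow> G \<in> L \<Longrightarrow> F \<subseteq> G \<Longrightarrow> rk F \<le> rk G"
  using rk_mono[of F G] by (auto split: if_splits)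

lemma rk_less: "F \<in> L \<Longrightarrow> G \<in> L \<Longrightarrow> F \<subset> G \<Longrightarrow> rk F < rk G"
  using rk_mono[of F G] by (auto split: if_splits)

lemma flat_eqI: "F \<in> L \<Longrightarrow> G \<in> L \<Longrightarrow> F \<subseteq> G \<Longrightarrow> rk G \<le> rk F \<Longrightarrow> F = G"
  using rk_less[of F G] by fastforce

lemma rk_interpolate:
  assumes "F \<in> L" "G \<in> L" "F \<subseteq> G" "rk F \<le> k" "k \<le> rk G"
  shows "\<exists>K\<in>L. F \<subseteq> K \<and> K \<subseteq> G \<and> rk K = k"
  using assms(4,5)
proof (induction k rule: dec_induct)
  case (step k)
  then obtain K where K: "K \<in> L" "F \<subseteq> K" "K \<subseteq> G" "rk K = k" by auto
  then have "K \<noteq> G" using step by auto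
  then obtain e where e: "e \<in> G" "e \<notin> K" using K by auto
  then have "e \<in> E" using assms flat_subset by auto
  then show ?case
    using e K assms cl_insert_flat[of K e] rk_insert[of K e] cl_least[of G "insert e K"] cl_superset[of "insert e K"]
    by (intro bexI[of _ "cl (insert e K)"]) auto
qed (use assms in auto)

lemma coatomsD: "H \<in> coatoms F \<Longrightarrow> H \<in> L \<and> H \<subset> F \<and> rk F = Suc (rk H)"
  by (auto simp: coatoms_def)

lemma coatom_above:
  assumes "F \<in> L" "G \<in> L" "G \<subset> F"
  shows "\<exists>H\<in>coatoms F. G \<subseteq> H"
proof -
  have "rk G \<le> rk F - 1" using rk_less[OF assms(2,1,3)] by simp
  moreover have "G \<subseteq> F" using assms(3) by auto
  ultimately have "\<exists>K\<in>L. G \<subseteq> K \<and> K \<subseteq> F \<and> rk K = rk F - 1"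
    using rk_interpolate assms(1,2) by simp
  then obtain K where K: "K \<in> L" "G \<subseteq> K" "K \<subseteq> F" "rk K = rk F - 1" by blast
  then have "rk F = Suc (rk K)" using rk_less[OF assms(2,1,3)] by auto
  then show ?thesis using K by (intro bexI[of _ K]) (auto simp: coatoms_def)
qed

text \<open>The closure lies in \<open>F\<close> and already has the rank of
  \<open>F\<close>.\<close>

lemma coatom_insert:
  assumes "F \<in> L" "H \<in> coatoms F" "e \<in> F" "e \<notin> H"
  shows "cl (insert e H) = F"
proof -
  have "e \<in> E" using assms flat_subset by auto
  then show ?thesis
    using assms coatomsD[of H F] cl_insert_flat[of H e] rk_insert[of H e] cl_least[of F "insert e H"]
    by (intro flat_eqI) auto
qed

lemma rk_insert_le: "F \<in> L \<Longrightarrow> e \<in> E \<Longrightarrow> rk (cl (insert e F)) \<le> Suc (rk F)"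
  using rk_insert[of F e] rk_le[of "cl (insert e F)" F] cl_least[of F "insert e F"] cl_insert_flat[of F e]
  by (cases "e \<in> F") auto

text \<open>Going from \<open>F\<close> to \<open>F'\<close> element by element, the rank of the
  flat grows by exactly one at each step, that of its join with \<open>K\<close> by at most one.
  This is submodularity as diminishing returns; the usual inequality is the case where the smaller
  flat is \<open>F \<inter> G\<close>, the larger one \<open>F\<close>, and
  \<open>K = G\<close>.\<close>

lemma rk_join_diff:
  assumes "F \<in> L" "F' \<in> L" "K \<in> L" "F \<subseteq> F'"
  shows "rk (join F' K) + rk F \<le> rk (join F K) + rk F'"
  using assms
proof (induction "rk F' - rk F" arbitrary: F rule: less_induct)
  case less
  show ?case
  proof (cases "F = F'")
    case False
    then obtain e where e: "e \<in> F'" "e \<notin> F" using less.prems by auto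
    let ?G = "cl (insert e F)"
    have eE: "e \<in> E" using e less.prems flat_subset by auto
    then have G: "?G \<in> L" "?G \<subseteq> F'" "rk ?G = Suc (rk F)"
      using e less.prems cl_insert_flat rk_insert cl_least[of F' "insert e F"] by auto
    have J: "join F K \<in> L" using less.prems join_flat by auto
    have "join ?G K \<subseteq> cl (insert e (join F K))"
    proof (rule join_least)
      show J': "cl (insert e (join F K)) \<in> L" using J eE cl_insert_flat by auto
      have *: "insert e (join F K) \<subseteq> cl (insert e (join F K))" by (rule cl_superset)
      then show "?G \<subseteq> cl (insert e (join F K))"
        using join_upper(1)[of F K] by (intro cl_least J') auto
      show "K \<subseteq> cl (insert e (join F K))" using * join_upper(2)[of K F] by auto
    qed
    then have "rk (join ?G K) \<le> Suc (rk (join F K))"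
      using rk_le[of "join ?G K" "cl (insert e (join F K))"] rk_insert_le[OF J eE]
        join_flat[of ?G K] G less.prems cl_insert_flat[OF J eE] by auto
    moreover have "rk F < rk F'" using rk_less[of F F'] less.prems False by auto
    ultimately have "rk F' - rk ?G < rk F' - rk F" using G by linarith
    then have "rk (join F' K) + rk ?G \<le> rk (join ?G K) + rk F'"
      by (rule less.hyps) (use G less.prems in auto)
    then show ?thesis using \<open>rk (join ?G K) \<le> Suc (rk (join F K))\<close> G by linarith
  qed simp
qed

lemma rk_submodular:
  assumes "F \<in> L" "G \<in> L"
  shows "rk (join F G) + rk (F \<inter> G) \<le> rk F + rk G"
proof -
  have "join (F \<inter> G) G = G" using join_least[of G "F \<inter> G" G] join_upper(2)[of G "F \<inter> G"] assms by auto
  then show ?thesis using rk_join_diff[of "F \<inter> G" F G] assms flat_Int by auto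
qed

section \<open>The degree functionals\<close>

abbreviation wt :: "('a set \<Rightarrow>\<^sub>0 nat) \<Rightarrow> 'a set \<Rightarrow> nat" where
  "wt m K \<equiv> wsum (\<lambda>G. G \<subseteq> K) m"

text \<open>The Hall--Rado condition: the flats of \<open>m\<close> admit a transversal that is a basis of \<open>F\<close>.\<close>

definition hall_rado :: "'a set \<Rightarrow> ('a set \<Rightarrow>\<^sub>0 nat) \<Rightarrow> bool" where
  "hall_rado F m \<longleftrightarrow> (\<forall>G\<in>supp m. G \<in> L \<and> G \<subseteq> F) \<and> tdeg m = rk F \<and> (\<forall>K\<in>L. wt m K \<le> rk K)"

definition delta :: "'a set \<Rightarrow> 'a set mpoly \<Rightarrow> rat" where
  "delta F p = (\<Sum>m\<in>supp p. coef p m * of_bool (hall_rado F m))"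

lemma delta_superset:
  assumes "finite A" "supp p \<subseteq> A"
  shows "delta F p = (\<Sum>m\<in>A. coef p m * of_bool (hall_rado F m))"
  unfolding delta_def using assms
  by (intro sum.mono_neutral_left) (auto simp: in_keys_iff)

lemma delta_add: "delta F (p + q) = delta F p + delta F q"
proof -
  let ?A = "supp p \<union> supp q"
  have "delta F (p + q) = (\<Sum>m\<in>?A. coef (p + q) m * of_bool (hall_rado F m))"
    by (rule delta_superset) (auto dest: Poly_Mapping.keys_add[THEN subsetD])
  also have "\<dots> = delta F p + delta F q"
    by (simp add: delta_superset[of ?A p] delta_superset[of ?A q] lookup_add algebra_simps sum.distrib)
  finally show ?thesis .
qed

lemma delta_zero [simp]: "delta F 0 = 0"
  by (simp add: delta_def)

lemma delta_diff: "delta F (p - q) = delta F p - delta F q"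
  by (metis add_diff_cancel diff_add_cancel delta_add)

lemma delta_single [simp]: "delta F (Poly_Mapping.single m c) = c * of_bool (hall_rado F m)"
  by (cases "c = 0") (auto simp: delta_def)

lemma delta_const_mult: "delta F (const c * p) = c * delta F p"
proof (induction p rule: poly_induct)
  case (add d n q)
  have "delta F (const c * (const d * mon n)) = c * delta F (const d * mon n)"
    unfolding const_mult_mon by (simp only: mult_single delta_single add_0 mult.assoc)
  then show ?case using add by (simp only: distrib_left delta_add)
qed auto

text \<open>The largest ideal inside the kernel of \<open>delta F\<close>, that is, the null ideal
  of the pairing \<open>delta F (u * v)\<close>. Because it is an ideal, it contains
  \<open>RI\<close> once it contains the relations, and membership is tested on monomials
  \<open>v\<close>.\<close>

definition annih :: "'a set \<Rightarrow> 'a set mpoly set" where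
  "annih F = {u. \<forall>v. delta F (u * v) = 0}"

lemma subspace_annih: "ideal.subspace (annih F)"
proof (rule ideal.subspaceI)
  fix c x assume "x \<in> annih F"
  then have "delta F (x * (c * v)) = 0" for v by (simp add: annih_def)
  then show "c * x \<in> annih F" by (simp add: annih_def mult.assoc mult.left_commute[of c x])
qed (auto simp: annih_def distrib_right delta_add)

lemma annihI:
  assumes "\<And>m. delta F (u * mon m) = 0"
  shows "u \<in> annih F"
proof -
  have "delta F (u * v) = 0" for v
  proof (induction v rule: poly_induct)
    case (add c m q)
    have "delta F (u * (const c * mon m)) = 0"
      using assms[of m] by (simp only: mult.left_commute[of u] delta_const_mult mult_zero_right)
    then show ?case using add by (simp only: distrib_left delta_add)
  qed simp
  then show ?thesis by (simp add: annih_def)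
qed

text \<open>There is a variable for every subset of \<open>E\<close>, so that no subtype of flats is needed; those which
  do not belong to a nonempty flat are set to zero.\<close>

definition rels :: "'a set mpoly set" where
  "rels = {var A |A. A \<notin> L \<or> A = {}}
     \<union> {(var F - var (join F G)) * (var G - var (join F G)) |F G. F \<in> L \<and> G \<in> L}
     \<union> {var F * (var F - var G) |F G. F \<in> L \<and> G \<in> coatoms F}"

definition RI :: "'a set mpoly set" where
  "RI = ideal.span rels"

lemma subspace_RI: "ideal.subspace RI"
  by (simp add: RI_def)

lemma RI_zero: "A \<notin> L \<or> A = {} \<Longrightarrow> var A \<in> RI"
  unfolding RI_def by (rule ideal.span_base) (auto simp: rels_def)

lemma RI_join: "F \<in> L \<Longrightarrow> G \<in> L \<Longrightarrow> (var F - var (join F G)) * (var G - var (join F G)) \<in> RI"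
  unfolding RI_def by (rule ideal.span_base) (auto simp: rels_def)

lemma RI_cover: "F \<in> L \<Longrightarrow> G \<in> coatoms F \<Longrightarrow> var F * (var F - var G) \<in> RI"
  unfolding RI_def by (rule ideal.span_base) (auto simp: rels_def)

section \<open>The functional of the whole ground set annihilates the relations\<close>

lemma wt_join: "wt m K + wt m K' \<le> wt m (join K K') + wt m (K \<inter> K')"
proof -
  have "wt m K + wt m K' = wsum (\<lambda>G. G \<subseteq> K \<or> G \<subseteq> K') m + wt m (K \<inter> K')"
    using wsum_modular[of "\<lambda>G. G \<subseteq> K" m "\<lambda>G. G \<subseteq> K'"] by simp
  moreover have "wsum (\<lambda>G. G \<subseteq> K \<or> G \<subseteq> K') m \<le> wt m (join K K')"
    by (rule wsum_mono) (use join_upper in blast)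
  ultimately show ?thesis by linarith
qed

lemma wt_mono: "K \<subseteq> K' \<Longrightarrow> wt m K \<le> wt m K'"
  by (rule wsum_mono) auto

abbreviation ind :: "'a set \<Rightarrow> 'a set \<Rightarrow> nat" where
  "ind F K \<equiv> if F \<subseteq> K then 1 else 0"

text \<open>Isolates the inequalities, the only part of the condition in which the terms of a
  relation differ: degree and support conditions are the same for all of them as long as
  \<open>F\<close> and \<open>G\<close> are flats.\<close>

lemma hall_rado_pair:
  "hall_rado E (vexp F 1 + (vexp G 1 + m)) \<longleftrightarrow>
    F \<in> L \<and> G \<in> L \<and> (\<forall>G\<in>supp m. G \<in> L) \<and> tdeg m + 2 = rk E \<and>
    (\<forall>K\<in>L. ind F K + ind G K + wt m K \<le> rk K)"
proof -
  have 1: "tdeg (vexp F 1 + (vexp G 1 + m)) = tdeg m + 2" by simp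
  have 2: "wt (vexp F 1 + (vexp G 1 + m)) K = ind F K + ind G K + wt m K" for K by simp
  have 3: "supp (vexp F 1 + (vexp G 1 + m)) = insert F (insert G (supp m))"
    by (auto simp: keys_add_nat)
  have 4: "(\<forall>H\<in>insert F (insert G (supp m)). H \<in> L \<and> H \<subseteq> E) \<longleftrightarrow>
      F \<in> L \<and> G \<in> L \<and> (\<forall>G\<in>supp m. G \<in> L)"
    using flat_subset by blast
  show ?thesis unfolding hall_rado_def 1 2 3 4 by (simp only: conj_assoc)
qed

text \<open>Let \<open>J\<close> be the join and \<open>c A B\<close> the inequalities for
  \<open>A\<close>, \<open>B\<close> and \<open>m\<close>. Then \<open>c F G\<close> holds iff both
  \<open>c F J\<close> and \<open>c J G\<close> do, and \<open>c J J\<close> holds iff at least one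
  of them does. The four indicators therefore cancel by inclusion-exclusion.\<close>

lemma rel_join_annih:
  assumes F: "F \<in> L" and G: "G \<in> L"
  shows "(var F - var (join F G)) * (var G - var (join F G)) \<in> annih E"
proof (rule annihI)
  fix m
  let ?J = "join F G"
  define c where "c A B \<longleftrightarrow> (\<forall>K\<in>L. ind A K + ind B K + wt m K \<le> rk K)" for A B
  have J: "?J \<in> L" using F G join_flat by auto
  have FJ: "F \<subseteq> K" and GJ: "G \<subseteq> K" if "?J \<subseteq> K" for K using that join_upper by blast+
  have JK: "?J \<subseteq> K" if "F \<subseteq> K" "G \<subseteq> K" "K \<in> L" for K using that join_least by auto
  have 1: "c F ?J" if "c F G" unfolding c_def
  proof
    fix K assume "K \<in> L"
    then show "ind F K + ind ?J K + wt m K \<le> rk K"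
      using that[unfolded c_def, rule_format, of K] FJ[of K] GJ[of K] by (auto split: if_splits)
  qed
  have 2: "c ?J G" if "c F G" unfolding c_def
  proof
    fix K assume "K \<in> L"
    then show "ind ?J K + ind G K + wt m K \<le> rk K"
      using that[unfolded c_def, rule_format, of K] FJ[of K] GJ[of K] by (auto split: if_splits)
  qed
  have 3: "c ?J ?J" if "c F ?J" unfolding c_def
  proof
    fix K assume "K \<in> L"
    then show "ind ?J K + ind ?J K + wt m K \<le> rk K"
      using that[unfolded c_def, rule_format, of K] FJ[of K] by (auto split: if_splits)
  qed
  have 4: "c ?J ?J" if "c ?J G" unfolding c_def
  proof
    fix K assume "K \<in> L"
    then show "ind ?J K + ind ?J K + wt m K \<le> rk K"
      using that[unfolded c_def, rule_format, of K] GJ[of K] by (auto split: if_splits)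
  qed
  have 5: "c F G" if "c F ?J" "c ?J G" unfolding c_def
  proof
    fix K assume "K \<in> L"
    then show "ind F K + ind G K + wt m K \<le> rk K"
      using that[unfolded c_def, rule_format, of K] JK[of K] by (auto split: if_splits)
  qed
  \<comment> \<open>Uncrossing: a flat violating the first condition contains \<open>F\<close>, one
    violating the second contains \<open>G\<close>, and the weight of \<open>m\<close> reaches the
    rank on both. Their join contains \<open>J\<close>, hence has slack 2 by \<open>c J J\<close>,
    against submodularity.\<close>
  have 6: "c F ?J \<or> c ?J G" if JJ: "c ?J ?J"
  proof (rule ccontr)
    assume neg: "\<not> (c F ?J \<or> c ?J G)"
    note jj = JJ[unfolded c_def, rule_format]
    obtain K1 where K1: "K1 \<in> L" "\<not> ind F K1 + ind ?J K1 + wt m K1 \<le> rk K1"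
      using neg by (auto simp: c_def)
    obtain K2 where K2: "K2 \<in> L" "\<not> ind ?J K2 + ind G K2 + wt m K2 \<le> rk K2"
      using neg by (auto simp: c_def)
    have F1: "F \<subseteq> K1" and nJ1: "\<not> ?J \<subseteq> K1" using K1(2) jj[OF K1(1)] FJ[of K1] by (auto split: if_splits)
    have G2: "G \<subseteq> K2" and nJ2: "\<not> ?J \<subseteq> K2" using K2(2) jj[OF K2(1)] GJ[of K2] by (auto split: if_splits)
    have e1: "rk K1 \<le> wt m K1" using K1(2) F1 nJ1 by auto
    have e2: "rk K2 \<le> wt m K2" using K2(2) G2 nJ2 by auto
    have M: "join K1 K2 \<in> L" using K1 K2 join_flat by auto
    moreover have "?J \<subseteq> join K1 K2" using F1 G2 join_upper M by (intro join_least) blast+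
    ultimately have "2 + wt m (join K1 K2) \<le> rk (join K1 K2)" using jj[of "join K1 K2"] by auto
    moreover have "wt m (K1 \<inter> K2) \<le> rk (K1 \<inter> K2)"
      using jj[of "K1 \<inter> K2"] flat_Int K1 K2 by (auto split: if_splits)
    ultimately show False
      using wt_join[where m = m and K = K1 and K' = K2] rk_submodular[of K1 K2] e1 e2 K1 K2 by linarith
  qed
  have c: "of_bool (c F G) - of_bool (c F ?J) - (of_bool (c ?J G) - of_bool (c ?J ?J)) = (0 :: rat)"
  proof (cases "c F G")
    case True
    then show ?thesis using 1 2 3 by simp
  next
    case nFG: False
    show ?thesis
    proof (cases "c F ?J")
      case True
      then have "\<not> c ?J G" "c ?J ?J" using 3 5 nFG by blast+
      then show ?thesis using nFG True by simp
    next
      case False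
      then have "c ?J G \<longleftrightarrow> c ?J ?J" using 4 6 by blast
      then show ?thesis using nFG False by simp
    qed
  qed
  define ok where "ok \<longleftrightarrow> (\<forall>G\<in>supp m. G \<in> L) \<and> tdeg m + 2 = rk E"
  have hr: "delta E (mon (vexp A 1 + (vexp B 1 + m))) = of_bool (ok \<and> c A B)" if "A \<in> L" "B \<in> L" for A B
    using that unfolding delta_single hall_rado_pair c_def ok_def by simp
  have "(var F - var ?J) * (var G - var ?J) * mon m =
      mon (vexp F 1 + (vexp G 1 + m)) - mon (vexp F 1 + (vexp ?J 1 + m))
       - (mon (vexp ?J 1 + (vexp G 1 + m)) - mon (vexp ?J 1 + (vexp ?J 1 + m)))"
    unfolding mon_add mon_vexp power_one_right by (rule expand_identities)
  then have "delta E ((var F - var ?J) * (var G - var ?J) * mon m) =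
      of_bool (ok \<and> c F G) - of_bool (ok \<and> c F ?J) - (of_bool (ok \<and> c ?J G) - of_bool (ok \<and> c ?J ?J))"
    by (simp only: delta_diff hr F G J)
  then show "delta E ((var F - var ?J) * (var G - var ?J) * mon m) = 0"
    using c by (cases ok) auto
qed

text \<open>The conditions for \<open>F, F\<close> and for \<open>F, G\<close> differ only at flats
  \<open>K\<close> containing \<open>G\<close> but not \<open>F\<close>. Adding an element of
  \<open>F\<close> to such a \<open>K\<close> gives a flat above \<open>F\<close> of rank one
  higher; the inequality there, which counts \<open>F\<close> twice, implies the one at
  \<open>K\<close>.\<close>

lemma rel_cover_annih:
  assumes F: "F \<in> L" and G: "G \<in> coatoms F"
  shows "var F * (var F - var G) \<in> annih E"
proof (rule annihI)
  fix m
  have GL: "G \<in> L" "G \<subset> F" using coatomsD[OF G] by auto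
  have "(\<forall>K\<in>L. ind F K + ind F K + wt m K \<le> rk K) \<longleftrightarrow> (\<forall>K\<in>L. ind F K + ind G K + wt m K \<le> rk K)"
    (is "?l \<longleftrightarrow> ?r")
  proof
    assume ?l
    show ?r
    proof
      fix K assume K: "K \<in> L"
      show "ind F K + ind G K + wt m K \<le> rk K"
      proof (cases "F \<subseteq> K \<or> \<not> G \<subseteq> K")
        case True
        then show ?thesis using \<open>?l\<close>[rule_format, OF K] by (auto split: if_splits)
      next
        case False
        then obtain e where e: "e \<in> F" "e \<notin> K" "e \<notin> G" by auto
        then have eE: "e \<in> E" using F flat_subset by auto
        let ?K = "cl (insert e K)"
        have K': "?K \<in> L" "rk ?K = Suc (rk K)" "insert e K \<subseteq> ?K"
          using e eE K cl_insert_flat rk_insert cl_superset by auto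
        have "F \<subseteq> ?K" using coatom_insert[OF F G e(1,3)] cl_least[OF K'(1), of "insert e G"] False K'(3) by auto
        then have "2 + wt m ?K \<le> Suc (rk K)" using \<open>?l\<close>[rule_format, OF K'(1)] K'(2) by auto
        moreover have "wt m K \<le> wt m ?K" using K'(3) by (intro wt_mono) auto
        ultimately show ?thesis using False by auto
      qed
    qed
  next
    assume ?r
    show ?l
    proof
      fix K assume "K \<in> L"
      then show "ind F K + ind F K + wt m K \<le> rk K"
        using \<open>?r\<close>[rule_format, of K] GL by (auto split: if_splits)
    qed
  qed
  then have hr: "hall_rado E (vexp F 1 + (vexp F 1 + m)) \<longleftrightarrow> hall_rado E (vexp F 1 + (vexp G 1 + m))"
    unfolding hall_rado_pair using F GL by simp
  have "var F * (var F - var G) * mon m = mon (vexp F 1 + (vexp F 1 + m)) - mon (vexp F 1 + (vexp G 1 + m))"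
    unfolding mon_add mon_vexp power_one_right by (rule expand_identities)
  then show "delta E (var F * (var F - var G) * mon m) = 0"
    by (simp only: delta_diff delta_single hr diff_self)
qed

lemma rel_zero_annih:
  assumes "A \<notin> L \<or> A = {}"
  shows "var A \<in> annih E"
proof (rule annihI)
  fix m
  \<comment> \<open>A set that is not a flat fails the condition on the support; the empty flat has
    rank 0 but would have weight at least 1.\<close>
  have "\<not> hall_rado E (vexp A 1 + m)"
  proof
    assume hr: "hall_rado E (vexp A 1 + m)"
    then have "A \<in> L" by (auto simp: hall_rado_def keys_add_nat)
    with assms have "wt (vexp A 1 + m) {} \<ge> 1" by simp
    then show False using hr empty_flat rk_empty unfolding hall_rado_def by fastforce
  qed
  moreover have "var A * mon m = mon (vexp A 1 + m)" by (simp add: mon_add var_def)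
  ultimately show "delta E (var A * mon m) = 0" by (simp only: delta_single) simp
qed

lemma RI_subset_annih: "RI \<subseteq> annih E"
  unfolding RI_def
  by (rule ideal.span_minimal[OF _ subspace_annih])
     (auto simp: rels_def rel_join_annih rel_cover_annih rel_zero_annih)

text \<open>The monomials \<open>m\<close> for which \<open>F^(k+1) m\<close> satisfies the
  condition on \<open>F\<close> and \<open>F^k G m\<close> does not are exactly those satisfying the
  condition on \<open>G\<close>. Indeed a flat that violates the second is tight for
  \<open>m\<close>, contains \<open>G\<close> but not \<open>F\<close>, and has rank at most that of
  \<open>G\<close>, so it equals \<open>G\<close>. This passes from the functional of a flat to that
  of a smaller one and drives the induction for independence.\<close>

lemma delta_restrict:
  assumes F: "F \<in> L" and G: "G \<in> L" and GF: "G \<subset> F" and rk: "rk F = Suc (k + rk G)"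
  shows "delta F (var F ^ k * (var F - var G) * v) = delta G v"
proof (induction v rule: poly_induct)
  case (add c m q)
  define base where "base \<longleftrightarrow> (\<forall>H\<in>supp m. H \<in> L \<and> H \<subseteq> F) \<and> tdeg m = rk G"
  define A where "A \<longleftrightarrow> (\<forall>K\<in>L. (if F \<subseteq> K then Suc k else 0) + wt m K \<le> rk K)"
  define B where "B \<longleftrightarrow> (\<forall>K\<in>L. (if F \<subseteq> K then k else 0) + ind G K + wt m K \<le> rk K)"
  have a: "hall_rado F (vexp F (Suc k) + m) \<longleftrightarrow> base \<and> A"
    using F rk by (auto simp: hall_rado_def keys_add_nat base_def A_def)
  have b: "hall_rado F (vexp F k + (vexp G 1 + m)) \<longleftrightarrow> base \<and> B"
    using F G GF rk by (auto simp: hall_rado_def keys_add_nat base_def B_def add_ac)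
  have BA: "A" if B unfolding A_def
  proof
    fix K assume "K \<in> L"
    then show "(if F \<subseteq> K then Suc k else 0) + wt m K \<le> rk K"
      using that[unfolded B_def, rule_format, of K] GF by (auto split: if_splits)
  qed
  have g: "hall_rado G m \<longleftrightarrow> base \<and> A \<and> \<not> B"
  proof
    assume hr: "hall_rado G m"
    then have base: base using GF by (auto simp: base_def hall_rado_def)
    have A unfolding A_def
    proof
      fix K assume K: "K \<in> L"
      show "(if F \<subseteq> K then Suc k else 0) + wt m K \<le> rk K"
      proof (cases "F \<subseteq> K")
        case True
        have "wt m K \<le> tdeg m" by (rule wsum_mono) auto
        then show ?thesis using True rk_le[OF F K True] rk base by (auto simp: base_def)
      next
        case False
        then show ?thesis using hr K by (auto simp: hall_rado_def)
      qed
    qed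
    moreover have "wt m G = tdeg m" using hr by (intro wsum_cong) (auto simp: hall_rado_def)
    then have "\<not> B" using G GF hr by (auto simp: B_def hall_rado_def intro!: bexI[of _ G])
    ultimately show "base \<and> A \<and> \<not> B" using base by blast
  next
    assume *: "base \<and> A \<and> \<not> B"
    then have w: "wt m K \<le> rk K" if "K \<in> L" for K using that by (fastforce simp: A_def split: if_splits)
    obtain K where K: "K \<in> L" "\<not> (if F \<subseteq> K then k else 0) + ind G K + wt m K \<le> rk K"
      using * by (auto simp: B_def)
    have nF: "\<not> F \<subseteq> K"
    proof
      assume "F \<subseteq> K"
      then have "Suc k + wt m K \<le> rk K" using * K(1) by (auto simp: A_def)
      then show False using K(2) \<open>F \<subseteq> K\<close> by (simp split: if_splits)
    qed
    then have GK: "G \<subseteq> K" and e: "wt m K = rk K" using K w[OF K(1)] by (auto split: if_splits)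
    have "wt m (K \<inter> F) = wt m K" by (rule wsum_cong) (use * in \<open>auto simp: base_def\<close>)
    then have "rk K \<le> rk (K \<inter> F)" using e w[of "K \<inter> F"] flat_Int[OF K(1) F] by auto
    then have "K \<inter> F = K" using flat_eqI[of "K \<inter> F" K] K(1) F flat_Int by auto
    have "wt m K \<le> tdeg m" by (rule wsum_mono) auto
    then have "rk K \<le> rk G" using e * by (auto simp: base_def)
    then have "G = K" using flat_eqI G K(1) GK by auto
    then have "wt m G = tdeg m" using e * by (auto simp: base_def)
    then have "\<forall>H\<in>supp m. H \<subseteq> G" using wsum_eq_tdeg_iff[of "\<lambda>H. H \<subseteq> G" m] by simp
    then show "hall_rado G m" using w * by (auto simp: hall_rado_def base_def)
  qed
  have "var F ^ k * (var F - var G) * mon m = mon (vexp F (Suc k) + m) - mon (vexp F k + (vexp G 1 + m))"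
    unfolding mon_add mon_vexp power_one_right by (rule expand_identities)
  then have "delta F (var F ^ k * (var F - var G) * mon m) = of_bool (base \<and> A) - of_bool (base \<and> B)"
    by (simp only: delta_diff delta_single a b mult_1)
  also have "\<dots> = of_bool (hall_rado G m)" using g BA by auto
  finally have 1: "delta F (var F ^ k * (var F - var G) * mon m) = delta G (mon m)" by simp
  have 2: "var F ^ k * (var F - var G) * (const c * mon m + q) =
      const c * (var F ^ k * (var F - var G) * mon m) + var F ^ k * (var F - var G) * q"
    by (simp only: distrib_left mult.left_commute)
  show ?case unfolding 2 delta_add delta_const_mult 1 add ..
qed simp

end

lemma mon_factor:
  fixes u :: "'v mpoly"
  assumes "\<And>m. m \<in> supp u \<Longrightarrow> \<exists>n. m = a + n"
  shows "\<exists>w. u = mon a * w"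
proof
  let ?w = "\<Sum>m\<in>supp u. Poly_Mapping.single (m - a) (coef u m)"
  have "mon a * ?w = (\<Sum>m\<in>supp u. Poly_Mapping.single m (coef u m))"
    unfolding sum_distrib_left
  proof (rule sum.cong[OF refl])
    fix m assume "m \<in> supp u"
    then obtain n where "m = a + n" using assms by blast
    then show "mon a * Poly_Mapping.single (m - a) (coef u m) = Poly_Mapping.single m (coef u m)"
      by (simp add: mult_single)
  qed
  then show "u = mon a * ?w" using poly_sum_monomials[of u] by simp
qed

lemma mon_var_factor:
  assumes "A \<in> supp m"
  shows "\<exists>q. mon m = var A * q"
proof -
  obtain n where n: "m = vexp A (coef m A) + n" using mon_split[of m A] by auto
  obtain c where "coef m A = Suc c" using assms by (cases "coef m A") (auto simp: in_keys_iff)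
  then have "mon m = var A ^ Suc c * mon n" by (subst n) (simp only: mon_add mon_vexp)
  then show ?thesis by (auto simp: mult.assoc)
qed

context flat_lattice
begin

section \<open>Standard monomials\<close>

text \<open>These are the exponents of the Feichtner--Yuzvinsky basis, in the generators \<open>h\<^sub>F\<close>.\<close>

definition std :: "('a set \<Rightarrow>\<^sub>0 nat) \<Rightarrow> bool" where
  "std m \<longleftrightarrow> (\<forall>F\<in>supp m. F \<in> L \<and> F \<noteq> {} \<and> coef m F \<le> rk F) \<and>
     (\<forall>F\<in>supp m. \<forall>G\<in>supp m. F \<subseteq> G \<or> G \<subseteq> F) \<and>
     (\<forall>F\<in>supp m. \<forall>G\<in>supp m. G \<subset> F \<longrightarrow> coef m F + rk G < rk F)"

abbreviation below :: "'a set \<Rightarrow> ('a set \<Rightarrow>\<^sub>0 nat) \<Rightarrow> bool" where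
  "below F m \<equiv> \<forall>G\<in>supp m. G \<subseteq> F"

lemma std_divisor:
  assumes "std (m + n)"
  shows "std n"
proof -
  have "coef n F \<le> coef (m + n) F" for F by (simp add: lookup_add)
  moreover have "supp n \<subseteq> supp (m + n)" by (auto simp: keys_add_nat)
  ultimately show ?thesis using assms unfolding std_def
    by (meson le_trans order.strict_trans1 subsetD add_le_mono1)
qed

lemma std_zero [simp]: "std 0"
  by (simp add: std_def)

lemma std_coef_le: "std m \<Longrightarrow> coef m F \<le> rk F"
  by (cases "F \<in> supp m") (auto simp: std_def in_keys_iff)

text \<open>\<open>F\<close> may be absent from the monomial; then its exponent is 0 and the bound
  is strict monotonicity of the rank. This spares a case distinction whenever the power of a top
  flat is split off.\<close>

lemma std_coef_less:
  assumes "std m" "F \<in> L" "G \<in> supp m" "G \<subset> F"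
  shows "coef m F + rk G < rk F"
proof (cases "F \<in> supp m")
  case False
  have "G \<in> L" using assms by (auto simp: std_def)
  then show ?thesis using False rk_less[of G F] assms by (simp add: in_keys_iff)
qed (use assms in \<open>auto simp: std_def\<close>)

lemma std_chain_top:
  assumes "std m" "A \<subseteq> supp m" "A \<noteq> {}"
  obtains T where "T \<in> A" "\<And>G. G \<in> A \<Longrightarrow> G \<subseteq> T"
proof -
  have "finite A" using assms(2) finite_keys finite_subset by blast
  then obtain T where T: "T \<in> A" "\<And>G. G \<in> A \<Longrightarrow> T \<subseteq> G \<Longrightarrow> T = G"
    using finite_has_maximal[of A] assms(3) by blast
  have "G \<subseteq> T" if "G \<in> A" for G
    using T that assms(1,2) unfolding std_def by (metis subsetD)
  then show ?thesis using T that by blast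
qed

text \<open>Outer induction on the rank of \<open>F\<close>, inner induction on the exponent
  \<open>k\<close> of \<open>F\<close>, smallest first. After division by \<open>F^k\<close>,
  multiplying by \<open>h_F - h_G\<close> with \<open>rk G = rk F - k - 1\<close> leads to the
  functional of \<open>G\<close>, which sees only the monomials below \<open>G\<close>; these vanish
  by the outer induction. The exponent bounds in \<open>std\<close> are exactly what leaves room for
  such a \<open>G\<close> above the rest of the monomial.\<close>

lemma std_independent_annih:
  assumes "F \<in> L" "\<And>m. m \<in> supp u \<Longrightarrow> std m \<and> below F m" "u \<in> annih F"
  shows "u = 0"
  using assms
proof (induction "rk F" arbitrary: F u rule: less_induct)
  case less
  note F = less.prems(1) and u = less.prems(2) and ann = less.prems(3)
  have "\<forall>m\<in>supp u. coef m F \<noteq> k" for k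
  proof (induction k rule: less_induct)
    case (less k)
    note kIH = less.IH
    have ge: "k \<le> coef m F" if "m \<in> supp u" for m
      using kIH[of "coef m F"] that by (cases "coef m F < k") auto
    show ?case
    proof
      fix m assume m: "m \<in> supp u"
      show "coef m F \<noteq> k"
      proof
        assume k: "coef m F = k"
        obtain n where n: "m = vexp F k + n" "supp n = supp m - {F}"
          using mon_split[of m F] k by auto
        have stdm: "std m" "below F m" using u m by auto
        have lessF: "coef m F + rk G < rk F" if "G \<in> supp n" for G
          using std_coef_less[OF stdm(1) F, of G] that n(2) stdm(2) by auto
        show False
        proof (cases "k = rk F")
          case True
          \<comment> \<open>Every monomial now has the maximal exponent at \<open>F\<close>, which
            leaves no rank for a further flat. So \<open>u\<close> is a multiple of a single
            monomial, on which the functional is 1.\<close>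
          have eq: "m' = vexp F (rk F)" if m': "m' \<in> supp u" for m'
          proof -
            have "std m'" "below F m'" using u m' by auto
            then have c: "coef m' F = rk F" using ge[OF m'] std_coef_le[of m' F] True by auto
            obtain n' where n': "m' = vexp F (coef m' F) + n'" "supp n' = supp m' - {F}"
              using mon_split[of m' F] by auto
            have "supp n' = {}"
            proof (rule ccontr)
              assume "supp n' \<noteq> {}"
              then obtain G where "G \<in> supp n'" by blast
              then show False
                using std_coef_less[OF \<open>std m'\<close> F, of G] n'(2) \<open>below F m'\<close> c by auto
            qed
            then have "n' = 0" by simp
            then show ?thesis using n'(1) c by simp
          qed
          then have "supp u = {vexp F (rk F)}" using m by auto
          then obtain c where c: "u = Poly_Mapping.single (vexp F (rk F)) c" "c \<noteq> 0"
            using poly_sum_monomials[of u] by (simp add: in_keys_iff) (metis in_keys_iff singletonI)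
          have "hall_rado F (vexp F (rk F))"
            unfolding hall_rado_def using F rk_le[OF F] by auto
          then have "delta F (u * 1) \<noteq> 0" using c by simp
          moreover have "delta F (u * 1) = 0" using ann unfolding annih_def by blast
          ultimately show False by simp
        next
          case False
          then have k_less: "k < rk F" using std_coef_le[OF stdm(1), of F] k by auto
          obtain G where G: "G \<in> L" "G \<subset> F" "rk F = Suc (k + rk G)" "\<forall>H\<in>supp n. H \<subseteq> G"
          proof (cases "supp n = {}")
            case True
            obtain G where "G \<in> L" "G \<subseteq> F" "rk G = rk F - Suc k"
              using rk_interpolate[OF empty_flat F, of "rk F - Suc k"] rk_empty by auto
            moreover from this have "G \<noteq> F" using k_less by auto
            ultimately show ?thesis using that[of G] True k_less by (simp add: psubset_eq)
          next
            case nonempty: False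
            obtain T where T: "T \<in> supp n" "\<And>G. G \<in> supp n \<Longrightarrow> G \<subseteq> T"
              using std_chain_top[OF stdm(1), of "supp n"] n(2) nonempty by auto
            have TL: "T \<in> L" "T \<subseteq> F" using T(1) n(2) stdm by (auto simp: std_def)
            have "k + rk T < rk F" using lessF[OF T(1)] k by simp
            then have "rk T \<le> rk F - Suc k" by linarith
            then obtain G where "G \<in> L" "T \<subseteq> G" "G \<subseteq> F" "rk G = rk F - Suc k"
              using rk_interpolate[OF TL(1) F TL(2), of "rk F - Suc k"] by auto
            moreover from this have "G \<noteq> F" using k_less by auto
            moreover have "\<forall>H\<in>supp n. H \<subseteq> G" using T(2) \<open>T \<subseteq> G\<close> by blast
            ultimately show ?thesis using that[of G] k_less by (simp add: psubset_eq)
          qed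
          have "\<exists>n. m = vexp F k + n" if "m \<in> supp u" for m
          proof -
            obtain n where "m = vexp F (coef m F) + n" using mon_split[of m F] by auto
            moreover have "vexp F (coef m F) = vexp F k + vexp F (coef m F - k)"
              using ge[OF that] by (simp flip: single_add)
            ultimately show ?thesis by (metis add.assoc)
          qed
          then obtain w where w: "u = mon (vexp F k) * w" using mon_factor[of u "vexp F k"] by auto
          have suppw: "n \<in> supp w \<longleftrightarrow> vexp F k + n \<in> supp u" for n
            by (simp add: w in_keys_iff)
          \<comment> \<open>\<open>w2\<close> collects the monomials with a flat outside
            \<open>G\<close>, among them all that still contain \<open>F\<close>;
            \<open>delta G\<close> is 0 on every multiple of it.\<close>
          define w1 where "w1 = prestr {n. below G n} w"
          define w2 where "w2 = prestr (- {n. below G n}) w"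
          have w12: "w = w1 + w2" unfolding w1_def w2_def by (rule prestr_add_compl)
          have "w1 \<in> annih G"
            unfolding annih_def
          proof (rule CollectI, rule allI)
            fix v
            have "delta G (w2 * v) = 0"
              unfolding delta_def
            proof (rule sum.neutral, rule ballI)
              fix q assume "q \<in> supp (w2 * v)"
              then obtain a b where "q = a + b" "a \<in> supp w2" using keys_mult[of w2 v] by auto
              then have "\<not> below G q" by (auto simp: w2_def keys_prestr keys_add_nat)
              then show "coef (w2 * v) q * of_bool (hall_rado G q) = 0" by (auto simp: hall_rado_def)
            qed
            moreover have "delta F (u * ((var F - var G) * v)) = 0" using ann by (simp add: annih_def)
            then have "delta F (var F ^ k * (var F - var G) * (w * v)) = 0"
              by (simp add: w mon_vexp mult_ac)
            then have "delta G (w * v) = 0" using delta_restrict[OF F G(1,2,3)] by simp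
            ultimately show "delta G (w1 * v) = 0" by (simp add: w12 distrib_right delta_add)
          qed
          moreover have "std q \<and> below G q" if "q \<in> supp w1" for q
          proof -
            have "below G q" "vexp F k + q \<in> supp u" using that suppw by (auto simp: w1_def keys_prestr)
            then show ?thesis using std_divisor u by blast
          qed
          moreover have "rk G < rk F" using G(3) by simp
          ultimately have "w1 = 0" using less.hyps G(1) by blast
          moreover have "n \<in> supp w1" using n(1) m suppw G(4) by (simp add: w1_def keys_prestr)
          ultimately show False by simp
        qed
      qed
    qed
  qed
  then have "supp u = {}" by blast
  then show "u = 0" by simp
qed

lemma std_independent:
  assumes "\<And>m. m \<in> supp u \<Longrightarrow> std m" "u \<in> RI"
  shows "u = 0"
proof (rule std_independent_annih[OF E_flat])
  show "u \<in> annih E" using assms(2) RI_subset_annih by auto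
  show "std m \<and> below E m" if "m \<in> supp u" for m
    using assms(1)[OF that] flat_subset by (auto simp: std_def)
qed

section \<open>Absorption of smaller flats and vanishing of powers\<close>

lemma ideal_pull: "ideal.subspace I \<Longrightarrow> x \<in> I \<Longrightarrow> y - x \<in> I \<Longrightarrow> y \<in> I" for x y :: "'b::comm_ring_1"
  by (metis diff_add_cancel ideal.subspace_add)

text \<open>Let \<open>K\<close> cover \<open>G\<close> inside \<open>F\<close>. Then
  \<open>F^(c+1) G = F^c K G = F^c K^2 = F^(c+2)\<close>, where the outer equalities come from
  absorbing \<open>K\<close> into \<open>F^c\<close> and the middle one is the covering relation.
  Each power of \<open>F\<close> pays for one rank.\<close>

lemma RI_absorb:
  assumes "F \<in> L" "G \<in> L" "G \<subseteq> F" "rk F \<le> c + rk G"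
  shows "var F ^ c * var G - var F ^ Suc c \<in> RI"
  using assms(2-4)
proof (induction c arbitrary: G)
  case 0
  then have "G = F" using flat_eqI assms(1) by auto
  then show ?case using ideal.subspace_0[OF subspace_RI] by simp
next
  case (Suc c)
  show ?case
  proof (cases "G = F")
    case True
    then show ?thesis using ideal.subspace_0[OF subspace_RI] by (simp add: mult.commute)
  next
    case False
    then obtain e where e: "e \<in> F" "e \<notin> G" using Suc.prems by auto
    let ?K = "cl (insert e G)"
    have eE: "e \<in> E" using e assms(1) flat_subset by auto
    have K: "?K \<in> L" "?K \<subseteq> F" "rk ?K = Suc (rk G)" "insert e G \<subseteq> ?K"
      using e eE Suc.prems assms(1) cl_insert_flat rk_insert cl_least[of F "insert e G"] cl_superset by auto
    have "G \<in> coatoms ?K" using K e Suc.prems by (auto simp: coatoms_def)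
    then have 1: "var ?K * (var ?K - var G) \<in> RI" using RI_cover K by blast
    have 2: "var F ^ c * var ?K - var F ^ Suc c \<in> RI" using Suc.IH[of ?K] K Suc.prems by auto
    have "var F ^ Suc c * var G - var F ^ Suc (Suc c) =
        (var ?K + var F - var G) * (var F ^ c * var ?K - var F ^ Suc c)
        - var F ^ c * (var ?K * (var ?K - var G))"
      by (simp add: algebra_simps)
    moreover have "(var ?K + var F - var G) * (var F ^ c * var ?K - var F ^ Suc c)
        - var F ^ c * (var ?K * (var ?K - var G)) \<in> RI"
      by (rule ideal.subspace_diff[OF subspace_RI ideal.subspace_scale[OF subspace_RI 2]
            ideal.subspace_scale[OF subspace_RI 1]])
    ultimately show ?thesis by (simp only:)
  qed
qed

text \<open>Absorption of the empty flat, whose generator is itself a relation.\<close>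

lemma RI_power:
  assumes "F \<in> L" "rk F < c"
  shows "var F ^ c \<in> RI"
proof -
  obtain d where d: "c = Suc d" "rk F \<le> d" using assms by (cases c) auto
  have "var F ^ d * var {} - var F ^ Suc d \<in> RI"
    using RI_absorb[of F "{}" d] assms d empty_flat by auto
  moreover have "var F ^ d * var {} \<in> RI" using RI_zero[of "{}"] subspace_RI ideal.subspace_scale by blast
  ultimately show ?thesis using subspace_RI d(1) ideal.subspace_diff[of RI "var F ^ d * var {}"] by fastforce
qed

section \<open>Straightening\<close>

definition reducible :: "('a set \<Rightarrow>\<^sub>0 nat) set \<Rightarrow> 'a set mpoly set \<Rightarrow> 'a set mpoly \<Rightarrow> bool" where
  "reducible Q I p \<longleftrightarrow> (\<exists>u. supp u \<subseteq> Q \<and> p - u \<in> I)"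

lemma reducible_ideal: "p \<in> I \<Longrightarrow> reducible Q I p"
  unfolding reducible_def by (intro exI[of _ 0]) auto

lemma reducible_mon: "ideal.subspace I \<Longrightarrow> m \<in> Q \<Longrightarrow> reducible Q I (mon m)"
  unfolding reducible_def by (intro exI[of _ "mon m"]) (auto simp: ideal.subspace_0)

lemma reducible_add:
  assumes "ideal.subspace I" "reducible Q I p" "reducible Q I q"
  shows "reducible Q I (p + q)"
proof -
  obtain u v where "supp u \<subseteq> Q" "p - u \<in> I" "supp v \<subseteq> Q" "q - v \<in> I"
    using assms by (auto simp: reducible_def)
  then show ?thesis unfolding reducible_def
    using ideal.subspace_add[OF assms(1), of "p - u" "q - v"] Poly_Mapping.keys_add[of u v]
    by (intro exI[of _ "u + v"]) (auto simp: algebra_simps)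
qed

lemma reducible_const_mult:
  assumes "ideal.subspace I" "reducible Q I p"
  shows "reducible Q I (const c * p)"
proof -
  obtain u where u: "supp u \<subseteq> Q" "p - u \<in> I" using assms by (auto simp: reducible_def)
  have "supp (const c * u) \<subseteq> supp u" by (auto simp: in_keys_iff lookup_const_mult)
  moreover have "const c * p - const c * u = const c * (p - u)" by (simp only: right_diff_distrib)
  then have "const c * p - const c * u \<in> I" using ideal.subspace_scale[OF assms(1) u(2)] by (simp only:)
  ultimately show ?thesis unfolding reducible_def using u by blast
qed

lemma reducible_diff:
  assumes "ideal.subspace I" "reducible Q I p" "reducible Q I q"
  shows "reducible Q I (p - q)"
proof -
  have "const (- 1) * q = - q" by (simp add: single_uminus)
  then show ?thesis
    using reducible_add[OF assms(1,2) reducible_const_mult[OF assms(1,3), of "- 1"]] by simp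
qed

lemma reducible_cong: "ideal.subspace I \<Longrightarrow> reducible Q I q \<Longrightarrow> p - q \<in> I \<Longrightarrow> reducible Q I p"
  using reducible_add[of I Q q "p - q"] reducible_ideal[of "p - q" I Q] by simp

lemma reducible_poly:
  assumes "ideal.subspace I" "\<And>m. m \<in> supp p \<Longrightarrow> reducible Q I (mon m)"
  shows "reducible Q I p"
proof -
  have "reducible Q I (\<Sum>m\<in>A. const (coef p m) * mon m)" if "finite A" "A \<subseteq> supp p" for A
    using that
  proof (induction A)
    case (insert m A)
    then show ?case
      using reducible_add[OF assms(1) reducible_const_mult[OF assms(1,2), of m "coef p m"], of "\<Sum>m\<in>A. const (coef p m) * mon m"]
      by simp
  qed (use assms(1) in \<open>auto intro: reducible_ideal simp: ideal.subspace_0\<close>)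
  from this[OF finite_keys order_refl] show ?thesis using lin_mon[of p] unfolding lin_def by (simp only:)
qed

lemma reducible_trans:
  assumes "ideal.subspace I" "reducible Q I p" "\<And>m. m \<in> Q \<Longrightarrow> reducible Q' I (mon m)"
  shows "reducible Q' I p"
proof -
  obtain u where u: "supp u \<subseteq> Q" "p - u \<in> I" using assms(2) by (auto simp: reducible_def)
  have "reducible Q' I u"
    by (rule reducible_poly[OF assms(1)], rule assms(3)) (use u(1) in auto)
  then show ?thesis using reducible_cong[OF assms(1) _ u(2)] by blast
qed

lemma reducible_mono: "I \<subseteq> J \<Longrightarrow> Q \<subseteq> Q' \<Longrightarrow> reducible Q I p \<Longrightarrow> reducible Q' J p"
  unfolding reducible_def by blast

text \<open>The sum over all variables of exponent times \<open>rk E - rk F\<close>, written through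
  \<open>wsum\<close> so that additivity is immediate. It is the measure for straightening, since
  every rewriting step exchanges a flat for a strictly larger one.\<close>

definition corank :: "('a set \<Rightarrow>\<^sub>0 nat) \<Rightarrow> nat" where
  "corank m = (\<Sum>i<rk E. wsum (\<lambda>F. rk F \<le> i) m)"

lemma corank_add [simp]: "corank (m + n) = corank m + corank n"
  by (simp add: corank_def sum.distrib)

lemma corank_vexp: "corank (vexp F k) = k * (rk E - rk F)"
proof -
  have "corank (vexp F k) = (\<Sum>i<rk E. if rk F \<le> i then k else 0)"
    unfolding corank_def by (intro sum.cong) auto
  also have "\<dots> = (\<Sum>i\<in>{i \<in> {..<rk E}. rk F \<le> i}. k)" by (rule sum.inter_filter[symmetric]) simp
  also have "{i \<in> {..<rk E}. rk F \<le> i} = {rk F..<rk E}" by auto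
  finally show ?thesis by simp
qed

lemma corank_less:
  assumes "F \<in> L" "G \<in> L" "G \<subset> F"
  shows "rk E - rk F < rk E - rk G"
  using rk_less[of G F] rk_le[of F E] assms E_flat flat_subset by auto

definition upset :: "'a set set \<Rightarrow> bool" where
  "upset W \<longleftrightarrow> W \<subseteq> L - {{}} \<and> (\<forall>F\<in>W. \<forall>G\<in>L. F \<subseteq> G \<longrightarrow> G \<in> W)"

text \<open>Rewriting moves flats upwards only, to a join or to a larger flat of the monomial. Hence
  an up-set that was met is still met, and flats below \<open>K\<close> stay below \<open>K\<close>.
  The first condition serves the ideals of up-sets, the second the normal forms inside a smaller
  flat.\<close>

lemma straighten:
  assumes "upset W" "supp m \<inter> W \<noteq> {}" "K \<in> L" "below K m"
  shows "reducible {n. std n \<and> supp n \<inter> W \<noteq> {} \<and> below K n} RI (mon m)"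
  using assms(2,4)
proof (induction "corank m" arbitrary: m rule: less_induct)
  case less
  let ?Q = "{n. std n \<and> supp n \<inter> W \<noteq> {} \<and> below K n}"
  note RIs = subspace_RI
  \<comment> \<open>The negation of \<open>std\<close>, one case for each clause. In the middle
    cases the monomial vanishes; the last two call for the join relation and for absorption.\<close>
  consider (std) "std m"
    | (zero) A where "A \<in> supp m" "A \<notin> L \<or> A = {}"
    | (pow) F where "F \<in> supp m" "F \<in> L" "rk F < coef m F"
    | (incomp) F G where "F \<in> supp m" "G \<in> supp m" "F \<in> L" "G \<in> L" "\<not> F \<subseteq> G" "\<not> G \<subseteq> F"
    | (absorb) F G where "F \<in> supp m" "G \<in> supp m" "F \<in> L" "G \<in> L" "G \<subset> F" "rk F \<le> coef m F + rk G"
  proof -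
    assume *: "std m \<Longrightarrow> thesis" "\<And>A. A \<in> supp m \<Longrightarrow> A \<notin> L \<or> A = {} \<Longrightarrow> thesis"
      "\<And>F. F \<in> supp m \<Longrightarrow> F \<in> L \<Longrightarrow> rk F < coef m F \<Longrightarrow> thesis"
      "\<And>F G. F \<in> supp m \<Longrightarrow> G \<in> supp m \<Longrightarrow> F \<in> L \<Longrightarrow> G \<in> L \<Longrightarrow> \<not> F \<subseteq> G \<Longrightarrow> \<not> G \<subseteq> F \<Longrightarrow> thesis"
      "\<And>F G. F \<in> supp m \<Longrightarrow> G \<in> supp m \<Longrightarrow> F \<in> L \<Longrightarrow> G \<in> L \<Longrightarrow> G \<subset> F \<Longrightarrow> rk F \<le> coef m F + rk G \<Longrightarrow> thesis"
    show thesis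
    proof (rule ccontr)
      assume no: "\<not> thesis"
      have 1: "A \<in> L" "A \<noteq> {}" if "A \<in> supp m" for A using *(2)[OF that] no by blast+
      have 2: "coef m F \<le> rk F" if "F \<in> supp m" for F
        using *(3)[OF that 1(1)[OF that]] no by (meson not_le)
      have 3: "F \<subseteq> G \<or> G \<subseteq> F" if "F \<in> supp m" "G \<in> supp m" for F G
        using *(4)[OF that 1(1)[OF that(1)] 1(1)[OF that(2)]] no by blast
      have 4: "coef m F + rk G < rk F" if "F \<in> supp m" "G \<in> supp m" "G \<subset> F" for F G
        using *(5)[OF that(1,2) 1(1)[OF that(1)] 1(1)[OF that(2)] that(3)] no by (meson not_le)
      have "std m" unfolding std_def using 1 2 3 4 by (intro conjI ballI impI)
      then show False using *(1) no by blast
    qed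
  qed
  then show ?case
  proof cases
    case std
    then show ?thesis using less.prems by (intro reducible_mon[OF RIs]) auto
  next
    case zero
    obtain q where "mon m = var A * q" using mon_var_factor[OF zero(1)] by auto
    then show ?thesis using RI_zero[OF zero(2)] ideal_mult_right[OF RIs] by (intro reducible_ideal) simp
  next
    case pow
    obtain n where "m = vexp F (coef m F) + n" using mon_split[of m F] by auto
    then have "mon m = var F ^ coef m F * mon n" by (metis mon_add mon_vexp)
    then show ?thesis using RI_power[OF pow(2,3)] ideal_mult_right[OF RIs] by (intro reducible_ideal) simp
  next
    case incomp
    let ?J = "join F G"
    have J: "?J \<in> L" "F \<subset> ?J" "G \<subset> ?J" "?J \<subseteq> K"
      using join_flat incomp join_upper[of F G] join_upper[of G F] join_least[OF assms(3)] less.prems by auto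
    obtain n where n: "m = vexp F 1 + (vexp G 1 + n)"
    proof -
      obtain n1 where n1: "m = vexp F (coef m F) + n1" "supp n1 = supp m - {F}" using mon_split[of m F] by auto
      obtain n2 where n2: "n1 = vexp G (coef n1 G) + n2" using mon_split[of n1 G] by auto
      have "G \<in> supp n1" using n1 incomp by auto
      then have "vexp F (coef m F) = vexp F 1 + vexp F (coef m F - 1)"
        "vexp G (coef n1 G) = vexp G 1 + vexp G (coef n1 G - 1)"
        using incomp(1) by (simp_all add: in_keys_iff flip: single_add)
      then have "m = vexp F 1 + (vexp G 1 + (vexp F (coef m F - 1) + vexp G (coef n1 G - 1) + n2))"
        using n1 n2 by (metis (no_types, lifting) add.assoc add.left_commute)
      then show ?thesis by (rule that)
    qed
    \<comment> \<open>The join lies in \<open>W\<close> as soon as \<open>F\<close> or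
      \<open>G\<close> does, so the second variable \<open>A\<close> is arbitrary.\<close>
    have meets: "supp (vexp ?J 1 + (vexp A 1 + n)) \<inter> W \<noteq> {}" for A
      using less.prems(1) assms(1) J n unfolding upset_def by (force simp: keys_add_nat)
    have bel: "below K (vexp ?J 1 + (vexp A 1 + n))" if "A \<subseteq> K" for A
      using less.prems(2) J n that by (auto simp: keys_add_nat)
    have cr: "corank (vexp ?J 1 + (vexp A 1 + n)) < corank m" if "A \<in> {F, G, ?J}" for A
      using corank_less[OF J(1) incomp(3) J(2)] corank_less[OF J(1) incomp(4) J(3)] that
      by (auto simp: n corank_vexp)
    have red: "reducible ?Q RI (mon (vexp ?J 1 + (vexp A 1 + n)))" if "A \<in> {F, G, ?J}" for A
    proof (rule less.hyps[OF cr[OF that] meets bel])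
      show "A \<subseteq> K" using that J by auto
    qed
    have "mon m - (mon (vexp ?J 1 + (vexp F 1 + n)) + mon (vexp ?J 1 + (vexp G 1 + n)) - mon (vexp ?J 1 + (vexp ?J 1 + n)))
        = (var F - var ?J) * (var G - var ?J) * mon n"
      unfolding n mon_add mon_vexp power_one_right by (simp add: algebra_simps)
    then have "mon m - (mon (vexp ?J 1 + (vexp F 1 + n)) + mon (vexp ?J 1 + (vexp G 1 + n)) - mon (vexp ?J 1 + (vexp ?J 1 + n))) \<in> RI"
      using RI_join[OF incomp(3,4)] ideal_mult_right[OF RIs] by simp
    then show ?thesis
      by (rule reducible_cong[OF RIs, rotated]) (intro reducible_diff reducible_add RIs red; simp)
  next
    case absorb
    let ?c = "coef m F"
    obtain n1 where n1: "m = vexp F ?c + n1" "supp n1 = supp m - {F}" using mon_split[of m F] by auto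
    obtain n2 where n2: "n1 = vexp G (coef n1 G) + n2" using mon_split[of n1 G] by auto
    have "G \<in> supp n1" using n1 absorb by auto
    then have "vexp G (coef n1 G) = vexp G 1 + vexp G (coef n1 G - 1)"
      by (simp add: in_keys_iff flip: single_add)
    then have "m = vexp F ?c + (vexp G 1 + (vexp G (coef n1 G - 1) + n2))" using n1(1) n2
      by (simp only: add.assoc[symmetric])
    then obtain n where n: "m = vexp F ?c + (vexp G 1 + n)" by blast
    have "supp (vexp F (Suc ?c) + n) \<inter> W \<noteq> {}"
    proof -
      obtain A where A: "A \<in> supp m" "A \<in> W" using less.prems(1) by auto
      have "A = F \<or> A = G \<or> A \<in> supp n"
        using A(1) n by (metis UnE keys_add_nat keys_single empty_iff singletonD)
      moreover have "G \<in> W \<Longrightarrow> F \<in> W" using assms(1) absorb by (auto simp: upset_def)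
      ultimately show ?thesis using A(2) by (auto simp: keys_add_nat)
    qed
    moreover have "below K (vexp F (Suc ?c) + n)"
    proof -
      have "supp n \<subseteq> supp m" using n by (metis Un_iff keys_add_nat subsetI)
      then show ?thesis using less.prems(2) absorb(1) by (auto simp: keys_add_nat)
    qed
    moreover have "corank (vexp F (Suc ?c) + n) < corank m"
    proof -
      have "corank m = corank (vexp F ?c + (vexp G 1 + n))" using n by simp
      then show ?thesis using corank_less[OF absorb(3,4,5)] by (simp add: corank_vexp)
    qed
    ultimately have red: "reducible ?Q RI (mon (vexp F (Suc ?c) + n))" using less.hyps by blast
    have "mon m - mon (vexp F (Suc ?c) + n) = (var F ^ ?c * var G - var F ^ Suc ?c) * mon n"
      by (subst n, unfold mon_add mon_vexp power_one_right) (simp add: algebra_simps)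
    then have "mon m - mon (vexp F (Suc ?c) + n) \<in> RI"
      using RI_absorb[OF absorb(3,4) _ absorb(6)] absorb(5) ideal_mult_right[OF RIs] by simp
    then show ?thesis using reducible_cong[OF RIs red] by blast
  qed
qed

lemma straighten_any: "reducible {n. std n} RI p"
proof (rule reducible_poly[OF subspace_RI])
  fix m
  have W: "upset (L - {{}})" by (auto simp: upset_def)
  show "reducible {n. std n} RI (mon m)"
  \<comment> \<open>The monomial 1 meets no up-set of nonempty flats and is treated apart, together
    with the monomials containing a variable that is a relation.\<close>
  proof (cases "m = 0 \<or> (\<exists>A\<in>supp m. A \<notin> L \<or> A = {})")
    case True
    then show ?thesis
    proof
      assume "\<exists>A\<in>supp m. A \<notin> L \<or> A = {}"
      then obtain A where A: "A \<in> supp m" "A \<notin> L \<or> A = {}" by auto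
      obtain q where "mon m = var A * q" using mon_var_factor[OF A(1)] by auto
      then show ?thesis using RI_zero[OF A(2)] ideal_mult_right[OF subspace_RI] by (intro reducible_ideal) simp
    next
      assume "m = 0"
      then show ?thesis by (simp only:) (rule reducible_mon[OF subspace_RI], simp)
    qed
  next
    case False
    then have "supp m \<noteq> {}" "\<forall>A\<in>supp m. A \<in> L \<and> A \<noteq> {}" by auto
    then have "supp m \<inter> (L - {{}}) \<noteq> {}" "below E m" using flat_subset by blast+
    then show ?thesis
      by (intro reducible_mono[OF order_refl _ straighten[OF W _ E_flat]]) auto
  qed
qed

section \<open>Ideals generated by up-sets of flats\<close>

definition upset_ideal :: "'a set set \<Rightarrow> 'a set mpoly set" where
  "upset_ideal W = ideal.span (rels \<union> var ` W)"

lemma subspace_upset_ideal: "ideal.subspace (upset_ideal W)"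
  by (simp add: upset_ideal_def)

lemma RI_subset_upset_ideal: "RI \<subseteq> upset_ideal W"
  unfolding RI_def upset_ideal_def by (rule ideal.span_mono) auto

lemma upset_ideal_var: "F \<in> W \<Longrightarrow> var F \<in> upset_ideal W"
  unfolding upset_ideal_def by (rule ideal.span_base) auto

text \<open>Meeting \<open>W\<close> survives multiplication, and straightening does not lose it. So
  the polynomials that reduce to standard monomials meeting \<open>W\<close> form an ideal, and this
  ideal contains the generators.\<close>

lemma upset_ideal_reducible:
  assumes W: "upset W" and p: "p \<in> upset_ideal W"
  shows "reducible {n. std n \<and> supp n \<inter> W \<noteq> {}} RI p"
proof -
  let ?Q = "{n. std n \<and> supp n \<inter> W \<noteq> {}}"
  have mon: "reducible ?Q RI (mon m)" if m: "supp m \<inter> W \<noteq> {}" for m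
  proof (cases "\<exists>A\<in>supp m. A \<notin> L")
    case True
    then obtain A where A: "A \<in> supp m" "A \<notin> L \<or> A = {}" by auto
    obtain q where "mon m = var A * q" using mon_var_factor[OF A(1)] by auto
    then show ?thesis using RI_zero[OF A(2)] ideal_mult_right[OF subspace_RI] by (intro reducible_ideal) simp
  next
    case False
    then have "below E m" using flat_subset by auto
    then show ?thesis
      by (intro reducible_mono[OF order_refl _ straighten[OF W m E_flat]]) auto
  qed
  have sub: "ideal.subspace {p. reducible ?Q RI p}"
  proof (rule ideal.subspaceI; clarify)
    fix c x assume "reducible ?Q RI x"
    then obtain u where u: "supp u \<subseteq> ?Q" "x - u \<in> RI" by (auto simp: reducible_def)
    have "reducible ?Q RI (c * u)"
    proof (rule reducible_poly[OF subspace_RI])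
      fix m assume "m \<in> supp (c * u)"
      then obtain a b where "m = a + b" "b \<in> supp u" using keys_mult[of c u] by auto
      then have "supp m \<inter> W \<noteq> {}" using u(1) by (auto simp: keys_add_nat)
      then show "reducible ?Q RI (mon m)" by (rule mon)
    qed
    moreover have "c * x - c * u \<in> RI"
      using ideal.subspace_scale[OF subspace_RI u(2), of c] by (simp add: right_diff_distrib)
    ultimately show "reducible ?Q RI (c * x)" using reducible_cong[OF subspace_RI] by blast
  qed (auto intro: reducible_add[OF subspace_RI] reducible_ideal simp: ideal.subspace_0[OF subspace_RI])
  have "upset_ideal W \<subseteq> {p. reducible ?Q RI p}"
    unfolding upset_ideal_def
  proof (rule ideal.span_minimal[OF _ sub], rule Un_least)
    show "rels \<subseteq> {p. reducible ?Q RI p}"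
      using ideal.span_superset[of rels] by (auto simp: RI_def intro!: reducible_ideal)
    have "var F = mon (vexp F 1)" for F :: "'a set" by (simp add: var_def)
    then show "var ` W \<subseteq> {p. reducible ?Q RI p}" using mon[of "vexp _ 1"] by auto
  qed
  then show ?thesis using p by blast
qed

text \<open>An element of the ideal has a normal form all of whose terms meet \<open>W\<close>. By
  uniqueness of normal forms modulo \<open>RI\<close> it is \<open>u\<close> itself, whose terms
  avoid \<open>W\<close>.\<close>

lemma upset_ideal_independent:
  assumes W: "upset W" and u: "\<And>m. m \<in> supp u \<Longrightarrow> std m \<and> supp m \<inter> W = {}" and "u \<in> upset_ideal W"
  shows "u = 0"
proof -
  obtain v where v: "supp v \<subseteq> {n. std n \<and> supp n \<inter> W \<noteq> {}}" "u - v \<in> RI"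
    using upset_ideal_reducible[OF W assms(3)] by (auto simp: reducible_def)
  have uv: "u = v"
  proof -
    have "u - v = 0"
    proof (rule std_independent[OF _ v(2)])
      fix m assume "m \<in> supp (u - v)"
      then have "m \<in> supp u \<or> m \<in> supp v" by (auto simp: in_keys_iff lookup_minus)
      then show "std m" using u v by blast
    qed
    then show ?thesis by simp
  qed
  have "supp u = {}"
  proof (rule ccontr)
    assume "supp u \<noteq> {}"
    then obtain m where "m \<in> supp u" by blast
    then show False using u[of m] v(1) uv by auto
  qed
  then show ?thesis by simp
qed

end

text \<open>The colon is an ideal, so containing a generated ideal is a matter of its
  generators.\<close>

lemma span_colon:
  fixes x :: "'b::comm_ring_1"
  assumes "ideal.subspace J" "\<And>g. g \<in> A \<Longrightarrow> g * x \<in> J" "f \<in> ideal.span A"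
  shows "f * x \<in> J"
proof -
  have "ideal.subspace {f. f * x \<in> J}"
    by (rule ideal.subspaceI)
       (auto simp: distrib_right mult.assoc intro: ideal.subspace_0 ideal.subspace_add ideal.subspace_scale assms(1))
  then have "ideal.span A \<subseteq> {f. f * x \<in> J}"
    using assms(2) by (intro ideal.span_minimal) auto
  then show ?thesis using assms(3) by auto
qed

text \<open>The numbering orders the coatoms of every flat by one rule; this relates the order of
  the coatoms of \<open>F\<close> to the order of the coatoms of each such coatom.\<close>

locale ordered_flat_lattice = flat_lattice +
  fixes pos :: "'a \<Rightarrow> nat"
  assumes inj_pos: "inj_on pos E"
begin

section \<open>The ideals of the filtration\<close>

text \<open>The position of the first element of \<open>F\<close> that is missing from
  \<open>H\<close>. Coatoms of larger gap come earlier, so the last member of an initial set is one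
  of smallest gap.\<close>

definition gap :: "'a set \<Rightarrow> 'a set \<Rightarrow> nat" where
  "gap F H = Min (pos ` (F - H))"

text \<open>Up to ties these are the initial segments of the coatoms of \<open>F\<close> in the lexicographic
  order, which is a recursive coatom ordering.\<close>

definition initial :: "'a set \<Rightarrow> 'a set set \<Rightarrow> bool" where
  "initial F S \<longleftrightarrow> S \<subseteq> coatoms F \<and> (\<forall>H\<in>S. \<forall>H'\<in>coatoms F. gap F H < gap F H' \<longrightarrow> H' \<in> S)"

definition coatom_ideal :: "'a set \<Rightarrow> 'a set set \<Rightarrow> 'a set mpoly set" where
  "coatom_ideal F S = ideal.span (rels \<union> var ` {G \<in> L. \<not> G \<subseteq> F} \<union> {var F - var H |H. H \<in> S})"

text \<open>Exponents of a basis modulo \<open>coatom_ideal F S\<close>. Identifying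
  \<open>h_F\<close> with \<open>h_H\<close> discards the standard monomials whose flats other than
  \<open>F\<close> lie in \<open>H\<close> and whose exponent at \<open>F\<close> cannot be
  raised.\<close>

definition basis :: "'a set \<Rightarrow> 'a set set \<Rightarrow> ('a set \<Rightarrow>\<^sub>0 nat) set" where
  "basis F S = {m. std m \<and> below F m \<and>
     (\<forall>H\<in>S. (\<forall>G\<in>supp m - {F}. G \<subseteq> H) \<longrightarrow> std (vexp F 1 + m))}"

lemma basisD:
  assumes "m \<in> basis F S"
  shows "std m" "below F m" "H \<in> S \<Longrightarrow> (\<forall>G\<in>supp m - {F}. G \<subseteq> H) \<Longrightarrow> std (vexp F 1 + m)"
proof -
  have *: "std m \<and> below F m \<and> (\<forall>H\<in>S. (\<forall>G\<in>supp m - {F}. G \<subseteq> H) \<longrightarrow> std (vexp F 1 + m))"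
    using assms unfolding basis_def by (rule CollectD)
  then show "std m" and "below F m" by simp_all
  assume "H \<in> S" and 1: "\<forall>G\<in>supp m - {F}. G \<subseteq> H"
  then have "(\<forall>G\<in>supp m - {F}. G \<subseteq> H) \<longrightarrow> std (vexp F 1 + m)" using * by (elim conjE bspec)
  then show "std (vexp F 1 + m)" using 1 by (rule mp)
qed

lemma basisI:
  assumes "std m" "below F m" "\<And>H. H \<in> S \<Longrightarrow> (\<forall>G\<in>supp m - {F}. G \<subseteq> H) \<Longrightarrow> std (vexp F 1 + m)"
  shows "m \<in> basis F S"
  using assms unfolding basis_def mem_Collect_eq by simp

lemma gap_attained:
  assumes "F \<in> L" "H \<subset> F"
  obtains e where "e \<in> F" "e \<notin> H" "pos e = gap F H"
proof -
  have "finite (pos ` (F - H))" "pos ` (F - H) \<noteq> {}" using assms finite_flat by auto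
  then have "gap F H \<in> pos ` (F - H)" unfolding gap_def by (rule Min_in)
  then show ?thesis using that by auto
qed

lemma gap_le: "F \<in> L \<Longrightarrow> e \<in> F \<Longrightarrow> e \<notin> H \<Longrightarrow> gap F H \<le> pos e"
  unfolding gap_def using finite_flat by (intro Min_le) auto

lemma gap_greaterI:
  assumes "F \<in> L" "H \<subset> F" "\<And>e. e \<in> F \<Longrightarrow> e \<notin> H \<Longrightarrow> c < pos e"
  shows "c < gap F H"
  using gap_attained[OF assms(1,2)] assms(3) by metis

lemma pos_eqD: "F \<in> L \<Longrightarrow> x \<in> F \<Longrightarrow> y \<in> F \<Longrightarrow> pos x = pos y \<Longrightarrow> x = y"
  using inj_pos flat_subset by (meson inj_onD subsetD)

lemma subspace_coatom_ideal: "ideal.subspace (coatom_ideal F S)"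
  by (simp add: coatom_ideal_def)

lemma RI_subset_coatom_ideal: "RI \<subseteq> coatom_ideal F S"
  unfolding RI_def coatom_ideal_def by (rule ideal.span_mono) auto

lemma coatom_ideal_var: "G \<in> L \<Longrightarrow> \<not> G \<subseteq> F \<Longrightarrow> var G \<in> coatom_ideal F S"
  unfolding coatom_ideal_def by (rule ideal.span_base) auto

lemma coatom_ideal_diff: "H \<in> S \<Longrightarrow> var F - var H \<in> coatom_ideal F S"
  unfolding coatom_ideal_def by (rule ideal.span_base) auto

lemma coatom_ideal_empty: "coatom_ideal F {} = upset_ideal {G \<in> L. \<not> G \<subseteq> F}"
  by (simp add: coatom_ideal_def upset_ideal_def)

lemma upset_not_below: "upset {G \<in> L. \<not> G \<subseteq> F}"
  by (auto simp: upset_def)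

lemma coatom_ideal_mono: "S \<subseteq> S' \<Longrightarrow> coatom_ideal F S \<subseteq> coatom_ideal F S'"
  unfolding coatom_ideal_def by (rule ideal.span_mono) auto

lemma coatom_ideal_remove:
  assumes "H \<in> S"
  shows "coatom_ideal F S = ideal.span (insert (var F - var H) (coatom_ideal F (S - {H})))"
proof
  let ?I = "ideal.span (insert (var F - var H) (coatom_ideal F (S - {H})))"
  have sub: "coatom_ideal F (S - {H}) \<subseteq> ?I" using ideal.span_superset by blast
  show "coatom_ideal F S \<subseteq> ?I"
  proof (subst coatom_ideal_def, rule ideal.span_minimal[OF _ ideal.subspace_span], rule subsetI)
    fix p assume "p \<in> rels \<union> var ` {G \<in> L. \<not> G \<subseteq> F} \<union> {var F - var H |H. H \<in> S}"
    then consider "p = var F - var H"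
      | "p \<in> rels \<union> var ` {G \<in> L. \<not> G \<subseteq> F} \<union> {var F - var H' |H'. H' \<in> S - {H}}" by blast
    then show "p \<in> ?I"
    proof cases
      case 1
      then show ?thesis using ideal.span_base by blast
    next
      case 2
      then have "p \<in> coatom_ideal F (S - {H})" unfolding coatom_ideal_def by (rule ideal.span_base)
      then show ?thesis using sub by blast
    qed
  qed
  show "?I \<subseteq> coatom_ideal F S"
    using coatom_ideal_diff[OF assms] coatom_ideal_mono[of "S - {H}" S F]
    by (intro ideal.span_minimal[OF _ subspace_coatom_ideal]) auto
qed

text \<open>\<open>F\<close> sits on top of the chain of \<open>m\<close>, so only its own exponent
  has to be checked against the ranks below.\<close>

lemma std_vexp_add:
  assumes "F \<in> L" "std m" "below F m" "F \<notin> supp m" "0 < b" "b \<le> rk F"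
    and "\<And>G. G \<in> supp m \<Longrightarrow> b + rk G < rk F"
  shows "std (vexp F b + m)"
proof -
  have F: "F \<noteq> {}" using assms rk_empty by auto
  have supp: "supp (vexp F b + m) = insert F (supp m)"
    using assms(5) by (auto simp: keys_add_nat)
  have c1: "coef (vexp F b + m) F = b"
    using assms(4) by (simp add: lookup_add in_keys_iff)
  have c2: "coef (vexp F b + m) G = coef m G" if "G \<in> supp m" for G
    using that assms(4) by (auto simp: lookup_add lookup_single when_def)
  show ?thesis
    unfolding std_def supp
  proof (intro conjI ballI impI)
    fix G assume G: "G \<in> insert F (supp m)"
    show "G \<in> L" "G \<noteq> {}" using G assms(1,2) F by (auto simp: std_def)
    show "coef (vexp F b + m) G \<le> rk G"
    proof (cases "G = F")
      case False
      then show ?thesis using G c2 std_coef_le[OF assms(2), of G] by auto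
    qed (use c1 assms(6) in simp)
    fix H assume H: "H \<in> insert F (supp m)"
    show "G \<subseteq> H \<or> H \<subseteq> G" using G H assms(2,3) unfolding std_def by blast
    assume HG: "H \<subset> G"
    show "coef (vexp F b + m) G + rk H < rk G"
    proof (cases "G = F")
      case True
      then show ?thesis using H HG assms(7) c1 by auto
    next
      case False
      then have "G \<in> supp m" "H \<in> supp m" using G H HG assms(3) by auto
      then show ?thesis using c2 HG assms(2) by (auto simp: std_def)
    qed
  qed
qed

lemma std_vexpD:
  assumes "std (vexp F b + m)" "0 < b" "F \<notin> supp m"
  shows "F \<in> L" "F \<noteq> {}" "b \<le> rk F" "\<And>G. G \<in> supp m \<Longrightarrow> G \<subset> F \<Longrightarrow> b + rk G < rk F"
proof -
  have c1: "coef (vexp F b + m) F = b"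
    using assms(3) by (simp add: lookup_add in_keys_iff)
  have F: "F \<in> supp (vexp F b + m)" using assms(2) by (simp add: keys_add_nat)
  then show "F \<in> L" "F \<noteq> {}" "b \<le> rk F" using assms(1) c1 by (auto simp: std_def)
  show "b + rk G < rk F" if "G \<in> supp m" "G \<subset> F" for G
  proof -
    have "G \<in> supp (vexp F b + m)" using that by (simp add: keys_add_nat)
    then show ?thesis using assms(1) c1 F that(2) unfolding std_def by metis
  qed
qed

lemma basis_mono: "S \<subseteq> S' \<Longrightarrow> basis F S' \<subseteq> basis F S"
  by (auto simp: basis_def)

lemma split_at:
  obtains n where "m = vexp F (coef m F) + n" "supp n = supp m - {F}" "F \<notin> supp n"
  using mon_split[of m F] by auto

text \<open>A discarded monomial is \<open>F^b n\<close> with \<open>n\<close> below some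
  \<open>H\<close> in \<open>S\<close> and \<open>b\<close> maximal. Modulo the ideal,
  \<open>F\<close> may be traded for \<open>H\<close>. If \<open>n\<close> is 1, the power of
  \<open>H\<close> vanishes. Otherwise \<open>b = rk H - rk G\<close> for the top flat
  \<open>G\<close> of \<open>n = G^a r\<close>, so \<open>H^b\<close> absorbs all factors
  \<open>G\<close>, and trading back gives \<open>F^(b+a) r\<close>, which belongs to the basis. One
  such step suffices.\<close>

lemma basis_spans:
  assumes F: "F \<in> L" and S: "S \<subseteq> coatoms F"
  shows "reducible (basis F S) (coatom_ideal F S) p"
proof (rule reducible_trans[OF subspace_coatom_ideal])
  let ?I = "coatom_ideal F S"
  note sub = subspace_coatom_ideal[of F S]
  show "reducible {n. std n} ?I p"
    by (rule reducible_mono[OF RI_subset_coatom_ideal order_refl straighten_any])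
  fix m :: "'a set \<Rightarrow>\<^sub>0 nat" assume "m \<in> {n. std n}"
  then have m: "std m" by simp
  have RIx: "x \<in> RI \<Longrightarrow> x \<in> ?I" for x using RI_subset_coatom_ideal by blast
  consider (out) G where "G \<in> supp m" "\<not> G \<subseteq> F" | (basis) "m \<in> basis F S"
    | (tight) H where "below F m" "H \<in> S" "\<forall>G\<in>supp m - {F}. G \<subseteq> H" "\<not> std (vexp F 1 + m)"
  proof -
    assume out: "\<And>G. G \<in> supp m \<Longrightarrow> \<not> G \<subseteq> F \<Longrightarrow> thesis" and basis: "m \<in> basis F S \<Longrightarrow> thesis"
      and tight: "\<And>H. below F m \<Longrightarrow> H \<in> S \<Longrightarrow> \<forall>G\<in>supp m - {F}. G \<subseteq> H \<Longrightarrow> \<not> std (vexp F 1 + m) \<Longrightarrow> thesis"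
  show thesis
  proof (cases "below F m")
    case below: True
    show ?thesis
    proof (cases "\<exists>H\<in>S. (\<forall>G\<in>supp m - {F}. G \<subseteq> H) \<and> \<not> std (vexp F 1 + m)")
      case True
      then show ?thesis using tight below by meson
    next
      case False
      then have "m \<in> basis F S" by (intro basisI[OF m below]) meson
      then show ?thesis by (rule basis)
    qed
  next
    case False
    then show ?thesis using out by meson
  qed
  qed
  then show "reducible (basis F S) ?I (mon m)"
  proof cases
    case out
    then have "G \<in> L" using m by (auto simp: std_def)
    obtain q where "mon m = var G * q" using mon_var_factor[OF out(1)] by auto
    then show ?thesis
      using ideal_mult_right[OF sub coatom_ideal_var[OF \<open>G \<in> L\<close> out(2)]] by (intro reducible_ideal) simp
  next
    case basis
    then show ?thesis by (rule reducible_mon[OF sub])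
  next
    case tight
    have H: "H \<in> L" "H \<subset> F" "rk F = Suc (rk H)" using coatomsD tight(2) S by auto
    obtain n where n: "m = vexp F (coef m F) + n" "supp n = supp m - {F}" "F \<notin> supp n"
      by (rule split_at)
    define b where "b = coef m F"
    have stdn: "std n" using m n(1) std_divisor by metis
    have xI: "var F - var H \<in> ?I" using coatom_ideal_diff tight(2) by auto
    have powI: "var F ^ k - var H ^ k \<in> ?I" for k
    proof (induction k)
      case (Suc k)
      have "var F ^ Suc k - var H ^ Suc k = var F * (var F ^ k - var H ^ k) + var H ^ k * (var F - var H)"
        by (simp add: algebra_simps)
      then show ?case
        using ideal.subspace_add[OF sub ideal.subspace_scale[OF sub Suc] ideal.subspace_scale[OF sub xI]]
        by simp
    qed (simp add: ideal.subspace_0[OF sub])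
    have add1: "vexp F 1 + m = vexp F (Suc b) + n"
      by (subst n(1)) (simp add: b_def add.assoc[symmetric] flip: single_add)
    show ?thesis
    proof (cases "supp n = {}")
      case True
      then have "n = 0" by simp
      then have m': "m = vexp F b" using n b_def by simp
      have "\<not> Suc b \<le> rk F"
        using tight(4) std_vexp_add[OF F, of n "Suc b"] stdn \<open>n = 0\<close> unfolding add1 by auto
      then have "rk H < b" using H(3) by simp
      then have "var H ^ b \<in> ?I" using RI_power[OF H(1)] RIx by blast
      then have "var F ^ b \<in> ?I" by (rule ideal_pull[OF sub _ powI])
      then show ?thesis unfolding m' mon_vexp by (rule reducible_ideal)
    next
      case False
      obtain G where G: "G \<in> supp n" "\<And>K. K \<in> supp n \<Longrightarrow> K \<subseteq> G"
        using std_chain_top[OF stdn order_refl False] by blast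
      have GL: "G \<in> L" "G \<subseteq> H" "G \<subset> F" using G(1) n(2) tight(3) H(2) stdn by (auto simp: std_def)
      have less: "b + rk G < rk F"
        using std_coef_less[OF m F, of G] G(1) n(2) GL(3) b_def by auto
      have top: "rk K \<le> rk G" if "K \<in> supp n" for K
        using rk_le[of K G] G(2)[OF that] GL(1) stdn that by (auto simp: std_def)
      have "rk F \<le> Suc b + rk G"
      proof (rule ccontr)
        assume "\<not> ?thesis"
        then have *: "Suc b + rk G < rk F" by simp
        have "std (vexp F (Suc b) + n)"
        proof (rule std_vexp_add[OF F stdn _ n(3)])
          show "below F n" using n(2) tight(1) by auto
          show "Suc b + rk K < rk F" if "K \<in> supp n" for K using * top[OF that] by simp
        qed (use * in auto)
        then show False using tight(4) add1 by simp
      qed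
      then have b: "rk H = b + rk G" using less H(3) by simp
      obtain r where r: "n = vexp G (coef n G) + r" "supp r = supp n - {G}" "G \<notin> supp r"
        by (rule split_at)
      define a where "a = coef n G"
      have a: "0 < a" "a \<le> rk G" using G(1) std_coef_le[OF stdn] by (auto simp: a_def in_keys_iff)
      obtain a' where a': "a = Suc a'" using a by (cases a) auto
      have rless: "a + rk K < rk G" if "K \<in> supp r" for K
      proof -
        have "K \<in> supp n" "K \<subset> G" using that r G(2) by auto
        then show ?thesis using std_coef_less[OF stdn GL(1)] a_def by simp
      qed
      define m' where "m' = vexp F (b + a) + r"
      have rF: "F \<notin> supp r" "std r" "below F r"
        using r n stdn std_divisor[of "vexp G (coef n G)" r] tight(1) by auto
      \<comment> \<open>The flats of \<open>r\<close> have rank less than \<open>rk G - a\<close>,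
        which leaves room for one more factor \<open>F\<close>; so the condition in
        \<open>basis\<close> holds whatever coatom is considered.\<close>
      have "std (vexp F (Suc (b + a)) + r)"
      proof (rule std_vexp_add[OF F rF(2,3,1)])
        show "Suc (b + a) \<le> rk F" using a b H(3) by simp
        show "Suc (b + a) + rk K < rk F" if "K \<in> supp r" for K using rless[OF that] b H(3) by simp
      qed simp
      moreover have "vexp F 1 + m' = vexp F (Suc (b + a)) + r"
        by (simp add: m'_def add.assoc[symmetric] flip: single_add)
      ultimately have "std (vexp F 1 + m')" by simp
      then have "m' \<in> basis F S"
        using std_divisor rF(3) by (auto simp: basis_def m'_def keys_add_nat split: if_splits)
      moreover have "mon m - mon m' \<in> ?I"
      proof -
        have e1: "var F ^ b - var H ^ b \<in> ?I" by (rule powI)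
        have e2: "var H ^ b * var G - var H ^ Suc b \<in> RI"
          using RI_absorb[OF H(1) GL(1,2)] b by simp
        have e3: "var H ^ b * var G ^ Suc k - var H ^ (b + Suc k) \<in> ?I" for k
        proof (induction k)
          case 0
          then show ?case using RIx[OF e2] by simp
        next
          case (Suc k)
          have "var H ^ b * var G ^ Suc (Suc k) - var H ^ (b + Suc (Suc k)) =
              var G * (var H ^ b * var G ^ Suc k - var H ^ (b + Suc k))
              + var H ^ Suc k * (var H ^ b * var G - var H ^ Suc b)"
            by (simp add: algebra_simps power_add)
          then show ?case
            using ideal.subspace_add[OF sub ideal.subspace_scale[OF sub Suc] ideal.subspace_scale[OF sub RIx[OF e2]]]
            by (simp only:)
        qed
        have m: "m = vexp F b + (vexp G a + r)" using n(1) r(1) a_def b_def by simp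
        have "mon m - mon m' = (var G ^ a * mon r) * (var F ^ b - var H ^ b)
           + mon r * (var H ^ b * var G ^ a - var H ^ (b + a))
           - mon r * (var F ^ (b + a) - var H ^ (b + a))"
          unfolding m m'_def mon_add mon_vexp by (simp add: algebra_simps)
        moreover have "var H ^ b * var G ^ a - var H ^ (b + a) \<in> ?I" using e3[of a'] a' by simp
        note ideal.subspace_diff[OF sub ideal.subspace_add[OF sub ideal.subspace_scale[OF sub powI]
              ideal.subspace_scale[OF sub this]] ideal.subspace_scale[OF sub powI]]
        ultimately show ?thesis by (simp only:)
      qed
      ultimately show ?thesis
        using reducible_cong[OF sub reducible_mon[OF sub]] by blast
    qed
  qed
qed

text \<open>The coatoms of \<open>H\<close> containing all elements of \<open>H\<close> that precede
  the first element of \<open>F\<close> missing from \<open>H\<close>. They depend on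
  \<open>F\<close> and \<open>H\<close> alone; their relation to the earlier coatoms of
  \<open>F\<close> is the content of \<open>next_extend\<close> and
  \<open>next_meet\<close>.\<close>

definition next_coatoms :: "'a set \<Rightarrow> 'a set \<Rightarrow> 'a set set" where
  "next_coatoms F H = {G \<in> coatoms H. gap F H < gap H G}"

lemma initial_next: "initial H (next_coatoms F H)"
  by (auto simp: initial_def next_coatoms_def)

lemma initial_remove:
  assumes "initial F S" "H \<in> S" "\<And>H'. H' \<in> S \<Longrightarrow> gap F H \<le> gap F H'"
  shows "initial F (S - {H})"
  unfolding initial_def
proof (intro conjI ballI impI)
  show "S - {H} \<subseteq> coatoms F" using assms(1) unfolding initial_def by blast
  fix H1 H' assume H1: "H1 \<in> S - {H}" and H': "H' \<in> coatoms F" "gap F H1 < gap F H'"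
  then have "H' \<in> S" using assms(1) unfolding initial_def by blast
  moreover have "gap F H \<le> gap F H1" using assms(3) H1 by simp
  then have "H' \<noteq> H" using H'(2) by auto
  ultimately show "H' \<in> S - {H}" by simp
qed

section \<open>Multiplication by the difference of a flat and its last coatom\<close>

context
  fixes F S H
  assumes F: "F \<in> L" and S: "initial F S" and HS: "H \<in> S"
    and least: "\<And>H'. H' \<in> S \<Longrightarrow> gap F H \<le> gap F H'"
begin

lemma H_facts: "H \<in> L" "H \<subset> F" "rk F = Suc (rk H)" "H \<in> coatoms F" "F \<noteq> {}"
  using coatomsD[of H F] S HS by (auto simp: initial_def)

text \<open>\<open>H'\<close> is spanned by \<open>G\<close> and the first element \<open>e\<close>
  of \<open>F\<close> missing from \<open>H\<close>. Elements of \<open>F\<close> before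
  \<open>e\<close> lie in \<open>H\<close> and, by the choice of \<open>G\<close>, even in
  \<open>G\<close>. So \<open>H'\<close> has a strictly larger gap than \<open>H\<close> and comes
  earlier.\<close>

lemma next_extend:
  assumes G: "G \<in> next_coatoms F H"
  shows "\<exists>H'\<in>S - {H}. G \<subseteq> H' \<and> G \<in> coatoms H'"
proof -
  have GL: "G \<in> L" "G \<subset> H" "rk H = Suc (rk G)" "gap F H < gap H G"
    using G coatomsD by (auto simp: next_coatoms_def)
  obtain e where e: "e \<in> F" "e \<notin> H" "pos e = gap F H"
    using gap_attained[OF F H_facts(2)] .
  let ?H' = "cl (insert e G)"
  have eE: "e \<in> E" "e \<notin> G" using e F flat_subset GL by auto
  have H': "?H' \<in> L" "?H' \<subseteq> F" "rk ?H' = Suc (rk G)" "insert e G \<subseteq> ?H'"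
    using eE e GL F H_facts cl_insert_flat rk_insert cl_least[of F "insert e G"] cl_superset by auto
  have "?H' \<noteq> F" using H' GL(3) H_facts(3) by auto
  then have co: "?H' \<in> coatoms F" using H' GL H_facts by (auto simp: coatoms_def)
  have "gap F H < gap F ?H'"
  proof (rule gap_greaterI[OF F])
    show "?H' \<subset> F" using H'(2) \<open>?H' \<noteq> F\<close> by auto
    fix x assume x: "x \<in> F" "x \<notin> ?H'"
    then have "x \<noteq> e" "x \<notin> G" using H'(4) by auto
    show "gap F H < pos x"
    proof (cases "x \<in> H")
      case True
      then show ?thesis using gap_le[OF H_facts(1) True \<open>x \<notin> G\<close>] GL(4) by simp
    next
      case False
      then have "gap F H \<le> pos x" using gap_le[OF F x(1)] by simp
      moreover have "pos x \<noteq> gap F H" using pos_eqD[OF F x(1) e(1)] \<open>x \<noteq> e\<close> e(3) by metis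
      ultimately show ?thesis by simp
    qed
  qed
  then have "?H' \<in> S" using S HS co by (auto simp: initial_def)
  moreover have "?H' \<noteq> H" using H'(4) e by auto
  moreover have "G \<in> coatoms ?H'" using H' GL eE by (auto simp: coatoms_def)
  ultimately show ?thesis using H'(4) by auto
qed

text \<open>Every coatom of \<open>H\<close> above \<open>H \<inter> H'\<close> qualifies: an
  element of \<open>H\<close> outside it is missing from \<open>H'\<close>, hence does not precede
  the first element missing from \<open>H'\<close>, hence comes strictly after the first one missing
  from \<open>H\<close>.\<close>

lemma next_meet:
  assumes H': "H' \<in> S - {H}"
  shows "\<exists>G\<in>next_coatoms F H. H \<inter> H' \<subseteq> G"
proof -
  have H'c: "H' \<in> L" "H' \<subset> F" "rk F = Suc (rk H')" using coatomsD[of H' F] S H' by (auto simp: initial_def)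
  have "\<not> H \<subseteq> H'" using flat_eqI[OF H_facts(1) H'c(1)] H'c(3) H_facts(3) H' by auto
  then have K: "H \<inter> H' \<in> L" "H \<inter> H' \<subset> H" using flat_Int H_facts(1) H'c(1) by auto
  then obtain G where G: "G \<in> coatoms H" "H \<inter> H' \<subseteq> G" using coatom_above[OF H_facts(1)] by blast
  obtain e where e: "e \<in> F" "e \<notin> H" "pos e = gap F H"
    using gap_attained[OF F H_facts(2)] .
  have "gap F H < gap H G"
  proof (rule gap_greaterI[OF H_facts(1)])
    show "G \<subset> H" using coatomsD[OF G(1)] by auto
    fix x assume x: "x \<in> H" "x \<notin> G"
    then have "x \<notin> H'" "x \<in> F" using G(2) H_facts(2) by auto
    then have "gap F H' \<le> pos x" using gap_le[OF F] by auto
    moreover have "gap F H \<le> gap F H'" using least H' by auto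
    moreover have "pos x \<noteq> gap F H" using pos_eqD[OF F \<open>x \<in> F\<close> e(1)] x e by metis
    ultimately show "gap F H < pos x" by simp
  qed
  then show ?thesis using G by (auto simp: next_coatoms_def)
qed

text \<open>Checked on generators. If \<open>G\<close> is below \<open>F\<close> but not below
  \<open>H\<close>, its join with \<open>H\<close> is \<open>F\<close>, and the join relation
  together with \<open>F (F - H) = 0\<close> gives the claim. If \<open>G\<close> is in
  \<open>next_coatoms\<close>, then \<open>next_extend\<close> provides \<open>H'\<close> with
  \<open>F = H'\<close> modulo the smaller ideal and \<open>H'^2 = H' G\<close>. So
  \<open>F G = F^2 = F H\<close>, and with \<open>H^2 = H G\<close> the product
  \<open>(H - G) (F - H)\<close> vanishes.\<close>

lemma coatom_colon_superset:
  assumes f: "f \<in> coatom_ideal H (next_coatoms F H)"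
  shows "f * (var F - var H) \<in> coatom_ideal F (S - {H})"
proof (rule span_colon[OF subspace_coatom_ideal _ f[unfolded coatom_ideal_def]])
  let ?J = "coatom_ideal F (S - {H})"
  note sub = subspace_coatom_ideal[of F "S - {H}"]
  have RIx: "x \<in> RI \<Longrightarrow> x \<in> ?J" for x using RI_subset_coatom_ideal by blast
  have FH: "var F * (var F - var H) \<in> ?J" using RIx RI_cover[OF F H_facts(4)] by blast
  fix g assume "g \<in> rels \<union> var ` {G \<in> L. \<not> G \<subseteq> H} \<union> {var H - var G |G. G \<in> next_coatoms F H}"
  then consider (rel) "g \<in> rels" | (var) G where "G \<in> L" "\<not> G \<subseteq> H" "g = var G"
    | (nxt) G where "G \<in> next_coatoms F H" "g = var H - var G" by blast
  then show "g * (var F - var H) \<in> ?J"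
  proof cases
    case rel
    then show ?thesis using RIx ideal_mult_right[OF sub] ideal.span_base unfolding RI_def by metis
  next
    case var
    show ?thesis
    proof (cases "G \<subseteq> F")
      case False
      then show ?thesis using ideal_mult_right[OF sub coatom_ideal_var] var by simp
    next
      case True
      show ?thesis
      proof (cases "G = F")
        case True
        then show ?thesis using FH var by simp
      next
        case nF: False
        have JL: "join G H \<in> L" "join G H \<subseteq> F" "H \<subset> join G H"
          using join_flat[OF var(1) H_facts(1)] join_least[OF F] True H_facts(2) join_upper[of G H] join_upper[of H G] var(2)
          by auto
        then have "rk F \<le> rk (join G H)" using rk_less[OF H_facts(1) JL(1,3)] H_facts(3) by simp
        then have J: "join G H = F" using flat_eqI[OF JL(1) F JL(2)] by simp
        have 1: "(var G - var F) * (var H - var F) \<in> ?J" using RI_join[OF var(1) H_facts(1)] J RIx by simp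
        have "var G * (var F - var H) = var F * (var F - var H) - (var G - var F) * (var H - var F)"
          by (simp add: algebra_simps)
        then show ?thesis unfolding var(3) by (simp only:) (rule ideal.subspace_diff[OF sub FH 1])
      qed
    qed
  next
    case nxt
    obtain H' where H': "H' \<in> S" "H' \<noteq> H" "G \<in> coatoms H'" using next_extend[OF nxt(1)] by auto
    have H'c: "H' \<in> L" "H' \<subset> F" "rk F = Suc (rk H')" "H' \<in> coatoms F"
      using coatomsD[of H' F] S H' by (auto simp: initial_def)
    have G: "G \<in> L" "G \<in> coatoms H" "G \<subset> H" using nxt coatomsD by (auto simp: next_coatoms_def)
    have 2: "var H * (var H - var G) \<in> ?J" using RIx RI_cover[OF H_facts(1) G(2)] by blast
    have 3: "var H' * (var H' - var G) \<in> ?J" using RIx RI_cover[OF H'c(1) H'(3)] by blast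
    have 4: "var F - var H' \<in> ?J" using coatom_ideal_diff H' by auto
    have "(var H - var G) * (var F - var H) =
       (var F + var H' - var G) * (var F - var H') + var H' * (var H' - var G)
       - var F * (var F - var H) - var H * (var H - var G)"
      by (simp add: algebra_simps)
    moreover have "\<dots> \<in> ?J"
      by (rule ideal.subspace_diff[OF sub ideal.subspace_diff[OF sub ideal.subspace_add[OF sub
              ideal.subspace_scale[OF sub 4] 3] FH] 2])
    ultimately show ?thesis using nxt(2) by simp
  qed
qed

text \<open>The exponent of \<open>h_F\<close> times the monomial of \<open>m\<close>: since
  \<open>F H = F^2\<close>, every factor \<open>H\<close> turns into \<open>F\<close>.\<close>

definition lift :: "('a set \<Rightarrow>\<^sub>0 nat) \<Rightarrow> ('a set \<Rightarrow>\<^sub>0 nat)" where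
  "lift m = vexp F (Suc (coef m H)) + (m - vexp H (coef m H))"

lemma liftE:
  obtains n where "m = vexp H (coef m H) + n" "supp n = supp m - {H}" "H \<notin> supp n"
    "lift m = vexp F (Suc (coef m H)) + n"
proof -
  obtain n where n: "m = vexp H (coef m H) + n" "supp n = supp m - {H}" "H \<notin> supp n"
    by (rule split_at)
  have "m - vexp H (coef m H) = n" using n(1) by (metis add_diff_cancel_left')
  then show ?thesis using that n by (simp add: lift_def)
qed

lemma lift_inj:
  assumes "below H m" "below H m'" "lift m = lift m'"
  shows "m = m'"
proof -
  obtain n where n: "m = vexp H (coef m H) + n" "supp n = supp m - {H}" "lift m = vexp F (Suc (coef m H)) + n"
    by (rule liftE)
  obtain n' where n': "m' = vexp H (coef m' H) + n'" "supp n' = supp m' - {H}" "lift m' = vexp F (Suc (coef m' H)) + n'"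
    by (rule liftE)
  have "F \<notin> supp n" "F \<notin> supp n'" using assms n n' H_facts(2) by auto
  then have "coef (lift m) F = Suc (coef m H)" "coef (lift m') F = Suc (coef m' H)"
    using n(3) n'(3) by (simp_all add: lookup_add in_keys_iff)
  then have c: "coef m H = coef m' H" using assms(3) by simp
  then have "n = n'" using n(3) n'(3) assms(3) by simp
  then show ?thesis using n(1) n'(1) c by simp
qed

text \<open>If the flats of \<open>lift m\<close> other than \<open>F\<close> lie below an earlier
  coatom \<open>H'\<close>, then by \<open>next_meet\<close> the flats of \<open>m\<close> other
  than \<open>H\<close> lie below a member of \<open>next_coatoms\<close>. The basis condition on
  \<open>m\<close> then allows one more factor \<open>H\<close>, and the bounds for \<open>H\<close>
  and \<open>F\<close> differ by the rank between them.\<close>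

lemma lift_basis:
  assumes m: "m \<in> basis H (next_coatoms F H)"
  shows "lift m \<in> basis F (S - {H})" "F \<in> supp (lift m)"
proof -
  have stdm: "std m" "below H m" using basisD(1,2)[OF m] by simp_all
  obtain n where n: "m = vexp H (coef m H) + n" "supp n = supp m - {H}" "H \<notin> supp n" "lift m = vexp F (Suc (coef m H)) + n"
    by (rule liftE)
  define b where "b = coef m H"
  have stdn: "std n" using n(1) stdm(1) std_divisor by metis
  have nF: "below F n" "F \<notin> supp n" using n(2) stdm(2) H_facts(2) by auto
  have b: "b \<le> rk H" "\<And>G. G \<in> supp n \<Longrightarrow> b + rk G < rk H"
  proof -
    show "b \<le> rk H" using std_coef_le[OF stdm(1)] b_def by simp
    show "b + rk G < rk H" if "G \<in> supp n" for G
    proof -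
      have "G \<in> supp m" "G \<subset> H" using n(2) stdm(2) that by auto
      then show ?thesis using std_coef_less[OF stdm(1) H_facts(1)] b_def by simp
    qed
  qed
  show "F \<in> supp (lift m)" using n(4) by (simp add: keys_add_nat)
  have "std (lift m)"
    unfolding n(4) using b H_facts(3)
    by (intro std_vexp_add[OF F stdn nF]) (auto simp: b_def[symmetric])
  moreover have "below F (lift m)" using nF n(4) by (auto simp: keys_add_nat)
  moreover have "std (vexp F 1 + lift m)" if H': "H' \<in> S - {H}" and *: "\<forall>G\<in>supp (lift m) - {F}. G \<subseteq> H'" for H'
  proof -
    obtain G where G: "G \<in> next_coatoms F H" "H \<inter> H' \<subseteq> G" using next_meet[OF H'] by auto
    have "\<forall>K\<in>supp m - {H}. K \<subseteq> G"
    proof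
      fix K assume K: "K \<in> supp m - {H}"
      then have "K \<subseteq> H" "K \<in> supp (lift m) - {F}"
        using stdm(2) n H_facts(2) by (auto simp: keys_add_nat)
      then show "K \<subseteq> G" using * G(2) by blast
    qed
    then have "std (vexp H 1 + m)" by (rule basisD(3)[OF m G(1)])
    moreover have "vexp H 1 + m = vexp H (Suc b) + n"
      by (subst n(1)) (simp add: b_def add.assoc[symmetric] flip: single_add)
    ultimately have sH: "std (vexp H (Suc b) + n)" by simp
    have "\<And>G. G \<in> supp n \<Longrightarrow> G \<subset> H" using n(2) stdm(2) by auto
    then have s: "Suc b \<le> rk H" "\<And>G. G \<in> supp n \<Longrightarrow> Suc b + rk G < rk H"
      using std_vexpD[OF sH _ n(3)] by auto
    have "std (vexp F (Suc (Suc b)) + n)"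
    proof (rule std_vexp_add[OF F stdn nF])
      show "Suc (Suc b) + rk G < rk F" if "G \<in> supp n" for G using s(2)[OF that] H_facts(3) by simp
    qed (use s H_facts(3) in auto)
    moreover have "vexp F 1 + lift m = vexp F (Suc (Suc b)) + n"
      by (simp add: n(4) b_def add.assoc[symmetric] flip: single_add)
    ultimately show ?thesis by simp
  qed
  ultimately show "lift m \<in> basis F (S - {H})" by (rule basisI)
qed

lemma lift_mult: "var F * mon m - mon (lift m) \<in> RI"
proof -
  obtain n where n: "m = vexp H (coef m H) + n" "lift m = vexp F (Suc (coef m H)) + n"
    by (rule liftE)
  have "var F * var H ^ k - var F ^ Suc k \<in> RI" for k
  proof (induction k)
    case 0
    then show ?case using ideal.subspace_0[OF subspace_RI] by simp
  next
    case (Suc k)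
    have "var F * var H ^ Suc k - var F ^ Suc (Suc k) =
        var H * (var F * var H ^ k - var F ^ Suc k) - var F ^ k * (var F * (var F - var H))"
      by (simp add: algebra_simps)
    then show ?case
      using ideal.subspace_diff[OF subspace_RI ideal.subspace_scale[OF subspace_RI Suc]
          ideal.subspace_scale[OF subspace_RI RI_cover[OF F H_facts(4)]]] by (simp only:)
  qed
  then have "mon n * (var F * var H ^ coef m H - var F ^ Suc (coef m H)) \<in> RI"
    by (rule ideal.subspace_scale[OF subspace_RI])
  moreover have "var F * mon m - mon (lift m) = mon n * (var F * var H ^ coef m H - var F ^ Suc (coef m H))"
    by (subst n(1), subst n(2)) (simp only: mon_add mon_vexp right_diff_distrib mult_ac)
  ultimately show ?thesis by simp
qed

text \<open>Straightening takes place below \<open>H\<close> and with respect to the up-set of flats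
  above \<open>H\<close>; a monomial obeying both contains \<open>H\<close>. The last clause fixes
  the result when there is nothing to rewrite, and \<open>coatom_independent_step\<close> reads off
  coefficients in that case.\<close>

lemma residue_exists:
  assumes m: "m \<in> basis H (next_coatoms F H)"
  shows "\<exists>r. supp r \<subseteq> {n. std n \<and> below H n \<and> H \<in> supp n} \<and> var H * mon m - r \<in> RI \<and>
           (std (vexp H 1 + m) \<longrightarrow> r = mon (vexp H 1 + m))"
proof (cases "std (vexp H 1 + m)")
  case True
  have "below H (vexp H 1 + m)" using m by (auto simp: basis_def keys_add_nat)
  moreover have "var H * mon m - mon (vexp H 1 + m) \<in> RI"
    using ideal.subspace_0[OF subspace_RI] by (simp add: mon_add mon_vexp_Suc0)
  ultimately show ?thesis using True
    by (intro exI[of _ "mon (vexp H 1 + m)"]) (simp add: keys_add_nat)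
next
  case False
  show ?thesis
  proof (cases "H = {}")
    case True
    then have "var H * mon m \<in> RI" using RI_zero[of H] ideal_mult_right[OF subspace_RI] by blast
    then show ?thesis using False by (intro exI[of _ 0]) auto
  next
    case nonempty: False
    let ?W = "{G \<in> L. H \<subseteq> G}"
    have W: "upset ?W" using nonempty by (auto simp: upset_def)
    have b: "below H (vexp H 1 + m)" using m by (auto simp: basis_def keys_add_nat)
    have "supp (vexp H 1 + m) \<inter> ?W \<noteq> {}" using H_facts(1) by (auto simp: keys_add_nat)
    from straighten[OF W this H_facts(1) b] obtain r
      where r: "supp r \<subseteq> {n. std n \<and> supp n \<inter> ?W \<noteq> {} \<and> below H n}" "mon (vexp H 1 + m) - r \<in> RI"
      by (auto simp: reducible_def)
    have "H \<in> supp n" if n: "supp n \<inter> ?W \<noteq> {}" "below H n" for n :: "'a set \<Rightarrow>\<^sub>0 nat"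
    proof -
      obtain G where "G \<in> supp n" "G \<in> ?W" using n(1) by blast
      moreover from this have "G = H" using n(2) by blast
      ultimately show ?thesis by simp
    qed
    then have "supp r \<subseteq> {n. std n \<and> below H n \<and> H \<in> supp n}" using r(1) by blast
    moreover have "var H * mon m - r \<in> RI" using r(2) by (simp add: mon_add mon_vexp_Suc0)
    ultimately show ?thesis using False by blast
  qed
qed

definition residue :: "('a set \<Rightarrow>\<^sub>0 nat) \<Rightarrow> 'a set mpoly" where
  "residue m = (SOME r. supp r \<subseteq> {n. std n \<and> below H n \<and> H \<in> supp n} \<and> var H * mon m - r \<in> RI \<and>
           (std (vexp H 1 + m) \<longrightarrow> r = mon (vexp H 1 + m)))"

lemma residue:
  assumes "m \<in> basis H (next_coatoms F H)"
  shows "supp (residue m) \<subseteq> {n. std n \<and> below H n \<and> H \<in> supp n}" "var H * mon m - residue m \<in> RI"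
    "std (vexp H 1 + m) \<Longrightarrow> residue m = mon (vexp H 1 + m)"
  using someI_ex[OF residue_exists[OF assms]] unfolding residue_def by blast+

text \<open>A monomial containing \<open>H\<close> does not lie below another coatom
  \<open>H'\<close> of \<open>F\<close>, so the condition in \<open>basis\<close> is void for
  it.\<close>

lemma residue_basis:
  assumes "std n" "below H n" "H \<in> supp n"
  shows "n \<in> basis F (S - {H})" "F \<notin> supp n"
proof -
  show "F \<notin> supp n" using assms H_facts by auto
  have "\<not> (\<forall>G\<in>supp n - {F}. G \<subseteq> H')" if "H' \<in> S - {H}" for H'
  proof -
    have "H' \<in> L" "rk F = Suc (rk H')" using coatomsD[of H' F] S that by (auto simp: initial_def)
    then have "\<not> H \<subseteq> H'" using flat_eqI[OF H_facts(1)] that H_facts(3) by auto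
    then show ?thesis using assms(3) H_facts(2) by auto
  qed
  moreover have "below F n" using assms(2) H_facts(2) by blast
  ultimately show "n \<in> basis F (S - {H})" by (intro basisI[OF assms(1)]) blast+
qed

text \<open>The normal form of \<open>(h\<^sub>F - h\<^sub>H) u\<close> modulo \<open>coatom_ideal F (S - {H})\<close>. Its \<open>lift\<close> part
  involves \<open>F\<close> and its \<open>residue\<close> part does not, so nothing cancels.\<close>

definition shift :: "'a set mpoly \<Rightarrow> 'a set mpoly" where
  "shift u = lin (\<lambda>m. mon (lift m) - residue m) u"

lemma shift_cong:
  assumes "supp u \<subseteq> basis H (next_coatoms F H)"
  shows "(var F - var H) * u - shift u \<in> RI"
proof -
  have "lin (\<lambda>m. (var F - var H) * mon m) u - lin (\<lambda>m. mon (lift m) - residue m) u \<in> RI"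
  proof (rule lin_cong_ideal[OF subspace_RI])
    fix m assume "m \<in> supp u"
    then have m: "m \<in> basis H (next_coatoms F H)" using assms by auto
    have "(var F - var H) * mon m - (mon (lift m) - residue m) =
        (var F * mon m - mon (lift m)) - (var H * mon m - residue m)"
      by (simp add: algebra_simps)
    then show "(var F - var H) * mon m - (mon (lift m) - residue m) \<in> RI"
      by (simp only:) (rule ideal.subspace_diff[OF subspace_RI lift_mult residue(2)[OF m]])
  qed
  then show ?thesis by (simp add: shift_def lin_mult_left)
qed

lemma supp_shift:
  assumes "supp u \<subseteq> basis H (next_coatoms F H)"
  shows "supp (shift u) \<subseteq> basis F (S - {H})"
proof
  fix k assume "k \<in> supp (shift u)"
  then have "(\<Sum>m\<in>supp u. coef u m * coef (mon (lift m) - residue m) k) \<noteq> 0"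
    by (simp add: in_keys_iff shift_def lookup_lin)
  then obtain m where m: "m \<in> supp u" "coef (mon (lift m) - residue m) k \<noteq> 0"
    by (metis (no_types, lifting) mult_eq_0_iff sum.neutral)
  then have mb: "m \<in> basis H (next_coatoms F H)" using assms by auto
  from m(2) have "k = lift m \<or> k \<in> supp (residue m)"
    by (auto simp: lookup_minus lookup_single when_def in_keys_iff split: if_splits)
  then show "k \<in> basis F (S - {H})"
    using lift_basis(1)[OF mb] residue(1)[OF mb] residue_basis(1) by blast
qed

lemma coef_shift_lift:
  assumes u: "supp u \<subseteq> basis H (next_coatoms F H)" and m: "m \<in> supp u"
  shows "coef (shift u) (lift m) = coef u m"
proof -
  have "coef (mon (lift m') - residue m') (lift m) = (if m' = m then 1 else 0)" if "m' \<in> supp u" for m'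
  proof -
    have mb: "m \<in> basis H (next_coatoms F H)" "m' \<in> basis H (next_coatoms F H)" using that m u by auto
    have "lift m \<notin> supp (residue m')"
      using lift_basis(2)[OF mb(1)] residue(1)[OF mb(2)] residue_basis(2) by blast
    then have "coef (residue m') (lift m) = 0" by (simp add: in_keys_iff)
    moreover have "lift m' = lift m \<longleftrightarrow> m' = m"
      using lift_inj mb by (auto simp: basis_def)
    ultimately show ?thesis by (simp add: lookup_minus lookup_single when_def)
  qed
  then have "coef (shift u) (lift m) = (\<Sum>m'\<in>supp u. if m' = m then coef u m' else 0)"
    unfolding shift_def lookup_lin by (intro sum.cong) auto
  then show ?thesis using m by simp
qed

lemma shift_eq_0:
  assumes "supp u \<subseteq> basis H (next_coatoms F H)" "shift u = 0"
  shows "u = 0"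
proof -
  have "m \<notin> supp u" for m
    using coef_shift_lift[OF assms(1), of m] assms(2) by (auto simp: in_keys_iff)
  then show ?thesis by (metis all_not_in_conv keys_eq_empty)
qed

text \<open>Writing \<open>v\<close> as a multiple of \<open>F - H\<close> modulo the smaller ideal
  and normalizing the factor gives \<open>v = shift u\<close>. If \<open>m\<close> occurs in
  \<open>u\<close>, then \<open>lift m\<close> occurs in \<open>v\<close>, and the basis condition
  for \<open>H\<close> makes \<open>H m\<close> standard. So the residue of \<open>m\<close> is
  \<open>H m\<close> itself, and \<open>H m\<close> occurs in \<open>v\<close> as well, although it
  lies below \<open>H\<close> and admits no factor \<open>F\<close>.\<close>

lemma coatom_independent_step:
  assumes indep: "\<And>u. supp u \<subseteq> basis F (S - {H}) \<Longrightarrow> u \<in> coatom_ideal F (S - {H}) \<Longrightarrow> u = 0"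
    and v: "supp v \<subseteq> basis F S" "v \<in> coatom_ideal F S"
  shows "v = 0"
proof -
  let ?J = "coatom_ideal F (S - {H})" and ?B = "basis H (next_coatoms F H)"
  note sub = subspace_coatom_ideal[of F "S - {H}"]
  from v(2)[unfolded coatom_ideal_remove[OF HS]] obtain f where f: "v - f * (var F - var H) \<in> ?J"
    by (auto simp: ideal.span_insert ideal.span_eq_iff[THEN iffD2, OF sub])
  obtain u where u: "supp u \<subseteq> ?B" "f - u \<in> coatom_ideal H (next_coatoms F H)"
    using basis_spans[OF H_facts(1), of "next_coatoms F H" f] by (auto simp: reducible_def next_coatoms_def)
  have 1: "(f - u) * (var F - var H) \<in> ?J" by (rule coatom_colon_superset[OF u(2)])
  have 2: "(var F - var H) * u - shift u \<in> ?J" using shift_cong[OF u(1)] RI_subset_coatom_ideal by blast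
  have "v - shift u = (v - f * (var F - var H)) + (f - u) * (var F - var H) + ((var F - var H) * u - shift u)"
    by (simp add: algebra_simps)
  then have 3: "v - shift u \<in> ?J"
    by (simp only:) (rule ideal.subspace_add[OF sub ideal.subspace_add[OF sub f 1] 2])
  have "supp (v - shift u) \<subseteq> basis F (S - {H})"
  proof
    fix k assume "k \<in> supp (v - shift u)"
    then have "k \<in> supp v \<or> k \<in> supp (shift u)" by (auto simp: in_keys_iff lookup_minus)
    then show "k \<in> basis F (S - {H})"
      using v(1) supp_shift[OF u(1)] basis_mono[of "S - {H}" S F] by blast
  qed
  then have eq: "v = shift u" using indep[OF _ 3] by simp
  have stdH: "std (vexp H 1 + m)" if m: "m \<in> supp u" for m
  proof -
    have mb: "m \<in> ?B" using m u(1) by auto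
    then have below: "below H m" by (rule basisD)
    obtain n where n: "m = vexp H (coef m H) + n" "supp n = supp m - {H}" "H \<notin> supp n" "lift m = vexp F (Suc (coef m H)) + n"
      by (rule liftE)
    have "lift m \<in> supp v" using coef_shift_lift[OF u(1) m] m by (simp add: eq in_keys_iff)
    moreover have "\<forall>G\<in>supp (lift m) - {F}. G \<subseteq> H" using n below by (auto simp: keys_add_nat)
    ultimately have "std (vexp F 1 + lift m)" using v(1) by (intro basisD(3)[OF _ HS]) auto
    moreover have "vexp F 1 + lift m = vexp F (Suc (Suc (coef m H))) + n"
      by (simp add: n(4) add.assoc[symmetric] flip: single_add)
    ultimately have sF: "std (vexp F (Suc (Suc (coef m H))) + n)" by simp
    have nF: "F \<notin> supp n" "\<And>G. G \<in> supp n \<Longrightarrow> G \<subset> F" using n(2) below H_facts(2) by auto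
    have s: "Suc (Suc (coef m H)) \<le> rk F" "\<And>G. G \<in> supp n \<Longrightarrow> Suc (Suc (coef m H)) + rk G < rk F"
      using std_vexpD(3,4)[OF sF _ nF(1)] nF(2) by auto
    have "std (vexp H (Suc (coef m H)) + n)"
    proof (rule std_vexp_add[OF H_facts(1) _ _ n(3)])
      show "std n" using sF std_divisor by blast
      show "below H n" using below n(2) by auto
      show "Suc (coef m H) + rk G < rk H" if "G \<in> supp n" for G using s(2)[OF that] H_facts(3) by simp
    qed (use s(1) H_facts(3) in auto)
    moreover have "vexp H 1 + m = vexp H (Suc (coef m H)) + n"
      by (subst n(1)) (simp add: add.assoc[symmetric] flip: single_add)
    ultimately show ?thesis by simp
  qed
  have "supp u = {}"
  proof (rule ccontr)
    assume "supp u \<noteq> {}"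
    then obtain m where m: "m \<in> supp u" by blast
    let ?k = "vexp H 1 + m"
    have Hs: "std ?k" "H \<in> supp ?k" using stdH[OF m] by (auto simp: keys_add_nat)
    have below: "below H ?k" using m u(1) by (auto simp: basis_def keys_add_nat)
    have "coef (mon (lift m') - residue m') ?k = (if m' = m then - 1 else 0)" if m': "m' \<in> supp u" for m'
    proof -
      have mb: "m' \<in> ?B" using m' u(1) by auto
      have "lift m' \<noteq> ?k" using lift_basis(2)[OF mb] residue_basis(2)[OF Hs(1) below Hs(2)] by auto
      then show ?thesis unfolding residue(3)[OF mb stdH[OF m']]
        by (auto simp: lookup_minus lookup_single when_def)
    qed
    then have "coef (shift u) ?k = (\<Sum>m'\<in>supp u. coef u m' * (if m' = m then - 1 else 0))"
      unfolding shift_def lookup_lin by (intro sum.cong) auto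
    also have "\<dots> = (\<Sum>m'\<in>supp u. if m' = m then - coef u m' else 0)" by (intro sum.cong) auto
    also have "\<dots> = - coef u m" using m by simp
    finally have "?k \<in> supp v" using m by (simp add: eq in_keys_iff)
    moreover have "\<forall>G\<in>supp ?k - {F}. G \<subseteq> H" using below by auto
    ultimately have "std (vexp F 1 + ?k)" using v(1) by (intro basisD(3)[OF _ HS]) auto
    moreover have "F \<notin> supp ?k" using residue_basis(2)[OF Hs(1) below Hs(2)] .
    \<comment> \<open>A factor \<open>F\<close> above a factor \<open>H\<close> requires a rank
      difference of at least two, but \<open>H\<close> is a coatom.\<close>
    ultimately have "1 + rk H < rk F" using std_vexpD(4)[of F 1 ?k H] Hs(2) H_facts(2) by simp
    then show False using H_facts(3) by simp
  qed
  then have "u = 0" by simp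
  then show ?thesis using eq by (simp add: shift_def)
qed

end

text \<open>Removing a member of smallest gap keeps the set initial; with no coatom left the ideal
  is that of an up-set.\<close>

lemma coatom_independent:
  assumes F: "F \<in> L" and "initial F S" "supp u \<subseteq> basis F S" "u \<in> coatom_ideal F S"
  shows "u = 0"
  using assms(2-4)
proof (induction "card S" arbitrary: S u)
  case 0
  have "finite S" using 0(2) finite_L by (auto simp: initial_def coatoms_def intro: finite_subset)
  then have "S = {}" using 0 by simp
  show ?case
  proof (rule upset_ideal_independent[OF upset_not_below[of F]])
    show "u \<in> upset_ideal {G \<in> L. \<not> G \<subseteq> F}" using 0 \<open>S = {}\<close> by (simp add: coatom_ideal_empty)
    show "std m \<and> supp m \<inter> {G \<in> L. \<not> G \<subseteq> F} = {}" if "m \<in> supp u" for m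
      using that 0 by (auto simp: basis_def)
  qed
next
  case (Suc k)
  have fin: "finite S" using Suc(3) finite_L by (auto simp: initial_def coatoms_def intro: finite_subset)
  have "S \<noteq> {}" using Suc(2) by auto
  then obtain H where H: "H \<in> S" "\<And>H'. H' \<in> S \<Longrightarrow> gap F H \<le> gap F H'"
    using arg_min_if_finite(1)[OF fin, of "gap F"] arg_min_least[OF fin, of _ "gap F"] by metis
  show ?case
  proof (rule coatom_independent_step[OF F Suc(3) H])
    fix u assume "supp u \<subseteq> basis F (S - {H})" "u \<in> coatom_ideal F (S - {H})"
    then show "u = 0" using Suc(1)[of "S - {H}" u] Suc(2) H(1) fin initial_remove[OF Suc(3) H] by simp
  qed (use Suc in auto)
qed

text \<open>An element of the colon may be replaced by its normal form \<open>u\<close>. Its product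
  with \<open>F - H\<close> has the normal form \<open>shift u\<close>, which vanishes by
  independence, and \<open>shift\<close> is injective.\<close>

lemma coatom_colon:
  assumes F: "F \<in> L" and S: "initial F S" "H \<in> S" "\<And>H'. H' \<in> S \<Longrightarrow> gap F H \<le> gap F H'"
  shows "{f. f * (var F - var H) \<in> coatom_ideal F (S - {H})} = coatom_ideal H (next_coatoms F H)"
proof (intro equalityI subsetI; clarify?)
  let ?J = "coatom_ideal F (S - {H})" and ?C = "coatom_ideal H (next_coatoms F H)"
  note sub = subspace_coatom_ideal[of F "S - {H}"] and facts = F S
  have H: "H \<in> L" using coatomsD[of H F] S by (auto simp: initial_def)
  fix f
  {
    assume f: "f * (var F - var H) \<in> ?J"
    obtain u where u: "supp u \<subseteq> basis H (next_coatoms F H)" "f - u \<in> ?C"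
      using basis_spans[OF H, of "next_coatoms F H" f] by (auto simp: reducible_def next_coatoms_def)
    have 1: "(f - u) * (var F - var H) \<in> ?J" by (rule coatom_colon_superset[OF facts u(2)])
    have 2: "(var F - var H) * u - shift F H u \<in> ?J"
      using shift_cong[OF facts u(1)] RI_subset_coatom_ideal by blast
    have "shift F H u = f * (var F - var H) - (f - u) * (var F - var H) - ((var F - var H) * u - shift F H u)"
      by (simp add: algebra_simps)
    then have "shift F H u \<in> ?J"
      by (rule ssubst) (rule ideal.subspace_diff[OF sub ideal.subspace_diff[OF sub f 1] 2])
    then have "shift F H u = 0"
      using coatom_independent[OF F initial_remove[OF S]] supp_shift[OF facts u(1)] by blast
    then have "u = 0" using shift_eq_0[OF facts u(1)] by simp
    then show "f \<in> ?C" using u(2) by simp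
  next
    assume "f \<in> ?C"
    from coatom_colon_superset[OF facts this] show "f * (var F - var H) \<in> ?J" .
  }
qed

lemma initial_coatoms: "initial F (coatoms F)"
  by (auto simp: initial_def)

text \<open>The flats of a monomial below \<open>F\<close>, other than \<open>F\<close> itself,
  always lie in some coatom of \<open>F\<close>, so the condition in \<open>basis\<close> applies to
  each of its members and makes \<open>F m\<close> standard. As \<open>F\<close> is minimal in
  \<open>W\<close>, these products avoid \<open>W - {F}\<close>: multiplication by
  \<open>h_F\<close> takes normal forms to normal forms.\<close>

lemma upset_colon:
  assumes W: "upset W" and F: "F \<in> W" and minimal: "\<And>G. G \<in> W \<Longrightarrow> \<not> G \<subset> F"
  shows "{f. f * var F \<in> upset_ideal (W - {F})} = coatom_ideal F (coatoms F)"
proof (intro equalityI subsetI; clarify?)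
  let ?J = "upset_ideal (W - {F})" and ?C = "coatom_ideal F (coatoms F)"
  have FL: "F \<in> L" "F \<noteq> {}" using W F by (auto simp: upset_def)
  have W': "upset (W - {F})" using W minimal unfolding upset_def by blast
  note sub = subspace_upset_ideal[of "W - {F}"]
  have RIx: "x \<in> RI \<Longrightarrow> x \<in> ?J" for x using RI_subset_upset_ideal by blast
  have sup: "f * var F \<in> ?J" if f: "f \<in> ?C" for f
  proof (rule span_colon[OF sub _ f[unfolded coatom_ideal_def]])
    fix g assume "g \<in> rels \<union> var ` {G \<in> L. \<not> G \<subseteq> F} \<union> {var F - var H |H. H \<in> coatoms F}"
    then consider (rel) "g \<in> rels" | (var) G where "G \<in> L" "\<not> G \<subseteq> F" "g = var G"
      | (co) H where "H \<in> coatoms F" "g = var F - var H" by blast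
    then show "g * var F \<in> ?J"
    proof cases
      case rel
      then show ?thesis using RIx ideal_mult_right[OF sub] ideal.span_base unfolding RI_def by metis
    next
      case var
      let ?K = "join G F"
      have K: "?K \<in> L" "F \<subset> ?K"
        using join_flat[OF var(1) FL(1)] join_upper[of G F] join_upper[of F G] var(2) by auto
      then have "?K \<in> W - {F}" using W F by (auto simp: upset_def)
      then have 1: "var ?K \<in> ?J" by (rule upset_ideal_var)
      have 2: "(var G - var ?K) * (var F - var ?K) \<in> ?J" using RIx RI_join[OF var(1) FL(1)] by blast
      have "g * var F = (var G - var ?K) * (var F - var ?K) + (var G + var F - var ?K) * var ?K"
        by (simp add: var(3) algebra_simps)
      then show ?thesis by (simp only:) (rule ideal.subspace_add[OF sub 2 ideal.subspace_scale[OF sub 1]])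
    next
      case co
      then show ?thesis using RIx RI_cover[OF FL(1) co(1)] by (simp add: mult.commute)
    qed
  qed
  fix f
  {
    assume f: "f * var F \<in> ?J"
    obtain u where u: "supp u \<subseteq> basis F (coatoms F)" "f - u \<in> ?C"
      using basis_spans[OF FL(1), of "coatoms F" f] by (auto simp: reducible_def)
    have "(f - u) * var F \<in> ?J" by (rule sup[OF u(2)])
    then have "f * var F - (f - u) * var F \<in> ?J" by (rule ideal.subspace_diff[OF sub f])
    then have J: "mon (vexp F 1) * u \<in> ?J" by (simp add: mon_vexp_Suc0 algebra_simps)
    have "mon (vexp F 1) * u = 0"
    proof (rule upset_ideal_independent[OF W' _ J])
      fix k assume "k \<in> supp (mon (vexp F 1) * u)"
      then obtain m where m: "k = vexp F 1 + m" "m \<in> supp u" by (auto simp: keys_mon_mult)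
      then have mb: "std m" "below F m" "m \<in> basis F (coatoms F)" using u(1) basisD by blast+
      obtain H where H: "H \<in> coatoms F" "\<forall>G\<in>supp m - {F}. G \<subseteq> H"
      proof (cases "supp m - {F} = {}")
        case True
        obtain H where "H \<in> coatoms F" using coatom_above[OF FL(1) empty_flat] FL(2) by auto
        then show ?thesis using that True by blast
      next
        case False
        then obtain T where T: "T \<in> supp m - {F}" "\<And>G. G \<in> supp m - {F} \<Longrightarrow> G \<subseteq> T"
          using std_chain_top[OF mb(1), of "supp m - {F}"] by blast
        then have "T \<in> L" "T \<subset> F" using mb by (auto simp: std_def)
        then obtain H where "H \<in> coatoms F" "T \<subseteq> H" using coatom_above[OF FL(1)] by blast
        then show ?thesis using that T by blast
      qed
      have "std k" unfolding m(1) by (rule basisD(3)[OF mb(3) H])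
      moreover have "below F k" using mb(2) m(1) by (auto simp: keys_add_nat)
      then have "supp k \<inter> (W - {F}) = {}" using minimal by blast
      ultimately show "std k \<and> supp k \<inter> (W - {F}) = {}" by blast
    qed
    then have "coef u m = 0" for m using lookup_mon_mult_add[of "vexp F 1" u m] by simp
    then have "u = 0" by (intro poly_mapping_eqI) simp
    then show "f \<in> ?C" using u(2) by simp
  next
    assume "f \<in> ?C"
    then show "f * var F \<in> ?J" by (rule sup)
  }
qed

section \<open>The finite family of ideals and its step property\<close>

definition family :: "'a set mpoly set set" where
  "family = {upset_ideal W |W. upset W} \<union> {coatom_ideal F S |F S. F \<in> L \<and> initial F S}"

lemma finite_family: "finite family"
proof -
  have "{upset_ideal W |W. upset W} \<subseteq> upset_ideal ` Pow L" by (auto simp: upset_def)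
  moreover have "{coatom_ideal F S |F S. F \<in> L \<and> initial F S} \<subseteq> case_prod coatom_ideal ` (L \<times> Pow L)"
    by (force simp: initial_def coatoms_def)
  ultimately show ?thesis
    unfolding family_def using finite_L by (meson finite_Pow_iff finite_SigmaI finite_UnI finite_imageI finite_subset)
qed

lemma family_generated:
  assumes "I \<in> family"
  shows "\<exists>A. (\<forall>a\<in>A. homogeneous (Suc 0) a) \<and> I = ideal.span (rels \<union> A)"
  using assms unfolding family_def
proof (elim UnE CollectE exE conjE)
  fix W assume "I = upset_ideal W"
  then show ?thesis by (intro exI[of _ "var ` W"]) (auto simp: upset_ideal_def)
next
  fix F S assume "I = coatom_ideal F S"
  then show ?thesis
    by (intro exI[of _ "var ` {G \<in> L. \<not> G \<subseteq> F} \<union> {var F - var H |H. H \<in> S}"])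
       (auto simp: coatom_ideal_def Un_assoc intro: homogeneous_diff)
qed

lemma zero_coef_subspace: "ideal.subspace {p :: 'v mpoly. coef p 0 = 0}"
proof (rule ideal.subspaceI; clarify)
  fix c x :: "'v mpoly" assume x: "coef x 0 = 0"
  show "coef (c * x) 0 = 0"
  proof (rule ccontr)
    assume "coef (c * x) 0 \<noteq> 0"
    then have "0 \<in> supp (c * x)" by (simp add: in_keys_iff)
    then obtain a b where ab: "0 = a + b" "b \<in> supp x" using keys_mult[of c x] by auto
    have "supp (a + b) = {}" using ab(1) by (metis keys_zero)
    then have "supp b = {}" unfolding keys_add_nat by simp
    then show False using ab(2) x by (simp add: in_keys_iff)
  qed
qed (auto simp: lookup_add)

lemma homogeneous_coef_0: "homogeneous (Suc k) p \<Longrightarrow> coef p 0 = 0" for p :: "'v mpoly"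
proof (rule ccontr)
  assume "homogeneous (Suc k) p" "coef p 0 \<noteq> 0"
  then have "0 \<in> supp p" "\<forall>m\<in>supp p. tdeg m = Suc k" by (simp_all add: homogeneous_iff_tdeg in_keys_iff)
  then have "tdeg (0 :: 'v \<Rightarrow>\<^sub>0 nat) = Suc k" by (rule bspec[rotated])
  then show False by simp
qed

lemma rels_homogeneous:
  assumes "p \<in> rels"
  shows "homogeneous 1 p \<or> homogeneous 2 p"
proof -
  have *: "homogeneous 2 (p * q)" if "homogeneous (Suc 0) p" "homogeneous (Suc 0) q" for p q :: "'a set mpoly"
    using homogeneous_mult[OF that] by (simp add: numeral_2_eq_2)
  from assms consider A where "p = var A"
    | F G where "p = (var F - var (join F G)) * (var G - var (join F G))"
    | F G where "p = var F * (var F - var G)"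
    unfolding rels_def by blast
  then show ?thesis
  proof cases
    case 1
    then show ?thesis by simp
  next
    case 2
    then show ?thesis by (simp only:) (intro disjI2 * homogeneous_diff homogeneous_var)
  next
    case 3
    then show ?thesis by (simp only:) (intro disjI2 * homogeneous_diff homogeneous_var)
  qed
qed

text \<open>Generators and relations are homogeneous of positive degree. Hence 1 lies in no member
  of the family, which makes every step of the filtration proper.\<close>

lemma family_proper:
  assumes "I \<in> family"
  shows "I \<subseteq> {p. coef p 0 = 0}"
proof -
  obtain A where A: "\<forall>a\<in>A. homogeneous (Suc 0) a" "I = ideal.span (rels \<union> A)"
    using family_generated[OF assms] by auto
  have "coef p 0 = 0" if "p \<in> rels" for p
    using rels_homogeneous[OF that] homogeneous_coef_0[of 0 p] homogeneous_coef_0[of 1 p] by (auto simp: numeral_2_eq_2)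
  then show ?thesis unfolding A(2)
    using A(1) homogeneous_coef_0 by (intro ideal.span_minimal[OF _ zero_coef_subspace]) auto
qed

lemma one_notin_family: "I \<in> family \<Longrightarrow> 1 \<notin> I"
proof
  assume "I \<in> family" "1 \<in> I"
  then have "coef (1 :: 'a set mpoly) 0 = 0" using family_proper by blast
  then show False by simp
qed

text \<open>A step removes a minimal flat from an up-set or a coatom of smallest gap from an initial
  set; the empty set of coatoms falls under up-sets. If \<open>a\<close> were in \<open>J\<close>,
  the colon would contain 1, although it is a member of the family.\<close>

theorem family_step:
  assumes "I \<in> family" "I \<noteq> RI"
  shows "\<exists>J\<in>family. \<exists>a. homogeneous (Suc 0) a \<and> a \<notin> J \<and> I = ideal.span (insert a J) \<and>
           {f. f * a \<in> J} \<in> family"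
proof -
  have upset_step: ?thesis if I: "I = upset_ideal W" and W: "upset W" for W
  proof -
    have "W \<noteq> {}" using assms(2) I by (auto simp: upset_ideal_def RI_def)
    moreover have "finite W" using W finite_L by (auto simp: upset_def intro: finite_subset)
    ultimately obtain F where F: "F \<in> W" "\<And>G. G \<in> W \<Longrightarrow> G \<subseteq> F \<Longrightarrow> F = G"
      using finite_has_minimal[of W] by blast
    then have min: "\<And>G. G \<in> W \<Longrightarrow> \<not> G \<subset> F" by blast
    have W': "upset (W - {F})" using W min unfolding upset_def by blast
    have J: "upset_ideal (W - {F}) \<in> family" using W' by (auto simp: family_def)
    have FL: "F \<in> L" using F W by (auto simp: upset_def)
    have C: "{f. f * var F \<in> upset_ideal (W - {F})} \<in> family"
    proof -
      have "{f. f * var F \<in> upset_ideal (W - {F})} = coatom_ideal F (coatoms F)"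
        by (rule upset_colon[OF W F(1)]) (rule min)
      then show ?thesis unfolding family_def using FL initial_coatoms by blast
    qed
    have "1 \<notin> {f. f * var F \<in> upset_ideal (W - {F})}" by (rule one_notin_family[OF C])
    then have nin: "var F \<notin> upset_ideal (W - {F})" by simp
    have "I = ideal.span (insert (var F) (upset_ideal (W - {F})))"
    proof
      show "I \<subseteq> ideal.span (insert (var F) (upset_ideal (W - {F})))"
        unfolding I upset_ideal_def
      proof (rule ideal.span_minimal[OF _ ideal.subspace_span], rule subsetI)
        fix p assume "p \<in> rels \<union> var ` W"
        then have "p = var F \<or> p \<in> rels \<union> var ` (W - {F})"
        proof (elim UnE imageE)
          fix G assume G: "p = var G" "G \<in> W"
          show ?thesis
          proof (cases "G = F")
            case False
            then have "var G \<in> var ` (W - {F})" using G(2) by (intro imageI) simp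
            then show ?thesis unfolding G(1) by (intro disjI2 UnI2)
          qed (simp add: G(1))
        qed (intro disjI2 UnI1)
        then show "p \<in> ideal.span (insert (var F) (ideal.span (rels \<union> var ` (W - {F}))))"
        proof
          assume p: "p = var F"
          show ?thesis unfolding p by (rule ideal.span_base) (rule insertI1)
        next
          assume "p \<in> rels \<union> var ` (W - {F})"
          then show ?thesis by (intro ideal.span_base insertI2)
        qed
      qed
      show "ideal.span (insert (var F) (upset_ideal (W - {F}))) \<subseteq> I"
        unfolding I
      proof (rule ideal.span_minimal[OF _ subspace_upset_ideal])
        have "upset_ideal (W - {F}) \<subseteq> upset_ideal W"
          unfolding upset_ideal_def by (rule ideal.span_mono) auto
        then show "insert (var F) (upset_ideal (W - {F})) \<subseteq> upset_ideal W"
          using upset_ideal_var[OF F(1)] by auto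
      qed
    qed
    then show ?thesis
      by (intro bexI[OF _ J] exI[of _ "var F"] conjI homogeneous_var nin C)
  qed
  from assms(1) consider (up) W where "I = upset_ideal W" "upset W"
    | (co) F S where "I = coatom_ideal F S" "F \<in> L" "initial F S" by (auto simp: family_def)
  then show ?thesis
  proof cases
    case up
    then show ?thesis by (rule upset_step)
  next
    case co
    show ?thesis
    proof (cases "S = {}")
      case True
      then show ?thesis using upset_step co(1) upset_not_below by (simp add: coatom_ideal_empty)
    next
      case False
      have fin: "finite S" using co(3) finite_L by (auto simp: initial_def coatoms_def intro: finite_subset)
      then obtain H where H: "H \<in> S" "\<And>H'. H' \<in> S \<Longrightarrow> gap F H \<le> gap F H'"
        using False arg_min_if_finite(1)[OF fin, of "gap F"] arg_min_least[OF fin, of _ "gap F"] by metis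
      have HL: "H \<in> L" using coatomsD[of H F] co(3) H(1) by (auto simp: initial_def)
      have J: "coatom_ideal F (S - {H}) \<in> family"
        using co(2) initial_remove[OF co(3) H] by (auto simp: family_def)
      have C: "{f. f * (var F - var H) \<in> coatom_ideal F (S - {H})} \<in> family"
      proof -
        have "{f. f * (var F - var H) \<in> coatom_ideal F (S - {H})} = coatom_ideal H (next_coatoms F H)"
          by (rule coatom_colon[OF co(2,3) H(1)]) (rule H(2))
        then show ?thesis unfolding family_def using HL initial_next by blast
      qed
      have "1 \<notin> {f. f * (var F - var H) \<in> coatom_ideal F (S - {H})}"
        by (rule one_notin_family[OF C])
      then have "var F - var H \<notin> coatom_ideal F (S - {H})" by simp
      moreover have "I = ideal.span (insert (var F - var H) (coatom_ideal F (S - {H})))"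
        using coatom_ideal_remove[OF H(1)] co(1) by simp
      ultimately show ?thesis
        by (intro bexI[OF _ J] exI[of _ "var F - var H"] conjI homogeneous_diff homogeneous_var C)
    qed
  qed
qed

end

section \<open>The lattice of flats of a matroid\<close>

locale matroid_rank_function =
  fixes E :: "'a set" and indep :: "'a set \<Rightarrow> bool"
  assumes matroid: "matroid E indep"
begin

abbreviation r :: "'a set \<Rightarrow> nat" where
  "r \<equiv> matroid_rank indep"

lemma indep_subset: "indep I \<Longrightarrow> I \<subseteq> E"
  and indep_empty: "indep {}"
  and indep_mono: "indep J \<Longrightarrow> I \<subseteq> J \<Longrightarrow> indep I"
  and augment: "indep I \<Longrightarrow> indep J \<Longrightarrow> card I < card J \<Longrightarrow> \<exists>x\<in>J - I. indep (insert x I)"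
  and finite_ground: "finite E"
  using matroid unfolding matroid_def by blast+

lemma finite_indep: "finite {I. I \<subseteq> A \<and> indep I}"
  by (rule finite_subset[of _ "Pow E"]) (use indep_subset finite_ground in auto)

lemma indep_finite: "indep I \<Longrightarrow> finite I"
  using indep_subset finite_ground finite_subset by blast

lemma rank_ge: "I \<subseteq> A \<Longrightarrow> indep I \<Longrightarrow> card I \<le> r A"
  unfolding matroid_rank_def by (rule Max_ge) (use finite_indep in auto)

lemma rank_attained: "\<exists>I\<subseteq>A. indep I \<and> card I = r A"
proof -
  have "r A \<in> card ` {I. I \<subseteq> A \<and> indep I}"
    unfolding matroid_rank_def by (rule Max_in) (use finite_indep indep_empty in auto)
  then show ?thesis by auto
qed

lemma indep_extend:
  assumes "indep I" "I \<subseteq> A"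
  shows "\<exists>J. I \<subseteq> J \<and> J \<subseteq> A \<and> indep J \<and> card J = r A"
  using assms
proof (induction "r A - card I" arbitrary: I rule: less_induct)
  case less
  show ?case
  proof (cases "card I < r A")
    case True
    obtain B where B: "B \<subseteq> A" "indep B" "card B = r A" using rank_attained by blast
    then obtain x where x: "x \<in> B" "x \<notin> I" "indep (insert x I)" using augment[of I B] less.prems True by auto
    then have "card (insert x I) = Suc (card I)" using less.prems indep_finite by simp
    then have "\<exists>J. insert x I \<subseteq> J \<and> J \<subseteq> A \<and> indep J \<and> card J = r A"
      using x B less.prems True by (intro less.hyps) auto
    then show ?thesis by blast
  next
    case False
    then show ?thesis using rank_ge[OF less.prems(2,1)] less.prems by (intro exI[of _ I]) auto
  qed
qed

lemma rank_mono: "A \<subseteq> B \<Longrightarrow> r A \<le> r B"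
  using rank_attained[of A] rank_ge[of _ B] by (metis subset_trans)

lemma rank_le_insert: "r A \<le> r (insert x A)"
  by (rule rank_mono) auto

lemma rank_insert_le: "r (insert x A) \<le> Suc (r A)"
proof -
  obtain I where I: "I \<subseteq> insert x A" "indep I" "card I = r (insert x A)" using rank_attained by blast
  have "card I \<le> Suc (card (I - {x}))" 
    using card_Suc_Diff1[of I x] indep_finite[OF I(2)] by (cases "x \<in> I") auto
  moreover have "card (I - {x}) \<le> r A" using I indep_mono[of I "I - {x}"] by (intro rank_ge) auto
  ultimately show ?thesis using I(3) by simp
qed

text \<open>If \<open>x\<close> raised the rank of \<open>B\<close>, a basis of \<open>B\<close>
  extending one of \<open>A\<close> could be enlarged by \<open>x\<close>, and then so could the
  basis of \<open>A\<close>.\<close>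

lemma rank_insert_stable:
  assumes "A \<subseteq> B" "r (insert x A) = r A"
  shows "r (insert x B) = r B"
proof (rule ccontr)
  assume "r (insert x B) \<noteq> r B"
  then have less: "r B < r (insert x B)" using rank_le_insert[of B x] by auto
  obtain I where I: "I \<subseteq> A" "indep I" "card I = r A" using rank_attained by blast
  obtain J where J: "I \<subseteq> J" "J \<subseteq> B" "indep J" "card J = r B" using indep_extend[of I B] I assms(1) by blast
  obtain K where K: "K \<subseteq> insert x B" "indep K" "card K = r (insert x B)" using rank_attained by blast
  obtain y where y: "y \<in> K" "y \<notin> J" "indep (insert y J)" using augment[OF J(3) K(2)] J K less by auto
  have card: "card (insert y J) = Suc (card J)" using y J indep_finite by simp
  have "y = x"
  proof (rule ccontr)
    assume "y \<noteq> x"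
    then have "insert y J \<subseteq> B" using y K J by auto
    then show False using rank_ge[of "insert y J" B] y card J by auto
  qed
  then have "indep (insert x I)" using indep_mono[OF y(3), of "insert x I"] J(1) by auto
  moreover have "x \<notin> I" using y J \<open>y = x\<close> by auto
  ultimately have "Suc (card I) \<le> r (insert x A)"
    using rank_ge[of "insert x I" "insert x A"] I indep_finite by auto
  then show False using I assms(2) by simp
qed

lemma flat_iff: "F \<in> flats E indep \<longleftrightarrow> F \<subseteq> E \<and> (\<forall>x\<in>E - F. r (insert x F) \<noteq> r F)"
proof -
  have "r F < r (insert x F) \<longleftrightarrow> r (insert x F) \<noteq> r F" for x
    using rank_le_insert[of F x] by auto
  then show ?thesis by (simp add: flats_def)
qed

lemma flat_closed: "F \<in> flats E indep \<Longrightarrow> A \<subseteq> F \<Longrightarrow> x \<in> E \<Longrightarrow> r (insert x A) = r A \<Longrightarrow> x \<in> F"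
  using rank_insert_stable[of A F x] by (auto simp: flat_iff)

lemma rank_union_stable:
  assumes "finite C" "\<And>x. x \<in> C \<Longrightarrow> r (insert x A) = r A"
  shows "r (A \<union> C) = r A"
  using assms
proof (induction C)
  case (insert x C)
  have "r (insert x (A \<union> C)) = r (A \<union> C)"
    by (rule rank_insert_stable[of A]) (use insert.prems in blast)+
  moreover have "r (A \<union> C) = r A" using insert.IH insert.prems by blast
  ultimately show ?case by (simp only: Un_insert_right)
qed simp

text \<open>Ties \<open>clo\<close>, an intersection of flats, to the rank function, so that the
  rank axiom of \<open>flat_lattice\<close> becomes a statement about adding a single
  element.\<close>

lemma closure_rank:
  assumes "A \<subseteq> E"
  defines "C \<equiv> {x \<in> E. r (insert x A) = r A}"
  shows "C \<in> flats E indep" "r C = r A" "A \<subseteq> C" "clo (flats E indep) A = C"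
proof -
  show AC: "A \<subseteq> C"
  proof
    fix x assume "x \<in> A"
    then have "insert x A = A" "x \<in> E" using assms(1) by auto
    then show "x \<in> C" by (simp add: C_def)
  qed
  have "r (A \<union> C) = r A" using finite_ground by (intro rank_union_stable) (auto simp: C_def)
  then show rC: "r C = r A" using AC by (simp add: Un_absorb1)
  show flat: "C \<in> flats E indep"
    unfolding flat_iff
  proof (intro conjI ballI notI)
    fix x assume x: "x \<in> E - C" "r (insert x C) = r C"
    have "r (insert x A) \<le> r (insert x C)" using AC by (intro rank_mono) auto
    then have "r (insert x A) = r A" using x(2) rC rank_le_insert[of A x] by auto
    then show False using x(1) by (simp add: C_def)
  qed (auto simp: C_def)
  have "C \<subseteq> F" if "F \<in> flats E indep" "A \<subseteq> F" for F
    using flat_closed[OF that] by (auto simp: C_def)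
  then show "clo (flats E indep) A = C" using flat AC by (auto simp: clo_def)
qed

end

lemma simple_matroid_flat_lattice:
  assumes "simple_matroid E indep"
  shows "flat_lattice E (flats E indep) (matroid_rank indep)"
proof -
  interpret matroid_rank_function E indep
    using assms by unfold_locales (simp add: simple_matroid_def)
  have single: "indep {x}" if "x \<in> E" for x
    using assms that by (auto simp: simple_matroid_def loop_def)
  have r0: "r {} = 0" using rank_attained[of "{}"] by auto
  show ?thesis
  proof
    show "finite E" by (rule finite_ground)
    show "E \<in> flats E indep" by (auto simp: flat_iff)
    show "r {} = 0" by (rule r0)
    \<comment> \<open>In the absence of loops each singleton has rank at least 1.\<close>
    show "{} \<in> flats E indep"
      using rank_ge[of "{x}" "{x}" for x] single r0 by (fastforce simp: flat_iff)
    show "F \<subseteq> E" if "F \<in> flats E indep" for F using that by (simp add: flat_iff)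
    show "F \<inter> G \<in> flats E indep" if "F \<in> flats E indep" "G \<in> flats E indep" for F G
      using that flat_closed[of F "F \<inter> G"] flat_closed[of G "F \<inter> G"] unfolding flat_iff by blast
    show "r (clo (flats E indep) (insert e F)) = Suc (r F)"
      if "F \<in> flats E indep" "e \<in> E" "e \<notin> F" for F e
    proof -
      have "insert e F \<subseteq> E" using that by (simp add: flat_iff)
      then have "r (clo (flats E indep) (insert e F)) = r (insert e F)" using closure_rank(2,4)[of "insert e F"] by simp
      moreover have "r (insert e F) \<noteq> r F" using that by (simp add: flat_iff)
      ultimately show ?thesis using rank_le_insert[of F e] rank_insert_le[of e F] by auto
    qed
  qed
qed

section \<open>Comparison of the two presentations\<close>

text \<open>Formulated with sets \<open>C\<close> and \<open>I\<close> since it serves two rings: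
  all polynomials in the \<open>h\<close> generators, and the polynomials in the Chow variables,
  which are only a subset of their type. Accordingly the two substitutions are compared on the
  variables that occur.\<close>

lemma psubst_cong_ideal:
  assumes C: "\<And>c. const c \<in> C" "\<And>p q. p \<in> C \<Longrightarrow> q \<in> C \<Longrightarrow> p + q \<in> C" "\<And>p q. p \<in> C \<Longrightarrow> q \<in> C \<Longrightarrow> p * q \<in> C"
    and I: "0 \<in> I" "\<And>p q. p \<in> I \<Longrightarrow> q \<in> I \<Longrightarrow> p + q \<in> I" "\<And>c p. c \<in> C \<Longrightarrow> p \<in> I \<Longrightarrow> c * p \<in> I"
    and fg: "\<And>m v. m \<in> supp p \<Longrightarrow> v \<in> supp m \<Longrightarrow> f v \<in> C \<and> g v \<in> C \<and> f v - g v \<in> I"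
  shows "psubst f p - psubst g p \<in> I"
proof -
  have one: "1 \<in> C" using C(1)[of 1] by simp
  have pow: "f v ^ k \<in> C" "g v ^ k \<in> C" "f v ^ k - g v ^ k \<in> I" if "f v \<in> C \<and> g v \<in> C \<and> f v - g v \<in> I" for v k
  proof -
    show *: "f v ^ k \<in> C" "g v ^ k \<in> C" for k using that by (induction k) (auto simp: one C(3))
    show "f v ^ k - g v ^ k \<in> I"
    proof (induction k)
      case (Suc k)
      have "f v ^ Suc k - g v ^ Suc k = f v * (f v ^ k - g v ^ k) + g v ^ k * (f v - g v)"
        by (simp add: algebra_simps)
      then show ?case using I(2)[OF I(3)[OF _ Suc] I(3)[OF *(2)]] that by (simp only:)
    qed (simp add: I(1))
  qed
  have prod: "(\<Prod>v\<in>A. f v ^ k v) \<in> C \<and> (\<Prod>v\<in>A. g v ^ k v) \<in> C \<and> (\<Prod>v\<in>A. f v ^ k v) - (\<Prod>v\<in>A. g v ^ k v) \<in> I"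
    if "finite A" "\<And>v. v \<in> A \<Longrightarrow> f v \<in> C \<and> g v \<in> C \<and> f v - g v \<in> I" for A k
    using that
  proof (induction A)
    case (insert v A)
    let ?F = "\<Prod>v\<in>A. f v ^ k v" and ?G = "\<Prod>v\<in>A. g v ^ k v"
    have IH: "?F \<in> C" "?G \<in> C" "?F - ?G \<in> I" using insert by auto
    have v: "f v ^ k v \<in> C" "g v ^ k v \<in> C" "f v ^ k v - g v ^ k v \<in> I" using pow insert.prems by auto
    have "f v ^ k v * ?F - g v ^ k v * ?G = f v ^ k v * (?F - ?G) + ?G * (f v ^ k v - g v ^ k v)"
      by (simp add: algebra_simps)
    then have "f v ^ k v * ?F - g v ^ k v * ?G \<in> I"
      using I(2)[OF I(3)[OF v(1) IH(3)] I(3)[OF IH(2) v(3)]] by (simp only:)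
    then show ?case using insert.hyps IH v C(3) by simp
  qed (simp add: one I(1))
  have "(\<Sum>m\<in>A. const (coef p m) * (subst_mon f m - subst_mon g m)) \<in> I" if "finite A" "A \<subseteq> supp p" for A
    using that
  proof (induction A)
    case (insert m A)
    have "subst_mon f m - subst_mon g m \<in> I"
      unfolding subst_mon_def using prod[of "supp m" "coef m"] fg[of m] insert.prems by auto
    then show ?case using insert I(2) I(3)[OF C(1)] by simp
  qed (simp add: I(1))
  from this[OF finite_keys order_refl] show ?thesis
    unfolding psubst_def lin_def by (simp add: sum_subtractf right_diff_distrib)
qed

lemma psubst_psubst: "psubst g (psubst f p) = psubst (\<lambda>v. psubst g (f v)) p"
proof -
  have pow: "psubst g (q ^ k) = psubst g q ^ k" for q k by (induction k) (auto simp: psubst_mult)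
  have prod: "psubst g (\<Prod>v\<in>A. h v) = (\<Prod>v\<in>A. psubst g (h v))" for h A
    by (induction A rule: infinite_finite_induct) (auto simp: psubst_mult)
  have "psubst g (subst_mon f m) = subst_mon (\<lambda>v. psubst g (f v)) m" for m
    unfolding subst_mon_def prod pow ..
  then have "psubst g (lin (subst_mon f) p) = lin (subst_mon (\<lambda>v. psubst g (f v))) p"
    by (simp add: lin_def psubst_sum psubst_mult)
  then show ?thesis by (simp add: psubst_def)
qed

lemma psubst_id: "psubst var p = p" for p :: "'v mpoly"
proof -
  have "subst_mon var m = mon m" for m :: "'v \<Rightarrow>\<^sub>0 nat"
  proof -
    have "(\<Prod>v\<in>A. mon (vexp v (coef m v))) = mon (\<Sum>v\<in>A. vexp v (coef m v))" if "finite A" for A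
      using that by (induction A) (simp_all add: mon_add)
    moreover have "(\<Sum>v\<in>supp m. vexp v (coef m v)) = m"
      by (rule poly_mapping_eqI) (auto simp: lookup_sum lookup_single when_def in_keys_iff)
    ultimately show ?thesis by (simp add: subst_mon_def flip: mon_vexp)
  qed
  then have "subst_mon var = (mon :: ('v \<Rightarrow>\<^sub>0 nat) \<Rightarrow> 'v mpoly)" by (rule ext)
  then show ?thesis by (simp add: psubst_def)
qed

lemma psubst_closed:
  assumes C: "\<And>c. const c \<in> C" "\<And>p q. p \<in> C \<Longrightarrow> q \<in> C \<Longrightarrow> p + q \<in> C" "\<And>p q. p \<in> C \<Longrightarrow> q \<in> C \<Longrightarrow> p * q \<in> C"
    and f: "\<And>v. f v \<in> C"
  shows "psubst f p \<in> C"
proof -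
  have one: "1 \<in> C" using C(1)[of 1] by simp
  have zero: "0 \<in> C" using C(1)[of 0] by simp
  have pow: "f v ^ k \<in> C" for v k by (induction k) (simp_all add: one C(3) f)
  have prod: "(\<Prod>v\<in>A. f v ^ k v) \<in> C" for A k
    by (induction A rule: infinite_finite_induct) (simp_all add: one C(3) pow)
  have "(\<Sum>m\<in>A. const (k m) * subst_mon f m) \<in> C" for A k
    by (induction A rule: infinite_finite_induct) (simp_all add: zero C prod subst_mon_def)
  then show ?thesis unfolding psubst_def lin_def .
qed

section \<open>Polynomial rings on a set of variables\<close>

lemma poly_ring_carrier: "carrier (poly_ring V) = {p. \<forall>m\<in>supp p. supp m \<subseteq> V}"
  by (simp add: poly_ring_def)

lemma poly_ring_simps [simp]:
  "monoid.mult (poly_ring V) = (*)" "one (poly_ring V) = 1" "zero (poly_ring V) = 0" "add (poly_ring V) = (+)"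
  by (simp_all add: poly_ring_def)

lemma poly_ring_closed:
  fixes p q :: "'v mpoly"
  shows "const c \<in> carrier (poly_ring V)"
    and "p \<in> carrier (poly_ring V) \<Longrightarrow> q \<in> carrier (poly_ring V) \<Longrightarrow> p + q \<in> carrier (poly_ring V)"
    and "p \<in> carrier (poly_ring V) \<Longrightarrow> q \<in> carrier (poly_ring V) \<Longrightarrow> p * q \<in> carrier (poly_ring V)"
    and "p \<in> carrier (poly_ring V) \<Longrightarrow> - p \<in> carrier (poly_ring V)"
    and "v \<in> V \<Longrightarrow> var v \<in> carrier (poly_ring V)"
proof -
  show "const c \<in> carrier (poly_ring V)" by (cases "c = 0") (auto simp: poly_ring_carrier)
  show "p + q \<in> carrier (poly_ring V)" if "p \<in> carrier (poly_ring V)" "q \<in> carrier (poly_ring V)"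
    using that Poly_Mapping.keys_add[of p q] unfolding poly_ring_carrier mem_Collect_eq by (meson Un_iff subsetD)
  show "p * q \<in> carrier (poly_ring V)" if "p \<in> carrier (poly_ring V)" "q \<in> carrier (poly_ring V)"
    unfolding poly_ring_carrier mem_Collect_eq
  proof
    fix m assume "m \<in> supp (p * q)"
    then obtain a b where "m = a + b" "a \<in> supp p" "b \<in> supp q" using keys_mult[of p q] by auto
    then show "supp m \<subseteq> V" using that by (auto simp: poly_ring_carrier keys_add_nat)
  qed
  show "- p \<in> carrier (poly_ring V)" if "p \<in> carrier (poly_ring V)"
    using that by (simp add: poly_ring_carrier in_keys_iff)
  show "v \<in> V \<Longrightarrow> var v \<in> carrier (poly_ring V)" by (simp add: poly_ring_carrier var_def)
qed

lemma poly_ring_zero [simp]: "0 \<in> carrier (poly_ring V)"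
  by (simp add: poly_ring_carrier)

lemma poly_ring_cring: "cring (poly_ring V)"
proof (rule cringI)
  show "abelian_group (poly_ring V)"
  proof (rule abelian_groupI)
    fix x assume "x \<in> carrier (poly_ring V)"
    then show "\<exists>y\<in>carrier (poly_ring V). y \<oplus>\<^bsub>poly_ring V\<^esub> x = \<zero>\<^bsub>poly_ring V\<^esub>"
      by (intro bexI[of _ "- x"] poly_ring_closed(4)) simp_all
  next
    fix x y assume "x \<in> carrier (poly_ring V)" "y \<in> carrier (poly_ring V)"
    then show "x \<oplus>\<^bsub>poly_ring V\<^esub> y \<in> carrier (poly_ring V)"
      unfolding poly_ring_simps(4) by (rule poly_ring_closed(2))
  qed (simp_all add: add_ac)
  show "comm_monoid (poly_ring V)"
  proof (rule comm_monoidI)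
    fix x y assume "x \<in> carrier (poly_ring V)" "y \<in> carrier (poly_ring V)"
    then show "x \<otimes>\<^bsub>poly_ring V\<^esub> y \<in> carrier (poly_ring V)"
      unfolding poly_ring_simps(1) by (rule poly_ring_closed(3))
  next
    show "\<one>\<^bsub>poly_ring V\<^esub> \<in> carrier (poly_ring V)" using poly_ring_closed(1)[of 1 V] by simp
  qed (simp_all add: mult_ac)
qed (simp add: distrib_right)

lemma ideal_poly_ring:
  assumes "ideal I (poly_ring V)"
  shows "I \<subseteq> carrier (poly_ring V)" "0 \<in> I" "p \<in> I \<Longrightarrow> q \<in> I \<Longrightarrow> p + q \<in> I"
    "c \<in> carrier (poly_ring V) \<Longrightarrow> p \<in> I \<Longrightarrow> c * p \<in> I" "p \<in> I \<Longrightarrow> q \<in> I \<Longrightarrow> p - q \<in> I"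
proof -
  interpret ideal I "poly_ring V" by fact
  show "I \<subseteq> carrier (poly_ring V)" by (rule a_subset)
  show "0 \<in> I" using additive_subgroup.zero_closed[OF ideal.axioms(1)[OF assms]] by simp
  show *: "p + q \<in> I" if "p \<in> I" "q \<in> I" for p q
    using additive_subgroup.a_closed[OF ideal.axioms(1)[OF assms] that] by simp
  show **: "c * p \<in> I" if "c \<in> carrier (poly_ring V)" "p \<in> I" for c p
    using I_l_closed[OF that(2,1)] by simp
  show "p - q \<in> I" if "p \<in> I" "q \<in> I"
  proof -
    have "const (- 1) * q \<in> I" using **[OF poly_ring_closed(1) that(2)] .
    moreover have "const (- 1) * q = - q" by (simp add: single_uminus)
    ultimately show ?thesis using *[OF that(1), of "- q"] by simp
  qed
qed

section \<open>The defining ideal of the augmented Chow ring\<close>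

locale chow_ring =
  fixes E :: "'a set" and indep :: "'a set \<Rightarrow> bool"
  assumes simple: "simple_matroid E indep"

sublocale chow_ring \<subseteq> flat_lattice E "flats E indep" "matroid_rank indep"
  by (rule simple_matroid_flat_lattice[OF simple])

context chow_ring
begin

abbreviation "L \<equiv> flats E indep"
abbreviation "PR \<equiv> chow_poly_ring E indep"
abbreviation "AI \<equiv> chow_ideal E indep"

definition proper :: "'a set \<Rightarrow> bool" where
  "proper F \<longleftrightarrow> F \<in> L \<and> F \<noteq> E"

lemma finite_proper: "finite {G. proper G \<and> Q G}"
  by (rule finite_subset[OF _ finite_L]) (auto simp: proper_def)

interpretation PR: cring PR by (rule poly_ring_cring)

lemma var_X_closed: "proper F \<Longrightarrow> var (X F) \<in> carrier PR"
  by (rule poly_ring_closed(5)) (auto simp: chow_vars_def proper_def)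

lemma var_Y_closed: "i \<in> E \<Longrightarrow> var (Y i) \<in> carrier PR"
  by (rule poly_ring_closed(5)) (auto simp: chow_vars_def)

lemma PR_sum: "(\<And>x. x \<in> A \<Longrightarrow> f x \<in> carrier PR) \<Longrightarrow> sum f A \<in> carrier PR"
proof (induction A rule: infinite_finite_induct)
  case (insert x A)
  then have "f x \<in> carrier PR" "sum f A \<in> carrier PR" by blast+
  then show ?case using poly_ring_closed(2) insert.hyps by (simp only: sum.insert[OF insert.hyps])
qed simp_all

definition linear_rel :: "'a \<Rightarrow> 'a chow_var mpoly" where
  "linear_rel i = var (Y i) - (\<Sum>F\<in>{F. proper F \<and> i \<notin> F}. var (X F))"

lemma PR_minus: "p \<in> carrier PR \<Longrightarrow> q \<in> carrier PR \<Longrightarrow> p - q \<in> carrier PR"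
  unfolding diff_conv_add_uminus[of p q] by (intro poly_ring_closed(2,4))

lemma linear_rel_closed: "i \<in> E \<Longrightarrow> linear_rel i \<in> carrier PR"
  unfolding linear_rel_def by (intro PR_minus var_Y_closed PR_sum var_X_closed) auto

definition "gens1 = {linear_rel i |i. i \<in> E}"
definition "gens2 = {var (X F) * var (X G) |F G. proper F \<and> proper G \<and> \<not> F \<subseteq> G \<and> \<not> G \<subseteq> F}"
definition "gens3 = {var (Y i) * var (X F) |i F. i \<in> E \<and> proper F \<and> i \<notin> F}"

lemma gens_closed: "gens1 \<subseteq> carrier PR" "gens2 \<subseteq> carrier PR" "gens3 \<subseteq> carrier PR"
proof -
  show "gens1 \<subseteq> carrier PR" unfolding gens1_def using linear_rel_closed by blast
  show "gens2 \<subseteq> carrier PR"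
    unfolding gens2_def using poly_ring_closed(3)[OF var_X_closed var_X_closed] by blast
  show "gens3 \<subseteq> carrier PR"
    unfolding gens3_def using poly_ring_closed(3)[OF var_Y_closed var_X_closed] by blast
qed

text \<open>A flat not containing \<open>i\<close> is automatically different from \<open>E\<close>,
  so the sums in the linear relations run over proper flats.\<close>

lemma AI_eq: "AI = Idl\<^bsub>PR\<^esub> gens1 <+>\<^bsub>PR\<^esub> (Idl\<^bsub>PR\<^esub> gens2 <+>\<^bsub>PR\<^esub> Idl\<^bsub>PR\<^esub> gens3)"
proof -
  have 1: "{F \<in> L. i \<notin> F} = {F. proper F \<and> i \<notin> F}" if "i \<in> E" for i using that by (auto simp: proper_def)
  have "{var (Y i) - (\<Sum>F\<in>{F \<in> L. i \<notin> F}. var (X F)) | i. i \<in> E} = gens1"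
    unfolding gens1_def linear_rel_def using 1 by (metis (no_types, lifting))
  moreover have "{var (X F) * var (X G) | F G. F \<in> L - {E} \<and> G \<in> L - {E} \<and> \<not> F \<subseteq> G \<and> \<not> G \<subseteq> F} = gens2"
    unfolding gens2_def proper_def by auto
  moreover have "{var (Y i) * var (X F) | i F. i \<in> E \<and> F \<in> L - {E} \<and> i \<notin> F} = gens3"
    unfolding gens3_def proper_def by auto
  ultimately show ?thesis unfolding chow_ideal_def chow_I_def chow_J_def by simp
qed

lemma idl: "ideal (Idl\<^bsub>PR\<^esub> gens1) PR" "ideal (Idl\<^bsub>PR\<^esub> gens2) PR" "ideal (Idl\<^bsub>PR\<^esub> gens3) PR"
  using PR.genideal_ideal gens_closed by blast+

lemma ideal_AI: "ideal AI PR"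
  unfolding AI_eq by (intro PR.add_ideals idl)

lemmas AI = ideal_poly_ring[OF ideal_AI]

lemma gens_AI: "gens1 \<union> gens2 \<union> gens3 \<subseteq> AI"
proof -
  note I1 = ideal_poly_ring[OF idl(1)] and I2 = ideal_poly_ring[OF idl(2)] and I3 = ideal_poly_ring[OF idl(3)]
  have mem: "a + (b + c) \<in> AI" if "a \<in> Idl\<^bsub>PR\<^esub> gens1" "b \<in> Idl\<^bsub>PR\<^esub> gens2" "c \<in> Idl\<^bsub>PR\<^esub> gens3" for a b c
    unfolding AI_eq set_add_def' using that by auto
  have "p \<in> AI" if "p \<in> gens1" for p
    using mem[of p 0 0] I2(2) I3(2) PR.genideal_self[OF gens_closed(1)] that by auto
  moreover have "p \<in> AI" if "p \<in> gens2" for p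
    using mem[of 0 p 0] I1(2) I3(2) PR.genideal_self[OF gens_closed(2)] that by auto
  moreover have "p \<in> AI" if "p \<in> gens3" for p
    using mem[of 0 0 p] I1(2) I2(2) PR.genideal_self[OF gens_closed(3)] that by auto
  ultimately show ?thesis by blast
qed

lemma AI_least:
  assumes K: "ideal K PR" and "gens1 \<union> gens2 \<union> gens3 \<subseteq> K"
  shows "AI \<subseteq> K"
proof -
  have "Idl\<^bsub>PR\<^esub> gens1 \<subseteq> K" "Idl\<^bsub>PR\<^esub> gens2 \<subseteq> K" "Idl\<^bsub>PR\<^esub> gens3 \<subseteq> K"
    using PR.genideal_minimal[OF K] assms(2) by blast+
  then have "a + (b + c) \<in> K" if "a \<in> Idl\<^bsub>PR\<^esub> gens1" "b \<in> Idl\<^bsub>PR\<^esub> gens2" "c \<in> Idl\<^bsub>PR\<^esub> gens3" for a b c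
    using ideal_poly_ring(3)[OF K] that by blast
  then show ?thesis unfolding AI_eq set_add_def' by auto
qed

subsection \<open>The generators \<open>h\<^sub>F\<close> in terms of the \<open>x\<^sub>F\<close>\<close>

definition hsub :: "'a set \<Rightarrow> 'a chow_var mpoly" where
  "hsub A = (if A \<in> L then \<Sum>G\<in>{G. proper G \<and> \<not> A \<subseteq> G}. var (X G) else 0)"

definition chi :: "'a set mpoly \<Rightarrow> 'a chow_var mpoly" where
  "chi = psubst hsub"

lemma hsub_closed: "hsub A \<in> carrier PR"
proof -
  have "(\<Sum>G\<in>{G. proper G \<and> \<not> A \<subseteq> G}. var (X G)) \<in> carrier PR"
    by (rule PR_sum) (simp add: var_X_closed)
  then show ?thesis by (simp add: hsub_def)
qed

lemma chi_closed: "chi u \<in> carrier PR"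
  unfolding chi_def by (rule psubst_closed[OF poly_ring_closed(1,2,3) hsub_closed])

lemma chi_diff: "chi (u - v) = chi u - chi v" and chi_mult: "chi (u * v) = chi u * chi v"
  and chi_var: "chi (var A) = hsub A" and chi_add: "chi (u + v) = chi u + chi v"
  by (simp_all add: chi_def psubst_diff psubst_mult psubst_add)

lemma hsub_diff:
  assumes "F \<in> L" "G \<in> L" "F \<subseteq> G"
  shows "hsub G - hsub F = (\<Sum>K\<in>{K. proper K \<and> F \<subseteq> K \<and> \<not> G \<subseteq> K}. var (X K))"
proof -
  have "{K. proper K \<and> \<not> G \<subseteq> K} = {K. proper K \<and> \<not> F \<subseteq> K} \<union> {K. proper K \<and> F \<subseteq> K \<and> \<not> G \<subseteq> K}"
    using assms(3) by auto
  then have "hsub G = hsub F + (\<Sum>K\<in>{K. proper K \<and> F \<subseteq> K \<and> \<not> G \<subseteq> K}. var (X K))"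
    using assms finite_proper by (simp add: hsub_def sum.union_disjoint disjoint_iff)
  then show ?thesis by simp
qed

lemma X_mult_AI: "proper F \<Longrightarrow> proper G \<Longrightarrow> \<not> F \<subseteq> G \<Longrightarrow> \<not> G \<subseteq> F \<Longrightarrow> var (X F) * var (X G) \<in> AI"
  using gens_AI unfolding gens2_def by blast

lemma YX_mult_AI: "i \<in> E \<Longrightarrow> proper F \<Longrightarrow> i \<notin> F \<Longrightarrow> var (Y i) * var (X F) \<in> AI"
  using gens_AI unfolding gens3_def by blast

lemma linear_rel_AI: "i \<in> E \<Longrightarrow> linear_rel i \<in> AI"
  using gens_AI unfolding gens1_def by blast

lemma AI_sum: "(\<And>x. x \<in> A \<Longrightarrow> f x \<in> AI) \<Longrightarrow> sum f A \<in> AI"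
  by (induction A rule: infinite_finite_induct) (simp_all add: AI(2,3))

lemma AI_mult_right: "p \<in> AI \<Longrightarrow> c \<in> carrier PR \<Longrightarrow> p * c \<in> AI"
  using AI(4)[of c p] by (simp only: mult.commute)

text \<open>Differences of the \<open>h\<close> are sums of \<open>x_K\<close> over flats
  \<open>K\<close> above one flat but not above another. In the join relation both factors are such
  sums, and flats from the two sums are incomparable, since the larger one would contain the join.
  In the covering relation the flats \<open>K\<close> of the second factor omit an element
  \<open>i\<close> of \<open>F\<close> outside \<open>G\<close>; modulo the linear relation
  \<open>h_F\<close> is \<open>y_i\<close> plus the \<open>x\<close> of flats containing
  \<open>i\<close> but not \<open>F\<close>, and each of these kills \<open>x_K\<close>.\<close>

lemma chi_rels:
  assumes "p \<in> rels"
  shows "chi p \<in> AI"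
proof -
  from assms consider (zero) A where "p = var A" "A \<notin> L \<or> A = {}"
    | (join) F G where "p = (var F - var (join F G)) * (var G - var (join F G))" "F \<in> L" "G \<in> L"
    | (cover) F G where "p = var F * (var F - var G)" "F \<in> L" "G \<in> coatoms F"
    unfolding rels_def by blast
  then show ?thesis
  proof cases
    case zero
    then have "hsub A = 0" by (auto simp: hsub_def)
    then show ?thesis using AI(2) by (simp add: zero(1) chi_var)
  next
    case join
    let ?J = "join F G"
    let ?A = "{K. proper K \<and> F \<subseteq> K \<and> \<not> ?J \<subseteq> K}" and ?B = "{K. proper K \<and> G \<subseteq> K \<and> \<not> ?J \<subseteq> K}"
    have J: "?J \<in> L" "F \<subseteq> ?J" "G \<subseteq> ?J" using join_flat join_upper join(2,3) by auto
    have "chi p = (hsub ?J - hsub F) * (hsub ?J - hsub G)"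
      unfolding join(1) chi_mult chi_diff chi_var by (simp add: algebra_simps)
    also have "\<dots> = (\<Sum>K\<in>?A. \<Sum>K'\<in>?B. var (X K) * var (X K'))"
      unfolding hsub_diff[OF join(2) J(1,2)] hsub_diff[OF join(3) J(1,3)] sum_product ..
    also have "\<dots> \<in> AI"
    proof (intro AI_sum X_mult_AI)
      fix K K' assume K: "K \<in> ?A" "K' \<in> ?B"
      have "K \<in> L" "K' \<in> L" using K by (auto simp: proper_def)
      then show "\<not> K \<subseteq> K'" "\<not> K' \<subseteq> K"
        using K join_least[of K' F G] join_least[of K F G] by auto
    qed simp_all
    finally show ?thesis .
  next
    case cover
    have G: "G \<in> L" "G \<subset> F" using coatomsD[OF cover(3)] by auto
    then obtain i where i: "i \<in> F" "i \<notin> G" by auto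
    have iE: "i \<in> E" using i cover(2) flat_subset by auto
    let ?A = "{K. proper K \<and> G \<subseteq> K \<and> \<not> F \<subseteq> K}"
    have Fi: "F \<subseteq> K" if "K \<in> L" "G \<subseteq> K" "i \<in> K" for K
      using coatom_insert[OF cover(2,3) i] cl_least[of K "insert i G"] that by auto
    have "chi p = hsub F * (hsub F - hsub G)" by (simp add: cover(1) chi_mult chi_diff chi_var)
    also have "\<dots> = (\<Sum>K\<in>?A. hsub F * var (X K))"
      using hsub_diff[OF G(1) cover(2)] G(2) by (simp add: sum_distrib_left psubset_imp_subset)
    also have "\<dots> \<in> AI"
    proof (rule AI_sum)
      fix K assume "K \<in> ?A"
      then have K: "proper K" "G \<subseteq> K" "\<not> F \<subseteq> K" "K \<in> L" by (auto simp: proper_def)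
      then have iK: "i \<notin> K" using Fi by blast
      let ?B = "{K'. proper K' \<and> i \<in> K' \<and> \<not> F \<subseteq> K'}"
      have "{K'. proper K' \<and> \<not> F \<subseteq> K'} = {K'. proper K' \<and> i \<notin> K'} \<union> ?B" using i(1) by auto
      then have h: "hsub F = (\<Sum>K'\<in>{K'. proper K' \<and> i \<notin> K'}. var (X K')) + (\<Sum>K'\<in>?B. var (X K'))"
        using cover(2) finite_proper by (simp add: hsub_def sum.union_disjoint disjoint_iff)
      have "hsub F * var (X K) = var (Y i) * var (X K) - linear_rel i * var (X K) + (\<Sum>K'\<in>?B. var (X K') * var (X K))"
        unfolding h linear_rel_def by (simp add: algebra_simps sum_distrib_left)
      also have "\<dots> \<in> AI"
      proof (intro AI(3,5))
        show "var (Y i) * var (X K) \<in> AI" by (rule YX_mult_AI[OF iE K(1) iK])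
        show "linear_rel i * var (X K) \<in> AI" by (rule AI_mult_right[OF linear_rel_AI[OF iE] var_X_closed[OF K(1)]])
        show "(\<Sum>K'\<in>?B. var (X K') * var (X K)) \<in> AI"
        proof (intro AI_sum X_mult_AI)
          fix K' assume K': "K' \<in> ?B"
          then show "\<not> K' \<subseteq> K" using iK by auto
          show "\<not> K \<subseteq> K'" using K' K(2) Fi[of K'] by (auto simp: proper_def)
        qed (simp_all add: K(1))
      qed
      finally show "hsub F * var (X K) \<in> AI" .
    qed
    finally show ?thesis .
  qed
qed

lemma chi_RI: "u \<in> RI \<Longrightarrow> chi u \<in> AI"
proof -
  have zero: "chi 0 = 0" using chi_diff[of 0 0] by simp
  have "ideal.subspace {u. chi u \<in> AI}"
  proof (rule ideal.subspaceI)
    show "0 \<in> {u. chi u \<in> AI}" using AI(2) by (simp add: zero)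
    show "x + y \<in> {u. chi u \<in> AI}" if "x \<in> {u. chi u \<in> AI}" "y \<in> {u. chi u \<in> AI}" for x y
      using that AI(3) by (simp add: chi_add)
    show "c * x \<in> {u. chi u \<in> AI}" if "x \<in> {u. chi u \<in> AI}" for c x
      using that AI(4)[OF chi_closed] by (simp add: chi_mult)
  qed
  then have "RI \<subseteq> {u. chi u \<in> AI}" unfolding RI_def using chi_rels by (intro ideal.span_minimal) auto
  then show "u \<in> RI \<Longrightarrow> chi u \<in> AI" by blast
qed

subsection \<open>Moebius inversion\<close>

text \<open>The element that \<open>chi\<close> sends to \<open>x_F\<close>. The \<open>x_K\<close>
  over all proper \<open>K\<close> above \<open>F\<close> sum to \<open>h_E - h_F\<close>, and this
  triangular system is solved from the top.\<close>

function xi :: "'a set \<Rightarrow> 'a set mpoly" where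
  "xi F = (if proper F then var E - var F - (\<Sum>K\<in>{K. proper K \<and> F \<subset> K}. xi K) else 0)"
  by pat_completeness auto
termination
proof (relation "measure (\<lambda>F. card (E - F))")
  fix F K assume "proper F" "K \<in> {K. proper K \<and> F \<subset> K}"
  then have "E - K \<subset> E - F" using flat_subset by (auto simp: proper_def)
  then show "(K, F) \<in> measure (\<lambda>F. card (E - F))" using finite_E by (simp add: psubset_card_mono)
qed simp

declare xi.simps [simp del]

lemma card_diff_less: "proper F \<Longrightarrow> proper K \<Longrightarrow> F \<subset> K \<Longrightarrow> card (E - K) < card (E - F)"
  using finite_E flat_subset by (intro psubset_card_mono) (auto simp: proper_def)

lemma xi_sum:
  assumes "F \<in> L"
  shows "(\<Sum>K\<in>{K. proper K \<and> F \<subseteq> K}. xi K) = var E - var F"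
proof (cases "F = E")
  case True
  then have "{K. proper K \<and> F \<subseteq> K} = {}" using flat_subset by (auto simp: proper_def)
  then show ?thesis using True by (simp only: sum.empty) simp
next
  case False
  then have F: "proper F" using assms by (simp add: proper_def)
  then have "{K. proper K \<and> F \<subseteq> K} = insert F {K. proper K \<and> F \<subset> K}" by auto
  then have "(\<Sum>K\<in>{K. proper K \<and> F \<subseteq> K}. xi K) = xi F + (\<Sum>K\<in>{K. proper K \<and> F \<subset> K}. xi K)"
    using finite_proper by simp
  then show ?thesis using xi.simps[of F] F by simp
qed

lemma xi_diff:
  assumes "F \<in> L" "G \<in> L" "F \<subseteq> G"
  shows "(\<Sum>K\<in>{K. proper K \<and> F \<subseteq> K \<and> \<not> G \<subseteq> K}. xi K) = var G - var F"
proof -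
  have "{K. proper K \<and> F \<subseteq> K} = {K. proper K \<and> F \<subseteq> K \<and> \<not> G \<subseteq> K} \<union> {K. proper K \<and> G \<subseteq> K}"
    using assms(3) by auto
  then have "(\<Sum>K\<in>{K. proper K \<and> F \<subseteq> K}. xi K) =
      (\<Sum>K\<in>{K. proper K \<and> F \<subseteq> K \<and> \<not> G \<subseteq> K}. xi K) + (\<Sum>K\<in>{K. proper K \<and> G \<subseteq> K}. xi K)"
    using finite_proper by (simp add: sum.union_disjoint disjoint_iff)
  then show ?thesis using xi_sum[OF assms(1)] xi_sum[OF assms(2)] by (simp add: algebra_simps)
qed

lemma chi_xi: "proper F \<Longrightarrow> chi (xi F) = var (X F)"
proof (induction "card (E - F)" arbitrary: F rule: less_induct)
  case less
  have FE: "F \<in> L" "F \<subseteq> E" using less.prems flat_subset by (auto simp: proper_def)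
  have eq: "{K. proper K \<and> F \<subseteq> K \<and> \<not> E \<subseteq> K} = insert F {K. proper K \<and> F \<subset> K}"
    using less.prems flat_subset by (auto simp: proper_def)
  have "chi (xi F) = (hsub E - hsub F) - (\<Sum>K\<in>{K. proper K \<and> F \<subset> K}. chi (xi K))"
    using less.prems xi.simps[of F] by (simp add: chi_diff chi_var) (simp add: chi_def psubst_sum)
  also have "(\<Sum>K\<in>{K. proper K \<and> F \<subset> K}. chi (xi K)) = (\<Sum>K\<in>{K. proper K \<and> F \<subset> K}. var (X K))"
    using less.hyps less.prems card_diff_less by (intro sum.cong) auto
  also have "hsub E - hsub F = var (X F) + (\<Sum>K\<in>{K. proper K \<and> F \<subset> K}. var (X K))"
    unfolding hsub_diff[OF FE(1) E_flat FE(2)] eq using finite_proper by simp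
  finally show ?case by simp
qed

lemma homogeneous_xi: "homogeneous (Suc 0) (xi F)"
proof (induction "card (E - F)" arbitrary: F rule: less_induct)
  case less
  show ?case
  proof (cases "proper F")
    case True
    then have "homogeneous (Suc 0) (var E - var F - (\<Sum>K\<in>{K. proper K \<and> F \<subset> K}. xi K))"
      using less card_diff_less by (intro homogeneous_diff homogeneous_sum homogeneous_var) auto
    then show ?thesis using True xi.simps[of F] by simp
  qed (simp add: xi.simps)
qed

lemma RI_sum: "(\<And>x. x \<in> A \<Longrightarrow> f x \<in> RI) \<Longrightarrow> sum f A \<in> RI"
  by (rule ideal.subspace_sum[OF subspace_RI])

text \<open>The join relation expands into products over pairs of flats above \<open>F\<close> and
  above \<open>G\<close>. All pairs except \<open>(F, G)\<close> are higher up and again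
  incomparable, so they vanish modulo \<open>RI\<close> by induction.\<close>

lemma xi_mult:
  assumes "proper F" "proper G" "\<not> F \<subseteq> G" "\<not> G \<subseteq> F"
  shows "xi F * xi G \<in> RI"
  using assms
proof (induction "card (E - F) + card (E - G)" arbitrary: F G rule: less_induct)
  case less
  have FG: "F \<in> L" "G \<in> L" using less.prems by (auto simp: proper_def)
  let ?J = "join F G"
  let ?A = "{K. proper K \<and> F \<subseteq> K \<and> \<not> ?J \<subseteq> K}" and ?B = "{K. proper K \<and> G \<subseteq> K \<and> \<not> ?J \<subseteq> K}"
  have J: "?J \<in> L" "F \<subseteq> ?J" "G \<subseteq> ?J" using join_flat join_upper FG by auto
  have "(var F - var ?J) * (var G - var ?J) = (\<Sum>K\<in>?A. xi K) * (\<Sum>K\<in>?B. xi K)"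
    unfolding xi_diff[OF FG(1) J(1,2)] xi_diff[OF FG(2) J(1,3)] by (simp add: algebra_simps)
  also have "\<dots> = (\<Sum>(K, K')\<in>?A \<times> ?B. xi K * xi K')"
    by (simp add: sum_product sum.cartesian_product)
  also have "\<dots> = xi F * xi G + (\<Sum>(K, K')\<in>?A \<times> ?B - {(F, G)}. xi K * xi K')"
  proof -
    have "(F, G) \<in> ?A \<times> ?B" using less.prems J by auto
    then show ?thesis using finite_proper by (subst sum.remove[of _ "(F, G)"]) auto
  qed
  finally have eq: "xi F * xi G = (var F - var ?J) * (var G - var ?J) - (\<Sum>(K, K')\<in>?A \<times> ?B - {(F, G)}. xi K * xi K')"
    by (simp add: algebra_simps)
  have "(\<Sum>(K, K')\<in>?A \<times> ?B - {(F, G)}. xi K * xi K') \<in> RI"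
  proof (rule RI_sum)
    fix x assume x: "x \<in> ?A \<times> ?B - {(F, G)}"
    then obtain K K' where K: "x = (K, K')" "K \<in> ?A" "K' \<in> ?B" "(K, K') \<noteq> (F, G)" by auto
    have KL: "K \<in> L" "K' \<in> L" using K by (auto simp: proper_def)
    have "card (E - K) \<le> card (E - F)" "card (E - K') \<le> card (E - G)"
      using K finite_E by (auto intro!: card_mono)
    moreover have "card (E - K) < card (E - F) \<or> card (E - K') < card (E - G)"
      using K card_diff_less[OF less.prems(1), of K] card_diff_less[OF less.prems(2), of K'] by auto
    ultimately have "card (E - K) + card (E - K') < card (E - F) + card (E - G)" by linarith
    moreover have "\<not> K \<subseteq> K'" "\<not> K' \<subseteq> K"
      using K join_least[OF KL(2), of F G] join_least[OF KL(1), of F G] by auto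
    ultimately have "xi K * xi K' \<in> RI" using K less.hyps by simp
    then show "(case x of (K, K') \<Rightarrow> xi K * xi K') \<in> RI" by (simp add: K(1))
  qed
  then show ?case unfolding eq by (rule ideal.subspace_diff[OF subspace_RI RI_join[OF FG]])
qed

text \<open>Let \<open>G\<close> be the closure of \<open>F\<close> and \<open>i\<close>. The join
  relation for the flat of \<open>i\<close> and \<open>F\<close>, combined with the covering
  relation for \<open>G\<close> over \<open>F\<close>, kills the generator of \<open>i\<close> times
  \<open>h_G - h_F\<close>. This difference is \<open>xi F\<close> plus the \<open>xi\<close> of
  larger flats that still avoid \<open>i\<close>.\<close>

lemma var_xi_mult:
  assumes i: "i \<in> E" and "proper F" "i \<notin> F"
  shows "var (cl {i}) * xi F \<in> RI"
  using assms(2,3)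
proof (induction "card (E - F)" arbitrary: F rule: less_induct)
  case less
  have F: "F \<in> L" using less.prems by (auto simp: proper_def)
  let ?G = "cl (insert i F)" and ?c = "cl {i}"
  have G: "?G \<in> L" "insert i F \<subseteq> ?G" "matroid_rank indep ?G = Suc (matroid_rank indep F)"
    using cl_insert_flat cl_superset rk_insert F i less.prems(2) by auto
  have c: "?c \<in> L" "{i} \<subseteq> ?c" using i cl_flat cl_superset[of "{i}"] by auto
  have join: "join ?c F = ?G"
  proof
    show "join ?c F \<subseteq> ?G" using cl_least[OF G(1), of "{i}"] G by (intro join_least) auto
    show "?G \<subseteq> join ?c F" using join_flat[OF c(1) F] join_upper[of ?c F] join_upper[of F ?c] c(2) by (intro cl_least) auto
  qed
  have co: "F \<in> coatoms ?G" using F G less.prems(2) by (auto simp: coatoms_def)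
  have set: "{K. proper K \<and> F \<subseteq> K \<and> \<not> ?G \<subseteq> K} = insert F {K. proper K \<and> F \<subset> K \<and> i \<notin> K}"
    using G(2) cl_least[of _ "insert i F"] less.prems by (auto simp: proper_def)
  have eq: "var ?c * (var ?G - var F) = var ?c * xi F + (\<Sum>K\<in>{K. proper K \<and> F \<subset> K \<and> i \<notin> K}. var ?c * xi K)"
  proof -
    have fin: "finite {K. proper K \<and> F \<subset> K \<and> i \<notin> K}" by (rule finite_proper)
    have "F \<subseteq> ?G" using G(2) by blast
    from xi_diff[OF F G(1) this, unfolded set] have "xi F + (\<Sum>K\<in>{K. proper K \<and> F \<subset> K \<and> i \<notin> K}. xi K) = var ?G - var F"
      by (subst (asm) sum.insert[OF fin]) auto
    from this[symmetric] show ?thesis by (simp only: distrib_left sum_distrib_left)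
  qed
  have sum: "(\<Sum>K\<in>{K. proper K \<and> F \<subset> K \<and> i \<notin> K}. var ?c * xi K) \<in> RI"
    using less card_diff_less by (intro RI_sum) auto
  have mem: "var ?c * (var ?G - var F) \<in> RI"
  proof -
    have "var ?c * (var ?G - var F) =
        var ?G * (var ?G - var F) - (var ?c - var (join ?c F)) * (var F - var (join ?c F))"
      unfolding join by (simp add: algebra_simps)
    then show ?thesis
      using ideal.subspace_diff[OF subspace_RI RI_cover[OF G(1) co] RI_join[OF c(1) F]] by (simp only:)
  qed
  have "var ?c * xi F = var ?c * (var ?G - var F) - (\<Sum>K\<in>{K. proper K \<and> F \<subset> K \<and> i \<notin> K}. var ?c * xi K)"
    unfolding eq by (rule add_diff_cancel_right'[symmetric])
  then show ?case using ideal.subspace_diff[OF subspace_RI mem sum] by (simp only:)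
qed

section \<open>The two substitutions are inverse modulo the ideals\<close>

definition gsub :: "'a chow_var \<Rightarrow> 'a set mpoly" where
  "gsub v = (case v of Y i \<Rightarrow> var (cl {i}) | X F \<Rightarrow> xi F)"

definition psi :: "'a chow_var mpoly \<Rightarrow> 'a set mpoly" where
  "psi = psubst gsub"

lemma psi_diff: "psi (p - q) = psi p - psi q" and psi_mult: "psi (p * q) = psi p * psi q"
  and psi_add: "psi (p + q) = psi p + psi q" and psi_zero: "psi 0 = 0"
  and psi_Y: "psi (var (Y i)) = var (cl {i})" and psi_X: "psi (var (X F)) = xi F"
  by (simp_all add: psi_def psubst_diff psubst_mult psubst_add gsub_def)

lemma not_cl_subset: "i \<in> E \<Longrightarrow> proper F \<Longrightarrow> cl {i} \<subseteq> F \<longleftrightarrow> i \<in> F"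
  using cl_superset[of "{i}"] cl_least[of F "{i}"] by (auto simp: proper_def)

lemma psi_linear_rel:
  assumes i: "i \<in> E"
  shows "psi (linear_rel i) \<in> RI"
proof -
  have c: "cl {i} \<in> L" using i cl_flat by auto
  have set: "{F. proper F \<and> i \<notin> F} = {F. proper F \<and> {} \<subseteq> F \<and> \<not> cl {i} \<subseteq> F}"
    using not_cl_subset[OF i] by auto
  have "psi (\<Sum>F\<in>{F. proper F \<and> i \<notin> F}. var (X F)) = (\<Sum>F\<in>{F. proper F \<and> i \<notin> F}. xi F)"
    unfolding psi_def psubst_sum using psi_X unfolding psi_def by simp
  then have "psi (linear_rel i) = var (cl {i}) - (var (cl {i}) - var {})"
    unfolding linear_rel_def psi_diff psi_Y set xi_diff[OF empty_flat c empty_subsetI] by simp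
  then show ?thesis using RI_zero[of "{}"] by simp
qed

lemma psi_AI: "p \<in> AI \<Longrightarrow> psi p \<in> RI"
proof -
  let ?K = "{p \<in> carrier PR. psi p \<in> RI}"
  have "ideal ?K PR"
  proof (rule idealI[OF PR.ring_axioms])
    show "subgroup ?K (add_monoid PR)"
    proof (rule PR.add.subgroupI)
      show "?K \<noteq> {}" using poly_ring_zero ideal.subspace_0[OF subspace_RI] psi_zero by (metis (mono_tags, lifting) empty_iff mem_Collect_eq)
      fix a assume a: "a \<in> ?K"
      have m: "\<ominus>\<^bsub>PR\<^esub> a = - a"
        using PR.minus_equality[of "- a" a] a poly_ring_closed(4)[of a] by simp
      have "psi (- a) = - psi a" using psi_diff[of 0 a] psi_zero by simp
      then have "psi (- a) \<in> RI" using a ideal.subspace_neg[OF subspace_RI] by simp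
      moreover have "- a \<in> carrier PR" using poly_ring_closed(4) a by blast
      ultimately show "\<ominus>\<^bsub>PR\<^esub> a \<in> ?K" using m by simp
      fix b assume b: "b \<in> ?K"
      have "a + b \<in> carrier PR" using poly_ring_closed(2) a b by blast
      then show "a \<oplus>\<^bsub>PR\<^esub> b \<in> ?K"
        using a b ideal.subspace_add[OF subspace_RI] by (simp add: psi_add)
    qed auto
    fix a x assume a: "a \<in> ?K" and x: "x \<in> carrier PR"
    have "x * a \<in> carrier PR" using poly_ring_closed(3) a x by blast
    moreover have "psi (x * a) \<in> RI" unfolding psi_mult using a ideal.subspace_scale[OF subspace_RI] by blast
    ultimately show "x \<otimes>\<^bsub>PR\<^esub> a \<in> ?K" "a \<otimes>\<^bsub>PR\<^esub> x \<in> ?K" by (simp_all add: mult.commute)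
  qed
  moreover have "gens1 \<union> gens2 \<union> gens3 \<subseteq> ?K"
  proof (intro Un_least subsetI)
    fix p
    assume p: "p \<in> gens1"
    then show "p \<in> ?K" using gens_closed(1) psi_linear_rel unfolding gens1_def by auto
  next
    fix p
    assume p: "p \<in> gens2"
    then obtain F G where "p = var (X F) * var (X G)" "proper F" "proper G" "\<not> F \<subseteq> G" "\<not> G \<subseteq> F"
      unfolding gens2_def by blast
    then have "psi p \<in> RI" using xi_mult by (simp only: psi_mult psi_X)
    then show "p \<in> ?K" using gens_closed(2) p by blast
  next
    fix p
    assume p: "p \<in> gens3"
    then obtain i F where "p = var (Y i) * var (X F)" "i \<in> E" "proper F" "i \<notin> F"
      unfolding gens3_def by blast
    then have "psi p \<in> RI" using var_xi_mult by (simp only: psi_mult psi_X psi_Y)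
    then show "p \<in> ?K" using gens_closed(3) p by blast
  qed
  ultimately have "AI \<subseteq> ?K" by (rule AI_least)
  then show "p \<in> AI \<Longrightarrow> psi p \<in> RI" by blast
qed

lemma psi_chi: "psi (chi u) - u \<in> RI"
proof -
  have "psubst (\<lambda>A. psi (hsub A)) u - psubst var u \<in> RI"
  proof (rule psubst_cong_ideal[where C = UNIV])
    fix A
    show "psi (hsub A) \<in> UNIV \<and> var A \<in> UNIV \<and> psi (hsub A) - var A \<in> RI"
    proof (cases "A \<in> L")
      case True
      have "psi (hsub A) = (\<Sum>F\<in>{F. proper F \<and> {} \<subseteq> F \<and> \<not> A \<subseteq> F}. xi F)"
        using True psi_X unfolding hsub_def psi_def by (simp add: psubst_sum)
      then have "psi (hsub A) = var A - var {}" using xi_diff[OF empty_flat True] by simp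
      then have "psi (hsub A) - var A = - var {}" by simp
      then show ?thesis using RI_zero[of "{}"] ideal.subspace_neg[OF subspace_RI] by simp
    next
      case False
      then have "psi (hsub A) = 0" by (simp add: hsub_def psi_zero)
      then show ?thesis using RI_zero[of A] False ideal.subspace_neg[OF subspace_RI] by simp
    qed
  qed (auto intro: ideal.subspace_0[OF subspace_RI] ideal.subspace_add[OF subspace_RI] ideal.subspace_scale[OF subspace_RI])
  then show ?thesis unfolding psi_def chi_def psubst_psubst psubst_id .
qed

text \<open>The composite fixes each \<open>x_F\<close> and changes \<open>y_i\<close> by the linear
  relation of \<open>i\<close>.\<close>

lemma chi_psi:
  assumes p: "p \<in> carrier PR"
  shows "chi (psi p) - p \<in> AI"
proof -
  have "psubst (\<lambda>v. chi (gsub v)) p - psubst var p \<in> AI"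
  proof (rule psubst_cong_ideal[where C = "carrier PR"])
    fix m v assume "m \<in> supp p" "v \<in> supp m"
    then have v: "v \<in> chow_vars E indep" using p unfolding poly_ring_carrier by blast
    show "chi (gsub v) \<in> carrier PR \<and> var v \<in> carrier PR \<and> chi (gsub v) - var v \<in> AI"
    proof (intro conjI)
      show "chi (gsub v) \<in> carrier PR" by (rule chi_closed)
      show "var v \<in> carrier PR" by (rule poly_ring_closed(5)[OF v])
      from v consider i where "v = Y i" "i \<in> E" | F where "v = X F" "proper F"
        by (auto simp: chow_vars_def proper_def)
      then show "chi (gsub v) - var v \<in> AI"
      proof cases
        case 1
        have c: "cl {i} \<in> L" using 1(2) cl_flat by auto
        have "{G. proper G \<and> \<not> cl {i} \<subseteq> G} = {G. proper G \<and> i \<notin> G}" using not_cl_subset[OF 1(2)] by auto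
        then have "chi (gsub v) - var v = 0 - linear_rel i"
          using c by (simp add: 1(1) gsub_def chi_var hsub_def linear_rel_def)
        then show ?thesis using AI(5)[OF AI(2) linear_rel_AI[OF 1(2)]] by (simp only:)
      next
        case 2
        then show ?thesis using chi_xi[OF 2(2)] AI(2) by (simp add: gsub_def)
      qed
    qed
  next
    show "const c \<in> carrier PR" for c by (rule poly_ring_closed(1))
    show "p + q \<in> carrier PR" if "p \<in> carrier PR" "q \<in> carrier PR" for p q by (rule poly_ring_closed(2)[OF that])
    show "p * q \<in> carrier PR" if "p \<in> carrier PR" "q \<in> carrier PR" for p q by (rule poly_ring_closed(3)[OF that])
    show "c * p \<in> AI" if "c \<in> carrier PR" "p \<in> AI" for c p by (rule AI(4)[OF that])
  qed (rule AI(2), rule AI(3))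
  then show ?thesis unfolding psi_def chi_def psubst_psubst psubst_id .
qed

lemma homogeneous_chi: "homogeneous k u \<Longrightarrow> homogeneous k (chi u)"
  unfolding chi_def by (rule homogeneous_psubst) (auto simp: hsub_def intro!: homogeneous_sum)

lemma homogeneous_psi: "homogeneous k p \<Longrightarrow> homogeneous k (psi p)"
  unfolding psi_def by (rule homogeneous_psubst) (auto simp: gsub_def homogeneous_xi split: chow_var.splits)

text \<open>The quotient map expressed in the \<open>h\<close> generators. It is onto with kernel
  \<open>RI\<close> and respects degrees, so the Chow ring can be handled as the polynomial ring
  modulo \<open>RI\<close>.\<close>

definition proj :: "'a set mpoly \<Rightarrow> 'a chow_var mpoly set" where
  "proj u = AI +>\<^bsub>PR\<^esub> chi u"

abbreviation "CH \<equiv> augmented_chow_ring E indep"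

interpretation AI: ideal AI PR by (rule ideal_AI)

lemma CH_cring: "cring CH"
  unfolding augmented_chow_ring_def by (rule AI.quotient_is_cring[OF PR.is_cring])

lemma coset_eq: "p \<in> carrier PR \<Longrightarrow> q \<in> carrier PR \<Longrightarrow> AI +>\<^bsub>PR\<^esub> p = AI +>\<^bsub>PR\<^esub> q \<longleftrightarrow> p - q \<in> AI"
proof -
  assume p: "p \<in> carrier PR" and q: "q \<in> carrier PR"
  have "p \<in> AI +>\<^bsub>PR\<^esub> q \<longleftrightarrow> p - q \<in> AI"
  proof
    assume "p \<in> AI +>\<^bsub>PR\<^esub> q"
    then show "p - q \<in> AI" by (auto simp: a_r_coset_def')
  next
    assume "p - q \<in> AI"
    then show "p \<in> AI +>\<^bsub>PR\<^esub> q" by (auto simp: a_r_coset_def' intro!: bexI[of _ "p - q"])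
  qed
  moreover have "p \<in> AI +>\<^bsub>PR\<^esub> q \<longleftrightarrow> AI +>\<^bsub>PR\<^esub> p = AI +>\<^bsub>PR\<^esub> q"
    using AI.a_rcos_self[OF p] AI.a_repr_independence'[of p q] q by metis
  ultimately show ?thesis by blast
qed

lemma proj_closed: "proj u \<in> carrier CH"
  and proj_add: "proj (u + v) = proj u \<oplus>\<^bsub>CH\<^esub> proj v"
  and proj_mult: "proj (u * v) = proj u \<otimes>\<^bsub>CH\<^esub> proj v"
  and proj_one: "proj 1 = \<one>\<^bsub>CH\<^esub>"
proof -
  note hom = AI.rcos_ring_hom[folded augmented_chow_ring_def]
  show "proj u \<in> carrier CH" unfolding proj_def by (rule ring_hom_closed[OF hom chi_closed])
  show "proj (u + v) = proj u \<oplus>\<^bsub>CH\<^esub> proj v"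
    unfolding proj_def chi_add using ring_hom_add[OF hom chi_closed chi_closed] by simp
  show "proj (u * v) = proj u \<otimes>\<^bsub>CH\<^esub> proj v"
    unfolding proj_def chi_mult using ring_hom_mult[OF hom chi_closed chi_closed] by simp
  have "chi 1 = 1" by (simp add: chi_def)
  then show "proj 1 = \<one>\<^bsub>CH\<^esub>" unfolding proj_def using ring_hom_one[OF hom] by simp
qed

lemma proj_eq_zero: "proj u = \<zero>\<^bsub>CH\<^esub> \<longleftrightarrow> u \<in> RI"
proof -
  have "\<zero>\<^bsub>CH\<^esub> = AI +>\<^bsub>PR\<^esub> 0"
    using AI.a_rcos_const[OF AI(2)] by (simp add: augmented_chow_ring_def FactRing_def)
  then have "proj u = \<zero>\<^bsub>CH\<^esub> \<longleftrightarrow> chi u \<in> AI"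
    unfolding proj_def using coset_eq[OF chi_closed, of 0 u] by simp
  also have "\<dots> \<longleftrightarrow> u \<in> RI"
  proof
    assume "chi u \<in> AI"
    then have "psi (chi u) \<in> RI" by (rule psi_AI)
    then have "psi (chi u) - (psi (chi u) - u) \<in> RI" by (rule ideal.subspace_diff[OF subspace_RI _ psi_chi])
    then show "u \<in> RI" by simp
  qed (rule chi_RI)
  finally show ?thesis .
qed

lemma proj_psi: "p \<in> carrier PR \<Longrightarrow> AI +>\<^bsub>PR\<^esub> p = proj (psi p)"
  unfolding proj_def using coset_eq[OF chi_closed, of p "psi p"] chi_psi[of p] by metis

lemma proj_surj:
  assumes "x \<in> carrier CH"
  shows "\<exists>u. x = proj u"
proof -
  obtain p where "p \<in> carrier PR" "x = AI +>\<^bsub>PR\<^esub> p"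
    using assms unfolding augmented_chow_ring_def FactRing_def A_RCOSETS_def' by auto
  then show ?thesis using proj_psi by blast
qed

lemma chow_grading_proj: "chow_grading E indep k = proj ` {u. homogeneous k u}"
proof
  show "chow_grading E indep k \<subseteq> proj ` {u. homogeneous k u}"
    unfolding chow_grading_def using proj_psi homogeneous_psi by blast
  show "proj ` {u. homogeneous k u} \<subseteq> chow_grading E indep k"
    unfolding chow_grading_def proj_def using chi_closed homogeneous_chi by blast
qed

end

section \<open>Free modules and resolutions\<close>

lemma pow_module_simps [simp]:
  "carrier (pow_module N k) = {..<k} \<rightarrow>\<^sub>E carrier N"
  "zero (pow_module N k) = (\<lambda>i\<in>{..<k}. zero N)"
  "add (pow_module N k) u v = (\<lambda>i\<in>{..<k}. add N (u i) (v i))"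
  "module.smult (pow_module N k) a v = (\<lambda>i\<in>{..<k}. module.smult N a (v i))"
  by (simp_all add: pow_module_def)

lemma regular_module_simps [simp]:
  "carrier (regular_module R) = carrier R"
  "zero (regular_module R) = zero R"
  "add (regular_module R) = add R"
  "module.smult (regular_module R) = monoid.mult R"
  "finsum (regular_module R) f A = finsum R f A"
  "a_inv (regular_module R) x = a_inv R x"
  "a_minus (regular_module R) x y = a_minus R x y"
  by (simp_all add: regular_module_def finsum_def finprod_def a_inv_def m_inv_def a_minus_def)

lemma pow_eqI:
  "u \<in> {..<k} \<rightarrow>\<^sub>E A \<Longrightarrow> v \<in> {..<k} \<rightarrow>\<^sub>E A \<Longrightarrow> (\<And>i. i < k \<Longrightarrow> u i = v i) \<Longrightarrow> u = v"
  by (rule PiE_ext) auto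

lemma (in abelian_group) exchange_minus:
  assumes "x \<in> carrier G" "v \<in> carrier G" "a \<in> carrier G" "b \<in> carrier G" "x \<ominus> v = a \<oplus> b"
  shows "v = \<ominus> a \<oplus> (x \<ominus> b)"
proof -
  have "v = x \<ominus> (x \<ominus> v)"
    using assms(1,2) by (simp add: a_minus_def minus_add r_neg2)
  also have "\<dots> = x \<ominus> (a \<oplus> b)" using assms(5) by simp
  also have "\<dots> = \<ominus> a \<oplus> (x \<ominus> b)"
    using assms(1-4) by (simp add: a_minus_def minus_add a_ac)
  finally show ?thesis .
qed

context cring
begin

lemma regular_module: "Module.module R (regular_module R)"
proof (rule Module.moduleI)
  show "cring R" by (rule is_cring)
  show "abelian_group (regular_module R)"
    by (rule abelian_groupI) (auto simp: a_ac intro: l_neg bexI[of _ "\<ominus> _"])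
qed (auto simp: l_distr r_distr m_assoc)

lemma pow_module:
  assumes "Module.module R N"
  shows "Module.module R (pow_module N k)"
proof -
  interpret N: Module.module R N by fact
  show ?thesis
  proof (rule Module.moduleI)
    show "cring R" by (rule is_cring)
    show "abelian_group (pow_module N k)"
    proof (rule abelian_groupI)
      fix x y z assume x: "x \<in> carrier (pow_module N k)" and y: "y \<in> carrier (pow_module N k)"
        and z: "z \<in> carrier (pow_module N k)"
      show "x \<oplus>\<^bsub>pow_module N k\<^esub> y \<in> carrier (pow_module N k)" using x y by (auto simp: PiE_iff)
      show "x \<oplus>\<^bsub>pow_module N k\<^esub> y \<oplus>\<^bsub>pow_module N k\<^esub> z = x \<oplus>\<^bsub>pow_module N k\<^esub> (y \<oplus>\<^bsub>pow_module N k\<^esub> z)"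
        using x y z by (auto simp: PiE_iff N.a_assoc intro!: ext)
      show "x \<oplus>\<^bsub>pow_module N k\<^esub> y = y \<oplus>\<^bsub>pow_module N k\<^esub> x"
        using x y by (auto simp: PiE_iff N.a_comm intro!: ext)
      show "\<zero>\<^bsub>pow_module N k\<^esub> \<oplus>\<^bsub>pow_module N k\<^esub> x = x"
        using x by (intro pow_eqI[of _ k "carrier N"]) (auto simp: PiE_iff)
      show "\<exists>y\<in>carrier (pow_module N k). y \<oplus>\<^bsub>pow_module N k\<^esub> x = \<zero>\<^bsub>pow_module N k\<^esub>"
        using x by (intro bexI[of _ "\<lambda>i\<in>{..<k}. \<ominus>\<^bsub>N\<^esub> x i"]) (auto simp: PiE_iff N.l_neg intro!: ext)
    qed (auto simp: PiE_iff)
  next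
    fix a b x y assume a: "a \<in> carrier R" and b: "b \<in> carrier R"
      and x: "x \<in> carrier (pow_module N k)" and y: "y \<in> carrier (pow_module N k)"
    show "a \<odot>\<^bsub>pow_module N k\<^esub> x \<in> carrier (pow_module N k)" using a x by (auto simp: PiE_iff)
    show "(a \<oplus> b) \<odot>\<^bsub>pow_module N k\<^esub> x = a \<odot>\<^bsub>pow_module N k\<^esub> x \<oplus>\<^bsub>pow_module N k\<^esub> b \<odot>\<^bsub>pow_module N k\<^esub> x"
      using a b x by (auto simp: PiE_iff N.smult_l_distr intro!: ext)
    show "a \<odot>\<^bsub>pow_module N k\<^esub> (x \<oplus>\<^bsub>pow_module N k\<^esub> y) = a \<odot>\<^bsub>pow_module N k\<^esub> x \<oplus>\<^bsub>pow_module N k\<^esub> a \<odot>\<^bsub>pow_module N k\<^esub> y"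
      using a x y by (auto simp: PiE_iff N.smult_r_distr intro!: ext)
    show "(a \<otimes> b) \<odot>\<^bsub>pow_module N k\<^esub> x = a \<odot>\<^bsub>pow_module N k\<^esub> (b \<odot>\<^bsub>pow_module N k\<^esub> x)"
      using a b x by (auto simp: PiE_iff N.smult_assoc1 intro!: ext)
  next
    fix x assume "x \<in> carrier (pow_module N k)"
    then show "\<one> \<odot>\<^bsub>pow_module N k\<^esub> x = x"
      by (intro pow_eqI[of _ k "carrier N"]) (auto simp: PiE_iff)
  qed
qed

abbreviation free :: "nat \<Rightarrow> ('a, nat \<Rightarrow> 'a) module" where
  "free n \<equiv> pow_module (regular_module R) n"

lemma free_module: "Module.module R (free n)"
  by (rule pow_module[OF regular_module])

lemma pow_a_inv:
  assumes "Module.module R N" "v \<in> carrier (pow_module N k)" "i < k"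
  shows "(\<ominus>\<^bsub>pow_module N k\<^esub> v) i = \<ominus>\<^bsub>N\<^esub> v i"
proof -
  interpret N: Module.module R N by fact
  interpret P: Module.module R "pow_module N k" by (rule pow_module) fact
  have w: "\<ominus>\<^bsub>pow_module N k\<^esub> v \<in> {..<k} \<rightarrow>\<^sub>E carrier N" using P.a_inv_closed[OF assms(2)] by simp
  have "(\<ominus>\<^bsub>pow_module N k\<^esub> v \<oplus>\<^bsub>pow_module N k\<^esub> v) i = \<zero>\<^bsub>pow_module N k\<^esub> i"
    using P.l_neg[OF assms(2)] by simp
  then have "(\<ominus>\<^bsub>pow_module N k\<^esub> v) i \<oplus>\<^bsub>N\<^esub> v i = \<zero>\<^bsub>N\<^esub>" using assms(3) by simp
  moreover have "(\<ominus>\<^bsub>pow_module N k\<^esub> v) i \<in> carrier N" "v i \<in> carrier N" using w assms(2,3) by (auto simp: PiE_iff)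
  ultimately show ?thesis using N.minus_equality by metis
qed

lemma pow_minus:
  assumes "Module.module R N" "u \<in> carrier (pow_module N k)" "v \<in> carrier (pow_module N k)" "i < k"
  shows "(u \<ominus>\<^bsub>pow_module N k\<^esub> v) i = u i \<ominus>\<^bsub>N\<^esub> v i"
  using pow_a_inv[OF assms(1,3,4)] assms(4) by (simp add: a_minus_def)

lemma pow_finsum:
  assumes "Module.module R N" "finite A" "f \<in> A \<rightarrow> carrier (pow_module N k)" "i < k"
  shows "(\<Oplus>\<^bsub>pow_module N k\<^esub>j\<in>A. f j) i = (\<Oplus>\<^bsub>N\<^esub>j\<in>A. f j i)"
proof -
  interpret N: Module.module R N by fact
  interpret P: Module.module R "pow_module N k" by (rule pow_module) fact
  show ?thesis
    using assms(2,3)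
  proof (induction A)
    case (insert j A)
    then have "(\<lambda>j. f j i) \<in> A \<rightarrow> carrier N" "f j i \<in> carrier N" using assms(4) by (auto simp: PiE_iff Pi_iff)
    moreover have "f \<in> A \<rightarrow> carrier (pow_module N k)" "f j \<in> carrier (pow_module N k)" using insert.prems by auto
    ultimately show ?case
      using insert P.finsum_insert[of A j f] N.finsum_insert[of A j "\<lambda>j. f j i"] assms(4) by simp
  qed (use assms(4) in simp)
qed

lemma module_homD:
  assumes "f \<in> module_hom R M N"
  shows "x \<in> carrier M \<Longrightarrow> f x \<in> carrier N"
    and "x \<in> carrier M \<Longrightarrow> y \<in> carrier M \<Longrightarrow> f (x \<oplus>\<^bsub>M\<^esub> y) = f x \<oplus>\<^bsub>N\<^esub> f y"
    and "a \<in> carrier R \<Longrightarrow> x \<in> carrier M \<Longrightarrow> f (a \<odot>\<^bsub>M\<^esub> x) = a \<odot>\<^bsub>N\<^esub> f x"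
  using assms by (auto simp: module_hom_def Pi_iff)

lemma module_homI:
  assumes "\<And>x. x \<in> carrier M \<Longrightarrow> f x \<in> carrier N"
    and "\<And>x y. x \<in> carrier M \<Longrightarrow> y \<in> carrier M \<Longrightarrow> f (x \<oplus>\<^bsub>M\<^esub> y) = f x \<oplus>\<^bsub>N\<^esub> f y"
    and "\<And>a x. a \<in> carrier R \<Longrightarrow> x \<in> carrier M \<Longrightarrow> f (a \<odot>\<^bsub>M\<^esub> x) = a \<odot>\<^bsub>N\<^esub> f x"
  shows "f \<in> module_hom R M N"
  using assms by (auto simp: module_hom_def)

context
  fixes M :: "('a, 'm) module" and N :: "('a, 'n) module"
  assumes M: "Module.module R M" and N: "Module.module R N"
begin

interpretation M: Module.module R M by (rule M)
interpretation N: Module.module R N by (rule N)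

lemma hom_zero: "f \<in> module_hom R M N \<Longrightarrow> f \<zero>\<^bsub>M\<^esub> = \<zero>\<^bsub>N\<^esub>"
  using module_homD(1,3)[of f M N] by (metis M.smult_l_null M.zero_closed N.smult_l_null zero_closed)

lemma hom_neg: "f \<in> module_hom R M N \<Longrightarrow> x \<in> carrier M \<Longrightarrow> f (\<ominus>\<^bsub>M\<^esub> x) = \<ominus>\<^bsub>N\<^esub> f x"
  using module_homD[of f M N] hom_zero[of f]
  by (metis M.a_inv_closed M.l_neg N.minus_equality)

lemma hom_minus:
  "f \<in> module_hom R M N \<Longrightarrow> x \<in> carrier M \<Longrightarrow> y \<in> carrier M \<Longrightarrow> f (x \<ominus>\<^bsub>M\<^esub> y) = f x \<ominus>\<^bsub>N\<^esub> f y"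
  unfolding a_minus_def using module_homD(2)[of f M N] hom_neg[of f] by simp

lemma hom_finsum:
  assumes f: "f \<in> module_hom R M N" and "finite A" "g \<in> A \<rightarrow> carrier M"
  shows "f (\<Oplus>\<^bsub>M\<^esub>j\<in>A. g j) = (\<Oplus>\<^bsub>N\<^esub>j\<in>A. f (g j))"
  using assms(2,3)
proof (induction A)
  case (insert j A)
  then have "g \<in> A \<rightarrow> carrier M" "g j \<in> carrier M" by auto
  moreover from this have "(\<lambda>j. f (g j)) \<in> A \<rightarrow> carrier N" "f (g j) \<in> carrier N"
    using module_homD(1)[OF f] by auto
  ultimately show ?case
    using insert module_homD(2)[OF f, of "g j" "\<Oplus>\<^bsub>M\<^esub>j\<in>A. g j"] by simp
qed (simp add: hom_zero[OF f])

lemma hom_diff: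
  assumes "f \<in> module_hom R M N" "g \<in> module_hom R M N"
  shows "(\<lambda>x. f x \<ominus>\<^bsub>N\<^esub> g x) \<in> module_hom R M N"
proof (rule module_homI)
  note F = module_homD[OF assms(1)] and G = module_homD[OF assms(2)]
  show "f x \<ominus>\<^bsub>N\<^esub> g x \<in> carrier N" if "x \<in> carrier M" for x using F G that by simp
  show "f (x \<oplus>\<^bsub>M\<^esub> y) \<ominus>\<^bsub>N\<^esub> g (x \<oplus>\<^bsub>M\<^esub> y) = f x \<ominus>\<^bsub>N\<^esub> g x \<oplus>\<^bsub>N\<^esub> (f y \<ominus>\<^bsub>N\<^esub> g y)"
    if "x \<in> carrier M" "y \<in> carrier M" for x y
    using F G that by (simp add: a_minus_def N.minus_add N.a_ac)
  show "f (a \<odot>\<^bsub>M\<^esub> x) \<ominus>\<^bsub>N\<^esub> g (a \<odot>\<^bsub>M\<^esub> x) = a \<odot>\<^bsub>N\<^esub> (f x \<ominus>\<^bsub>N\<^esub> g x)"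
    if "a \<in> carrier R" "x \<in> carrier M" for a x
    using F G that by (simp add: a_minus_def N.smult_r_distr N.smult_r_minus)
qed

end

lemma hom_compose:
  "f \<in> module_hom R M N \<Longrightarrow> g \<in> module_hom R N K \<Longrightarrow> (\<lambda>x. g (f x)) \<in> module_hom R M K"
  by (auto simp: module_hom_def Pi_iff)

lemma hom_id: "(\<lambda>x. x) \<in> module_hom R M M"
  by (auto simp: module_hom_def)

section \<open>Homomorphisms out of free modules\<close>

definition unit_vec :: "nat \<Rightarrow> nat \<Rightarrow> nat \<Rightarrow> 'a" where
  "unit_vec n j = (\<lambda>i\<in>{..<n}. if i = j then \<one> else \<zero>)"

lemma unit_vec_closed [simp]: "unit_vec n j \<in> {..<n} \<rightarrow>\<^sub>E carrier R"
  by (auto simp: unit_vec_def)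

definition lincomb_hom :: "('a, 'm) module \<Rightarrow> (nat \<Rightarrow> 'm) \<Rightarrow> nat \<Rightarrow> (nat \<Rightarrow> 'a) \<Rightarrow> 'm" where
  "lincomb_hom N x n v = (\<Oplus>\<^bsub>N\<^esub>j\<in>{..<n}. v j \<odot>\<^bsub>N\<^esub> x j)"

lemma lincomb_hom:
  assumes "Module.module R N" "x \<in> {..<n} \<rightarrow> carrier N"
  shows "lincomb_hom N x n \<in> module_hom R (free n) N"
proof (rule module_homI)
  interpret N: Module.module R N by fact
  fix u v assume u: "u \<in> carrier (free n)" and v: "v \<in> carrier (free n)"
  have c: "(\<lambda>j. v j \<odot>\<^bsub>N\<^esub> x j) \<in> {..<n} \<rightarrow> carrier N" if "v \<in> carrier (free n)" for v
    using that assms(2) by (auto simp: PiE_iff Pi_iff)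
  show "lincomb_hom N x n u \<in> carrier N" unfolding lincomb_hom_def by (rule N.finsum_closed[OF c[OF u]])
  have "lincomb_hom N x n (u \<oplus>\<^bsub>free n\<^esub> v) = (\<Oplus>\<^bsub>N\<^esub>j\<in>{..<n}. u j \<odot>\<^bsub>N\<^esub> x j \<oplus>\<^bsub>N\<^esub> v j \<odot>\<^bsub>N\<^esub> x j)"
    unfolding lincomb_hom_def
    using c[OF u] c[OF v] u v assms(2) by (intro N.finsum_cong') (auto simp: PiE_iff Pi_iff N.smult_l_distr)
  then show "lincomb_hom N x n (u \<oplus>\<^bsub>free n\<^esub> v) = lincomb_hom N x n u \<oplus>\<^bsub>N\<^esub> lincomb_hom N x n v"
    unfolding lincomb_hom_def by (simp only: N.finsum_addf[OF c[OF u] c[OF v]])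
next
  interpret N: Module.module R N by fact
  fix a v assume a: "a \<in> carrier R" and v: "v \<in> carrier (free n)"
  have c: "(\<lambda>j. v j \<odot>\<^bsub>N\<^esub> x j) \<in> {..<n} \<rightarrow> carrier N"
    using v assms(2) by (auto simp: PiE_iff Pi_iff)
  have "lincomb_hom N x n (a \<odot>\<^bsub>free n\<^esub> v) = (\<Oplus>\<^bsub>N\<^esub>j\<in>{..<n}. a \<odot>\<^bsub>N\<^esub> (v j \<odot>\<^bsub>N\<^esub> x j))"
    unfolding lincomb_hom_def
    using c v a assms(2) by (intro N.finsum_cong') (auto simp: PiE_iff Pi_iff N.smult_assoc1)
  then show "lincomb_hom N x n (a \<odot>\<^bsub>free n\<^esub> v) = a \<odot>\<^bsub>N\<^esub> lincomb_hom N x n v"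
    unfolding lincomb_hom_def using N.finsum_smult_ldistr[OF _ a c] by simp
qed

lemma hom_eq_lincomb:
  assumes N: "Module.module R N" and f: "f \<in> module_hom R (free n) N" and v: "v \<in> carrier (free n)"
  shows "f v = lincomb_hom N (\<lambda>j. f (unit_vec n j)) n v"
proof -
  interpret F: Module.module R "free n" by (rule free_module)
  interpret N: Module.module R N by fact
  have c: "(\<lambda>j. v j \<odot>\<^bsub>free n\<^esub> unit_vec n j) \<in> {..<n} \<rightarrow> carrier (free n)"
    using v by (auto simp: PiE_iff unit_vec_def)
  have "v = (\<Oplus>\<^bsub>free n\<^esub>j\<in>{..<n}. v j \<odot>\<^bsub>free n\<^esub> unit_vec n j)"
  proof (rule pow_eqI[of _ n "carrier R"])
    show "v \<in> {..<n} \<rightarrow>\<^sub>E carrier R" using v by simp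
    show "(\<Oplus>\<^bsub>free n\<^esub>j\<in>{..<n}. v j \<odot>\<^bsub>free n\<^esub> unit_vec n j) \<in> {..<n} \<rightarrow>\<^sub>E carrier R"
      using F.finsum_closed[OF c] by simp
    fix i assume i: "i < n"
    have vc: "v \<in> {..<n} \<rightarrow> carrier R" using v by auto
    have "(\<Oplus>\<^bsub>free n\<^esub>j\<in>{..<n}. v j \<odot>\<^bsub>free n\<^esub> unit_vec n j) i =
        (\<Oplus>\<^bsub>regular_module R\<^esub>j\<in>{..<n}. (v j \<odot>\<^bsub>free n\<^esub> unit_vec n j) i)"
      by (rule pow_finsum[OF regular_module _ c i]) simp
    also have "\<dots> = (\<Oplus>j\<in>{..<n}. if i = j then v j else \<zero>)"
      unfolding regular_module_simps
      using vc i by (intro finsum_cong') (auto simp: unit_vec_def Pi_iff)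
    also have "\<dots> = v i" using i vc by (intro add.finprod_singleton) auto
    finally show "v i = (\<Oplus>\<^bsub>free n\<^esub>j\<in>{..<n}. v j \<odot>\<^bsub>free n\<^esub> unit_vec n j) i" ..
  qed
  then have "f v = f (\<Oplus>\<^bsub>free n\<^esub>j\<in>{..<n}. v j \<odot>\<^bsub>free n\<^esub> unit_vec n j)" by simp
  also have "\<dots> = (\<Oplus>\<^bsub>N\<^esub>j\<in>{..<n}. f (v j \<odot>\<^bsub>free n\<^esub> unit_vec n j))"
    by (rule hom_finsum[OF free_module N f _ c]) simp
  also have "\<dots> = lincomb_hom N (\<lambda>j. f (unit_vec n j)) n v"
    unfolding lincomb_hom_def
  proof (rule N.finsum_cong')
    have u: "unit_vec n j \<in> carrier (free n)" for j by simp
    show "(\<lambda>j. v j \<odot>\<^bsub>N\<^esub> f (unit_vec n j)) \<in> {..<n} \<rightarrow> carrier N"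
      using v module_homD(1)[OF f u] by (auto simp: PiE_iff)
    show "f (v j \<odot>\<^bsub>free n\<^esub> unit_vec n j) = v j \<odot>\<^bsub>N\<^esub> f (unit_vec n j)" if "j \<in> {..<n}" for j
      using v that by (intro module_homD(3)[OF f _ u]) (auto simp: PiE_iff)
  qed simp
  finally show ?thesis .
qed

text \<open>Projectivity of free modules: preimages are chosen for the images of the unit vectors
  and extended linearly.\<close>

lemma free_lift:
  fixes M :: "('a, 'm) module" and G :: "('a, 'g) module"
  assumes M: "Module.module R M" and G: "Module.module R G"
    and f: "f \<in> module_hom R (free n) M" and p: "p \<in> module_hom R G M"
    and im: "\<And>v. v \<in> carrier (free n) \<Longrightarrow> f v \<in> p ` carrier G"
  shows "\<exists>h\<in>module_hom R (free n) G. \<forall>v\<in>carrier (free n). p (h v) = f v"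
proof -
  have "\<exists>x\<in>carrier G. p x = f (unit_vec n j)" for j
  proof -
    have "f (unit_vec n j) \<in> p ` carrier G" by (rule im) simp
    then show ?thesis by (metis imageE)
  qed
  then obtain x where x: "\<And>j. x j \<in> carrier G" "\<And>j. p (x j) = f (unit_vec n j)" by metis
  interpret M: Module.module R M by fact
  have h: "lincomb_hom G x n \<in> module_hom R (free n) G" using x(1) by (intro lincomb_hom[OF G]) auto
  have "p (lincomb_hom G x n v) = f v" if v: "v \<in> carrier (free n)" for v
  proof -
    have ph: "(\<lambda>v. p (lincomb_hom G x n v)) \<in> module_hom R (free n) M" by (rule hom_compose[OF h p])
    have "lincomb_hom G x n (unit_vec n j) = x j" if "j < n" for j
    proof -
      interpret G: Module.module R G by fact
      have "lincomb_hom G x n (unit_vec n j) = (\<Oplus>\<^bsub>G\<^esub>i\<in>{..<n}. if j = i then x i else \<zero>\<^bsub>G\<^esub>)"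
        unfolding lincomb_hom_def using x(1) by (intro G.finsum_cong') (auto simp: unit_vec_def)
      also have "\<dots> = x j" using that x(1) by (intro G.add.finprod_singleton) auto
      finally show ?thesis .
    qed
    then have "lincomb_hom M (\<lambda>j. p (lincomb_hom G x n (unit_vec n j))) n v = lincomb_hom M (\<lambda>j. f (unit_vec n j)) n v"
      unfolding lincomb_hom_def
    proof (intro M.finsum_cong')
      have "f (unit_vec n j) \<in> carrier M" for j by (rule module_homD(1)[OF f]) simp
      then show "(\<lambda>j. v j \<odot>\<^bsub>M\<^esub> f (unit_vec n j)) \<in> {..<n} \<rightarrow> carrier M"
        using v by (auto simp: PiE_iff)
    qed (use x(2) in \<open>auto simp: lincomb_hom_def\<close>)
    then show ?thesis using hom_eq_lincomb[OF M ph v] hom_eq_lincomb[OF M f v] by simp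
  qed
  then show ?thesis using h by blast
qed

lemma mat_map_hom:
  assumes N: "Module.module R N" and A: "\<And>i j. i < k \<Longrightarrow> j < l \<Longrightarrow> A i j \<in> carrier R"
  shows "mat_map N k l A \<in> module_hom R (pow_module N l) (pow_module N k)"
proof (rule module_homI)
  interpret N: Module.module R N by fact
  have c: "(\<lambda>j. A i j \<odot>\<^bsub>N\<^esub> v j) \<in> {..<l} \<rightarrow> carrier N" if "v \<in> carrier (pow_module N l)" "i < k" for v i
    using that A by (auto simp: PiE_iff)
  fix u v assume u: "u \<in> carrier (pow_module N l)" and v: "v \<in> carrier (pow_module N l)"
  show "mat_map N k l A u \<in> carrier (pow_module N k)"
    using N.finsum_closed[OF c[OF u]] by (auto simp: mat_map_def)
  have "(\<Oplus>\<^bsub>N\<^esub>j\<in>{..<l}. A i j \<odot>\<^bsub>N\<^esub> (u \<oplus>\<^bsub>pow_module N l\<^esub> v) j) =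
      (\<Oplus>\<^bsub>N\<^esub>j\<in>{..<l}. A i j \<odot>\<^bsub>N\<^esub> u j) \<oplus>\<^bsub>N\<^esub> (\<Oplus>\<^bsub>N\<^esub>j\<in>{..<l}. A i j \<odot>\<^bsub>N\<^esub> v j)" if i: "i < k" for i
  proof -
    have "(\<Oplus>\<^bsub>N\<^esub>j\<in>{..<l}. A i j \<odot>\<^bsub>N\<^esub> (u \<oplus>\<^bsub>pow_module N l\<^esub> v) j) =
        (\<Oplus>\<^bsub>N\<^esub>j\<in>{..<l}. A i j \<odot>\<^bsub>N\<^esub> u j \<oplus>\<^bsub>N\<^esub> A i j \<odot>\<^bsub>N\<^esub> v j)"
      using u v A i by (intro N.finsum_cong') (auto simp: PiE_iff N.smult_r_distr)
    then show ?thesis by (simp only: N.finsum_addf[OF c[OF u i] c[OF v i]])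
  qed
  then show "mat_map N k l A (u \<oplus>\<^bsub>pow_module N l\<^esub> v) = mat_map N k l A u \<oplus>\<^bsub>pow_module N k\<^esub> mat_map N k l A v"
    by (auto simp: mat_map_def intro!: ext)
next
  interpret N: Module.module R N by fact
  fix a v assume a: "a \<in> carrier R" and v: "v \<in> carrier (pow_module N l)"
  have c: "(\<lambda>j. A i j \<odot>\<^bsub>N\<^esub> v j) \<in> {..<l} \<rightarrow> carrier N" if "i < k" for i
    using that A v by (auto simp: PiE_iff)
  have "(\<Oplus>\<^bsub>N\<^esub>j\<in>{..<l}. A i j \<odot>\<^bsub>N\<^esub> (a \<odot>\<^bsub>pow_module N l\<^esub> v) j) = a \<odot>\<^bsub>N\<^esub> (\<Oplus>\<^bsub>N\<^esub>j\<in>{..<l}. A i j \<odot>\<^bsub>N\<^esub> v j)"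
    if i: "i < k" for i
  proof -
    have "A i j \<odot>\<^bsub>N\<^esub> (a \<odot>\<^bsub>N\<^esub> v j) = a \<odot>\<^bsub>N\<^esub> (A i j \<odot>\<^bsub>N\<^esub> v j)" if "j < l" for j
      using a A[OF i that] v that m_comm[of a "A i j"] by (simp add: PiE_iff flip: N.smult_assoc1)
    then have "(\<Oplus>\<^bsub>N\<^esub>j\<in>{..<l}. A i j \<odot>\<^bsub>N\<^esub> (a \<odot>\<^bsub>pow_module N l\<^esub> v) j) = (\<Oplus>\<^bsub>N\<^esub>j\<in>{..<l}. a \<odot>\<^bsub>N\<^esub> (A i j \<odot>\<^bsub>N\<^esub> v j))"
      using a A[OF i] v by (intro N.finsum_cong') (auto simp: PiE_iff)
    then show ?thesis using N.finsum_smult_ldistr[OF _ a c[OF i]] by simp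
  qed
  then show "mat_map N k l A (a \<odot>\<^bsub>pow_module N l\<^esub> v) = a \<odot>\<^bsub>pow_module N k\<^esub> mat_map N k l A v"
    by (auto simp: mat_map_def intro!: ext)
qed

text \<open>The conditions of \<open>free_resolution\<close> with matrices replaced by the maps they
  define, so that resolutions are compared by composing homomorphisms.\<close>

definition resolves ::
    "('a, 'm) module \<Rightarrow> (nat \<Rightarrow> nat) \<Rightarrow> (nat \<Rightarrow> (nat \<Rightarrow> 'a) \<Rightarrow> (nat \<Rightarrow> 'a)) \<Rightarrow> ((nat \<Rightarrow> 'a) \<Rightarrow> 'm) \<Rightarrow> bool" where
  "resolves M n D \<epsilon> \<longleftrightarrow>
     (\<forall>i. D i \<in> module_hom R (free (n (Suc i))) (free (n i))) \<and>
     \<epsilon> \<in> module_hom R (free (n 0)) M \<and>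
     \<epsilon> ` carrier (free (n 0)) = carrier M \<and>
     D 0 ` carrier (free (n 1)) = {v \<in> carrier (free (n 0)). \<epsilon> v = \<zero>\<^bsub>M\<^esub>} \<and>
     (\<forall>i. D (Suc i) ` carrier (free (n (Suc (Suc i)))) =
            {v \<in> carrier (free (n (Suc i))). D i v = \<zero>\<^bsub>free (n i)\<^esub>})"

lemma free_resolution_iff:
  "free_resolution R M n d \<epsilon> \<longleftrightarrow>
     (\<forall>i. \<forall>a<n i. \<forall>b<n (Suc i). d i a b \<in> carrier R) \<and>
     resolves M n (\<lambda>i. mat_map (regular_module R) (n i) (n (Suc i)) (d i)) \<epsilon>"
  unfolding free_resolution_def resolves_def Let_def
  using mat_map_hom[OF regular_module] by (intro iffI conjI allI; (elim conjE)?; auto?)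

context
  fixes M n D \<epsilon> n' D' \<epsilon>'
  assumes M: "Module.module R M" and res: "resolves M n D \<epsilon>" and res': "resolves M n' D' \<epsilon>'"
begin

lemma res_hom: "D i \<in> module_hom R (free (n (Suc i))) (free (n i))" "\<epsilon> \<in> module_hom R (free (n 0)) M"
  and res_zero: "v \<in> carrier (free (n 1)) \<Longrightarrow> \<epsilon> (D 0 v) = \<zero>\<^bsub>M\<^esub>"
    "v \<in> carrier (free (n (Suc (Suc i)))) \<Longrightarrow> D i (D (Suc i) v) = \<zero>\<^bsub>free (n i)\<^esub>"
  using res unfolding resolves_def by blast+

lemma res'_hom: "D' i \<in> module_hom R (free (n' (Suc i))) (free (n' i))" "\<epsilon>' \<in> module_hom R (free (n' 0)) M"
  and res'_surj: "\<epsilon>' ` carrier (free (n' 0)) = carrier M"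
  and res'_exact: "v \<in> carrier (free (n' 0)) \<Longrightarrow> \<epsilon>' v = \<zero>\<^bsub>M\<^esub> \<Longrightarrow> v \<in> D' 0 ` carrier (free (n' 1))"
    "v \<in> carrier (free (n' (Suc i))) \<Longrightarrow> D' i v = \<zero>\<^bsub>free (n' i)\<^esub> \<Longrightarrow> v \<in> D' (Suc i) ` carrier (free (n' (Suc (Suc i))))"
  using res' unfolding resolves_def by blast+

text \<open>Each map is chosen together with the property that it sends boundaries to boundaries; by
  projectivity this is what the next lift requires.\<close>

lemma chain_map_exists:
  "\<exists>f. (\<forall>i. f i \<in> module_hom R (free (n i)) (free (n' i))) \<and>
     (\<forall>v\<in>carrier (free (n 0)). \<epsilon>' (f 0 v) = \<epsilon> v) \<and>
     (\<forall>i. \<forall>v\<in>carrier (free (n (Suc i))). D' i (f (Suc i) v) = f i (D i v))"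
proof -
  define P where "P i f \<longleftrightarrow> f \<in> module_hom R (free (n i)) (free (n' i)) \<and>
     (\<forall>v\<in>carrier (free (n (Suc i))). f (D i v) \<in> D' i ` carrier (free (n' (Suc i)))) \<and>
     (i = 0 \<longrightarrow> (\<forall>v\<in>carrier (free (n 0)). \<epsilon>' (f v) = \<epsilon> v))" for i f
  define Q where "Q i f g \<longleftrightarrow> (\<forall>v\<in>carrier (free (n (Suc i))). D' i (g v) = f (D i v))"
    for i and f g :: "(nat \<Rightarrow> 'a) \<Rightarrow> (nat \<Rightarrow> 'a)"
  have "\<exists>f. P 0 f"
  proof -
    have "\<exists>f\<in>module_hom R (free (n 0)) (free (n' 0)). \<forall>v\<in>carrier (free (n 0)). \<epsilon>' (f v) = \<epsilon> v"
      using module_homD(1)[OF res_hom(2)] res'_surj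
      by (intro free_lift[OF M free_module res_hom(2) res'_hom(2)]) blast
    then obtain f where f: "f \<in> module_hom R (free (n 0)) (free (n' 0))"
      "\<And>v. v \<in> carrier (free (n 0)) \<Longrightarrow> \<epsilon>' (f v) = \<epsilon> v" by blast
    have "f (D 0 v) \<in> D' 0 ` carrier (free (n' (Suc 0)))" if "v \<in> carrier (free (n (Suc 0)))" for v
    proof -
      have Dv: "D 0 v \<in> carrier (free (n 0))" using module_homD(1)[OF res_hom(1)] that by blast
      show ?thesis
        using res'_exact(1)[OF module_homD(1)[OF f(1) Dv]] f(2)[OF Dv] res_zero(1)[of v] that by simp
    qed
    then show ?thesis unfolding P_def using f by blast
  qed
  moreover have "\<exists>g. P (Suc i) g \<and> Q i f g" if P: "P i f" for i f
  proof -
    have f: "f \<in> module_hom R (free (n i)) (free (n' i))" using P by (simp add: P_def)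
    have "\<exists>g\<in>module_hom R (free (n (Suc i))) (free (n' (Suc i))). \<forall>v\<in>carrier (free (n (Suc i))). D' i (g v) = f (D i v)"
      using P unfolding P_def
      by (intro free_lift[OF free_module free_module hom_compose[OF res_hom(1) f] res'_hom(1)]) blast
    then obtain g where g: "g \<in> module_hom R (free (n (Suc i))) (free (n' (Suc i)))"
      "\<And>v. v \<in> carrier (free (n (Suc i))) \<Longrightarrow> D' i (g v) = f (D i v)" by blast
    have "g (D (Suc i) v) \<in> D' (Suc i) ` carrier (free (n' (Suc (Suc i))))"
      if v: "v \<in> carrier (free (n (Suc (Suc i))))" for v
    proof -
      have Dv: "D (Suc i) v \<in> carrier (free (n (Suc i)))" using module_homD(1)[OF res_hom(1) v] .
      have "D' i (g (D (Suc i) v)) = \<zero>\<^bsub>free (n' i)\<^esub>"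
        using g(2)[OF Dv] res_zero(2)[OF v] hom_zero[OF free_module free_module f] by simp
      then show ?thesis by (rule res'_exact(2)[OF module_homD(1)[OF g(1) Dv]])
    qed
    then show ?thesis unfolding P_def Q_def using g by blast
  qed
  ultimately obtain f where "\<And>i. P i (f i) \<and> Q i (f i) (f (Suc i))"
    using dependent_nat_choice[of P Q] by blast
  then show ?thesis unfolding P_def Q_def by blast
qed

text \<open>A chain map over the zero map is null-homotopic. The invariant \<open>P\<close> says
  that the defect of the homotopy constructed so far is a cycle, hence a boundary by
  exactness.\<close>

lemma homotopy_exists:
  assumes a: "\<And>i. a i \<in> module_hom R (free (n i)) (free (n' i))"
    and a0: "\<And>v. v \<in> carrier (free (n 0)) \<Longrightarrow> \<epsilon>' (a 0 v) = \<zero>\<^bsub>M\<^esub>"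
    and aS: "\<And>i v. v \<in> carrier (free (n (Suc i))) \<Longrightarrow> D' i (a (Suc i) v) = a i (D i v)"
  shows "\<exists>h. (\<forall>i. h i \<in> module_hom R (free (n i)) (free (n' (Suc i)))) \<and>
     (\<forall>v\<in>carrier (free (n 0)). a 0 v = D' 0 (h 0 v)) \<and>
     (\<forall>i. \<forall>v\<in>carrier (free (n (Suc i))). a (Suc i) v = D' (Suc i) (h (Suc i) v) \<oplus>\<^bsub>free (n' (Suc i))\<^esub> h i (D i v))"
proof -
  define P where "P i h \<longleftrightarrow> h \<in> module_hom R (free (n i)) (free (n' (Suc i))) \<and>
     (\<forall>v\<in>carrier (free (n (Suc i))). D' i (a (Suc i) v \<ominus>\<^bsub>free (n' (Suc i))\<^esub> h (D i v)) = \<zero>\<^bsub>free (n' i)\<^esub>) \<and>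
     (i = 0 \<longrightarrow> (\<forall>v\<in>carrier (free (n 0)). a 0 v = D' 0 (h v)))" for i h
  define Q where "Q i h g \<longleftrightarrow> (\<forall>v\<in>carrier (free (n (Suc i))).
      a (Suc i) v = D' (Suc i) (g v) \<oplus>\<^bsub>free (n' (Suc i))\<^esub> h (D i v))"
    for i and h g :: "(nat \<Rightarrow> 'a) \<Rightarrow> (nat \<Rightarrow> 'a)"
  have key: "D' i (a (Suc i) v \<ominus>\<^bsub>free (n' (Suc i))\<^esub> h (D i v)) = \<zero>\<^bsub>free (n' i)\<^esub>"
    if h: "h \<in> module_hom R (free (n i)) (free (n' (Suc i)))" and v: "v \<in> carrier (free (n (Suc i)))"
      and eq: "D' i (h (D i v)) = a i (D i v)" for i h v
  proof -
    interpret F: Module.module R "free (n' i)" by (rule free_module)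
    have Dv: "D i v \<in> carrier (free (n i))" by (rule module_homD(1)[OF res_hom(1) v])
    have "D' i (a (Suc i) v \<ominus>\<^bsub>free (n' (Suc i))\<^esub> h (D i v)) = a i (D i v) \<ominus>\<^bsub>free (n' i)\<^esub> a i (D i v)"
      using hom_minus[OF free_module free_module res'_hom(1) module_homD(1)[OF a v] module_homD(1)[OF h Dv]]
        aS[OF v] eq by simp
    then show ?thesis using F.r_neg[OF module_homD(1)[OF a Dv]] by (simp only: a_minus_def)
  qed
  have "\<exists>h. P 0 h"
  proof -
    have "\<exists>h\<in>module_hom R (free (n 0)) (free (n' (Suc 0))). \<forall>v\<in>carrier (free (n 0)). D' 0 (h v) = a 0 v"
    proof (rule free_lift[OF free_module free_module a res'_hom(1)])
      fix v assume v: "v \<in> carrier (free (n 0))"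
      show "a 0 v \<in> D' 0 ` carrier (free (n' (Suc 0)))"
        using res'_exact(1)[OF module_homD(1)[OF a v] a0[OF v]] by simp
    qed
    then obtain h where h: "h \<in> module_hom R (free (n 0)) (free (n' (Suc 0)))"
      "\<And>v. v \<in> carrier (free (n 0)) \<Longrightarrow> D' 0 (h v) = a 0 v" by blast
    have "P 0 h" unfolding P_def
    proof (intro conjI ballI impI)
      show "a 0 v = D' 0 (h v)" if "v \<in> carrier (free (n 0))" for v using h(2)[OF that] ..
      show "D' 0 (a (Suc 0) v \<ominus>\<^bsub>free (n' (Suc 0))\<^esub> h (D 0 v)) = \<zero>\<^bsub>free (n' 0)\<^esub>"
        if v: "v \<in> carrier (free (n (Suc 0)))" for v
        by (rule key[OF h(1) v h(2)[OF module_homD(1)[OF res_hom(1) v]]])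
    qed (rule h(1))
    then show ?thesis by blast
  qed
  moreover have "\<exists>g. P (Suc i) g \<and> Q i h g" if P: "P i h" for i h
  proof -
    have h: "h \<in> module_hom R (free (n i)) (free (n' (Suc i)))" using P by (simp only: P_def)
    let ?f = "\<lambda>v. a (Suc i) v \<ominus>\<^bsub>free (n' (Suc i))\<^esub> h (D i v)"
    have f: "?f \<in> module_hom R (free (n (Suc i))) (free (n' (Suc i)))"
      by (rule hom_diff[OF free_module free_module a hom_compose[OF res_hom(1) h]])
    have "\<exists>g\<in>module_hom R (free (n (Suc i))) (free (n' (Suc (Suc i)))).
        \<forall>v\<in>carrier (free (n (Suc i))). D' (Suc i) (g v) = ?f v"
    proof (rule free_lift[OF free_module free_module f res'_hom(1)])
      fix v assume v: "v \<in> carrier (free (n (Suc i)))"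
      have "D' i (?f v) = \<zero>\<^bsub>free (n' i)\<^esub>" using P v unfolding P_def by blast
      then show "?f v \<in> D' (Suc i) ` carrier (free (n' (Suc (Suc i))))"
        by (rule res'_exact(2)[OF module_homD(1)[OF f v]])
    qed
    then obtain g where g: "g \<in> module_hom R (free (n (Suc i))) (free (n' (Suc (Suc i))))"
      "\<And>v. v \<in> carrier (free (n (Suc i))) \<Longrightarrow> D' (Suc i) (g v) = ?f v" by blast
    have Q: "Q i h g" unfolding Q_def
    proof
      fix v assume v: "v \<in> carrier (free (n (Suc i)))"
      interpret F: Module.module R "free (n' (Suc i))" by (rule free_module)
      have hv: "h (D i v) \<in> carrier (free (n' (Suc i)))"
        by (rule module_homD(1)[OF h module_homD(1)[OF res_hom(1) v]])
      have av: "a (Suc i) v \<in> carrier (free (n' (Suc i)))" by (rule module_homD(1)[OF a v])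
      show "a (Suc i) v = D' (Suc i) (g v) \<oplus>\<^bsub>free (n' (Suc i))\<^esub> h (D i v)"
        unfolding g(2)[OF v] a_minus_def
        using av hv F.a_assoc[OF av F.a_inv_closed[OF hv] hv] F.l_neg[OF hv] F.r_zero[OF av] by metis
    qed
    have "P (Suc i) g" unfolding P_def
    proof (intro conjI ballI impI)
      fix v assume v: "v \<in> carrier (free (n (Suc (Suc i))))"
      have Dv: "D (Suc i) v \<in> carrier (free (n (Suc i)))" by (rule module_homD(1)[OF res_hom(1) v])
      have "h (D i (D (Suc i) v)) = \<zero>\<^bsub>free (n' (Suc i))\<^esub>"
        unfolding res_zero(2)[OF v] by (rule hom_zero[OF free_module free_module h])
      moreover interpret F: Module.module R "free (n' (Suc i))" by (rule free_module)
      have "a (Suc i) (D (Suc i) v) \<in> carrier (free (n' (Suc i)))" by (rule module_homD(1)[OF a Dv])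
      ultimately have "D' (Suc i) (g (D (Suc i) v)) = a (Suc i) (D (Suc i) v)"
        using g(2)[OF Dv] F.minus_equality[OF F.l_zero[OF F.zero_closed] F.zero_closed F.zero_closed]
        by (simp only: a_minus_def F.r_zero)
      then show "D' (Suc i) (a (Suc (Suc i)) v \<ominus>\<^bsub>free (n' (Suc (Suc i)))\<^esub> g (D (Suc i) v)) = \<zero>\<^bsub>free (n' (Suc i))\<^esub>"
        by (rule key[OF g(1) v])
    qed (use g(1) in simp_all)
    then show ?thesis using Q by blast
  qed
  ultimately obtain h where "\<And>i. P i (h i) \<and> Q i (h i) (h (Suc i))"
    using dependent_nat_choice[of P Q] by blast
  then show ?thesis unfolding P_def Q_def by blast
qed

end

section \<open>Comparison with a minimal resolution\<close>

lemma ideal_finsum: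
  assumes "ideal I R" "finite A" "\<And>j. j \<in> A \<Longrightarrow> f j \<in> I"
  shows "(\<Oplus>j\<in>A. f j) \<in> I"
proof -
  interpret I: ideal I R by fact
  show ?thesis
    using assms(2,3)
  proof (induction A)
    case (insert j A)
    then have "f \<in> A \<rightarrow> carrier R" "f j \<in> carrier R" using I.a_Hcarr by auto
    then show ?case using insert by simp
  qed simp
qed

definition vecs_in :: "'a set \<Rightarrow> nat \<Rightarrow> (nat \<Rightarrow> 'a) set" where
  "vecs_in I n = {v \<in> carrier (free n). \<forall>i<n. v i \<in> I}"

lemma vecs_in_add:
  assumes "ideal I R" "u \<in> vecs_in I n" "v \<in> vecs_in I n"
  shows "u \<oplus>\<^bsub>free n\<^esub> v \<in> vecs_in I n"
proof -
  interpret I: ideal I R by fact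
  show ?thesis using assms(2,3) by (auto simp: vecs_in_def PiE_iff)
qed

lemma vecs_in_minus:
  assumes "ideal I R" "u \<in> vecs_in I n" "v \<in> vecs_in I n"
  shows "u \<ominus>\<^bsub>free n\<^esub> v \<in> vecs_in I n"
proof -
  interpret I: ideal I R by fact
  interpret F: Module.module R "free n" by (rule free_module)
  have c: "u \<in> carrier (free n)" "v \<in> carrier (free n)" using assms by (auto simp: vecs_in_def)
  have "u \<ominus>\<^bsub>free n\<^esub> v \<in> carrier (free n)" using F.minus_closed[OF c] .
  moreover have "(u \<ominus>\<^bsub>free n\<^esub> v) i \<in> I" if "i < n" for i
    using pow_minus[OF regular_module c that] assms(2,3) that
    by (auto simp: vecs_in_def a_minus_def)
  ultimately show ?thesis by (simp add: vecs_in_def)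
qed

lemma hom_vecs_in:
  assumes I: "ideal I R" and f: "f \<in> module_hom R (free a) (free b)" and v: "v \<in> vecs_in I a"
  shows "f v \<in> vecs_in I b"
proof -
  interpret I: ideal I R by fact
  have vc: "v \<in> carrier (free a)" using v by (simp add: vecs_in_def)
  have u: "f (unit_vec a j) \<in> carrier (free b)" for j by (rule module_homD(1)[OF f]) simp
  interpret F: Module.module R "free b" by (rule free_module)
  have c: "(\<lambda>j. v j \<odot>\<^bsub>free b\<^esub> f (unit_vec a j)) \<in> {..<a} \<rightarrow> carrier (free b)"
    using vc u by (intro Pi_I F.smult_closed) (auto simp: PiE_iff)
  have "f v i \<in> I" if i: "i < b" for i
  proof -
    have "f v i = (\<Oplus>\<^bsub>regular_module R\<^esub>j\<in>{..<a}. (v j \<odot>\<^bsub>free b\<^esub> f (unit_vec a j)) i)"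
      unfolding hom_eq_lincomb[OF free_module f vc] lincomb_hom_def
      by (rule pow_finsum[OF regular_module _ c i]) simp
    also have "\<dots> = (\<Oplus>j\<in>{..<a}. (v j \<odot>\<^bsub>free b\<^esub> f (unit_vec a j)) i)" by simp
    also have "\<dots> \<in> I"
    proof (rule ideal_finsum[OF I])
      fix j assume j: "j \<in> {..<a}"
      have "v j \<in> I" "f (unit_vec a j) i \<in> carrier R" using v j u[of j] i by (auto simp: vecs_in_def PiE_iff)
      then show "(v j \<odot>\<^bsub>free b\<^esub> f (unit_vec a j)) i \<in> I" using i I.I_r_closed by simp
    qed simp
    finally show ?thesis .
  qed
  then show ?thesis using module_homD(1)[OF f vc] by (simp add: vecs_in_def)
qed

text \<open>Read modulo \<open>I\<close>, where the differential \<open>D'\<close> vanishes: \<open>g\<close> maps into the cycles of \<open>D\<close>, \<open>f\<close> is a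
  left inverse of \<open>g\<close>, and the kernel of \<open>f\<close> on cycles consists of the boundaries. So \<open>g\<close> induces an
  isomorphism onto the homology of \<open>D\<close>.\<close>

lemma minimal_comparison:
  assumes M: "Module.module R M" and I: "ideal I R"
    and res: "resolves M n D \<epsilon>" and res': "resolves M n' D' \<epsilon>'"
    and minimal: "\<And>i v. v \<in> carrier (free (n' (Suc i))) \<Longrightarrow> D' i v \<in> vecs_in I (n' i)"
  shows "\<exists>f g. \<forall>i.
     f i \<in> module_hom R (free (n i)) (free (n' i)) \<and>
     g i \<in> module_hom R (free (n' i)) (free (n i)) \<and>
     (\<forall>w\<in>carrier (free (n' (Suc i))). D i (g (Suc i) w) \<in> vecs_in I (n i)) \<and>
     (\<forall>w\<in>carrier (free (n' i)). f i (g i w) \<ominus>\<^bsub>free (n' i)\<^esub> w \<in> vecs_in I (n' i)) \<and>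
     (\<forall>u\<in>carrier (free (n (Suc i))). f i (D i u) \<in> vecs_in I (n' i)) \<and>
     (\<forall>v\<in>carrier (free (n i)). f i v \<in> vecs_in I (n' i) \<longrightarrow>
        (case i of 0 \<Rightarrow> True | Suc j \<Rightarrow> D j v \<in> vecs_in I (n j)) \<longrightarrow>
        (\<exists>u\<in>carrier (free (n (Suc i))). \<exists>z\<in>vecs_in I (n i). v = D i u \<oplus>\<^bsub>free (n i)\<^esub> z))"
proof -
  note homs = res_hom[OF M res res'] and homs' = res'_hom[OF M res res']
  obtain f where f: "\<And>i. f i \<in> module_hom R (free (n i)) (free (n' i))"
    and f0: "\<And>v. v \<in> carrier (free (n 0)) \<Longrightarrow> \<epsilon>' (f 0 v) = \<epsilon> v"
    and fS: "\<And>i v. v \<in> carrier (free (n (Suc i))) \<Longrightarrow> D' i (f (Suc i) v) = f i (D i v)"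
    using chain_map_exists[OF M res res'] by blast
  obtain g where g: "\<And>i. g i \<in> module_hom R (free (n' i)) (free (n i))"
    and g0: "\<And>v. v \<in> carrier (free (n' 0)) \<Longrightarrow> \<epsilon> (g 0 v) = \<epsilon>' v"
    and gS: "\<And>i v. v \<in> carrier (free (n' (Suc i))) \<Longrightarrow> D i (g (Suc i) v) = g i (D' i v)"
    using chain_map_exists[OF M res' res] by blast
  have cancel: "(x \<ominus>\<^bsub>K\<^esub> x) = \<zero>\<^bsub>K\<^esub>" if "Module.module R K" "x \<in> carrier K"
    for x :: 'y and K :: "('a, 'y) module"
  proof -
    interpret K: Module.module R K by fact
    show ?thesis using K.r_neg[OF that(2)] by (simp only: a_minus_def)
  qed
  \<comment> \<open>A composite of the two comparison maps differs from the identity by a chain map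
    over zero. Stated for two arbitrary resolutions, since both orders of composition occur.\<close>
  have homotopy: "\<exists>h. (\<forall>i. h i \<in> module_hom R (free (p i)) (free (p (Suc i)))) \<and>
     (\<forall>v\<in>carrier (free (p 0)). fb 0 (fa 0 v) \<ominus>\<^bsub>free (p 0)\<^esub> v = d 0 (h 0 v)) \<and>
     (\<forall>i. \<forall>v\<in>carrier (free (p (Suc i))). fb (Suc i) (fa (Suc i) v) \<ominus>\<^bsub>free (p (Suc i))\<^esub> v =
        d (Suc i) (h (Suc i) v) \<oplus>\<^bsub>free (p (Suc i))\<^esub> h i (d i v))"
    if r: "resolves M p d e" "resolves M q d' e'"
      and a: "\<And>i. fa i \<in> module_hom R (free (p i)) (free (q i))"
      and a0: "\<And>v. v \<in> carrier (free (p 0)) \<Longrightarrow> e' (fa 0 v) = e v"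
      and aS: "\<And>i v. v \<in> carrier (free (p (Suc i))) \<Longrightarrow> d' i (fa (Suc i) v) = fa i (d i v)"
      and b: "\<And>i. fb i \<in> module_hom R (free (q i)) (free (p i))"
      and b0: "\<And>v. v \<in> carrier (free (q 0)) \<Longrightarrow> e (fb 0 v) = e' v"
      and bS: "\<And>i v. v \<in> carrier (free (q (Suc i))) \<Longrightarrow> d i (fb (Suc i) v) = fb i (d' i v)"
    for p d e q d' e' fa fb
  proof (rule homotopy_exists[OF M r(1) r(1), where a = "\<lambda>i v. fb i (fa i v) \<ominus>\<^bsub>free (p i)\<^esub> v"])
    note d = res_hom[OF M r]
    have ba: "fb i (fa i v) \<in> carrier (free (p i))" if "v \<in> carrier (free (p i))" for i v
      by (rule module_homD(1)[OF b module_homD(1)[OF a that]])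
    show "(\<lambda>v. fb i (fa i v) \<ominus>\<^bsub>free (p i)\<^esub> v) \<in> module_hom R (free (p i)) (free (p i))" for i
      by (rule hom_diff[OF free_module free_module hom_compose[OF a b] hom_id])
    show "e (fb 0 (fa 0 v) \<ominus>\<^bsub>free (p 0)\<^esub> v) = \<zero>\<^bsub>M\<^esub>" if v: "v \<in> carrier (free (p 0))" for v
      unfolding hom_minus[OF free_module M d(2) ba[OF v] v] b0[OF module_homD(1)[OF a v]] a0[OF v]
      by (rule cancel[OF M module_homD(1)[OF d(2) v]])
    show "d i (fb (Suc i) (fa (Suc i) v) \<ominus>\<^bsub>free (p (Suc i))\<^esub> v) = fb i (fa i (d i v)) \<ominus>\<^bsub>free (p i)\<^esub> d i v"
      if v: "v \<in> carrier (free (p (Suc i)))" for i v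
      unfolding hom_minus[OF free_module free_module d(1) ba[OF v] v] bS[OF module_homD(1)[OF a v]] aS[OF v] ..
  qed
  obtain h where h: "\<And>i. h i \<in> module_hom R (free (n' i)) (free (n' (Suc i)))"
    and h0: "\<And>v. v \<in> carrier (free (n' 0)) \<Longrightarrow> f 0 (g 0 v) \<ominus>\<^bsub>free (n' 0)\<^esub> v = D' 0 (h 0 v)"
    and hS: "\<And>i v. v \<in> carrier (free (n' (Suc i))) \<Longrightarrow> f (Suc i) (g (Suc i) v) \<ominus>\<^bsub>free (n' (Suc i))\<^esub> v =
        D' (Suc i) (h (Suc i) v) \<oplus>\<^bsub>free (n' (Suc i))\<^esub> h i (D' i v)"
    using homotopy[of n' D' \<epsilon>' n D \<epsilon> g f,
        OF res' res g g0 gS f f0 fS] by blast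
  obtain k where k: "\<And>i. k i \<in> module_hom R (free (n i)) (free (n (Suc i)))"
    and k0: "\<And>v. v \<in> carrier (free (n 0)) \<Longrightarrow> g 0 (f 0 v) \<ominus>\<^bsub>free (n 0)\<^esub> v = D 0 (k 0 v)"
    and kS: "\<And>i v. v \<in> carrier (free (n (Suc i))) \<Longrightarrow> g (Suc i) (f (Suc i) v) \<ominus>\<^bsub>free (n (Suc i))\<^esub> v =
        D (Suc i) (k (Suc i) v) \<oplus>\<^bsub>free (n (Suc i))\<^esub> k i (D i v)"
    using homotopy[of n D \<epsilon> n' D' \<epsilon>' f g,
        OF res res' f f0 fS g g0 gS] by blast
  have "D i (g (Suc i) w) \<in> vecs_in I (n i)" if w: "w \<in> carrier (free (n' (Suc i)))" for i w
    unfolding gS[OF w] by (rule hom_vecs_in[OF I g minimal[OF w]])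
  moreover have "f i (g i w) \<ominus>\<^bsub>free (n' i)\<^esub> w \<in> vecs_in I (n' i)" if w: "w \<in> carrier (free (n' i))" for i w
  proof (cases i)
    case 0
    then show ?thesis using h0[of w] w minimal[OF module_homD(1)[OF h[of 0]], of w] by simp
  next
    case (Suc j)
    have w': "w \<in> carrier (free (n' (Suc j)))" using w Suc by simp
    show ?thesis
      unfolding Suc hS[OF w']
      by (rule vecs_in_add[OF I minimal[OF module_homD(1)[OF h w']] hom_vecs_in[OF I h minimal[OF w']]])
  qed
  moreover have "f i (D i u) \<in> vecs_in I (n' i)" if u: "u \<in> carrier (free (n (Suc i)))" for i u
    unfolding fS[OF u, symmetric] by (rule minimal[OF module_homD(1)[OF f u]])
  \<comment> \<open>Here the homotopy for the composite of \<open>f\<close> followed by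
    \<open>g\<close> enters: modulo \<open>I\<close> both \<open>g (f v)\<close> and the homotopy
    applied to \<open>D v\<close> vanish, so \<open>v\<close> is the boundary of \<open>k v\<close>
    up to sign.\<close>
  moreover have "\<exists>u\<in>carrier (free (n (Suc i))). \<exists>z\<in>vecs_in I (n i). v = D i u \<oplus>\<^bsub>free (n i)\<^esub> z"
    if v: "v \<in> carrier (free (n i))" and fv: "f i v \<in> vecs_in I (n' i)"
      and Dv: "case i of 0 \<Rightarrow> True | Suc j \<Rightarrow> D j v \<in> vecs_in I (n j)" for i v
  proof -
    interpret F: Module.module R "free (n i)" by (rule free_module)
    interpret F': Module.module R "free (n (Suc i))" by (rule free_module)
    have gf: "g i (f i v) \<in> vecs_in I (n i)" by (rule hom_vecs_in[OF I g fv])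
    then have gfc: "g i (f i v) \<in> carrier (free (n i))" by (simp only: vecs_in_def mem_Collect_eq)
    have kv: "k i v \<in> carrier (free (n (Suc i)))" by (rule module_homD(1)[OF k v])
    have "\<exists>y\<in>vecs_in I (n i). g i (f i v) \<ominus>\<^bsub>free (n i)\<^esub> v = D i (k i v) \<oplus>\<^bsub>free (n i)\<^esub> y"
    proof (cases i)
      case 0
      have zero: "\<zero>\<^bsub>free (n i)\<^esub> \<in> vecs_in I (n i)"
        using F.zero_closed I ideal.Icarr additive_subgroup.zero_closed[OF ideal.axioms(1)[OF I]] by (simp add: vecs_in_def)
      have v0: "v \<in> carrier (free (n 0))" using v 0 by (simp only:)
      have "g i (f i v) \<ominus>\<^bsub>free (n i)\<^esub> v = D i (k i v) \<oplus>\<^bsub>free (n i)\<^esub> \<zero>\<^bsub>free (n i)\<^esub>"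
        using k0[OF v0] F.r_zero[OF module_homD(1)[OF homs(1) kv]] 0 by (simp only:)
      then show ?thesis using zero by blast
    next
      case (Suc j)
      have v': "v \<in> carrier (free (n (Suc j)))" using v Suc by (simp only:)
      have "k j (D j v) \<in> vecs_in I (n i)"
        using hom_vecs_in[OF I k] Dv Suc by (simp only: nat.case)
      then show ?thesis using kS[OF v'] Suc by blast
    qed
    then obtain y where y: "y \<in> vecs_in I (n i)" "g i (f i v) \<ominus>\<^bsub>free (n i)\<^esub> v = D i (k i v) \<oplus>\<^bsub>free (n i)\<^esub> y" by blast
    have yc: "y \<in> carrier (free (n i))" using y(1) by (simp only: vecs_in_def mem_Collect_eq)
    have "v = \<ominus>\<^bsub>free (n i)\<^esub> D i (k i v) \<oplus>\<^bsub>free (n i)\<^esub> (g i (f i v) \<ominus>\<^bsub>free (n i)\<^esub> y)"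
      by (rule F.exchange_minus[OF gfc v module_homD(1)[OF homs(1) kv] yc y(2)])
    also have "\<ominus>\<^bsub>free (n i)\<^esub> D i (k i v) = D i (\<ominus>\<^bsub>free (n (Suc i))\<^esub> k i v)"
      by (rule hom_neg[OF free_module free_module homs(1) kv, symmetric])
    finally show ?thesis
      using F'.a_inv_closed[OF kv] vecs_in_minus[OF I gf y(1)] by blast
  qed
  ultimately show ?thesis using f g by blast
qed

end

section \<open>Rational generating functions\<close>

text \<open>Gaussian elimination by one equation at a time: an unknown with nonzero coefficient is
  solved for, at the cost of that unknown.\<close>

lemma homogeneous_system_solution:
  fixes f :: "'i \<Rightarrow> 'c \<Rightarrow> rat"
  assumes "finite S" "finite I" "card S < card I"
  shows "\<exists>c. (\<exists>i\<in>I. c i \<noteq> 0) \<and> (\<forall>x\<in>S. (\<Sum>i\<in>I. c i * f i x) = 0)"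
  using assms
proof (induction S arbitrary: I f)
  case empty
  then have "I \<noteq> {}" by auto
  then show ?case by (intro exI[of _ "\<lambda>_. 1"]) auto
next
  case (insert s S)
  show ?case
  proof (cases "\<exists>p\<in>I. f p s \<noteq> 0")
    case False
    then have z: "\<And>i. i \<in> I \<Longrightarrow> f i s = 0" by blast
    obtain c where "\<exists>i\<in>I. c i \<noteq> 0" "\<forall>x\<in>S. (\<Sum>i\<in>I. c i * f i x) = 0"
      using insert.IH[OF insert.prems(1), of f] insert.prems(2) insert.hyps by auto
    moreover have "(\<Sum>i\<in>I. c i * f i s) = 0" using z by (intro sum.neutral) auto
    ultimately show ?thesis by auto
  next
    case True
    then obtain p where p: "p \<in> I" "f p s \<noteq> 0" by blast
    define f' where "f' i x = f i x - f i s / f p s * f p x" for i x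
    have "card S < card (I - {p})" using insert p by auto
    then obtain c where c: "\<exists>i\<in>I - {p}. c i \<noteq> 0" "\<forall>x\<in>S. (\<Sum>i\<in>I - {p}. c i * f' i x) = 0"
      using insert.IH[of "I - {p}" f'] insert.prems by auto
    define t where "t = - (\<Sum>i\<in>I - {p}. c i * (f i s / f p s))"
    define c' where "c' = c(p := t)"
    have split: "(\<Sum>i\<in>I. c' i * f i x) = (\<Sum>i\<in>I - {p}. c i * f' i x)" for x
    proof -
      have "(\<Sum>i\<in>I. c' i * f i x) = t * f p x + (\<Sum>i\<in>I - {p}. c i * f i x)"
        using p(1) insert.prems(1) by (subst sum.remove[of I p]) (auto simp: c'_def intro!: sum.cong)
      also have "t * f p x = - (\<Sum>i\<in>I - {p}. c i * (f i s / f p s) * f p x)"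
        by (simp add: t_def sum_distrib_right)
      finally show ?thesis by (simp add: f'_def algebra_simps sum_subtractf)
    qed
    have "(\<Sum>i\<in>I - {p}. c i * f' i s) = 0" using p(2) by (intro sum.neutral) (auto simp: f'_def)
    then have "\<forall>x\<in>insert s S. (\<Sum>i\<in>I. c' i * f i x) = 0" using c(2) by (simp add: split)
    moreover have "\<exists>i\<in>I. c' i \<noteq> 0" using c(1) by (auto simp: c'_def)
    ultimately show ?thesis by blast
  qed
qed

text \<open>More than \<open>card S\<close> of the vectors \<open>q i\<close> are linearly dependent, which gives a linear recurrence.\<close>

lemma rational_fps_transfer_matrix:
  fixes q :: "nat \<Rightarrow> 'c \<Rightarrow> rat"
  assumes fin: "finite S" and rec: "\<And>i x. x \<in> S \<Longrightarrow> q (Suc i) x = (\<Sum>y\<in>S. B x y * q i y)"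
    and x: "x \<in> S"
  shows "rational_fps (Abs_fps (\<lambda>i. q i x))"
proof -
  let ?k = "card S"
  obtain c where c: "\<exists>i\<in>{..?k}. c i \<noteq> 0" "\<forall>x\<in>S. (\<Sum>i\<in>{..?k}. c i * q i x) = 0"
    using homogeneous_system_solution[OF fin, of "{..?k}" q] by auto
  \<comment> \<open>The dependence found at index 0 persists at all later indices, because the
    recursion is linear with coefficients that do not depend on \<open>i\<close>.\<close>
  have shift: "(\<Sum>j\<le>?k. c j * q (i + j) x) = 0" if "x \<in> S" for i x
    using that
  proof (induction i arbitrary: x)
    case 0
    then show ?case using c(2) by simp
  next
    case (Suc i)
    have "(\<Sum>j\<le>?k. c j * q (Suc i + j) x) = (\<Sum>j\<le>?k. \<Sum>y\<in>S. B x y * (c j * q (i + j) y))"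
      using rec[OF Suc.prems] by (simp add: sum_distrib_left mult_ac)
    also have "\<dots> = (\<Sum>y\<in>S. B x y * (\<Sum>j\<le>?k. c j * q (i + j) y))"
      by (subst sum.swap) (simp add: sum_distrib_left)
    also have "\<dots> = 0" using Suc.IH by simp
    finally show ?case .
  qed
  \<comment> \<open>The coefficients are reversed: multiplication by \<open>Q\<close> reaches back
    from index \<open>n\<close>, whereas the recurrence reaches forward from
    \<open>n - ?k\<close>.\<close>
  define Q where "Q = (\<Sum>i\<le>?k. monom (c (?k - i)) i)"
  have coeff_Q: "coeff Q i = (if i \<le> ?k then c (?k - i) else 0)" for i
    by (simp add: Q_def coeff_sum)
  have "Q \<noteq> 0"
  proof -
    obtain i where "i \<le> ?k" "c i \<noteq> 0" using c(1) by auto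
    then have "coeff Q (?k - i) \<noteq> 0" by (simp add: coeff_Q)
    then show ?thesis by auto
  qed
  let ?P = "Abs_fps (\<lambda>i. q i x)"
  define p where "p = (\<Sum>i<?k. monom (fps_nth (fps_of_poly Q * ?P) i) i)"
  have "fps_of_poly Q * ?P = fps_of_poly p"
  proof (rule fps_ext)
    fix n
    show "fps_nth (fps_of_poly Q * ?P) n = fps_nth (fps_of_poly p) n"
    proof (cases "n < ?k")
      case True
      then show ?thesis by (simp add: p_def coeff_sum)
    next
      case False
      have "fps_nth (fps_of_poly Q * ?P) n = (\<Sum>i=0..n. coeff Q i * q (n - i) x)"
        by (simp add: fps_mult_nth)
      also have "\<dots> = (\<Sum>i\<in>{..?k}. c (?k - i) * q (n - i) x)"
        using False by (intro sum.mono_neutral_cong_right) (auto simp: coeff_Q)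
      also have "\<dots> = (\<Sum>j\<le>?k. c j * q ((n - ?k) + j) x)"
        using False by (intro sum.reindex_bij_witness[of _ "\<lambda>j. ?k - j" "\<lambda>i. ?k - i"]) auto
      also have "\<dots> = 0" by (rule shift[OF x])
      finally show ?thesis using False by (simp add: p_def coeff_sum)
    qed
  qed
  then show ?thesis unfolding rational_fps_def using \<open>Q \<noteq> 0\<close> by blast
qed

section \<open>Computation of Tor\<close>

text \<open>The bases at hand are indexed families, while dimension is defined by sets. Independence
  of the family includes that its members are distinct, since two equal ones would satisfy a
  relation with coefficients 1 and -1.\<close>

lemma (in vectorspace) dim_family:
  assumes b: "b \<in> {..<g} \<rightarrow> carrier V"
    and span: "\<And>v. v \<in> carrier V \<Longrightarrow> \<exists>c\<in>{..<g::nat} \<rightarrow> carrier K. v = (\<Oplus>\<^bsub>V\<^esub>j\<in>{..<g}. c j \<odot>\<^bsub>V\<^esub> b j)"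
    and indep: "\<And>c j. c \<in> {..<g} \<rightarrow> carrier K \<Longrightarrow> (\<Oplus>\<^bsub>V\<^esub>j\<in>{..<g}. c j \<odot>\<^bsub>V\<^esub> b j) = \<zero>\<^bsub>V\<^esub> \<Longrightarrow> j < g \<Longrightarrow> c j = \<zero>\<^bsub>K\<^esub>"
  shows "fin_dim \<and> dim = g"
proof -
  have inj: "inj_on b {..<g}"
  proof (rule inj_onI, rule ccontr)
    fix i j assume ij: "i \<in> {..<g}" "j \<in> {..<g}" "b i = b j" "i \<noteq> j"
    let ?c = "\<lambda>k. (if i = k then \<one>\<^bsub>K\<^esub> else \<zero>\<^bsub>K\<^esub>) \<ominus>\<^bsub>K\<^esub> (if j = k then \<one>\<^bsub>K\<^esub> else \<zero>\<^bsub>K\<^esub>)"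
    let ?s = "\<lambda>i k. if i = k then b k else \<zero>\<^bsub>V\<^esub>"
    have s: "?s i \<in> {..<g} \<rightarrow> carrier V" for i using b by auto
    have ns: "(\<lambda>k. \<ominus>\<^bsub>V\<^esub> ?s j k) \<in> {..<g} \<rightarrow> carrier V" using b by (auto intro!: M.a_inv_closed)
    have single: "(\<Oplus>\<^bsub>V\<^esub>k\<in>{..<g}. ?s i k) = b i" if "i < g" for i
      using that b by (intro M.add.finprod_singleton) auto
    have neg: "(\<Oplus>\<^bsub>V\<^esub>k\<in>{..<g}. \<ominus>\<^bsub>V\<^esub> ?s j k) = \<ominus>\<^bsub>V\<^esub> b j"
    proof -
      have "(\<Oplus>\<^bsub>V\<^esub>k\<in>{..<g}. ?s j k) \<oplus>\<^bsub>V\<^esub> (\<Oplus>\<^bsub>V\<^esub>k\<in>{..<g}. \<ominus>\<^bsub>V\<^esub> ?s j k) = (\<Oplus>\<^bsub>V\<^esub>k\<in>{..<g}. ?s j k \<oplus>\<^bsub>V\<^esub> \<ominus>\<^bsub>V\<^esub> ?s j k)"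
        by (rule M.finsum_addf[OF s ns, symmetric])
      also have "\<dots> = (\<Oplus>\<^bsub>V\<^esub>k\<in>{..<g}. \<zero>\<^bsub>V\<^esub>)"
        using b by (intro M.finsum_cong') (auto intro!: M.r_neg)
      finally have "b j \<oplus>\<^bsub>V\<^esub> (\<Oplus>\<^bsub>V\<^esub>k\<in>{..<g}. \<ominus>\<^bsub>V\<^esub> ?s j k) = \<zero>\<^bsub>V\<^esub>" using single ij by simp
      moreover have "b j \<in> carrier V" "(\<Oplus>\<^bsub>V\<^esub>k\<in>{..<g}. \<ominus>\<^bsub>V\<^esub> ?s j k) \<in> carrier V"
        using b ij M.finsum_closed[OF ns] by auto
      ultimately show ?thesis by (metis M.a_comm M.minus_equality M.minus_minus)
    qed
    have "(\<Oplus>\<^bsub>V\<^esub>k\<in>{..<g}. ?c k \<odot>\<^bsub>V\<^esub> b k) = (\<Oplus>\<^bsub>V\<^esub>k\<in>{..<g}. ?s i k \<oplus>\<^bsub>V\<^esub> \<ominus>\<^bsub>V\<^esub> ?s j k)"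
      using b ij(4) by (intro M.finsum_cong') (auto simp: R.minus_eq smult_l_minus Pi_iff)
    also have "\<dots> = b i \<oplus>\<^bsub>V\<^esub> \<ominus>\<^bsub>V\<^esub> b j" using M.finsum_addf[OF s ns] single ij neg by simp
    also have "\<dots> = \<zero>\<^bsub>V\<^esub>" using ij b M.r_neg by auto
    finally have "?c i = \<zero>\<^bsub>K\<^esub>" using indep[of ?c i] ij by auto
    then show False using ij(4) by (auto simp: R.minus_eq)
  qed
  let ?B = "b ` {..<g}"
  have B: "finite ?B" "?B \<subseteq> carrier V" "card ?B = g" using b inj by (auto simp: card_image)
  have lc: "lincomb a ?B = (\<Oplus>\<^bsub>V\<^esub>j\<in>{..<g}. a (b j) \<odot>\<^bsub>V\<^esub> b j)" if "a \<in> ?B \<rightarrow> carrier K" for a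
    unfolding lincomb_def using that b inj by (subst M.finsum_reindex) auto
  have "gen_set ?B"
  proof
    show "span ?B \<subseteq> carrier V" by (rule span_is_subset2[OF B(2)])
    show "carrier V \<subseteq> span ?B"
    proof
      fix v assume "v \<in> carrier V"
      then obtain c where c: "c \<in> {..<g} \<rightarrow> carrier K" "v = (\<Oplus>\<^bsub>V\<^esub>j\<in>{..<g}. c j \<odot>\<^bsub>V\<^esub> b j)" using span by blast
      let ?a = "\<lambda>w. c (the_inv_into {..<g} b w)"
      have a: "?a \<in> ?B \<rightarrow> carrier K" using c(1) inj by (auto simp: the_inv_into_f_f)
      have "lincomb ?a ?B = (\<Oplus>\<^bsub>V\<^esub>j\<in>{..<g}. c j \<odot>\<^bsub>V\<^esub> b j)"
        unfolding lc[OF a] using b c(1) inj by (intro M.finsum_cong') (auto simp: the_inv_into_f_f)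
      then have "v = lincomb ?a ?B" using c(2) by simp
      then show "v \<in> span ?B" unfolding finite_span[OF B(1,2)] using a by blast
    qed
  qed
  moreover have "lin_indpt ?B"
  proof (rule finite_lin_indpt2[OF B(1,2)])
    fix a assume a: "a \<in> ?B \<rightarrow> carrier K" "lincomb a ?B = \<zero>\<^bsub>V\<^esub>"
    then have "(\<Oplus>\<^bsub>V\<^esub>j\<in>{..<g}. a (b j) \<odot>\<^bsub>V\<^esub> b j) = \<zero>\<^bsub>V\<^esub>" using lc by simp
    moreover have "(\<lambda>j. a (b j)) \<in> {..<g} \<rightarrow> carrier K" using a by auto
    ultimately show "\<forall>v\<in>?B. a v = \<zero>\<^bsub>K\<^esub>" using indep by blast
  qed
  ultimately have "basis ?B" using B by (auto simp: basis_def)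
  then show ?thesis using B dim_basis[OF B(1)] by (auto simp: fin_dim_def basis_def)
qed

context cring
begin

section \<open>Submodules, quotients and restriction of scalars\<close>

lemma hom_submodules:
  fixes M :: "('a, 'm) module" and N :: "('a, 'n) module"
  assumes M: "Module.module R M" and N: "Module.module R N" and f: "f \<in> module_hom R M N"
  shows "Module.submodule {v \<in> carrier M. f v = \<zero>\<^bsub>N\<^esub>} R M"
    and "Module.submodule (f ` carrier M) R N"
proof -
  interpret M: Module.module R M by fact
  interpret N: Module.module R N by fact
  note H = module_homD[OF f] hom_zero[OF M N f] hom_neg[OF M N f]
  show "Module.submodule {v \<in> carrier M. f v = \<zero>\<^bsub>N\<^esub>} R M"
    by (rule M.submoduleI) (auto simp: H)
  show "Module.submodule (f ` carrier M) R N"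
  proof (rule N.submoduleI)
    show "f ` carrier M \<subseteq> carrier N" using H(1) by blast
    show "\<zero>\<^bsub>N\<^esub> \<in> f ` carrier M" using H(4) M.zero_closed by (metis image_eqI)
    fix x assume "x \<in> f ` carrier M"
    then obtain v where v: "v \<in> carrier M" "x = f v" by blast
    show "\<ominus>\<^bsub>N\<^esub> x \<in> f ` carrier M" using v H(5) M.a_inv_closed by (metis image_eqI)
    show "a \<odot>\<^bsub>N\<^esub> x \<in> f ` carrier M" if "a \<in> carrier R" for a
      using v H(3) M.smult_closed that by (metis image_eqI)
    fix y assume "y \<in> f ` carrier M"
    then obtain w where w: "w \<in> carrier M" "y = f w" by blast
    show "x \<oplus>\<^bsub>N\<^esub> y \<in> f ` carrier M" using v w H(2) M.a_closed by (metis image_eqI)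
  qed
qed

lemma coset_eq_iff:
  fixes P :: "('a, 'm) module"
  assumes "Module.module R P" "Module.submodule B R P" "x \<in> carrier P" "y \<in> carrier P"
  shows "B +>\<^bsub>P\<^esub> x = B +>\<^bsub>P\<^esub> y \<longleftrightarrow> x \<ominus>\<^bsub>P\<^esub> y \<in> B"
proof -
  interpret P: Module.module R P by fact
  interpret B: abelian_subgroup B P
    using assms(2) by (intro abelian_subgroupI3 additive_subgroupI P.abelian_group_axioms Module.submodule.axioms(1))
  have "x \<in> B +>\<^bsub>P\<^esub> y \<longleftrightarrow> x \<ominus>\<^bsub>P\<^esub> y \<in> B"
    using B.a_rcos_module[OF assms(4,3)] by (simp add: a_minus_def)
  moreover have "x \<in> B +>\<^bsub>P\<^esub> y \<longleftrightarrow> B +>\<^bsub>P\<^esub> x = B +>\<^bsub>P\<^esub> y"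
    using B.a_rcos_self[OF assms(3)] B.a_repr_independence'[of x y] assms(4) by metis
  ultimately show ?thesis by blast
qed

context
  fixes P :: "('a, 'm) module" and Z B
  assumes P: "Module.module R P" and Z: "Module.submodule Z R P" and B: "Module.submodule B R P" and BZ: "B \<subseteq> Z"
begin

interpretation P: Module.module R P by (rule P)

interpretation B: abelian_subgroup B P
  using B by (intro abelian_subgroupI3 additive_subgroupI P.abelian_group_axioms Module.submodule.axioms(1))

abbreviation "cls z \<equiv> B +>\<^bsub>P\<^esub> z"

lemma Z_sub: "z \<in> Z \<Longrightarrow> z \<in> carrier P"
  using P.submoduleE(1)[OF Z] by auto

lemma quot_carrier: "carrier (quot_module P Z B) = cls ` Z"
  by (auto simp: quot_module_def)

lemma quot_add: "x \<in> Z \<Longrightarrow> y \<in> Z \<Longrightarrow> cls x \<oplus>\<^bsub>quot_module P Z B\<^esub> cls y = cls (x \<oplus>\<^bsub>P\<^esub> y)"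
  using B.a_rcos_sum Z_sub by (simp add: quot_module_def)

text \<open>The scalar multiple of a coset is a union over all representatives; they all give the
  same coset because \<open>B\<close> is a submodule.\<close>

lemma quot_smult:
  assumes a: "a \<in> carrier R" and x: "x \<in> Z"
  shows "a \<odot>\<^bsub>quot_module P Z B\<^esub> cls x = cls (a \<odot>\<^bsub>P\<^esub> x)"
proof -
  have "cls (a \<odot>\<^bsub>P\<^esub> y) = cls (a \<odot>\<^bsub>P\<^esub> x)" if y: "y \<in> cls x" for y
  proof -
    have yP: "y \<in> carrier P" using B.a_elemrcos_carrier[OF Z_sub[OF x] y] .
    have "y \<ominus>\<^bsub>P\<^esub> x \<in> B"
      using B.a_rcos_module[OF Z_sub[OF x] yP] y by (simp add: a_minus_def)
    then have "a \<odot>\<^bsub>P\<^esub> (y \<ominus>\<^bsub>P\<^esub> x) \<in> B" using P.submoduleE(4)[OF B a] by blast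
    moreover have "a \<odot>\<^bsub>P\<^esub> (y \<ominus>\<^bsub>P\<^esub> x) = a \<odot>\<^bsub>P\<^esub> y \<ominus>\<^bsub>P\<^esub> a \<odot>\<^bsub>P\<^esub> x"
      using a yP Z_sub[OF x] by (simp add: a_minus_def P.smult_r_distr P.smult_r_minus)
    ultimately show ?thesis using coset_eq_iff[OF P B] a yP Z_sub[OF x] by simp
  qed
  moreover have "x \<in> cls x" by (rule B.a_rcos_self[OF Z_sub[OF x]])
  ultimately have "(\<Union>y\<in>cls x. cls (a \<odot>\<^bsub>P\<^esub> y)) = cls (a \<odot>\<^bsub>P\<^esub> x)" by blast
  then show ?thesis by (simp add: quot_module_def)
qed

lemma quot_zero: "\<zero>\<^bsub>quot_module P Z B\<^esub> = cls \<zero>\<^bsub>P\<^esub>"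
  using P.a_coset_add_zero[OF B.a_subset] by (simp add: quot_module_def)

lemma quot_module: "Module.module R (quot_module P Z B)"
proof (rule Module.moduleI)
  let ?Q = "quot_module P Z B"
  note E = P.submoduleE[OF Z]
  have zero: "\<zero>\<^bsub>P\<^esub> \<in> Z" using BZ B.zero_closed by blast
  show "cring R" by (rule is_cring)
  show "abelian_group ?Q"
  proof (rule abelian_groupI)
    fix X Y assume "X \<in> carrier ?Q" "Y \<in> carrier ?Q"
    then obtain x y where xy: "x \<in> Z" "X = cls x" "y \<in> Z" "Y = cls y" by (auto simp: quot_carrier)
    show "X \<oplus>\<^bsub>?Q\<^esub> Y \<in> carrier ?Q" using xy E(5) by (auto simp: quot_add quot_carrier)
    show "X \<oplus>\<^bsub>?Q\<^esub> Y = Y \<oplus>\<^bsub>?Q\<^esub> X" using xy Z_sub by (simp add: quot_add P.a_comm)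
    fix W assume "W \<in> carrier ?Q"
    then obtain w where w: "w \<in> Z" "W = cls w" by (auto simp: quot_carrier)
    show "X \<oplus>\<^bsub>?Q\<^esub> Y \<oplus>\<^bsub>?Q\<^esub> W = X \<oplus>\<^bsub>?Q\<^esub> (Y \<oplus>\<^bsub>?Q\<^esub> W)"
      using xy w Z_sub E(5) by (simp add: quot_add P.a_assoc)
  next
    show "\<zero>\<^bsub>?Q\<^esub> \<in> carrier ?Q" using zero by (auto simp: quot_zero quot_carrier)
  next
    fix X assume "X \<in> carrier ?Q"
    then obtain x where x: "x \<in> Z" "X = cls x" by (auto simp: quot_carrier)
    show "\<zero>\<^bsub>?Q\<^esub> \<oplus>\<^bsub>?Q\<^esub> X = X" using x zero Z_sub by (simp add: quot_zero quot_add)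
    have "cls (\<ominus>\<^bsub>P\<^esub> x) \<oplus>\<^bsub>?Q\<^esub> X = \<zero>\<^bsub>?Q\<^esub>"
      using x E(3) Z_sub by (simp add: quot_zero quot_add P.l_neg)
    then show "\<exists>Y\<in>carrier ?Q. Y \<oplus>\<^bsub>?Q\<^esub> X = \<zero>\<^bsub>?Q\<^esub>" using x E(3) by (auto simp: quot_carrier)
  qed
next
  let ?Q = "quot_module P Z B"
  note E = P.submoduleE[OF Z]
  fix X assume "X \<in> carrier ?Q"
  then obtain x where x: "x \<in> Z" "X = cls x" by (auto simp: quot_carrier)
  show "\<one> \<odot>\<^bsub>?Q\<^esub> X = X" using x Z_sub by (simp add: quot_smult)
  fix a assume a: "a \<in> carrier R"
  show "a \<odot>\<^bsub>?Q\<^esub> X \<in> carrier ?Q" using a x E(4) by (auto simp: quot_smult quot_carrier)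
  {
    fix b assume b: "b \<in> carrier R"
    show "(a \<oplus> b) \<odot>\<^bsub>?Q\<^esub> X = a \<odot>\<^bsub>?Q\<^esub> X \<oplus>\<^bsub>?Q\<^esub> b \<odot>\<^bsub>?Q\<^esub> X"
      using a b x Z_sub E(4) by (simp add: quot_smult quot_add P.smult_l_distr)
    show "(a \<otimes> b) \<odot>\<^bsub>?Q\<^esub> X = a \<odot>\<^bsub>?Q\<^esub> (b \<odot>\<^bsub>?Q\<^esub> X)"
      using a b x Z_sub E(4) by (simp add: quot_smult P.smult_assoc1)
  next
    fix Y assume "Y \<in> carrier ?Q"
    then obtain y where y: "y \<in> Z" "Y = cls y" by (auto simp: quot_carrier)
    show "a \<odot>\<^bsub>?Q\<^esub> (X \<oplus>\<^bsub>?Q\<^esub> Y) = a \<odot>\<^bsub>?Q\<^esub> X \<oplus>\<^bsub>?Q\<^esub> a \<odot>\<^bsub>?Q\<^esub> Y"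
      using a x y Z_sub E(4,5) by (simp add: quot_smult quot_add P.smult_r_distr)
  }
qed

end

lemma restrict_scalars:
  fixes Q :: "('a, 'm) module"
  assumes Q: "Module.module R Q" and k: "subfield k R"
  shows "vectorspace (R\<lparr>carrier := k\<rparr>) Q"
proof -
  interpret Q: Module.module R Q by fact
  have field: "field (R\<lparr>carrier := k\<rparr>)" by (rule subfield_iff(2)[OF k])
  interpret F: field "R\<lparr>carrier := k\<rparr>" by (rule field)
  have sub: "k \<subseteq> carrier R" using subdomainE(1)[OF subfield.axioms(1)[OF k]] .
  have "Module.module (R\<lparr>carrier := k\<rparr>) Q"
    by (rule Module.moduleI[OF F.is_cring Q.abelian_group_axioms])
       (use sub in \<open>auto simp: Q.smult_l_distr Q.smult_r_distr Q.smult_assoc1 subset_eq\<close>)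
  then show ?thesis using field by (intro vectorspace.intro)
qed

section \<open>Reduction modulo an ideal\<close>

context
  fixes \<mm>
  assumes I: "ideal \<mm> R"
begin

interpretation I: ideal \<mm> R by (rule I)

interpretation Q: cring "R Quot \<mm>" by (rule I.quotient_is_cring[OF is_cring])

lemma residue_module_simps:
  "carrier (residue_module R \<mm>) = carrier (R Quot \<mm>)"
  "zero (residue_module R \<mm>) = zero (R Quot \<mm>)"
  "add (residue_module R \<mm>) = add (R Quot \<mm>)"
  "module.smult (residue_module R \<mm>) a A = (\<mm> +> a) \<otimes>\<^bsub>R Quot \<mm>\<^esub> A"
  by (simp_all add: residue_module_def)

lemma residue_class: "a \<in> carrier R \<Longrightarrow> \<mm> +> a \<in> carrier (R Quot \<mm>)"
  using ring_hom_closed[OF I.rcos_ring_hom] .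

lemma residue_carrierE:
  assumes "A \<in> carrier (R Quot \<mm>)"
  obtains a where "a \<in> carrier R" "A = \<mm> +> a"
  using assms by (auto simp: FactRing_def A_RCOSETS_def')

lemma residue_module: "Module.module R (residue_module R \<mm>)"
proof (rule Module.moduleI)
  show "abelian_group (residue_module R \<mm>)"
    by (rule abelian_groupI)
       (auto simp: residue_module_simps Q.a_ac intro: Q.l_neg bexI[of _ "\<ominus>\<^bsub>R Quot \<mm>\<^esub> _"])
qed (auto simp: residue_module_simps is_cring residue_class Q.r_distr Q.l_distr Q.m_assoc
    ring_hom_add[OF I.rcos_ring_hom] ring_hom_mult[OF I.rcos_ring_hom] ring_hom_one[OF I.rcos_ring_hom])

lemma residue_hom: "(+>) \<mm> \<in> module_hom R (regular_module R) (residue_module R \<mm>)"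
  by (rule module_homI)
     (auto simp: residue_module_simps residue_class ring_hom_add[OF I.rcos_ring_hom] ring_hom_mult[OF I.rcos_ring_hom])

lemma residue_eq_zero: "a \<in> carrier R \<Longrightarrow> \<mm> +> a = \<zero>\<^bsub>residue_module R \<mm>\<^esub> \<longleftrightarrow> a \<in> \<mm>"
  using I.a_rcos_const I.a_rcos_self[of a] by (auto simp: residue_module_simps FactRing_def)

abbreviation "kk \<equiv> residue_module R \<mm>"

definition reduce :: "nat \<Rightarrow> (nat \<Rightarrow> 'a) \<Rightarrow> nat \<Rightarrow> 'a set" where
  "reduce n v = (\<lambda>i\<in>{..<n}. \<mm> +> v i)"

lemma reduce_hom: "reduce n \<in> module_hom R (free n) (pow_module kk n)"
proof (rule module_homI)
  note H = module_homD[OF residue_hom, unfolded regular_module_simps]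
  fix u v a assume u: "u \<in> carrier (free n)"
  show "reduce n u \<in> carrier (pow_module kk n)" using u H(1) by (auto simp: reduce_def PiE_iff)
  show "a \<in> carrier R \<Longrightarrow> reduce n (a \<odot>\<^bsub>free n\<^esub> u) = a \<odot>\<^bsub>pow_module kk n\<^esub> reduce n u"
    using u H(3) by (auto simp: reduce_def PiE_iff intro!: ext)
  assume "v \<in> carrier (free n)"
  then show "reduce n (u \<oplus>\<^bsub>free n\<^esub> v) = reduce n u \<oplus>\<^bsub>pow_module kk n\<^esub> reduce n v"
    using u H(2) by (auto simp: reduce_def PiE_iff intro!: ext)
qed

lemma reduce_surj:
  assumes "z \<in> carrier (pow_module kk n)"
  shows "\<exists>v\<in>carrier (free n). z = reduce n v"
proof -
  have "\<exists>a\<in>carrier R. z i = \<mm> +> a" if "i < n" for i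
  proof -
    have "z i \<in> carrier (R Quot \<mm>)" using assms that by (auto simp: residue_module_simps PiE_iff)
    then show ?thesis by (rule residue_carrierE) blast
  qed
  then obtain w where w: "\<And>i. i < n \<Longrightarrow> w i \<in> carrier R" "\<And>i. i < n \<Longrightarrow> z i = \<mm> +> w i" by metis
  have "z = reduce n (restrict w {..<n})"
    using assms w by (intro ext) (auto simp: reduce_def PiE_iff extensional_def)
  moreover have "restrict w {..<n} \<in> carrier (free n)" using w by auto
  ultimately show ?thesis by blast
qed

lemma reduce_eq_zero:
  assumes "v \<in> carrier (free n)"
  shows "reduce n v = \<zero>\<^bsub>pow_module kk n\<^esub> \<longleftrightarrow> v \<in> vecs_in \<mm> n"
proof -
  have "reduce n v = \<zero>\<^bsub>pow_module kk n\<^esub> \<longleftrightarrow> (\<forall>i<n. \<mm> +> v i = \<zero>\<^bsub>kk\<^esub>)"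
    by (auto simp: reduce_def restrict_def fun_eq_iff)
  then show ?thesis using assms residue_eq_zero by (auto simp: vecs_in_def PiE_iff)
qed

lemma mat_map_reduce:
  assumes A: "\<And>i j. i < k \<Longrightarrow> j < l \<Longrightarrow> A i j \<in> carrier R" and v: "v \<in> carrier (free l)"
  shows "mat_map kk k l A (reduce l v) = reduce k (mat_map (regular_module R) k l A v)"
proof (rule ext)
  fix i
  interpret N: Module.module R kk by (rule residue_module)
  have "(\<Oplus>\<^bsub>kk\<^esub>j\<in>{..<l}. A i j \<odot>\<^bsub>kk\<^esub> reduce l v j) = \<mm> +> (\<Oplus>j\<in>{..<l}. A i j \<otimes> v j)" if i: "i < k"
  proof -
    have c: "(\<lambda>j. A i j \<otimes> v j) \<in> {..<l} \<rightarrow> carrier (regular_module R)" using A[OF i] v by (auto simp: PiE_iff)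
    have "\<mm> +> (\<Oplus>j\<in>{..<l}. A i j \<otimes> v j) = (\<Oplus>\<^bsub>kk\<^esub>j\<in>{..<l}. \<mm> +> (A i j \<otimes> v j))"
      using hom_finsum[OF regular_module residue_module residue_hom _ c] by simp
    also have "\<dots> = (\<Oplus>\<^bsub>kk\<^esub>j\<in>{..<l}. A i j \<odot>\<^bsub>kk\<^esub> reduce l v j)"
      using A[OF i] v module_homD(1,3)[OF residue_hom]
      by (intro N.finsum_cong') (auto simp: reduce_def PiE_iff)
    finally show ?thesis ..
  qed
  then show "mat_map kk k l A (reduce l v) i = reduce k (mat_map (regular_module R) k l A v) i"
    by (simp add: mat_map_def reduce_def)
qed

text \<open>The classes of \<open>g\<close> applied to the unit vectors form a basis of Tor: modulo
  \<open>\<mm>\<close>, \<open>f\<close> is inverse to \<open>g\<close> up to boundaries, and since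
  \<open>R\<close> is the sum of \<open>k\<close> and \<open>\<mm>\<close>, coefficients can be
  taken in \<open>k\<close>. Hence the dimension is a rank of the minimal resolution, whichever
  resolution was given.\<close>

lemma tor_dim:
  assumes k: "subfield k R" and split: "\<And>r. r \<in> carrier R \<Longrightarrow> \<exists>c\<in>k. r \<ominus> c \<in> \<mm>" and triv: "k \<inter> \<mm> = {\<zero>}"
    and res: "free_resolution R kk n d \<epsilon>"
    and res': "resolves kk n' D' \<epsilon>'"
    and minimal: "\<And>i v. v \<in> carrier (free (n' (Suc i))) \<Longrightarrow> D' i v \<in> vecs_in \<mm> (n' i)"
  shows "vectorspace.fin_dim (R\<lparr>carrier := k\<rparr>) (tor kk n d i) \<and>
         vectorspace.dim (R\<lparr>carrier := k\<rparr>) (tor kk n d i) = n' i"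
proof -
  define D where "D i = mat_map (regular_module R) (n i) (n (Suc i)) (d i)" for i
  have dc: "d i a b \<in> carrier R" if "a < n i" "b < n (Suc i)" for i a b
    using res that unfolding free_resolution_iff by blast
  have resD: "resolves kk n D \<epsilon>" using res unfolding free_resolution_iff D_def by blast
  have Dhom: "D i \<in> module_hom R (free (n (Suc i))) (free (n i))" for i
    using resD by (simp add: resolves_def)
  obtain f g where
    f: "f i \<in> module_hom R (free (n i)) (free (n' i))" and
    g: "g i \<in> module_hom R (free (n' i)) (free (n i))" and
    T1: "\<And>w. w \<in> carrier (free (n' (Suc i))) \<Longrightarrow> D i (g (Suc i) w) \<in> vecs_in \<mm> (n i)" and
    T2: "\<And>w. w \<in> carrier (free (n' i)) \<Longrightarrow> f i (g i w) \<ominus>\<^bsub>free (n' i)\<^esub> w \<in> vecs_in \<mm> (n' i)" and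
    T3: "\<And>u. u \<in> carrier (free (n (Suc i))) \<Longrightarrow> f i (D i u) \<in> vecs_in \<mm> (n' i)" and
    T4: "\<And>v. v \<in> carrier (free (n i)) \<Longrightarrow> f i v \<in> vecs_in \<mm> (n' i) \<Longrightarrow>
        (case i of 0 \<Rightarrow> True | Suc j \<Rightarrow> D j v \<in> vecs_in \<mm> (n j)) \<Longrightarrow>
        \<exists>u\<in>carrier (free (n (Suc i))). \<exists>z\<in>vecs_in \<mm> (n i). v = D i u \<oplus>\<^bsub>free (n i)\<^esub> z"
    for i
    using minimal_comparison[OF residue_module I resD res' minimal] by blast
  interpret F: Module.module R "free (n i)" by (rule free_module)
  interpret F': Module.module R "free (n' i)" by (rule free_module)
  let ?P = "pow_module kk (n i)"
  have P: "Module.module R ?P" by (rule pow_module[OF residue_module])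
  interpret P: Module.module R ?P by (rule P)
  define ZR where "ZR = {v \<in> carrier (free (n i)). case i of 0 \<Rightarrow> True | Suc j \<Rightarrow> D j v \<in> vecs_in \<mm> (n j)}"
  define Z where "Z = tor_cycles kk n d i"
  define B where "B = tor_boundaries kk n d i"
  have mm: "mat_map kk (n i) (n (Suc i)) (d i) (reduce (n (Suc i)) v) = reduce (n i) (D i v)"
    if "v \<in> carrier (free (n (Suc i)))" for i v
    unfolding D_def by (rule mat_map_reduce[OF dc that])
  have red: "reduce (n i) v \<in> carrier ?P" if "v \<in> carrier (free (n i))" for v
    by (rule module_homD(1)[OF reduce_hom that])
  have ZRZ: "reduce (n i) v \<in> Z \<longleftrightarrow> v \<in> ZR" if v: "v \<in> carrier (free (n i))" for v
  proof (cases i)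
    case 0
    then show ?thesis using red[OF v] v by (simp add: Z_def ZR_def tor_cycles_def)
  next
    case (Suc j)
    have v': "v \<in> carrier (free (n (Suc j)))" using v Suc by simp
    have "reduce (n (Suc j)) v \<in> carrier (pow_module kk (n (Suc j)))" using red[OF v] Suc by simp
    then show ?thesis
      unfolding Z_def ZR_def tor_cycles_def Suc nat.case
      using mm[OF v'] reduce_eq_zero[OF module_homD(1)[OF Dhom v']] v' by auto
  qed
  have Zc: "Z \<subseteq> carrier ?P" by (cases i) (auto simp: Z_def tor_cycles_def)
  have Zred: "\<exists>v\<in>ZR. z = reduce (n i) v" if z: "z \<in> Z" for z
  proof -
    obtain v where "v \<in> carrier (free (n i))" "z = reduce (n i) v" using reduce_surj[of z "n i"] Zc z by blast
    then show ?thesis using ZRZ z by blast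
  qed
  have Zsub: "Module.submodule Z R ?P"
  proof (cases i)
    case 0
    then show ?thesis using P.carrier_is_submodule by (simp add: Z_def tor_cycles_def)
  next
    case (Suc j)
    have h: "mat_map kk (n j) (n (Suc j)) (d j) \<in> module_hom R (pow_module kk (n (Suc j))) (pow_module kk (n j))"
      using dc by (intro mat_map_hom[OF residue_module]) auto
    show ?thesis
      using hom_submodules(1)[OF pow_module[OF residue_module] pow_module[OF residue_module] h]
      unfolding Z_def tor_cycles_def Suc nat.case .
  qed
  have Bsub: "Module.submodule B R ?P"
  proof -
    have h: "mat_map kk (n i) (n (Suc i)) (d i) \<in> module_hom R (pow_module kk (n (Suc i))) (pow_module kk (n i))"
      using dc by (intro mat_map_hom[OF residue_module]) auto
    show ?thesis unfolding B_def tor_boundaries_def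
      by (rule hom_submodules(2)[OF pow_module[OF residue_module] pow_module[OF residue_module] h])
  qed
  have Bred: "z \<in> B \<longleftrightarrow> (\<exists>u\<in>carrier (free (n (Suc i))). z = reduce (n i) (D i u))" for z
  proof
    assume "z \<in> B"
    then obtain y where y: "y \<in> carrier (pow_module kk (n (Suc i)))" "z = mat_map kk (n i) (n (Suc i)) (d i) y"
      unfolding B_def tor_boundaries_def by blast
    obtain u where "u \<in> carrier (free (n (Suc i)))" "y = reduce (n (Suc i)) u" using reduce_surj[OF y(1)] by blast
    then show "\<exists>u\<in>carrier (free (n (Suc i))). z = reduce (n i) (D i u)" using y(2) mm by blast
  next
    assume "\<exists>u\<in>carrier (free (n (Suc i))). z = reduce (n i) (D i u)"
    then obtain u where u: "u \<in> carrier (free (n (Suc i)))" "z = reduce (n i) (D i u)" by blast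
    then show "z \<in> B" unfolding B_def tor_boundaries_def
      using mm[OF u(1)] module_homD(1)[OF reduce_hom u(1)] by (metis image_eqI)
  qed
  have boundary: "D i u \<in> ZR" if u: "u \<in> carrier (free (n (Suc i)))" for u
  proof (cases i)
    case 0
    then show ?thesis using module_homD(1)[OF Dhom u] by (simp add: ZR_def)
  next
    case (Suc j)
    have u': "u \<in> carrier (free (n (Suc (Suc j))))" using u Suc by simp
    have "D j (D (Suc j) u) = \<zero>\<^bsub>free (n j)\<^esub>"
      using res_zero(2)[OF residue_module resD resD u'] .
    then have "D j (D i u) \<in> vecs_in \<mm> (n j)" unfolding Suc by (auto simp: vecs_in_def)
    then show ?thesis using module_homD(1)[OF Dhom u] by (simp add: ZR_def Suc)
  qed
  have BZ: "B \<subseteq> Z" using Bred boundary ZRZ module_homD(1)[OF Dhom] by (metis subsetI)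
  have tor: "tor kk n d i = quot_module ?P Z B" by (simp add: tor_def Z_def B_def)
  let ?V = "tor kk n d i"
  have V: "Module.module R ?V" unfolding tor by (rule quot_module[OF P Zsub Bsub BZ])
  interpret V: vectorspace "R\<lparr>carrier := k\<rparr>" ?V by (rule restrict_scalars[OF V k])
  have ksub: "k \<subseteq> carrier R" using subdomainE(1)[OF subfield.axioms(1)[OF k]] .
  have gZ: "g i w \<in> ZR" if w: "w \<in> carrier (free (n' i))" for w
    using module_homD(1)[OF g w] T1 w unfolding ZR_def by (cases i) auto
  define T where "T w = B +>\<^bsub>?P\<^esub> reduce (n i) (g i w)" for w
  have T: "T \<in> module_hom R (free (n' i)) ?V"
  proof (rule module_homI)
    have z: "reduce (n i) (g i w) \<in> Z" if "w \<in> carrier (free (n' i))" for w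
      using ZRZ[OF module_homD(1)[OF g that]] gZ[OF that] by blast
    fix w w' a assume w: "w \<in> carrier (free (n' i))"
    show "T w \<in> carrier ?V" unfolding tor quot_carrier[OF P Zsub Bsub BZ] T_def using z[OF w] by blast
    show "T (a \<odot>\<^bsub>free (n' i)\<^esub> w) = a \<odot>\<^bsub>?V\<^esub> T w" if a: "a \<in> carrier R"
      unfolding T_def tor quot_smult[OF P Zsub Bsub BZ a z[OF w]]
        module_homD(3)[OF g a w] module_homD(3)[OF reduce_hom a module_homD(1)[OF g w]] ..
    assume w': "w' \<in> carrier (free (n' i))"
    show "T (w \<oplus>\<^bsub>free (n' i)\<^esub> w') = T w \<oplus>\<^bsub>?V\<^esub> T w'"
      unfolding T_def tor quot_add[OF P Zsub Bsub BZ z[OF w] z[OF w']]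
        module_homD(2)[OF g w w'] module_homD(2)[OF reduce_hom module_homD(1)[OF g w] module_homD(1)[OF g w']] ..
  qed
  define b where "b j = T (unit_vec (n' i) j)" for j
  have bV: "b \<in> {..<n' i} \<rightarrow> carrier ?V" unfolding b_def using module_homD(1)[OF T] by simp
  have comb: "(\<Oplus>\<^bsub>?V\<^esub>j\<in>{..<n' i}. c j \<odot>\<^bsub>?V\<^esub> b j) = T (restrict c {..<n' i})"
    "restrict c {..<n' i} \<in> carrier (free (n' i))" if c: "c \<in> {..<n' i} \<rightarrow> k" for c
  proof -
    interpret VR: Module.module R ?V by (rule V)
    show rc: "restrict c {..<n' i} \<in> carrier (free (n' i))" using c ksub by auto
    show "(\<Oplus>\<^bsub>?V\<^esub>j\<in>{..<n' i}. c j \<odot>\<^bsub>?V\<^esub> b j) = T (restrict c {..<n' i})"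
      unfolding hom_eq_lincomb[OF V T rc] lincomb_hom_def b_def
      using c ksub module_homD(1)[OF T] by (intro V.M.finsum_cong') auto
  qed
  have zero_iff: "B +>\<^bsub>?P\<^esub> reduce (n i) v = B +>\<^bsub>?P\<^esub> reduce (n i) v' \<longleftrightarrow> reduce (n i) (v \<ominus>\<^bsub>free (n i)\<^esub> v') \<in> B"
    if "v \<in> carrier (free (n i))" "v' \<in> carrier (free (n i))" for v v'
    using coset_eq_iff[OF P Bsub red red] hom_minus[OF free_module P reduce_hom] that by simp
  show ?thesis
  proof (rule V.dim_family[OF bV])
    fix x assume "x \<in> carrier ?V"
    then obtain z where "z \<in> Z" "x = B +>\<^bsub>?P\<^esub> z" unfolding tor quot_carrier[OF P Zsub Bsub BZ] by blast
    then obtain v where v: "v \<in> ZR" "x = B +>\<^bsub>?P\<^esub> reduce (n i) v" using Zred by blast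
    have vc: "v \<in> carrier (free (n i))" using v(1) by (simp add: ZR_def)
    \<comment> \<open>The coefficients of the class of \<open>v\<close> are the entries of
      \<open>f v\<close>, each replaced by a congruent scalar from \<open>k\<close>.\<close>
    let ?w = "f i v"
    have w: "?w \<in> carrier (free (n' i))" by (rule module_homD(1)[OF f vc])
    have "\<exists>c\<in>k. ?w j \<ominus> c \<in> \<mm>" if "j < n' i" for j using split[of "?w j"] w that by (auto simp: PiE_iff)
    then obtain c where c: "\<And>j. j < n' i \<Longrightarrow> c j \<in> k" "\<And>j. j < n' i \<Longrightarrow> ?w j \<ominus> c j \<in> \<mm>" by metis
    have ck: "c \<in> {..<n' i} \<rightarrow> k" using c by auto
    let ?c = "restrict c {..<n' i}"
    note cc = comb(2)[OF ck]
    have gc: "g i ?c \<in> carrier (free (n i))" by (rule module_homD(1)[OF g cc])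
    have fgc: "f i (g i ?c) \<in> carrier (free (n' i))" by (rule module_homD(1)[OF f gc])
    have wc: "?w \<ominus>\<^bsub>free (n' i)\<^esub> ?c \<in> vecs_in \<mm> (n' i)"
    proof -
      have "(?w \<ominus>\<^bsub>free (n' i)\<^esub> ?c) j \<in> \<mm>" if "j < n' i" for j
        using pow_minus[OF regular_module w cc that] c(2)[OF that] that by simp
      then show ?thesis using F'.minus_closed[OF w cc] by (simp add: vecs_in_def)
    qed
    let ?y = "v \<ominus>\<^bsub>free (n i)\<^esub> g i ?c"
    have y: "?y \<in> carrier (free (n i))" by (rule F.minus_closed[OF vc gc])
    have "f i ?y = (?w \<ominus>\<^bsub>free (n' i)\<^esub> ?c) \<ominus>\<^bsub>free (n' i)\<^esub> (f i (g i ?c) \<ominus>\<^bsub>free (n' i)\<^esub> ?c)"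
    proof -
      have "f i ?y = ?w \<ominus>\<^bsub>free (n' i)\<^esub> f i (g i ?c)" by (rule hom_minus[OF free_module free_module f vc gc])
      also have "\<dots> = (?w \<ominus>\<^bsub>free (n' i)\<^esub> ?c) \<ominus>\<^bsub>free (n' i)\<^esub> (f i (g i ?c) \<ominus>\<^bsub>free (n' i)\<^esub> ?c)"
      proof (rule pow_eqI[of _ "n' i" "carrier R"])
        fix j assume j: "j < n' i"
        have cs: "?w j \<in> carrier R" "?c j \<in> carrier R" "f i (g i ?c) j \<in> carrier R"
          using w cc fgc j by (auto simp only: pow_module_simps regular_module_simps PiE_iff lessThan_iff)
        have sub: "a \<ominus> b = (a \<ominus> x) \<ominus> (b \<ominus> x)" if "a \<in> carrier R" "b \<in> carrier R" "x \<in> carrier R" for a b x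
          using that by algebra
        show "(?w \<ominus>\<^bsub>free (n' i)\<^esub> f i (g i ?c)) j =
            ((?w \<ominus>\<^bsub>free (n' i)\<^esub> ?c) \<ominus>\<^bsub>free (n' i)\<^esub> (f i (g i ?c) \<ominus>\<^bsub>free (n' i)\<^esub> ?c)) j"
          by (simp only: pow_minus[OF regular_module w fgc j] pow_minus[OF regular_module w cc j]
              pow_minus[OF regular_module fgc cc j] regular_module_simps
              pow_minus[OF regular_module F'.minus_closed[OF w cc] F'.minus_closed[OF fgc cc] j])
             (rule sub[OF cs(1,3,2)])
      qed (use F'.minus_closed w cc fgc in \<open>simp_all only: pow_module_simps regular_module_simps\<close>)
      finally show ?thesis .
    qed
    then have fy: "f i ?y \<in> vecs_in \<mm> (n' i)" using vecs_in_minus[OF I wc T2[OF cc]] by simp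
    have "case i of 0 \<Rightarrow> True | Suc j \<Rightarrow> D j ?y \<in> vecs_in \<mm> (n j)"
    proof (cases i)
      case (Suc j)
      have vg: "D j v \<in> vecs_in \<mm> (n j)" "D j (g i ?c) \<in> vecs_in \<mm> (n j)"
        using v(1) gZ[OF cc] Suc by (simp_all add: ZR_def)
      have "D j ?y = D j v \<ominus>\<^bsub>free (n j)\<^esub> D j (g i ?c)"
        using hom_minus[OF free_module free_module Dhom[of j]] vc gc unfolding Suc by blast
      then show ?thesis using vecs_in_minus[OF I vg] Suc by simp
    qed simp
    from T4[OF y fy this] obtain u z where u: "u \<in> carrier (free (n (Suc i)))" and z: "z \<in> vecs_in \<mm> (n i)"
      and yuz: "?y = D i u \<oplus>\<^bsub>free (n i)\<^esub> z" by blast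
    have zc: "z \<in> carrier (free (n i))" using z by (simp add: vecs_in_def)
    have Du: "D i u \<in> carrier (free (n i))" by (rule module_homD(1)[OF Dhom u])
    have "reduce (n i) ?y = reduce (n i) (D i u)"
      unfolding yuz module_homD(2)[OF reduce_hom Du zc] reduce_eq_zero[OF zc, THEN iffD2, OF z]
      by (rule P.r_zero[OF red[OF Du]])
    then have "reduce (n i) ?y \<in> B" using Bred u by blast
    then have "x = T ?c" using zero_iff[OF vc gc] v(2) by (simp add: T_def)
    then show "\<exists>c\<in>{..<n' i} \<rightarrow> carrier (R\<lparr>carrier := k\<rparr>). x = (\<Oplus>\<^bsub>?V\<^esub>j\<in>{..<n' i}. c j \<odot>\<^bsub>?V\<^esub> b j)"
      using comb(1)[OF ck] ck by (intro bexI[of _ c]) simp_all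
  next
    fix c j assume "c \<in> {..<n' i} \<rightarrow> carrier (R\<lparr>carrier := k\<rparr>)"
      and zero: "(\<Oplus>\<^bsub>?V\<^esub>j\<in>{..<n' i}. c j \<odot>\<^bsub>?V\<^esub> b j) = \<zero>\<^bsub>?V\<^esub>" and j: "j < n' i"
    then have ck: "c \<in> {..<n' i} \<rightarrow> k" by simp
    let ?c = "restrict c {..<n' i}"
    note cc = comb(2)[OF ck]
    have gc: "g i ?c \<in> carrier (free (n i))" by (rule module_homD(1)[OF g cc])
    have fgc: "f i (g i ?c) \<in> carrier (free (n' i))" by (rule module_homD(1)[OF f gc])
    have zr: "reduce (n i) \<zero>\<^bsub>free (n i)\<^esub> = \<zero>\<^bsub>?P\<^esub>" by (rule hom_zero[OF free_module P reduce_hom])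
    have "T ?c = B +>\<^bsub>?P\<^esub> \<zero>\<^bsub>?P\<^esub>" using zero comb(1)[OF ck] quot_zero[OF P Zsub Bsub BZ] tor by simp
    then have "B +>\<^bsub>?P\<^esub> reduce (n i) (g i ?c) = B +>\<^bsub>?P\<^esub> reduce (n i) \<zero>\<^bsub>free (n i)\<^esub>"
      unfolding T_def zr .
    then have "reduce (n i) (g i ?c \<ominus>\<^bsub>free (n i)\<^esub> \<zero>\<^bsub>free (n i)\<^esub>) \<in> B"
      by (rule zero_iff[OF gc F.zero_closed, THEN iffD1])
    moreover have "g i ?c \<ominus>\<^bsub>free (n i)\<^esub> \<zero>\<^bsub>free (n i)\<^esub> = g i ?c"
      using F.minus_equality[OF F.l_zero[OF F.zero_closed] F.zero_closed F.zero_closed] F.r_zero[OF gc]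
      by (simp only: a_minus_def)
    ultimately obtain u where u: "u \<in> carrier (free (n (Suc i)))" "reduce (n i) (g i ?c) = reduce (n i) (D i u)"
      using Bred by auto
    have Du: "D i u \<in> carrier (free (n i))" by (rule module_homD(1)[OF Dhom u(1)])
    have "reduce (n i) (g i ?c \<ominus>\<^bsub>free (n i)\<^esub> D i u) = \<zero>\<^bsub>?P\<^esub>"
      unfolding hom_minus[OF free_module P reduce_hom gc Du] u(2) using P.r_neg[OF red[OF Du]] by (simp only: a_minus_def)
    then have "g i ?c \<ominus>\<^bsub>free (n i)\<^esub> D i u \<in> vecs_in \<mm> (n i)"
      using reduce_eq_zero[OF F.minus_closed[OF gc Du]] by blast
    then have "f i (g i ?c \<ominus>\<^bsub>free (n i)\<^esub> D i u) \<in> vecs_in \<mm> (n' i)" by (rule hom_vecs_in[OF I f])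
    then have 1: "f i (g i ?c) \<ominus>\<^bsub>free (n' i)\<^esub> f i (D i u) \<in> vecs_in \<mm> (n' i)"
      unfolding hom_minus[OF free_module free_module f gc Du] .
    have entry: "w j \<in> \<mm>" if "w \<in> vecs_in \<mm> (n' i)" for w using that j by (simp add: vecs_in_def)
    have j1: "f i (g i ?c) j \<ominus> f i (D i u) j \<in> \<mm>"
      using entry[OF 1] unfolding pow_minus[OF regular_module fgc module_homD(1)[OF f Du] j] regular_module_simps .
    have j2: "f i (D i u) j \<in> \<mm>" using T3[OF u(1)] j by (simp add: vecs_in_def)
    have j3: "f i (g i ?c) j \<ominus> c j \<in> \<mm>"
      using entry[OF T2[OF cc]] j unfolding pow_minus[OF regular_module fgc cc j] by simp
    have cs: "f i (g i ?c) j \<in> carrier R" "f i (D i u) j \<in> carrier R" "c j \<in> carrier R"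
      using fgc module_homD(1)[OF f Du] cc j ck ksub by (auto simp: PiE_iff)
    have "c j = (f i (g i ?c) j \<ominus> f i (D i u) j) \<oplus> f i (D i u) j \<ominus> (f i (g i ?c) j \<ominus> c j)"
      using cs by algebra
    moreover have "\<dots> \<in> \<mm>" unfolding a_minus_def[of R "_ \<oplus> _"] using I.a_closed I.a_inv_closed j1 j2 j3 by blast
    ultimately have "c j \<in> \<mm>" by simp
    then have "c j = \<zero>" using triv ck j by auto
    then show "c j = \<zero>\<^bsub>R\<lparr>carrier := k\<rparr>\<^esub>" by simp
  qed
qed

end

end

section \<open>Resolutions from Koszul filtrations\<close>

lemma sum_list_eq_sum_count_list:
  fixes f :: "'c \<Rightarrow> 'd :: semiring_1"
  assumes "finite S" "set xs \<subseteq> S"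
  shows "(\<Sum>x\<leftarrow>xs. f x) = (\<Sum>x\<in>S. of_nat (count_list xs x) * f x)"
  using assms(2)
proof (induction xs)
  case (Cons y xs)
  have "(\<Sum>x\<in>S. of_nat (count_list (y # xs) x) * f x) =
      (\<Sum>x\<in>S. of_nat (count_list xs x) * f x + (if x = y then f y else 0))"
    by (intro sum.cong) (auto simp: algebra_simps)
  also have "\<dots> = (\<Sum>x\<in>S. of_nat (count_list xs x) * f x) + f y"
    using Cons.prems assms(1) by (simp add: sum.distrib)
  finally show ?case using Cons by (simp add: add.commute)
qed simp

section \<open>Homogeneous components in a standard graded algebra\<close>

locale graded_ring = cring R for R :: "('a, 'b) ring_scheme" (structure) +
  fixes gr :: "nat \<Rightarrow> 'a set"
  assumes graded: "standard_graded R gr"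
begin

lemma gr_subgroup: "additive_subgroup (gr i) R"
  using graded by (simp add: standard_graded_def)

lemma gr_carrier: "a \<in> gr i \<Longrightarrow> a \<in> carrier R"
  using additive_subgroup.a_subset[OF gr_subgroup] by blast

lemma gr_closed:
  "\<zero> \<in> gr i" "a \<in> gr i \<Longrightarrow> b \<in> gr i \<Longrightarrow> a \<oplus> b \<in> gr i" "a \<in> gr i \<Longrightarrow> \<ominus> a \<in> gr i"
  "a \<in> gr i \<Longrightarrow> b \<in> gr j \<Longrightarrow> a \<otimes> b \<in> gr (i + j)"
  using additive_subgroup.zero_closed[OF gr_subgroup] additive_subgroup.a_closed[OF gr_subgroup]
    additive_subgroup.a_inv_closed[OF gr_subgroup] graded
  by (simp_all add: standard_graded_def)

definition decomposes :: "'a \<Rightarrow> (nat \<Rightarrow> 'a) \<Rightarrow> bool" where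
  "decomposes r f \<longleftrightarrow> (\<forall>i. f i \<in> gr i) \<and> finite {i. f i \<noteq> \<zero>} \<and> r = (\<Oplus>i\<in>{i. f i \<noteq> \<zero>}. f i)"

lemma decomposes_unique: "r \<in> carrier R \<Longrightarrow> \<exists>!f. decomposes r f"
  using graded unfolding standard_graded_def decomposes_def by blast

definition comp :: "'a \<Rightarrow> nat \<Rightarrow> 'a" where
  "comp r = (THE f. decomposes r f)"

lemma decomposes_comp: "r \<in> carrier R \<Longrightarrow> decomposes r (comp r)"
  unfolding comp_def by (rule theI'[OF decomposes_unique])

lemma finsum_support:
  assumes "finite A" "\<And>i. f i \<in> carrier R" "\<And>i. i \<notin> A \<Longrightarrow> f i = \<zero>"
  shows "(\<Oplus>i\<in>{i. f i \<noteq> \<zero>}. f i) = (\<Oplus>i\<in>A. f i)"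
  using assms by (intro add.finprod_mono_neutral_cong_left) auto

lemma comp_eqI:
  assumes A: "finite A" and f: "\<And>i. f i \<in> gr i" and z: "\<And>i. i \<notin> A \<Longrightarrow> f i = \<zero>" and r: "r = (\<Oplus>i\<in>A. f i)"
  shows "comp r = f"
proof -
  have fc: "\<And>i. f i \<in> carrier R" using f gr_carrier by blast
  then have "r \<in> carrier R" unfolding r by (intro finsum_closed) auto
  moreover have "decomposes r f"
    unfolding decomposes_def using f finsum_support[OF A fc z] r finite_subset[OF _ A, of "{i. f i \<noteq> \<zero>}"] z by auto
  ultimately show ?thesis using decomposes_unique decomposes_comp by blast
qed

lemma comp_gr: "r \<in> carrier R \<Longrightarrow> comp r i \<in> gr i"
  using decomposes_comp by (simp add: decomposes_def)

lemma comp_carrier: "r \<in> carrier R \<Longrightarrow> comp r i \<in> carrier R"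
  using comp_gr gr_carrier by blast

lemma comp_sum:
  assumes "r \<in> carrier R"
  obtains A where "finite A" "\<And>i. i \<notin> A \<Longrightarrow> comp r i = \<zero>" "r = (\<Oplus>i\<in>A. comp r i)"
  using decomposes_comp[OF assms] unfolding decomposes_def by blast

lemma comp_add:
  assumes "r \<in> carrier R" "s \<in> carrier R"
  shows "comp (r \<oplus> s) i = comp r i \<oplus> comp s i"
proof -
  obtain A where A: "finite A" "\<And>i. i \<notin> A \<Longrightarrow> comp r i = \<zero>" "r = (\<Oplus>i\<in>A. comp r i)" using comp_sum[OF assms(1)] by metis
  obtain B where B: "finite B" "\<And>i. i \<notin> B \<Longrightarrow> comp s i = \<zero>" "s = (\<Oplus>i\<in>B. comp s i)" using comp_sum[OF assms(2)] by metis
  note c = comp_carrier[OF assms(1)] comp_carrier[OF assms(2)]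
  have ext: "(\<Oplus>i\<in>A. f i) = (\<Oplus>i\<in>A \<union> B. f i)" "(\<Oplus>i\<in>B. g i) = (\<Oplus>i\<in>A \<union> B. g i)"
    if "\<And>i. f i \<in> carrier R" "\<And>i. i \<notin> A \<Longrightarrow> f i = \<zero>" "\<And>i. g i \<in> carrier R" "\<And>i. i \<notin> B \<Longrightarrow> g i = \<zero>" for f g
    using A(1) B(1) that by (auto intro!: add.finprod_mono_neutral_cong_left)
  have "comp (r \<oplus> s) = (\<lambda>i. comp r i \<oplus> comp s i)"
  proof (rule comp_eqI[of "A \<union> B"])
    show "r \<oplus> s = (\<Oplus>i\<in>A \<union> B. comp r i \<oplus> comp s i)"
      using A(3) B(3) ext[of "comp r" "comp s"] A(2) B(2) c finsum_addf[of "comp r" "A \<union> B" "comp s"] by auto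
  qed (use A B gr_closed(2) comp_gr[OF assms(1)] comp_gr[OF assms(2)] in auto)
  then show ?thesis by simp
qed

lemma comp_homogeneous:
  assumes "r \<in> gr i"
  shows "comp r j = (if j = i then r else \<zero>)"
proof -
  have "comp r = (\<lambda>j. if j = i then r else \<zero>)"
    using assms gr_closed(1) gr_carrier[OF assms] by (intro comp_eqI[of "{i}"]) auto
  then show ?thesis by simp
qed

lemma comp_zero: "comp \<zero> i = \<zero>"
  using comp_homogeneous[OF gr_closed(1), of i i] by simp

lemma comp_neg:
  assumes "r \<in> carrier R"
  shows "comp (\<ominus> r) i = \<ominus> comp r i"
proof -
  have "comp (\<ominus> r) i \<oplus> comp r i = \<zero>"
    using comp_add[of "\<ominus> r" r i] assms by (simp add: l_neg comp_zero)
  then show ?thesis using minus_equality[of "comp (\<ominus> r) i" "comp r i"] comp_carrier assms by simp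
qed

lemma comp_finsum:
  assumes "finite A" "f \<in> A \<rightarrow> carrier R"
  shows "comp (\<Oplus>j\<in>A. f j) i = (\<Oplus>j\<in>A. comp (f j) i)"
  using assms
proof (induction A)
  case (insert j A)
  then have "f \<in> A \<rightarrow> carrier R" "f j \<in> carrier R" by auto
  moreover from this have "(\<lambda>j. comp (f j) i) \<in> A \<rightarrow> carrier R" "comp (f j) i \<in> carrier R"
    using comp_carrier by auto
  ultimately show ?case using insert by (simp add: comp_add)
qed (simp add: comp_zero)

lemma comp_mult_linear:
  assumes a: "a \<in> gr 1" and r: "r \<in> carrier R"
  shows "comp (a \<otimes> r) (Suc i) = a \<otimes> comp r i"
proof -
  obtain A where A: "finite A" "\<And>i. i \<notin> A \<Longrightarrow> comp r i = \<zero>" "r = (\<Oplus>i\<in>A. comp r i)" using comp_sum[OF r] by metis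
  note ac = gr_carrier[OF a] and rc = comp_carrier[OF r]
  let ?f = "\<lambda>i. case i of 0 \<Rightarrow> \<zero> | Suc i \<Rightarrow> a \<otimes> comp r i"
  have "comp (a \<otimes> r) = ?f"
  proof (rule comp_eqI[of "Suc ` A"])
    show "finite (Suc ` A)" using A(1) by simp
    show "?f i \<in> gr i" for i using gr_closed(1) gr_closed(4)[OF a comp_gr[OF r]] by (cases i) auto
    show "?f i = \<zero>" if "i \<notin> Suc ` A" for i
    proof (cases i)
      case (Suc j)
      then have "j \<notin> A" using that by blast
      then show ?thesis using A(2)[of j] ac Suc by simp
    qed simp
    have "a \<otimes> r = (\<Oplus>i\<in>A. a \<otimes> comp r i)"
      using finsum_rdistr[OF A(1) ac, of "comp r"] rc A(3) by auto
    also have "\<dots> = (\<Oplus>i\<in>Suc ` A. ?f i)" using ac rc by (subst finsum_reindex) auto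
    finally show "a \<otimes> r = (\<Oplus>i\<in>Suc ` A. ?f i)" .
  qed
  then show ?thesis by simp
qed

text \<open>Turns a generated additive subgroup into a condition on the component of degree 0, the
  form in which membership is tested below.\<close>

lemma irrelevant_ideal_eq: "irrelevant_ideal R gr = {r \<in> carrier R. comp r 0 = \<zero>}"
proof
  have "subgroup {r \<in> carrier R. comp r 0 = \<zero>} (add_monoid R)"
    by (rule add.subgroupI) (auto simp: comp_add comp_neg comp_zero intro!: exI[of _ "\<zero>"])
  moreover have "(\<Union>i\<in>{1..}. gr i) \<subseteq> {r \<in> carrier R. comp r 0 = \<zero>}"
    using comp_homogeneous gr_carrier by auto
  ultimately show "irrelevant_ideal R gr \<subseteq> {r \<in> carrier R. comp r 0 = \<zero>}"
    unfolding irrelevant_ideal_def by (intro add.generate_subgroup_incl)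
next
  have sub: "subgroup (irrelevant_ideal R gr) (add_monoid R)"
    unfolding irrelevant_ideal_def using gr_carrier by (intro add.generate_is_subgroup) auto
  have fs: "(\<Oplus>i\<in>A. f i) \<in> irrelevant_ideal R gr"
    if "finite A" "\<And>i. i \<in> A \<Longrightarrow> f i \<in> irrelevant_ideal R gr" for A :: "nat set" and f
    using that
  proof (induction A)
    case empty
    then show ?case using subgroup.one_closed[OF sub] by simp
  next
    case (insert i A)
    then have "f \<in> A \<rightarrow> carrier R" "f i \<in> carrier R" using subgroup.subset[OF sub] by auto
    then show ?case using insert subgroup.m_closed[OF sub, of "f i" "finsum R f A"] by simp
  qed
  show "{r \<in> carrier R. comp r 0 = \<zero>} \<subseteq> irrelevant_ideal R gr"
  proof
    fix r assume r: "r \<in> {r \<in> carrier R. comp r 0 = \<zero>}"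
    then have rc: "r \<in> carrier R" by simp
    obtain A where A: "finite A" "r = (\<Oplus>i\<in>A. comp r i)" using comp_sum[OF rc] by metis
    have "comp r i \<in> irrelevant_ideal R gr" for i
    proof (cases i)
      case 0
      then show ?thesis using r subgroup.one_closed[OF sub] by simp
    next
      case (Suc k)
      then have "comp r i \<in> (\<Union>i\<in>{1..}. gr i)" using comp_gr[OF rc] by auto
      then show ?thesis unfolding irrelevant_ideal_def by (rule generate.incl)
    qed
    then show "r \<in> irrelevant_ideal R gr" using fs[OF A(1), of "comp r"] A(2) by simp
  qed
qed

lemma gr_1_irrelevant: "gr 1 \<subseteq> irrelevant_ideal R gr"
  unfolding irrelevant_ideal_eq using comp_homogeneous gr_carrier by auto

section \<open>Linear matrices and labelled syzygy modules\<close>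

definition linear_vec :: "nat \<Rightarrow> (nat \<Rightarrow> 'a) \<Rightarrow> bool" where
  "linear_vec n v \<longleftrightarrow> v \<in> {..<n} \<rightarrow>\<^sub>E gr 1"

definition linear_mat :: "nat \<Rightarrow> nat \<Rightarrow> (nat \<Rightarrow> nat \<Rightarrow> 'a) \<Rightarrow> bool" where
  "linear_mat n l A \<longleftrightarrow> (\<forall>i<n. \<forall>j<l. A i j \<in> gr 1)"

abbreviation mat :: "nat \<Rightarrow> nat \<Rightarrow> (nat \<Rightarrow> nat \<Rightarrow> 'a) \<Rightarrow> (nat \<Rightarrow> 'a) \<Rightarrow> nat \<Rightarrow> 'a" where
  "mat \<equiv> mat_map (regular_module R)"

lemma linear_vec_carrier: "linear_vec n v \<Longrightarrow> v \<in> carrier (free n)"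
  using gr_carrier by (auto simp: linear_vec_def PiE_iff)

lemma linear_vec_ext: "linear_vec n v \<Longrightarrow> a \<in> gr 1 \<Longrightarrow> linear_vec (Suc n) (v(n := a))"
  unfolding linear_vec_def lessThan_Suc by (rule PiE_fun_upd)

lemma linear_mat_carrier: "linear_mat n l A \<Longrightarrow> i < n \<Longrightarrow> j < l \<Longrightarrow> A i j \<in> carrier R"
  using gr_carrier by (auto simp: linear_mat_def)

lemma linear_mat_hom: "linear_mat n l A \<Longrightarrow> mat n l A \<in> module_hom R (free l) (free n)"
  by (rule mat_map_hom[OF regular_module]) (simp add: linear_mat_carrier)

lemma mat_nth: "i < n \<Longrightarrow> mat n l A v i = (\<Oplus>j\<in>{..<l}. A i j \<otimes> v j)"
  by (simp add: mat_map_def)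

text \<open>As the matrix has linear entries, the degree 2 component of the image involves only the
  degree 1 part of \<open>u\<close>, which is therefore a preimage already. This is what keeps
  syzygies linear.\<close>

lemma linear_preimage:
  assumes A: "linear_mat n l A" and u: "u \<in> carrier (free l)" and v: "\<And>i. i < n \<Longrightarrow> mat n l A u i \<in> gr 2"
  obtains w where "linear_vec l w" "mat n l A w = mat n l A u"
proof
  let ?w = "\<lambda>j\<in>{..<l}. comp (u j) 1"
  have uc: "u j \<in> carrier R" if "j < l" for j using u that by auto
  show w: "linear_vec l ?w" using comp_gr uc by (auto simp: linear_vec_def)
  show "mat n l A ?w = mat n l A u"
  proof (rule pow_eqI[of _ n "carrier R"])
    show "mat n l A ?w \<in> {..<n} \<rightarrow>\<^sub>E carrier R" "mat n l A u \<in> {..<n} \<rightarrow>\<^sub>E carrier R"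
      using module_homD(1)[OF linear_mat_hom[OF A] linear_vec_carrier[OF w]]
        module_homD(1)[OF linear_mat_hom[OF A] u] by simp_all
    fix i assume i: "i < n"
    have Ai: "A i j \<in> gr 1" if "j < l" for j using A i that by (simp add: linear_mat_def)
    have "mat n l A u i = comp (mat n l A u i) 2" using comp_homogeneous[OF v[OF i], of 2] by simp
    also have "\<dots> = (\<Oplus>j\<in>{..<l}. comp (A i j \<otimes> u j) 2)"
      unfolding mat_nth[OF i] using m_closed[OF gr_carrier[OF Ai] uc] by (intro comp_finsum) auto
    also have "\<dots> = (\<Oplus>j\<in>{..<l}. A i j \<otimes> ?w j)"
    proof (rule finsum_cong')
      show "(\<lambda>j. A i j \<otimes> ?w j) \<in> {..<l} \<rightarrow> carrier R"
        using m_closed[OF gr_carrier[OF Ai] comp_carrier[OF uc]] by simp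
      show "comp (A i j \<otimes> u j) 2 = A i j \<otimes> ?w j" if "j \<in> {..<l}" for j
        using comp_mult_linear[OF Ai uc, of j j 1] that by (simp add: numeral_2_eq_2)
    qed simp
    finally show "mat n l A ?w i = mat n l A u i" unfolding mat_nth[OF i] ..
  qed
qed

text \<open>Coordinates are ordered by their index: the leading coordinate of a vector is the nonzero
  one of largest index. The entry \<open>ls ! k\<close> bounds the ideal of leading coefficients at
  position \<open>k\<close>, and its linear elements lift to linear vectors.\<close>

definition labelled :: "'a set list \<Rightarrow> (nat \<Rightarrow> 'a) set \<Rightarrow> bool" where
  "labelled ls T \<longleftrightarrow>
     Module.submodule T R (free (length ls)) \<and>
     (\<forall>k<length ls.
        (\<forall>v\<in>T. (\<forall>i. k < i \<longrightarrow> i < length ls \<longrightarrow> v i = \<zero>) \<longrightarrow> v k \<in> ls ! k) \<and>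
        (\<forall>a\<in>gr 1 \<inter> ls ! k. \<exists>v\<in>T. linear_vec (length ls) v \<and>
           (\<forall>i. k < i \<longrightarrow> i < length ls \<longrightarrow> v i = \<zero>) \<and> v k = a))"

definition presented :: "nat \<Rightarrow> (nat \<Rightarrow> 'a) set \<Rightarrow> 'a set list \<Rightarrow> (nat \<Rightarrow> nat \<Rightarrow> 'a) \<Rightarrow> bool" where
  "presented n S ls A \<longleftrightarrow>
     linear_mat n (length ls) A \<and> mat n (length ls) A ` carrier (free (length ls)) = S \<and>
     labelled ls {w \<in> carrier (free (length ls)). mat n (length ls) A w = \<zero>\<^bsub>free n\<^esub>}"

lemma presented_zero: "presented n {\<zero>\<^bsub>free n\<^esub>} [] A"
proof -
  interpret F: Module.module R "free 0" by (rule free_module)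
  have z: "mat n 0 A w = \<zero>\<^bsub>free n\<^esub>" for w by (auto simp: mat_map_def)
  have "{w \<in> carrier (free 0). mat n 0 A w = \<zero>\<^bsub>free n\<^esub>} = carrier (free 0)" by (simp only: z simp_thms Collect_mem_eq)
  moreover have "mat n 0 A ` carrier (free 0) = {\<zero>\<^bsub>free n\<^esub>}" unfolding z using F.zero_closed by (rule image_constant)
  ultimately show ?thesis
    unfolding presented_def labelled_def linear_mat_def list.size using F.carrier_is_submodule by simp
qed

text \<open>The new column comes last, so its coefficient leads every syzygy involving it, and the
  possible coefficients are the \<open>r\<close> with \<open>r v\<close> in \<open>S\<close>. For a
  linear \<open>a\<close> among them, \<open>a v\<close> is quadratic and in the image of the old
  columns, so \<open>linear_preimage\<close> provides linear remaining coordinates. Syzygies not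
  involving the new column are the old ones.\<close>

lemma presented_add_column:
  assumes S: "presented n S ls A" and v: "linear_vec n v"
  shows "\<exists>A'. presented n {s \<oplus>\<^bsub>free n\<^esub> r \<odot>\<^bsub>free n\<^esub> v |s r. s \<in> S \<and> r \<in> carrier R}
           (ls @ [{r \<in> carrier R. r \<odot>\<^bsub>free n\<^esub> v \<in> S}]) A'"
proof
  let ?l = "length ls"
  let ?A = "\<lambda>i j. if j = ?l then v i else A i j"
  let ?C = "{r \<in> carrier R. r \<odot>\<^bsub>free n\<^esub> v \<in> S}"
  let ?S = "{s \<oplus>\<^bsub>free n\<^esub> r \<odot>\<^bsub>free n\<^esub> v |s r. s \<in> S \<and> r \<in> carrier R}"
  let ?K = "{w \<in> carrier (free (Suc ?l)). mat n (Suc ?l) ?A w = \<zero>\<^bsub>free n\<^esub>}"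
  interpret F: Module.module R "free n" by (rule free_module)
  have A: "linear_mat n ?l A" and im: "mat n ?l A ` carrier (free ?l) = S"
    and lab: "labelled ls {w \<in> carrier (free ?l). mat n ?l A w = \<zero>\<^bsub>free n\<^esub>}"
    using S by (simp_all add: presented_def)
  note vc = linear_vec_carrier[OF v]
  note hom = linear_mat_hom[OF A]
  have A': "linear_mat n (Suc ?l) ?A"
    using A v by (auto simp: linear_mat_def linear_vec_def)
  note hom' = linear_mat_hom[OF A']
  have ext: "w(?l := r) \<in> carrier (free (Suc ?l))" "restrict (w(?l := r)) {..<?l} = w"
    if w: "w \<in> carrier (free ?l)" and r: "r \<in> carrier R" for w r
  proof -
    have w': "w \<in> {..<?l} \<rightarrow>\<^sub>E carrier R" using w by simp
    show "w(?l := r) \<in> carrier (free (Suc ?l))"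
      using PiE_fun_upd[OF r w'] by (simp add: lessThan_Suc)
    show "restrict (w(?l := r)) {..<?l} = w"
      by (rule pow_eqI[OF _ w']) (use w' in \<open>simp_all add: restrict_PiE_iff PiE_mem\<close>)
  qed
  have res: "restrict u {..<?l} \<in> carrier (free ?l)" "u ?l \<in> carrier R" if u: "u \<in> carrier (free (Suc ?l))" for u
  proof -
    have "u j \<in> carrier R" if "j < Suc ?l" for j using u PiE_mem[of u "{..<Suc ?l}" "\<lambda>_. carrier R" j] that by simp
    then show "restrict u {..<?l} \<in> carrier (free ?l)" "u ?l \<in> carrier R" by (simp_all add: restrict_PiE_iff)
  qed
  have mat': "mat n (Suc ?l) ?A u = mat n ?l A (restrict u {..<?l}) \<oplus>\<^bsub>free n\<^esub> u ?l \<odot>\<^bsub>free n\<^esub> v"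
    if u: "u \<in> carrier (free (Suc ?l))" for u
  proof (rule pow_eqI[of _ n "carrier R"])
    show "mat n (Suc ?l) ?A u \<in> {..<n} \<rightarrow>\<^sub>E carrier R" using module_homD(1)[OF hom' u] by simp
    show "mat n ?l A (restrict u {..<?l}) \<oplus>\<^bsub>free n\<^esub> u ?l \<odot>\<^bsub>free n\<^esub> v \<in> {..<n} \<rightarrow>\<^sub>E carrier R"
      using F.a_closed[OF module_homD(1)[OF hom res(1)[OF u]] F.smult_closed[OF res(2)[OF u] vc]] by simp
    fix i assume i: "i < n"
    have Ac: "A i j \<otimes> u j \<in> carrier R" if "j < ?l" for j
      using linear_mat_carrier[OF A i that] PiE_mem[of "restrict u {..<?l}" "{..<?l}" "\<lambda>_. carrier R" j] res(1)[OF u] that by simp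
    have vi: "v i \<in> carrier R" using vc i PiE_mem[of v "{..<n}" "\<lambda>_. carrier R" i] by simp
    have eq: "(\<Oplus>j\<in>{..<?l}. ?A i j \<otimes> u j) = (\<Oplus>j\<in>{..<?l}. A i j \<otimes> restrict u {..<?l} j)"
      using Ac by (intro finsum_cong') auto
    have "mat n (Suc ?l) ?A u i = v i \<otimes> u ?l \<oplus> (\<Oplus>j\<in>{..<?l}. ?A i j \<otimes> u j)"
      unfolding mat_nth[OF i] lessThan_Suc using Ac vi res(2)[OF u] by (subst finsum_insert) auto
    also have "\<dots> = (mat n ?l A (restrict u {..<?l}) \<oplus>\<^bsub>free n\<^esub> u ?l \<odot>\<^bsub>free n\<^esub> v) i"
      unfolding eq
      using i vi res(2)[OF u] finsum_closed[of "\<lambda>j. A i j \<otimes> restrict u {..<?l} j" "{..<?l}"] Ac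
      by (simp add: mat_nth[OF i] a_comm m_comm Pi_iff)
    finally show "mat n (Suc ?l) ?A u i = (mat n ?l A (restrict u {..<?l}) \<oplus>\<^bsub>free n\<^esub> u ?l \<odot>\<^bsub>free n\<^esub> v) i" .
  qed
  have Ssub: "Module.submodule S R (free n)"
    using hom_submodules(2)[OF free_module free_module hom] unfolding im .
  note SE = F.submoduleE[OF Ssub]
  have im': "mat n (Suc ?l) ?A ` carrier (free (Suc ?l)) = ?S"
  proof
    show "mat n (Suc ?l) ?A ` carrier (free (Suc ?l)) \<subseteq> ?S"
      using mat' res im by blast
    show "?S \<subseteq> mat n (Suc ?l) ?A ` carrier (free (Suc ?l))"
    proof
      fix x assume "x \<in> ?S"
      then obtain w r where w: "w \<in> carrier (free ?l)" and r: "r \<in> carrier R"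
        and x: "x = mat n ?l A w \<oplus>\<^bsub>free n\<^esub> r \<odot>\<^bsub>free n\<^esub> v" using im by blast
      have "mat n (Suc ?l) ?A (w(?l := r)) = x"
        unfolding mat'[OF ext(1)[OF w r]] ext(2)[OF w r] x by simp
      then show "x \<in> mat n (Suc ?l) ?A ` carrier (free (Suc ?l))" using ext(1)[OF w r] by blast
    qed
  qed
  have "labelled (ls @ [?C]) ?K"
    unfolding labelled_def length_append_singleton
  proof (intro conjI allI impI)
    show "Module.submodule ?K R (free (Suc ?l))" by (rule hom_submodules(1)[OF free_module free_module hom'])
    have tail: "restrict u {..<?l} \<in> {w \<in> carrier (free ?l). mat n ?l A w = \<zero>\<^bsub>free n\<^esub>}"
      if u: "u \<in> ?K" "u ?l = \<zero>" for u
    proof -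
      have uc: "u \<in> carrier (free (Suc ?l))" using u by blast
      have "\<zero>\<^bsub>free n\<^esub> = mat n (Suc ?l) ?A u" using u(1) by (simp only: mem_Collect_eq)
      also have "\<dots> = mat n ?l A (restrict u {..<?l})"
        unfolding mat'[OF uc] u(2) F.smult_l_null[OF vc] by (rule F.r_zero[OF module_homD(1)[OF hom res(1)[OF uc]]])
      finally show ?thesis using res(1)[OF uc] by (simp only: mem_Collect_eq simp_thms)
    qed
    fix k assume k: "k < Suc ?l"
    show "\<forall>u\<in>?K. (\<forall>i. k < i \<longrightarrow> i < Suc ?l \<longrightarrow> u i = \<zero>) \<longrightarrow> u k \<in> (ls @ [?C]) ! k"
    proof (intro ballI impI)
      fix u assume u: "u \<in> ?K" and z: "\<forall>i. k < i \<longrightarrow> i < Suc ?l \<longrightarrow> u i = \<zero>"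
      have uc: "u \<in> carrier (free (Suc ?l))" using u by blast
      show "u k \<in> (ls @ [?C]) ! k"
      proof (cases "k = ?l")
        case True
        note w = res(1)[OF uc] and r = res(2)[OF uc]
        have "mat n ?l A (restrict u {..<?l}) \<oplus>\<^bsub>free n\<^esub> u ?l \<odot>\<^bsub>free n\<^esub> v = \<zero>\<^bsub>free n\<^esub>"
          using u unfolding mat'[OF uc, symmetric] by (simp only: mem_Collect_eq)
        then have "u ?l \<odot>\<^bsub>free n\<^esub> v = \<ominus>\<^bsub>free n\<^esub> mat n ?l A (restrict u {..<?l})"
          using F.minus_equality[OF _ module_homD(1)[OF hom w] F.smult_closed[OF r vc]] F.a_comm[OF module_homD(1)[OF hom w] F.smult_closed[OF r vc]]
          by (simp only:)
        also have "\<dots> \<in> S" using SE(3) im w by blast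
        finally show ?thesis using r by (simp add: True)
      next
        case False
        then have kl: "k < ?l" using k by simp
        have "u ?l = \<zero>" using z kl by simp
        note t = tail[OF u this]
        have "\<forall>i. k < i \<longrightarrow> i < ?l \<longrightarrow> restrict u {..<?l} i = \<zero>" using z by simp
        then have "restrict u {..<?l} k \<in> ls ! k" using lab t kl unfolding labelled_def by blast
        then show ?thesis using kl by (simp add: nth_append)
      qed
    qed
    show "\<forall>a\<in>gr 1 \<inter> (ls @ [?C]) ! k. \<exists>u\<in>?K. linear_vec (Suc ?l) u \<and> (\<forall>i. k < i \<longrightarrow> i < Suc ?l \<longrightarrow> u i = \<zero>) \<and> u k = a"
    proof
      fix a assume a: "a \<in> gr 1 \<inter> (ls @ [?C]) ! k"
      then have ac: "a \<in> carrier R" using gr_carrier by blast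
      show "\<exists>u\<in>?K. linear_vec (Suc ?l) u \<and> (\<forall>i. k < i \<longrightarrow> i < Suc ?l \<longrightarrow> u i = \<zero>) \<and> u k = a"
      proof (cases "k = ?l")
        case True
        then have aS: "a \<odot>\<^bsub>free n\<^esub> v \<in> S" using a by simp
        note avc = F.smult_closed[OF ac vc]
        have "\<ominus>\<^bsub>free n\<^esub> (a \<odot>\<^bsub>free n\<^esub> v) \<in> mat n ?l A ` carrier (free ?l)"
          unfolding im by (rule SE(3)[OF aS])
        then obtain w where w2: "\<ominus>\<^bsub>free n\<^esub> (a \<odot>\<^bsub>free n\<^esub> v) = mat n ?l A w" and w1: "w \<in> carrier (free ?l)"
          by (rule imageE)
        note w = w1 w2[symmetric]
        have "mat n ?l A w i \<in> gr 2" if i: "i < n" for i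
        proof -
          have "v i \<in> gr 1" using v PiE_mem[of v "{..<n}" "\<lambda>_. gr 1" i] i by (simp add: linear_vec_def)
          then have "a \<otimes> v i \<in> gr 2" using gr_closed(4)[of a 1 "v i" 1] a by (simp only: IntD1 one_add_one)
          then have "\<ominus> (a \<otimes> v i) \<in> gr 2" by (rule gr_closed(3))
          then show ?thesis unfolding w(2) pow_a_inv[OF regular_module avc i] using i by (simp only: pow_module_simps regular_module_simps restrict_apply' lessThan_iff)
        qed
        then obtain w' where w': "linear_vec ?l w'" "mat n ?l A w' = mat n ?l A w" by (rule linear_preimage[OF A w(1)])
        note w'c = linear_vec_carrier[OF w'(1)]
        let ?u = "w'(?l := a)"
        have "mat n (Suc ?l) ?A ?u = \<zero>\<^bsub>free n\<^esub>"
          unfolding mat'[OF ext(1)[OF w'c ac]] ext(2)[OF w'c ac] w'(2) w(2) using F.l_neg[OF avc] by simp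
        moreover have "linear_vec (Suc ?l) ?u" using linear_vec_ext[OF w'(1)] a by blast
        moreover have "\<forall>i. k < i \<longrightarrow> i < Suc ?l \<longrightarrow> ?u i = \<zero>" "?u k = a" using True by simp_all
        ultimately show ?thesis using ext(1)[OF w'c ac] by blast
      next
        case False
        then have kl: "k < ?l" using k by simp
        then have "a \<in> gr 1 \<inter> ls ! k" using a by (simp add: nth_append)
        then obtain w where w: "w \<in> carrier (free ?l)" "mat n ?l A w = \<zero>\<^bsub>free n\<^esub>" "linear_vec ?l w"
          "\<forall>i. k < i \<longrightarrow> i < ?l \<longrightarrow> w i = \<zero>" "w k = a"
          using lab kl unfolding labelled_def by blast
        let ?u = "w(?l := \<zero>)"
        have "mat n (Suc ?l) ?A ?u = \<zero>\<^bsub>free n\<^esub>"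
          unfolding mat'[OF ext(1)[OF w(1) zero_closed]] ext(2)[OF w(1) zero_closed] w(2)
          using F.smult_l_null[OF vc] F.l_zero[OF F.zero_closed] by simp
        moreover have "linear_vec (Suc ?l) ?u" using linear_vec_ext[OF w(3) gr_closed(1)] .
        moreover have "\<forall>i. k < i \<longrightarrow> i < Suc ?l \<longrightarrow> ?u i = \<zero>" "?u k = a" using w(4,5) kl by simp_all
        ultimately show ?thesis using ext(1)[OF w(1) zero_closed] by blast
      qed
    qed
  qed
  then show "presented n ?S (ls @ [?C]) ?A"
    unfolding presented_def length_append_singleton using A' im' by blast
qed

end

text \<open>In contrast to \<open>koszul_filtration\<close>, the family is finite, each step is
  given by a linear element, and the colon is that of this element. The columns of the resolution
  are lifted from these elements.\<close>

locale strong_koszul_filtration = graded_ring +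
  fixes \<F> :: "'a set set"
  assumes finite_filtration: "finite \<F>"
    and filtration_ideal: "I \<in> \<F> \<Longrightarrow> ideal I R"
    and irrelevant_filtration: "irrelevant_ideal R gr \<in> \<F>"
    and filtration_step: "I \<in> \<F> \<Longrightarrow> I \<noteq> {\<zero>} \<Longrightarrow>
      \<exists>J\<in>\<F>. \<exists>a\<in>gr 1. J \<subset> I \<and> I = {j \<oplus> r \<otimes> a |j r. j \<in> J \<and> r \<in> carrier R} \<and> {r \<in> carrier R. r \<otimes> a \<in> J} \<in> \<F>"
begin

text \<open>\<open>colons I cs\<close>: the list \<open>cs\<close> consists of the colon ideals along a chain from \<open>0\<close> to \<open>I\<close>.\<close>

inductive colons :: "'a set \<Rightarrow> 'a set list \<Rightarrow> bool" where
  colons_zero: "colons {\<zero>} []"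
| colons_step: "colons J cs \<Longrightarrow> J \<in> \<F> \<Longrightarrow> a \<in> gr 1 \<Longrightarrow> I = {j \<oplus> r \<otimes> a |j r. j \<in> J \<and> r \<in> carrier R} \<Longrightarrow>
    {r \<in> carrier R. r \<otimes> a \<in> J} \<in> \<F> \<Longrightarrow> colons I (cs @ [{r \<in> carrier R. r \<otimes> a \<in> J}])"

text \<open>Each step goes to a properly smaller member, and the family is finite.\<close>

lemma colons_exists: "I \<in> \<F> \<Longrightarrow> \<exists>cs. colons I cs"
proof (induction "card {J \<in> \<F>. J \<subset> I}" arbitrary: I rule: less_induct)
  case less
  show ?case
  proof (cases "I = {\<zero>}")
    case True
    then show ?thesis using colons_zero by blast
  next
    case False
    obtain J a where J: "J \<in> \<F>" "a \<in> gr 1" "J \<subset> I" "I = {j \<oplus> r \<otimes> a |j r. j \<in> J \<and> r \<in> carrier R}"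
      "{r \<in> carrier R. r \<otimes> a \<in> J} \<in> \<F>"
      using filtration_step[OF less.prems False] by blast
    have "{K \<in> \<F>. K \<subset> J} \<subset> {K \<in> \<F>. K \<subset> I}" using J(1,3) by blast
    then have "card {K \<in> \<F>. K \<subset> J} < card {K \<in> \<F>. K \<subset> I}"
      using finite_filtration by (intro psubset_card_mono) auto
    then obtain cs where "colons J cs" using less.hyps J(1) by blast
    then show ?thesis using colons_step J(1,2,4,5) by blast
  qed
qed

lemma colons_subset: "colons I cs \<Longrightarrow> set cs \<subseteq> \<F>"
  by (induction rule: colons.induct) auto

text \<open>One chain is fixed for each ideal, so that the new labels depend on the ideal alone and
  not on the place where it occurs. The recursion in \<open>rational_rk\<close> relies on
  this.\<close>

definition colon_list :: "'a set \<Rightarrow> 'a set list" where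
  "colon_list I = (SOME cs. colons I cs)"

lemma colons_colon_list: "I \<in> \<F> \<Longrightarrow> colons I (colon_list I)"
  unfolding colon_list_def by (rule someI_ex[OF colons_exists])

text \<open>Follows the chain from 0 to \<open>I\<close> at coordinate \<open>k\<close>. The linear
  element \<open>a\<close> of a step lifts to a linear vector \<open>v\<close> of \<open>T\<close>
  with leading entry \<open>a\<close>. Adjoining \<open>v\<close> as a column contributes the colon
  of \<open>a\<close> as label, because \<open>r v\<close> falls into the part already presented iff
  \<open>r a\<close> is in \<open>J\<close>.\<close>

lemma presented_colons:
  assumes "colons I cs" and lab: "labelled ls T" and k: "k < length ls"
    and pre: "presented (length ls) {v \<in> T. \<forall>i. k \<le> i \<longrightarrow> i < length ls \<longrightarrow> v i = \<zero>} pre A"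
    and "I \<subseteq> ls ! k"
  shows "\<exists>A'. presented (length ls) {v \<in> T. (\<forall>i. k < i \<longrightarrow> i < length ls \<longrightarrow> v i = \<zero>) \<and> v k \<in> I} (pre @ cs) A'"
  using assms(1,5)
proof (induction rule: colons.induct)
  case colons_zero
  have "{v \<in> T. (\<forall>i. k < i \<longrightarrow> i < length ls \<longrightarrow> v i = \<zero>) \<and> v k \<in> {\<zero>}} =
      {v \<in> T. \<forall>i. k \<le> i \<longrightarrow> i < length ls \<longrightarrow> v i = \<zero>}"
    using k by (auto simp: le_less)
  then show ?case using pre by auto
next
  case (colons_step J cs a I)
  let ?n = "length ls"
  let ?S = "\<lambda>I. {v \<in> T. (\<forall>i. k < i \<longrightarrow> i < ?n \<longrightarrow> v i = \<zero>) \<and> v k \<in> I}"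
  interpret F: Module.module R "free ?n" by (rule free_module)
  interpret J: ideal J R by (rule filtration_ideal) fact
  have a: "a \<in> carrier R" using gr_carrier colons_step.hyps(3) by blast
  have "j \<in> I" if "j \<in> J" for j
  proof -
    have "j = j \<oplus> \<zero> \<otimes> a" using that a by simp
    then show ?thesis using that colons_step.hyps(4) by blast
  qed
  then have JI: "J \<subseteq> I" by blast
  have "a = \<zero> \<oplus> \<one> \<otimes> a" using a by simp
  then have "a \<in> I" using colons_step.hyps(4) J.zero_closed by blast
  then obtain v where v: "v \<in> T" "linear_vec ?n v" "\<forall>i. k < i \<longrightarrow> i < ?n \<longrightarrow> v i = \<zero>" "v k = a"
    using lab k colons_step.hyps(3) colons_step.prems unfolding labelled_def by blast
  have T: "Module.submodule T R (free ?n)" using lab by (simp add: labelled_def)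
  note TE = F.submoduleE[OF T]
  have Tc: "u i \<in> carrier R" if "u \<in> T" "i < ?n" for u i
    using TE(1) that PiE_mem[of u "{..<?n}" "\<lambda>_. carrier R" i] by auto
  obtain A where A: "presented ?n (?S J) (pre @ cs) A" using colons_step.IH JI colons_step.prems by blast
  have add_nth: "(u \<oplus>\<^bsub>free ?n\<^esub> w) i = u i \<oplus> w i" and smult_nth: "(r \<odot>\<^bsub>free ?n\<^esub> u) i = r \<otimes> u i"
    if "i < ?n" for u w i r using that by simp_all
  have "{s \<oplus>\<^bsub>free ?n\<^esub> r \<odot>\<^bsub>free ?n\<^esub> v |s r. s \<in> ?S J \<and> r \<in> carrier R} = ?S I"
  proof (intro equalityI subsetI)
    fix x assume "x \<in> {s \<oplus>\<^bsub>free ?n\<^esub> r \<odot>\<^bsub>free ?n\<^esub> v |s r. s \<in> ?S J \<and> r \<in> carrier R}"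
    then obtain s r where x: "x = s \<oplus>\<^bsub>free ?n\<^esub> r \<odot>\<^bsub>free ?n\<^esub> v" and s: "s \<in> ?S J" and r: "r \<in> carrier R" by blast
    have "x \<in> T" unfolding x using TE(4)[OF r v(1)] TE(5) s by blast
    moreover have "x i = \<zero>" if "k < i" "i < ?n" for i
      unfolding x add_nth[OF that(2)] smult_nth[OF that(2)] using s v(3) that r by simp
    moreover have "x k \<in> I" unfolding x add_nth[OF k] smult_nth[OF k] v(4) colons_step.hyps(4) using s r by blast
    ultimately show "x \<in> ?S I" by blast
  next
    fix x assume x: "x \<in> ?S I"
    then obtain j r where jr: "x k = j \<oplus> r \<otimes> a" "j \<in> J" "r \<in> carrier R" using colons_step.hyps(4) by blast
    have xT: "x \<in> T" and xc: "x \<in> carrier (free ?n)" using x TE(1) by blast+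
    have rv: "r \<odot>\<^bsub>free ?n\<^esub> v \<in> T" "r \<odot>\<^bsub>free ?n\<^esub> v \<in> carrier (free ?n)" using TE(4)[OF jr(3) v(1)] TE(1) by blast+
    define s where "s = x \<ominus>\<^bsub>free ?n\<^esub> r \<odot>\<^bsub>free ?n\<^esub> v"
    have sT: "s \<in> T" unfolding s_def a_minus_def using TE(5)[OF xT TE(3)[OF rv(1)]] .
    have s_nth: "s i = x i \<ominus> r \<otimes> v i" if "i < ?n" for i
      unfolding s_def pow_minus[OF regular_module xc rv(2) that] smult_nth[OF that] by simp
    have "s i = \<zero>" if "k < i" "i < ?n" for i
      unfolding s_nth[OF that(2)] using x v(3) that jr(3) by (simp add: a_minus_def)
    moreover have "s k = j"
      unfolding s_nth[OF k] jr(1) v(4) using J.a_Hcarr[OF jr(2)] jr(3) a by (simp add: a_minus_def a_assoc r_neg)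
    ultimately have "s \<in> ?S J" using sT jr(2) by blast
    moreover have "x = s \<oplus>\<^bsub>free ?n\<^esub> r \<odot>\<^bsub>free ?n\<^esub> v"
      unfolding s_def a_minus_def F.a_assoc[OF xc F.a_inv_closed[OF rv(2)] rv(2)] F.l_neg[OF rv(2)] F.r_zero[OF xc] ..
    ultimately show "x \<in> {s \<oplus>\<^bsub>free ?n\<^esub> r \<odot>\<^bsub>free ?n\<^esub> v |s r. s \<in> ?S J \<and> r \<in> carrier R}" using jr(3) by blast
  qed
  moreover have "{r \<in> carrier R. r \<odot>\<^bsub>free ?n\<^esub> v \<in> ?S J} = {r \<in> carrier R. r \<otimes> a \<in> J}"
  proof (intro Collect_cong conj_cong refl)
    fix r assume r: "r \<in> carrier R"
    have "(r \<odot>\<^bsub>free ?n\<^esub> v) i = \<zero>" if "k < i" "i < ?n" for i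
      unfolding smult_nth[OF that(2)] using v(3) that r by simp
    moreover have "(r \<odot>\<^bsub>free ?n\<^esub> v) k = r \<otimes> a" unfolding smult_nth[OF k] v(4) ..
    ultimately show "(r \<odot>\<^bsub>free ?n\<^esub> v \<in> ?S J) = (r \<otimes> a \<in> J)" using TE(4)[OF r v(1)] by (simp only: mem_Collect_eq) blast
  qed
  ultimately show ?case using presented_add_column[OF A v(2)] by (simp only: append_assoc)
qed

text \<open>\<open>T\<close> is filtered by the vectors that vanish from coordinate \<open>k\<close>
  on. Passing from \<open>k\<close> to \<open>k + 1\<close> admits leading entries from the ideal
  \<open>ls ! k\<close>, so the colons along its chain are appended to the labels.\<close>

lemma presented_step:
  assumes lab: "labelled ls T" and sub: "set ls \<subseteq> \<F>"
  shows "\<exists>A. presented (length ls) T (concat (map colon_list ls)) A"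
proof -
  let ?n = "length ls"
  interpret F: Module.module R "free ?n" by (rule free_module)
  have T: "Module.submodule T R (free ?n)" using lab by (simp add: labelled_def)
  note TE = F.submoduleE[OF T]
  have "\<exists>A. presented ?n {v \<in> T. \<forall>i. k \<le> i \<longrightarrow> i < ?n \<longrightarrow> v i = \<zero>} (concat (map colon_list (take k ls))) A" if "k \<le> ?n" for k
    using that
  proof (induction k)
    case 0
    have uniq: "v = \<zero>\<^bsub>free ?n\<^esub>" if "v \<in> T" "\<forall>i. i < ?n \<longrightarrow> v i = \<zero>" for v
    proof (rule pow_eqI[of _ ?n "carrier R"])
      show "v \<in> {..<?n} \<rightarrow>\<^sub>E carrier R" using TE(1) that(1) by (simp add: subset_iff)
    qed (use that(2) F.zero_closed in simp_all)
    have zT: "\<zero>\<^bsub>free ?n\<^esub> \<in> T" using subgroup.one_closed[OF Module.submodule.axioms(1)[OF T]] by simp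
    have zn: "\<forall>i. 0 \<le> i \<longrightarrow> i < ?n \<longrightarrow> \<zero>\<^bsub>free ?n\<^esub> i = \<zero>" by simp
    have eq: "{v \<in> T. \<forall>i. 0 \<le> i \<longrightarrow> i < ?n \<longrightarrow> v i = \<zero>} = {\<zero>\<^bsub>free ?n\<^esub>}"
    proof (intro equalityI subsetI)
      fix v assume "v \<in> {v \<in> T. \<forall>i. 0 \<le> i \<longrightarrow> i < ?n \<longrightarrow> v i = \<zero>}"
      then have "v \<in> T" "\<forall>i. i < ?n \<longrightarrow> v i = \<zero>" by simp_all
      then show "v \<in> {\<zero>\<^bsub>free ?n\<^esub>}" unfolding singleton_iff by (rule uniq)
    next
      fix v assume "v \<in> {\<zero>\<^bsub>free ?n\<^esub>}"
      then have v: "v = \<zero>\<^bsub>free ?n\<^esub>" by (rule singletonD)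
      show "v \<in> {v \<in> T. \<forall>i. 0 \<le> i \<longrightarrow> i < ?n \<longrightarrow> v i = \<zero>}" unfolding v mem_Collect_eq by (intro conjI zT zn)
    qed
    show ?case unfolding eq take_0 list.map concat.simps using presented_zero by blast
  next
    case (Suc k)
    then have k: "k < ?n" by simp
    obtain A where A: "presented ?n {v \<in> T. \<forall>i. k \<le> i \<longrightarrow> i < ?n \<longrightarrow> v i = \<zero>} (concat (map colon_list (take k ls))) A"
      using Suc by auto
    have "ls ! k \<in> \<F>" using sub k by auto
    from presented_colons[OF colons_colon_list[OF this] lab k A subset_refl]
    obtain A' where "presented ?n {v \<in> T. (\<forall>i. k < i \<longrightarrow> i < ?n \<longrightarrow> v i = \<zero>) \<and> v k \<in> ls ! k}
        (concat (map colon_list (take k ls)) @ colon_list (ls ! k)) A'" by blast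
    moreover have "{v \<in> T. (\<forall>i. k < i \<longrightarrow> i < ?n \<longrightarrow> v i = \<zero>) \<and> v k \<in> ls ! k} = {v \<in> T. \<forall>i. Suc k \<le> i \<longrightarrow> i < ?n \<longrightarrow> v i = \<zero>}"
      using lab k unfolding labelled_def Suc_le_eq by blast
    ultimately show ?case using k by (simp only: take_Suc_conv_app_nth map_append list.map concat_append concat.simps append_Nil2) blast
  qed
  from this[OF order_refl] obtain A where "presented ?n {v \<in> T. \<forall>i. ?n \<le> i \<longrightarrow> i < ?n \<longrightarrow> v i = \<zero>} (concat (map colon_list ls)) A"
    unfolding take_all_iff[THEN iffD2, OF order_refl] by blast
  moreover have "{v \<in> T. \<forall>i. ?n \<le> i \<longrightarrow> i < ?n \<longrightarrow> v i = \<zero>} = T" by (auto simp del: pow_module_simps)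
  ultimately show ?thesis by (auto simp only:)
qed

abbreviation "\<mm> \<equiv> irrelevant_ideal R gr"

definition labels :: "nat \<Rightarrow> 'a set list" where
  "labels i = ((\<lambda>ls. concat (map colon_list ls)) ^^ i) [\<mm>]"

lemma labels_subset: "set (labels i) \<subseteq> \<F>"
proof (induction i)
  case 0
  then show ?case using irrelevant_filtration by (simp add: labels_def)
next
  case (Suc i)
  then show ?case using colons_subset[OF colons_colon_list] by (auto simp: labels_def)
qed

abbreviation "rk i \<equiv> length (labels i)"

lemma ideal_irrelevant: "ideal \<mm> R"
  by (rule filtration_ideal[OF irrelevant_filtration])

definition aug :: "(nat \<Rightarrow> 'a) \<Rightarrow> 'a set" where
  "aug v = \<mm> +> v 0"

lemma rk_0: "rk 0 = 1"
  by (simp add: labels_def)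

lemma aug_hom: "aug \<in> module_hom R (free (rk 0)) (residue_module R \<mm>)"
proof -
  have "(\<lambda>v. v 0) \<in> module_hom R (free 1) (regular_module R)"
  proof (rule module_homI)
    show "x 0 \<in> carrier (regular_module R)" if "x \<in> carrier (free 1)" for x
      using that PiE_mem[of x "{..<1}" "\<lambda>_. carrier R" 0] by (simp only: pow_module_simps regular_module_simps lessThan_iff zero_less_one)
  qed simp_all
  from hom_compose[OF this residue_hom[OF ideal_irrelevant]] show ?thesis unfolding rk_0 aug_def .
qed

lemma aug_eq_zero: "v \<in> carrier (free (rk 0)) \<Longrightarrow> aug v = \<zero>\<^bsub>residue_module R \<mm>\<^esub> \<longleftrightarrow> v 0 \<in> \<mm>"
  unfolding aug_def rk_0 pow_module_simps regular_module_simps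
  by (intro residue_eq_zero[OF ideal_irrelevant] PiE_mem[of v "{..<1}" "\<lambda>_. carrier R" 0]) simp_all

lemma labelled_aug: "labelled (labels 0) {v \<in> carrier (free (rk 0)). aug v = \<zero>\<^bsub>residue_module R \<mm>\<^esub>}"
  unfolding labelled_def
proof (intro conjI allI impI)
  show "Module.submodule {v \<in> carrier (free (rk 0)). aug v = \<zero>\<^bsub>residue_module R \<mm>\<^esub>} R (free (rk 0))"
    by (rule hom_submodules(1)[OF free_module residue_module[OF ideal_irrelevant] aug_hom])
  fix k assume "k < rk 0"
  then have k: "k = 0" by (simp add: rk_0)
  have l: "labels 0 ! 0 = \<mm>" by (simp add: labels_def)
  show "\<forall>v\<in>{v \<in> carrier (free (rk 0)). aug v = \<zero>\<^bsub>residue_module R \<mm>\<^esub>}. (\<forall>i. k < i \<longrightarrow> i < rk 0 \<longrightarrow> v i = \<zero>) \<longrightarrow> v k \<in> labels 0 ! k"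
    unfolding k l
  proof (intro ballI impI)
    fix v assume "v \<in> {v \<in> carrier (free (rk 0)). aug v = \<zero>\<^bsub>residue_module R \<mm>\<^esub>}"
    then have "v \<in> carrier (free (rk 0))" "aug v = \<zero>\<^bsub>residue_module R \<mm>\<^esub>" by (simp_all only: mem_Collect_eq)
    then show "v 0 \<in> \<mm>" by (rule aug_eq_zero[THEN iffD1])
  qed
  show "\<forall>a\<in>gr 1 \<inter> labels 0 ! k. \<exists>v\<in>{v \<in> carrier (free (rk 0)). aug v = \<zero>\<^bsub>residue_module R \<mm>\<^esub>}.
      linear_vec (rk 0) v \<and> (\<forall>i. k < i \<longrightarrow> i < rk 0 \<longrightarrow> v i = \<zero>) \<and> v k = a"
  proof
    fix a assume a: "a \<in> gr 1 \<inter> labels 0 ! k"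
    let ?v = "\<lambda>i\<in>{..<rk 0}. a"
    have v: "linear_vec (rk 0) ?v" using a by (simp add: linear_vec_def)
    moreover have "aug ?v = \<zero>\<^bsub>residue_module R \<mm>\<^esub>"
      using aug_eq_zero[OF linear_vec_carrier[OF v]] a l k by (simp add: rk_0)
    ultimately show "\<exists>v\<in>{v \<in> carrier (free (rk 0)). aug v = \<zero>\<^bsub>residue_module R \<mm>\<^esub>}.
        linear_vec (rk 0) v \<and> (\<forall>i. k < i \<longrightarrow> i < rk 0 \<longrightarrow> v i = \<zero>) \<and> v k = a"
      using linear_vec_carrier[OF v] by (intro bexI[of _ ?v]) (simp_all add: rk_0 k)
  qed
qed

text \<open>The invariant is that the kernel of the current matrix is labelled by the next list;
  \<open>presented_step\<close> then supplies a linear matrix onto this kernel whose own kernel is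
  labelled again.\<close>

lemma linear_resolution:
  "\<exists>d. (\<forall>i. linear_mat (rk i) (rk (Suc i)) (d i)) \<and> free_resolution R (residue_module R \<mm>) rk d aug"
proof -
  let ?Z = "{v \<in> carrier (free (rk 0)). aug v = \<zero>\<^bsub>residue_module R \<mm>\<^esub>}"
  let ?K = "\<lambda>i A. {w \<in> carrier (free (rk (Suc i))). mat (rk i) (rk (Suc i)) A w = \<zero>\<^bsub>free (rk i)\<^esub>}"
  let ?P = "\<lambda>i A. linear_mat (rk i) (rk (Suc i)) A \<and> labelled (labels (Suc i)) (?K i A) \<and>
      (i = 0 \<longrightarrow> mat (rk i) (rk (Suc i)) A ` carrier (free (rk (Suc i))) = ?Z)"
  have lS: "labels (Suc i) = concat (map colon_list (labels i))" for i by (simp add: labels_def)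
  have "\<exists>d. \<forall>i. ?P i (d i) \<and>
      mat (rk (Suc i)) (rk (Suc (Suc i))) (d (Suc i)) ` carrier (free (rk (Suc (Suc i)))) = ?K i (d i)"
  proof (rule dependent_nat_choice)
    obtain A where "presented (rk 0) ?Z (labels (Suc 0)) A"
      using presented_step[OF labelled_aug labels_subset] unfolding lS[symmetric] by (rule exE)
    then show "\<exists>A. ?P 0 A" unfolding presented_def by (intro exI[of _ A] conjI impI) (elim conjE, assumption)+
    fix A i assume "?P i A"
    then have "labelled (labels (Suc i)) (?K i A)" by (elim conjE)
    from presented_step[OF this labels_subset] obtain A' where "presented (rk (Suc i)) (?K i A) (labels (Suc (Suc i))) A'"
      unfolding lS[of "Suc i", symmetric] by (rule exE)
    then have A': "linear_mat (rk (Suc i)) (rk (Suc (Suc i))) A'"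
      "mat (rk (Suc i)) (rk (Suc (Suc i))) A' ` carrier (free (rk (Suc (Suc i)))) = ?K i A"
      "labelled (labels (Suc (Suc i))) (?K (Suc i) A')"
      unfolding presented_def by (simp_all only: simp_thms)
    show "\<exists>A'. ?P (Suc i) A' \<and> mat (rk (Suc i)) (rk (Suc (Suc i))) A' ` carrier (free (rk (Suc (Suc i)))) = ?K i A"
      by (intro exI[of _ A'] conjI impI A') simp
  qed
  then obtain d where dd: "\<forall>i. ?P i (d i) \<and>
      mat (rk (Suc i)) (rk (Suc (Suc i))) (d (Suc i)) ` carrier (free (rk (Suc (Suc i)))) = ?K i (d i)"
    by (rule exE)
  note d = conjunct1[OF spec[OF dd]] conjunct2[OF spec[OF dd]]
  have lin: "linear_mat (rk i) (rk (Suc i)) (d i)" for i by (rule conjunct1[OF d(1)])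
  have surj: "aug ` carrier (free (rk 0)) = carrier (residue_module R \<mm>)"
  proof
    show "aug ` carrier (free (rk 0)) \<subseteq> carrier (residue_module R \<mm>)" using module_homD(1)[OF aug_hom] by blast
    show "carrier (residue_module R \<mm>) \<subseteq> aug ` carrier (free (rk 0))"
    proof
      fix A assume "A \<in> carrier (residue_module R \<mm>)"
      then obtain a where a: "a \<in> carrier R" "A = \<mm> +> a"
        using residue_carrierE[OF ideal_irrelevant] residue_module_simps(1)[OF ideal_irrelevant] by metis
      have "A = aug (\<lambda>i\<in>{..<rk 0}. a)" by (simp add: aug_def rk_0 a(2))
      moreover have "(\<lambda>i\<in>{..<rk 0}. a) \<in> carrier (free (rk 0))" using a(1) by simp
      ultimately show "A \<in> aug ` carrier (free (rk 0))" by (rule image_eqI)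
    qed
  qed
  have "resolves (residue_module R \<mm>) rk (\<lambda>i. mat (rk i) (rk (Suc i)) (d i)) aug"
    unfolding resolves_def
  proof (intro conjI allI)
    show "mat (rk 0) (rk (Suc 0)) (d 0) ` carrier (free (rk 1)) = ?Z" unfolding One_nat_def by (rule d(1)[of 0, THEN conjunct2, THEN conjunct2, THEN mp, OF refl])
  qed (rule linear_mat_hom[OF lin] aug_hom surj d(2))+
  then have "free_resolution R (residue_module R \<mm>) rk d aug"
    unfolding free_resolution_iff using linear_mat_carrier[OF lin] by blast
  then show ?thesis using lin by blast
qed

text \<open>The number of labels after \<open>i\<close> steps is additive over the starting list. So
  the counts for single ideals satisfy a linear recursion, whose matrix records how often one ideal
  occurs among the colons of another.\<close>

lemma rational_rk: "rational_fps (Abs_fps (\<lambda>i. of_nat (rk i) :: rat))"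
proof -
  let ?g = "\<lambda>ls. concat (map colon_list ls)"
  define q where "q i I = (of_nat (length ((?g ^^ i) [I])) :: rat)" for i I
  have app: "(?g ^^ i) (xs @ ys) = (?g ^^ i) xs @ (?g ^^ i) ys" for i xs ys by (induction i) simp_all
  have nil: "(?g ^^ i) [] = []" for i by (induction i) simp_all
  have len: "of_nat (length ((?g ^^ i) xs)) = (\<Sum>I\<leftarrow>xs. q i I)" for i xs
  proof (induction xs)
    case (Cons x xs)
    then show ?case using app[of i "[x]" xs] by (simp add: q_def)
  qed (simp add: nil)
  have "rational_fps (Abs_fps (\<lambda>i. q i \<mm>))"
  proof (rule rational_fps_transfer_matrix[OF finite_filtration _ irrelevant_filtration,
      where B = "\<lambda>I C. of_nat (count_list (colon_list I) C)"])
    fix i I assume I: "I \<in> \<F>"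
    have "q (Suc i) I = of_nat (length ((?g ^^ i) (colon_list I)))" by (simp add: q_def funpow_Suc_right del: funpow.simps)
    also have "\<dots> = (\<Sum>C\<leftarrow>colon_list I. q i C)" by (rule len)
    also have "\<dots> = (\<Sum>C\<in>\<F>. of_nat (count_list (colon_list I) C) * q i C)"
      by (rule sum_list_eq_sum_count_list[OF finite_filtration colons_subset[OF colons_colon_list[OF I]]])
    finally show "q (Suc i) I = (\<Sum>C\<in>\<F>. of_nat (count_list (colon_list I) C) * q i C)" .
  qed
  then show ?thesis by (simp add: q_def labels_def)
qed

theorem rational_poincare_series: "\<exists>P. is_poincare_series R gr P \<and> rational_fps P"
proof -
  obtain d where lin: "\<And>i. linear_mat (rk i) (rk (Suc i)) (d i)"
    and res: "free_resolution R (residue_module R \<mm>) rk d aug" using linear_resolution by blast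
  note I = ideal_irrelevant
  interpret I: ideal \<mm> R by (rule I)
  have k: "subfield (gr 0) R" using graded by (simp add: standard_graded_def)
  have split: "\<exists>c\<in>gr 0. r \<ominus> c \<in> \<mm>" if r: "r \<in> carrier R" for r
  proof
    show "comp r 0 \<in> gr 0" by (rule comp_gr[OF r])
    have "comp (r \<ominus> comp r 0) 0 = \<zero>"
      using r comp_carrier[OF r] comp_homogeneous[OF comp_gr[OF r], of 0 0] by (simp add: a_minus_def comp_add comp_neg r_neg)
    then show "r \<ominus> comp r 0 \<in> \<mm>" unfolding irrelevant_ideal_eq using r comp_carrier[OF r] by simp
  qed
  have triv: "gr 0 \<inter> \<mm> = {\<zero>}"
  proof
    show "gr 0 \<inter> \<mm> \<subseteq> {\<zero>}" unfolding irrelevant_ideal_eq using comp_homogeneous[of _ 0 0] by auto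
    show "{\<zero>} \<subseteq> gr 0 \<inter> \<mm>" using gr_closed(1) I.zero_closed by blast
  qed
  have res': "resolves (residue_module R \<mm>) rk (\<lambda>i. mat (rk i) (rk (Suc i)) (d i)) aug"
    using res by (simp add: free_resolution_iff)
  \<comment> \<open>Entries of degree 1 lie in \<open>\<mm>\<close>, so the differentials vanish
    modulo \<open>\<mm>\<close>.\<close>
  have minimal: "mat (rk i) (rk (Suc i)) (d i) v \<in> vecs_in \<mm> (rk i)" if v: "v \<in> carrier (free (rk (Suc i)))" for i v
  proof -
    have "mat (rk i) (rk (Suc i)) (d i) v a \<in> \<mm>" if a: "a < rk i" for a
      unfolding mat_nth[OF a]
    proof (rule ideal_finsum[OF I])
      show "d i a j \<otimes> v j \<in> \<mm>" if "j \<in> {..<rk (Suc i)}" for j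
        using I.I_r_closed[of "d i a j" "v j"] gr_1_irrelevant lin[of i] a that v
          PiE_mem[of v "{..<rk (Suc i)}" "\<lambda>_. carrier R" j] by (auto simp: linear_mat_def)
    qed simp
    then show ?thesis unfolding vecs_in_def using module_homD(1)[OF linear_mat_hom[OF lin] v] by blast
  qed
  have "is_poincare_series R gr (Abs_fps (\<lambda>i. of_nat (rk i)))"
    unfolding is_poincare_series_def Let_def
  proof (intro conjI allI impI)
    show "\<exists>n d \<epsilon>. free_resolution R (residue_module R \<mm>) n d \<epsilon>" using res by blast
    fix n d' \<epsilon> i assume r: "free_resolution R (residue_module R \<mm>) n d' \<epsilon>"
    note T = tor_dim[OF I k split triv r res' minimal, of i]
    show "vectorspace.fin_dim (R\<lparr>carrier := gr 0\<rparr>) (tor (residue_module R \<mm>) n d' i)" using T by blast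
    show "fps_nth (Abs_fps (\<lambda>i. of_nat (rk i) :: rat)) i =
        of_nat (vectorspace.dim (R\<lparr>carrier := gr 0\<rparr>) (tor (residue_module R \<mm>) n d' i))" using T by simp
  qed
  then show ?thesis using rational_rk by blast
qed

end

section \<open>The Koszul filtration of the augmented Chow ring\<close>

abbreviation part :: "nat \<Rightarrow> 'v mpoly \<Rightarrow> 'v mpoly" where
  "part k \<equiv> prestr {m. tdeg m = k}"

lemma part_add: "part k (p + q) = part k p + part k q"
  by (rule poly_mapping_eqI) (simp add: lookup_prestr lookup_add)

lemma part_diff: "part k (p - q) = part k p - part k q"
  by (rule poly_mapping_eqI) (simp add: lookup_prestr lookup_minus)

lemma part_homogeneous: "homogeneous d p \<Longrightarrow> part k p = (if k = d then p else 0)"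
  by (rule poly_mapping_eqI) (auto simp: lookup_prestr homogeneous_iff_tdeg in_keys_iff)

lemma part_zero [simp]: "part k 0 = 0"
  by (simp add: prestr_def)

lemma homogeneous_part: "homogeneous k (part k p)"
  by (simp add: homogeneous_iff_tdeg keys_prestr)

lemma part_sum: "part k (\<Sum>i\<in>A. f i) = (\<Sum>i\<in>A. part k (f i))"
  by (induction A rule: infinite_finite_induct) (auto simp: part_add)

lemma sum_parts: "p = (\<Sum>k\<in>tdeg ` supp p. part k p)"
proof (rule poly_mapping_eqI)
  fix m
  have "coef (\<Sum>k\<in>tdeg ` supp p. part k p) m = (\<Sum>k\<in>tdeg ` supp p. if tdeg m = k then coef p m else 0)"
    by (simp add: lookup_sum lookup_prestr)
  also have "\<dots> = coef p m" by (auto simp: in_keys_iff image_iff)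
  finally show "coef p m = coef (\<Sum>k\<in>tdeg ` supp p. part k p) m" ..
qed

lemma part_eq_0: "k \<notin> tdeg ` supp p \<Longrightarrow> part k p = 0"
  by (rule poly_mapping_eqI) (auto simp: lookup_prestr in_keys_iff image_iff)

lemma part_mult_homogeneous:
  assumes "homogeneous d c"
  shows "part k (c * p) = (if d \<le> k then c * part (k - d) p else 0)"
proof -
  have "part k (c * part j p) = (if k = d + j then c * part j p else 0)" for j
    by (rule part_homogeneous[OF homogeneous_mult[OF assms homogeneous_part]])
  then have "part k (c * p) = (\<Sum>j\<in>tdeg ` supp p. if k = d + j then c * part j p else 0)"
    by (subst (1) sum_parts[of p]) (simp only: sum_distrib_left part_sum)
  also have "\<dots> = (\<Sum>j\<in>tdeg ` supp p. if j = k - d then (if d \<le> k then c * part j p else 0) else 0)"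
    by (intro sum.cong) auto
  also have "\<dots> = (if d \<le> k then c * part (k - d) p else 0)"
    using part_eq_0[of "k - d" p] by (simp add: sum.delta)
  finally show ?thesis .
qed

lemma homogeneous_0_const: "homogeneous 0 p \<Longrightarrow> p = const (coef p 0)" for p :: "'v mpoly"
proof (rule poly_mapping_eqI)
  fix m
  assume p: "homogeneous 0 p"
  have "m = 0" if m: "m \<in> supp p"
  proof (rule poly_mapping_eqI)
    fix v
    show "coef m v = coef 0 v"
      using lookup_le_wsum[of "\<lambda>_. True" v m] p m by (simp add: homogeneous_iff_tdeg)
  qed
  then show "coef p m = coef (const (coef p 0)) m"
    by (cases "m = 0") (auto simp: lookup_single in_keys_iff)
qed

text \<open>The relations are homogeneous, so they generate a homogeneous ideal. The uniqueness of
  homogeneous components in the Chow ring rests on this.\<close>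

lemma (in ordered_flat_lattice) RI_part: "p \<in> RI \<Longrightarrow> part k p \<in> RI"
proof -
  have "ideal.subspace {p. \<forall>k. part k p \<in> RI}"
  proof (rule ideal.subspaceI)
    show "0 \<in> {p. \<forall>k. part k p \<in> RI}"
      using ideal.subspace_0[OF subspace_RI] by simp
    show "x + y \<in> {p. \<forall>k. part k p \<in> RI}" if "x \<in> {p. \<forall>k. part k p \<in> RI}" "y \<in> {p. \<forall>k. part k p \<in> RI}" for x y
      using that ideal.subspace_add[OF subspace_RI] by (simp add: part_add)
    fix c x :: "'a set mpoly" assume x: "x \<in> {p. \<forall>k. part k p \<in> RI}"
    have "part k (part d c * x) \<in> RI" for k d
      unfolding part_mult_homogeneous[OF homogeneous_part]
      using x ideal.subspace_scale[OF subspace_RI] ideal.subspace_0[OF subspace_RI] by auto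
    then have "(\<Sum>d\<in>tdeg ` supp c. part k (part d c * x)) \<in> RI" for k
      by (intro ideal.subspace_sum[OF subspace_RI])
    then have "part k ((\<Sum>d\<in>tdeg ` supp c. part d c) * x) \<in> RI" for k
      unfolding sum_distrib_right part_sum .
    then show "c * x \<in> {p. \<forall>k. part k p \<in> RI}" unfolding sum_parts[of c, symmetric] by simp
  qed
  moreover have "rels \<subseteq> {p. \<forall>k. part k p \<in> RI}"
  proof clarify
    fix p k assume p: "p \<in> rels"
    then have "p \<in> RI" unfolding RI_def by (rule ideal.span_base)
    moreover obtain d where "homogeneous d p" using rels_homogeneous[OF p] by blast
    ultimately show "part k p \<in> RI" using part_homogeneous ideal.subspace_0[OF subspace_RI] by metis
  qed
  ultimately have "RI \<subseteq> {p. \<forall>k. part k p \<in> RI}" unfolding RI_def by (intro ideal.span_minimal)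
  then show "p \<in> RI \<Longrightarrow> part k p \<in> RI" by blast
qed

section \<open>The grading of the Chow ring\<close>

locale ordered_chow_ring = chow_ring +
  fixes pos :: "'a \<Rightarrow> nat"
  assumes pos: "inj_on pos E"

sublocale ordered_chow_ring \<subseteq> ordered_flat_lattice E "flats E indep" "matroid_rank indep" pos
  by unfold_locales (rule pos)

context ordered_chow_ring
begin

abbreviation "gr \<equiv> chow_grading E indep"

interpretation CH: cring CH by (rule CH_cring)

lemma proj_zero: "proj 0 = \<zero>\<^bsub>CH\<^esub>"
  unfolding proj_eq_zero by (rule ideal.subspace_0[OF subspace_RI])

lemma proj_uminus: "proj (- u) = \<ominus>\<^bsub>CH\<^esub> proj u"
proof -
  have "proj (- u) \<oplus>\<^bsub>CH\<^esub> proj u = \<zero>\<^bsub>CH\<^esub>" unfolding proj_add[symmetric] by (simp add: proj_zero)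
  then show ?thesis using CH.minus_equality proj_closed by metis
qed

lemma proj_eq_iff: "proj u = proj v \<longleftrightarrow> u - v \<in> RI"
proof -
  have "proj (u - v) = proj u \<ominus>\<^bsub>CH\<^esub> proj v"
    unfolding a_minus_def proj_uminus[symmetric] proj_add[symmetric] by simp
  then show ?thesis unfolding proj_eq_zero[symmetric] using CH.r_right_minus_eq proj_closed by simp
qed

lemma proj_sum: "finite A \<Longrightarrow> proj (\<Sum>i\<in>A. f i) = (\<Oplus>\<^bsub>CH\<^esub>i\<in>A. proj (f i))"
  by (induction A rule: finite_induct) (simp_all add: proj_zero proj_add proj_closed)

lemma RI_family: "RI \<in> family"
  unfolding family_def using upset_def by (auto simp: RI_def upset_ideal_def intro!: exI[of _ "{}"])

lemma const_RI: "const c \<in> RI \<Longrightarrow> c = 0"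
  using family_proper[OF RI_family] by (auto dest: subsetD)

lemma grI: "homogeneous i u \<Longrightarrow> proj u \<in> gr i"
  unfolding chow_grading_proj by (intro imageI CollectI)

lemma grE:
  assumes "x \<in> gr i"
  obtains u where "x = proj u" "homogeneous i u"
  using assms unfolding chow_grading_proj by (elim imageE CollectE)

lemma gr_0: "gr 0 = range (\<lambda>c. proj (const c))"
proof
  show "gr 0 \<subseteq> range (\<lambda>c. proj (const c))"
  proof
    fix x assume "x \<in> gr 0"
    then obtain u where "x = proj u" "homogeneous 0 u" by (rule grE)
    then have "x = proj (const (coef u 0))" by (simp only: homogeneous_0_const[symmetric])
    then show "x \<in> range (\<lambda>c. proj (const c))" by (rule range_eqI)
  qed
  show "range (\<lambda>c. proj (const c)) \<subseteq> gr 0" unfolding chow_grading_proj by (intro image_subsetI imageI CollectI homogeneous_const)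
qed

lemma subgroup_gr: "subgroup (gr i) (add_monoid CH)"
proof (rule CH.add.subgroupI)
  show "gr i \<subseteq> carrier CH" using proj_closed by (auto elim: grE)
  show "gr i \<noteq> {}" using grI[OF homogeneous_zero] by blast
  fix a assume "a \<in> gr i"
  then obtain u where u: "a = proj u" "homogeneous i u" by (rule grE)
  have "homogeneous i (- u)" using homogeneous_diff[OF homogeneous_zero u(2)] by simp
  then show "\<ominus>\<^bsub>CH\<^esub> a \<in> gr i" unfolding u(1) proj_uminus[symmetric] by (rule grI)
  fix b assume "b \<in> gr i"
  then obtain v where v: "b = proj v" "homogeneous i v" by (rule grE)
  show "a \<oplus>\<^bsub>CH\<^esub> b \<in> gr i" unfolding u(1) v(1) proj_add[symmetric] by (rule grI[OF homogeneous_add[OF u(2) v(2)]])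
qed

lemma subfield_gr_0: "subfield (gr 0) CH"
proof (rule CH.subfieldI[OF CH.subcringI'], rule CH.subringI)
  show "gr 0 \<subseteq> carrier CH" using proj_closed by (auto simp: gr_0)
  show "\<one>\<^bsub>CH\<^esub> \<in> gr 0" unfolding gr_0 using proj_one by (metis rangeI single_one)
  show "\<ominus>\<^bsub>CH\<^esub> h \<in> gr 0" if "h \<in> gr 0" for h
    using that subgroup.m_inv_closed[OF subgroup_gr] by (simp add: a_inv_def)
  show "h1 \<oplus>\<^bsub>CH\<^esub> h2 \<in> gr 0" if "h1 \<in> gr 0" "h2 \<in> gr 0" for h1 h2
    using subgroup.m_closed[OF subgroup_gr that] by simp
  have cm: "proj (const c) \<otimes>\<^bsub>CH\<^esub> proj (const d) = proj (const (c * d))" for c d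
    unfolding proj_mult[symmetric] by (simp add: mult_single)
  show "h1 \<otimes>\<^bsub>CH\<^esub> h2 \<in> gr 0" if "h1 \<in> gr 0" "h2 \<in> gr 0" for h1 h2
    using that cm unfolding gr_0 by auto
  have ne: "proj (const c) = \<zero>\<^bsub>CH\<^esub> \<longleftrightarrow> c = 0" for c
    unfolding proj_eq_zero using const_RI ideal.subspace_0[OF subspace_RI] by auto
  have one: "\<one>\<^bsub>CH\<^esub> = proj (const 1)" using proj_one by simp
  show "Units (CH\<lparr>carrier := gr 0\<rparr>) = gr 0 - {\<zero>\<^bsub>CH\<^esub>}"
  proof (intro equalityI subsetI)
    fix x assume x: "x \<in> Units (CH\<lparr>carrier := gr 0\<rparr>)"
    then obtain y where xy: "x \<in> gr 0" "y \<in> gr 0" "x \<otimes>\<^bsub>CH\<^esub> y = \<one>\<^bsub>CH\<^esub>" by (auto simp: Units_def)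
    then obtain c d where "x = proj (const c)" "y = proj (const d)" by (auto simp: gr_0)
    then have "proj (const (c * d)) = proj (const 1)" using xy(3) cm one by simp
    then have "const (c * d) - const 1 \<in> RI" unfolding proj_eq_iff .
    then have "const (c * d - 1) \<in> RI" by (simp add: single_diff)
    then have "c \<noteq> 0" using const_RI by fastforce
    then show "x \<in> gr 0 - {\<zero>\<^bsub>CH\<^esub>}" using xy(1) ne \<open>x = proj (const c)\<close> by simp
  next
    fix x assume x: "x \<in> gr 0 - {\<zero>\<^bsub>CH\<^esub>}"
    then obtain c where c: "x = proj (const c)" by (auto simp: gr_0)
    then have "c \<noteq> 0" using x ne by auto
    then have "x \<otimes>\<^bsub>CH\<^esub> proj (const (1 / c)) = \<one>\<^bsub>CH\<^esub>" "proj (const (1 / c)) \<otimes>\<^bsub>CH\<^esub> x = \<one>\<^bsub>CH\<^esub>"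
      unfolding c cm one by simp_all
    moreover have "proj (const (1 / c)) \<in> gr 0" by (simp add: gr_0)
    ultimately show "x \<in> Units (CH\<lparr>carrier := gr 0\<rparr>)" using x by (auto simp: Units_def)
  qed
qed

lemma decomposition:
  assumes "r \<in> carrier CH"
  shows "\<exists>!f. (\<forall>i. f i \<in> gr i) \<and> finite {i. f i \<noteq> \<zero>\<^bsub>CH\<^esub>} \<and> r = (\<Oplus>\<^bsub>CH\<^esub>i\<in>{i. f i \<noteq> \<zero>\<^bsub>CH\<^esub>}. f i)"
proof -
  obtain u where u: "r = proj u" using proj_surj[OF assms] by blast
  let ?f = "\<lambda>i. proj (part i u)"
  show ?thesis
  proof (intro ex1I conjI allI)
    show "?f i \<in> gr i" for i unfolding chow_grading_proj using homogeneous_part by blast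
    have z: "?f i = \<zero>\<^bsub>CH\<^esub>" if "i \<notin> tdeg ` supp u" for i using part_eq_0[OF that] proj_zero by simp
    then have sub: "{i. ?f i \<noteq> \<zero>\<^bsub>CH\<^esub>} \<subseteq> tdeg ` supp u" by blast
    then show "finite {i. ?f i \<noteq> \<zero>\<^bsub>CH\<^esub>}" by (rule finite_subset) simp
    have "r = (\<Oplus>\<^bsub>CH\<^esub>i\<in>tdeg ` supp u. ?f i)"
      unfolding u by (subst (1) sum_parts[of u]) (simp add: proj_sum)
    also have "\<dots> = (\<Oplus>\<^bsub>CH\<^esub>i\<in>{i. ?f i \<noteq> \<zero>\<^bsub>CH\<^esub>}. ?f i)"
      using sub proj_closed by (intro CH.add.finprod_mono_neutral_cong_right) auto
    finally show "r = (\<Oplus>\<^bsub>CH\<^esub>i\<in>{i. ?f i \<noteq> \<zero>\<^bsub>CH\<^esub>}. ?f i)" .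
    fix g assume g: "(\<forall>i. g i \<in> gr i) \<and> finite {i. g i \<noteq> \<zero>\<^bsub>CH\<^esub>} \<and> r = (\<Oplus>\<^bsub>CH\<^esub>i\<in>{i. g i \<noteq> \<zero>\<^bsub>CH\<^esub>}. g i)"
    let ?A = "{i. g i \<noteq> \<zero>\<^bsub>CH\<^esub>}"
    have "\<forall>i. \<exists>w. homogeneous i w \<and> g i = proj w" using g unfolding chow_grading_proj by blast
    then obtain w where w: "\<And>i. homogeneous i (w i)" "\<And>i. g i = proj (w i)" by metis
    have fin: "finite ?A" and "r = (\<Oplus>\<^bsub>CH\<^esub>i\<in>?A. proj (w i))" using g w(2) by auto
    then have "proj u = proj (\<Sum>i\<in>?A. w i)" using proj_sum[OF fin, of w] u by simp
    then have "u - (\<Sum>i\<in>?A. w i) \<in> RI" unfolding proj_eq_iff .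
    \<comment> \<open>Uniqueness: the difference of two representatives lies in \<open>RI\<close>,
      hence so does each of its homogeneous parts.\<close>
    then have "part k u - part k (\<Sum>i\<in>?A. w i) \<in> RI" for k using RI_part part_diff by metis
    then have "proj (part k u) = proj (part k (\<Sum>i\<in>?A. w i))" for k unfolding proj_eq_iff .
    moreover have "part k (\<Sum>i\<in>?A. w i) = (if k \<in> ?A then w k else 0)" for k
      unfolding part_sum part_homogeneous[OF w(1)] using fin by (simp add: sum.delta')
    ultimately show "g = ?f" using w(2) proj_zero by (intro ext) auto
  qed
qed

lemma generators: "generate_ring CH (gr 0 \<union> proj ` var ` L) = carrier CH"
proof
  let ?G = "generate_ring CH (gr 0 \<union> proj ` var ` L)"
  show "?G \<subseteq> carrier CH" using proj_closed by (intro CH.generate_ring_incl) (auto simp: gr_0)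
  have "psubst var u \<in> {u. proj u \<in> ?G}" for u
  proof (rule psubst_closed)
    show "const c \<in> {u. proj u \<in> ?G}" for c by (auto simp: gr_0 intro: generate_ring.incl)
    show "var A \<in> {u. proj u \<in> ?G}" for A
    proof (cases "A \<in> L")
      case False
      then have "proj (var A) = \<zero>\<^bsub>CH\<^esub>" unfolding proj_eq_zero by (intro RI_zero) simp
      then show ?thesis using CH.zero_in_generate by simp
    qed (auto intro: generate_ring.incl)
  qed (auto simp: proj_add proj_mult intro: generate_ring.eng_add generate_ring.eng_mult)
  then have "proj u \<in> ?G" for u unfolding psubst_id by blast
  then show "carrier CH \<subseteq> ?G" using proj_surj by blast
qed

lemma standard_graded_CH: "standard_graded CH gr"
  unfolding standard_graded_def
proof (intro conjI allI ballI)
  show "additive_subgroup (gr i) CH" for i by (rule additive_subgroup.intro[OF subgroup_gr])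
  show "a \<otimes>\<^bsub>CH\<^esub> b \<in> gr (i + j)" if "a \<in> gr i" "b \<in> gr j" for i j a b
  proof -
    obtain u where u: "a = proj u" "homogeneous i u" using \<open>a \<in> gr i\<close> by (rule grE)
    obtain v where v: "b = proj v" "homogeneous j v" using \<open>b \<in> gr j\<close> by (rule grE)
    show ?thesis unfolding u(1) v(1) proj_mult[symmetric] by (rule grI[OF homogeneous_mult[OF u(2) v(2)]])
  qed
  show "\<exists>S. finite S \<and> S \<subseteq> gr 1 \<and> generate_ring CH (gr 0 \<union> S) = carrier CH"
    using generators finite_L by (intro exI[of _ "proj ` var ` L"]) (auto simp: chow_grading_proj)
qed (rule CH_cring decomposition subfield_gr_0; assumption?)+

section \<open>Ideals of the Chow ring as images of ideals of polynomials\<close>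

lemma proj_image_iff: "ideal.subspace K \<Longrightarrow> RI \<subseteq> K \<Longrightarrow> proj x \<in> proj ` K \<longleftrightarrow> x \<in> K"
proof
  assume K: "ideal.subspace K" "RI \<subseteq> K" and "proj x \<in> proj ` K"
  then obtain y where "y \<in> K" "x - y \<in> RI" using proj_eq_iff by auto
  then show "x \<in> K" using ideal.subspace_add[OF K(1), of y "x - y"] K(2) by auto
qed blast

lemma family_subspace:
  assumes "K \<in> family"
  shows "ideal.subspace K" "RI \<subseteq> K"
proof -
  obtain A where A: "K = ideal.span (rels \<union> A)" using family_generated[OF assms] by blast
  show "ideal.subspace K" unfolding A by simp
  show "RI \<subseteq> K" unfolding A RI_def by (rule ideal.span_mono) auto
qed

lemma ideal_image: "ideal.subspace K \<Longrightarrow> ideal (proj ` K) CH"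
proof (rule idealI[OF CH.ring_axioms])
  assume K: "ideal.subspace K"
  show "subgroup (proj ` K) (add_monoid CH)"
  proof (rule CH.add.subgroupI)
    show "proj ` K \<subseteq> carrier CH" using proj_closed by blast
    show "proj ` K \<noteq> {}" using ideal.subspace_0[OF K] by blast
    show "\<ominus>\<^bsub>CH\<^esub> a \<in> proj ` K" if "a \<in> proj ` K" for a
      using that ideal.subspace_neg[OF K] by (auto simp flip: proj_uminus)
    show "a \<oplus>\<^bsub>CH\<^esub> b \<in> proj ` K" if "a \<in> proj ` K" "b \<in> proj ` K" for a b
      using that ideal.subspace_add[OF K] by (auto simp flip: proj_add)
  qed
  fix a x assume "a \<in> proj ` K" "x \<in> carrier CH"
  then obtain u v where uv: "a = proj u" "u \<in> K" "x = proj v" using proj_surj by blast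
  then show "x \<otimes>\<^bsub>CH\<^esub> a \<in> proj ` K" using ideal.subspace_scale[OF K] by (auto simp flip: proj_mult)
  then show "a \<otimes>\<^bsub>CH\<^esub> x \<in> proj ` K" using CH.m_comm uv proj_closed by metis
qed

lemma Idl_image: "Idl\<^bsub>CH\<^esub> (proj ` A) = proj ` ideal.span (rels \<union> A)"
proof
  have A: "proj ` A \<subseteq> carrier CH" using proj_closed by blast
  show "Idl\<^bsub>CH\<^esub> (proj ` A) \<subseteq> proj ` ideal.span (rels \<union> A)"
    by (rule CH.genideal_minimal[OF ideal_image]) (auto intro: ideal.span_base)
  interpret G: ideal "Idl\<^bsub>CH\<^esub> (proj ` A)" CH by (rule CH.genideal_ideal[OF A])
  have "ideal.subspace {u. proj u \<in> Idl\<^bsub>CH\<^esub> (proj ` A)}"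
    by (rule ideal.subspaceI)
       (use G.zero_closed G.a_closed G.I_l_closed proj_closed in \<open>simp_all add: proj_zero proj_add proj_mult\<close>)
  moreover have "rels \<union> A \<subseteq> {u. proj u \<in> Idl\<^bsub>CH\<^esub> (proj ` A)}"
  proof (intro Un_least subsetI CollectI)
    fix p assume "p \<in> rels"
    then have "proj p = \<zero>\<^bsub>CH\<^esub>" unfolding proj_eq_zero RI_def by (rule ideal.span_base)
    then show "proj p \<in> Idl\<^bsub>CH\<^esub> (proj ` A)" using G.zero_closed by simp
  qed (use CH.genideal_self[OF A] in blast)
  ultimately have "ideal.span (rels \<union> A) \<subseteq> {u. proj u \<in> Idl\<^bsub>CH\<^esub> (proj ` A)}" by (intro ideal.span_minimal)
  then show "proj ` ideal.span (rels \<union> A) \<subseteq> Idl\<^bsub>CH\<^esub> (proj ` A)" by blast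
qed

interpretation graded: graded_ring CH gr
  by (intro graded_ring.intro graded_ring_axioms.intro CH_cring standard_graded_CH)

lemma upset_positive: "upset (L - {{}})"
  by (auto simp: upset_def)

text \<open>The up-set of all nonempty flats yields the polynomials without constant term: every
  variable lies in its ideal, those outside the up-set because they are relations. This places the
  irrelevant ideal in the family.\<close>

lemma irrelevant_ideal_CH: "irrelevant_ideal CH gr = proj ` upset_ideal (L - {{}})"
proof -
  let ?K = "upset_ideal (L - {{}})"
  have K: "?K \<in> family" using upset_positive by (auto simp: family_def)
  note sub = family_subspace[OF K]
  have var_K: "var A \<in> ?K" for A
  proof (cases "A \<in> L - {{}}")
    case True
    then show ?thesis unfolding upset_ideal_def by (intro ideal.span_base) auto
  next
    case False
    then show ?thesis using sub(2) RI_zero by blast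
  qed
  have mon_K: "mon m \<in> ?K" if "m \<noteq> 0" for m
  proof -
    have "supp m \<noteq> {}" using that by simp
    then obtain v where "v \<in> supp m" unfolding ex_in_conv[symmetric] by (rule exE)
    then have "coef m v \<noteq> 0" by (simp add: in_keys_iff)
    then obtain k where k: "coef m v = Suc k" by (cases "coef m v") auto
    obtain n where n: "m = vexp v (coef m v) + n" using mon_split[of m v] by (elim exE conjE)
    have "mon m = mon (vexp v (Suc k)) * mon n" by (subst n) (simp only: k mon_add)
    then have "mon m = (mon n * var v ^ k) * var v" by (simp only: mon_vexp power_Suc mult_ac)
    then show ?thesis using ideal.subspace_scale[OF sub(1) var_K[of v], of "mon n * var v ^ k"] by (simp only:)
  qed
  have K_iff: "u \<in> ?K \<longleftrightarrow> coef u 0 = 0" for u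
  proof
    show "u \<in> ?K \<Longrightarrow> coef u 0 = 0" using family_proper[OF K] by blast
    assume u: "coef u 0 = 0"
    have "(\<Sum>m\<in>supp u. const (coef u m) * mon m) \<in> ?K"
    proof (intro ideal.subspace_sum[OF sub(1)] ideal.subspace_scale[OF sub(1)] mon_K)
      fix m assume "m \<in> supp u"
      then show "m \<noteq> 0" using u by (auto simp: in_keys_iff)
    qed
    then show "u \<in> ?K" using lin_mon[of u] by (simp only: lin_def)
  qed
  have comp: "graded.comp (proj u) = (\<lambda>i. proj (part i u))" for u
  proof (rule graded.comp_eqI[of "tdeg ` supp u"])
    show "proj (part i u) \<in> gr i" for i unfolding chow_grading_proj using homogeneous_part by blast
    show "proj u = (\<Oplus>\<^bsub>CH\<^esub>i\<in>tdeg ` supp u. proj (part i u))"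
      by (subst (1) sum_parts[of u]) (simp add: proj_sum)
  qed (simp_all add: part_eq_0 proj_zero)
  have part_0: "part 0 u = const (coef u 0)" for u :: "'a set mpoly"
    using homogeneous_0_const[OF homogeneous_part[of 0 u]] by (simp add: lookup_prestr)
  have "proj u \<in> irrelevant_ideal CH gr \<longleftrightarrow> u \<in> ?K" for u
    unfolding graded.irrelevant_ideal_eq mem_Collect_eq comp part_0 proj_eq_zero K_iff
    using proj_closed const_RI ideal.subspace_0[OF subspace_RI] by auto
  moreover have "irrelevant_ideal CH gr \<subseteq> range proj"
    unfolding graded.irrelevant_ideal_eq using proj_surj by blast
  ultimately show ?thesis by blast
qed

lemma span_insert_iff: "ideal.subspace J \<Longrightarrow> u \<in> ideal.span (insert a J) \<longleftrightarrow> (\<exists>f. u - f * a \<in> J)"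
  by (simp add: ideal.span_insert ideal.span_eq_iff[THEN iffD2])

text \<open>Transports \<open>family_step\<close> along \<open>proj\<close>. All ideals involved
  contain the kernel \<open>RI\<close>, so membership in an image is membership in the preimage, and
  colons commute with taking images.\<close>

lemma strong_filtration: "strong_koszul_filtration CH gr ((`) proj ` family)"
proof (intro strong_koszul_filtration.intro strong_koszul_filtration_axioms.intro)
  show "graded_ring CH gr" by (rule graded.graded_ring_axioms)
  show "finite ((`) proj ` family)" using finite_family by simp
  show "ideal I CH" if "I \<in> (`) proj ` family" for I using that ideal_image family_subspace(1) by blast
  show "irrelevant_ideal CH gr \<in> (`) proj ` family"
    unfolding irrelevant_ideal_CH using upset_positive by (auto simp: family_def)
  fix I assume "I \<in> (`) proj ` family" "I \<noteq> {\<zero>\<^bsub>CH\<^esub>}"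
  then obtain K where K: "K \<in> family" "I = proj ` K" by blast
  have "proj ` RI = {\<zero>\<^bsub>CH\<^esub>}" using proj_eq_zero ideal.subspace_0[OF subspace_RI] by blast
  then have "K \<noteq> RI" using K(2) \<open>I \<noteq> _\<close> by blast
  then obtain J a where J: "J \<in> family" "homogeneous (Suc 0) a" "a \<notin> J" "K = ideal.span (insert a J)"
    "{f. f * a \<in> J} \<in> family"
    using family_step[OF K(1)] by blast
  note Js = family_subspace[OF J(1)]
  have sub: "proj ` J \<subseteq> I" unfolding K(2) J(4) using ideal.span_base by (intro image_mono) blast
  have "a \<in> K" unfolding J(4) by (rule ideal.span_base) simp
  then have "proj a \<in> I" "proj a \<notin> proj ` J" using K(2) proj_image_iff[OF Js] J(3) by blast+
  then have "proj ` J \<subset> I" using sub by blast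
  moreover have "proj a \<in> gr 1" unfolding chow_grading_proj using J(2) by simp
  moreover have "I = {j \<oplus>\<^bsub>CH\<^esub> r \<otimes>\<^bsub>CH\<^esub> proj a |j r. j \<in> proj ` J \<and> r \<in> carrier CH}"
  proof (intro equalityI subsetI)
    fix x assume "x \<in> I"
    then obtain u f where u: "x = proj u" "u - f * a \<in> J" unfolding K(2) J(4) using span_insert_iff[OF Js(1)] by blast
    have "x = proj (u - f * a) \<oplus>\<^bsub>CH\<^esub> proj f \<otimes>\<^bsub>CH\<^esub> proj a"
      unfolding u(1) proj_mult[symmetric] proj_add[symmetric] by simp
    then show "x \<in> {j \<oplus>\<^bsub>CH\<^esub> r \<otimes>\<^bsub>CH\<^esub> proj a |j r. j \<in> proj ` J \<and> r \<in> carrier CH}"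
      using u(2) proj_closed by blast
  next
    fix x assume "x \<in> {j \<oplus>\<^bsub>CH\<^esub> r \<otimes>\<^bsub>CH\<^esub> proj a |j r. j \<in> proj ` J \<and> r \<in> carrier CH}"
    then obtain j r where "x = proj j \<oplus>\<^bsub>CH\<^esub> r \<otimes>\<^bsub>CH\<^esub> proj a" "j \<in> J" "r \<in> carrier CH" by blast
    moreover from this obtain f where "r = proj f" using proj_surj by blast
    ultimately have x: "x = proj (j + f * a)" "j \<in> J" by (simp_all add: proj_add proj_mult)
    have "j + f * a \<in> K" unfolding J(4) span_insert_iff[OF Js(1)] using x(2) by (intro exI[of _ f]) simp
    then show "x \<in> I" unfolding K(2) x(1) by blast
  qed
  moreover have "{r \<in> carrier CH. r \<otimes>\<^bsub>CH\<^esub> proj a \<in> proj ` J} = proj ` {f. f * a \<in> J}"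
  proof (intro equalityI subsetI)
    fix r assume r: "r \<in> {r \<in> carrier CH. r \<otimes>\<^bsub>CH\<^esub> proj a \<in> proj ` J}"
    then obtain f where f: "r = proj f" using proj_surj by blast
    have "proj (f * a) \<in> proj ` J" unfolding proj_mult using r f by simp
    then have "f * a \<in> J" unfolding proj_image_iff[OF Js] .
    then show "r \<in> proj ` {f. f * a \<in> J}" using f by blast
  next
    fix r assume "r \<in> proj ` {f. f * a \<in> J}"
    then obtain f where f: "r = proj f" "f * a \<in> J" by blast
    then show "r \<in> {r \<in> carrier CH. r \<otimes>\<^bsub>CH\<^esub> proj a \<in> proj ` J}"
      using proj_closed by (simp flip: proj_mult)
  qed
  ultimately show "\<exists>J\<in>(`) proj ` family. \<exists>a\<in>gr 1. J \<subset> I \<and>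
      I = {j \<oplus>\<^bsub>CH\<^esub> r \<otimes>\<^bsub>CH\<^esub> a |j r. j \<in> J \<and> r \<in> carrier CH} \<and> {r \<in> carrier CH. r \<otimes>\<^bsub>CH\<^esub> a \<in> J} \<in> (`) proj ` family"
    using J(1,5) by (intro bexI[of _ "proj ` J"] bexI[of _ "proj a"] conjI) simp_all
qed

end

text \<open>Since \<open>I\<close> is \<open>J\<close> plus the multiples of \<open>a\<close>, a
  ring element carries \<open>I\<close> into \<open>J\<close> as soon as it carries \<open>a\<close>
  there. So the colon of ideals is the colon of the element.\<close>

lemma (in strong_koszul_filtration) koszul_filtration:
  assumes zero: "{\<zero>} \<in> \<F>" and linear: "\<And>I. I \<in> \<F> \<Longrightarrow> \<exists>S\<subseteq>gr 1. I = Idl S"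
  shows "koszul_filtration R gr \<F>"
  unfolding koszul_filtration_def
proof (intro conjI ballI impI)
  fix I assume I: "I \<in> \<F>" "I \<noteq> {\<zero>}"
  obtain J a where J: "J \<in> \<F>" "a \<in> gr 1" "J \<subset> I" "I = {j \<oplus> r \<otimes> a |j r. j \<in> J \<and> r \<in> carrier R}"
    "{r \<in> carrier R. r \<otimes> a \<in> J} \<in> \<F>"
    using filtration_step[OF I] by blast
  interpret J: ideal J R by (rule filtration_ideal[OF J(1)])
  have a: "a \<in> carrier R" using gr_carrier[OF J(2)] .
  have "a = \<zero> \<oplus> \<one> \<otimes> a" using a by simp
  then have aI: "a \<in> I" using J(4) J.zero_closed by blast
  have "I = J <+> PIdl a" unfolding J(4) set_add_def' cgenideal_def by blast
  moreover have "colon_ideal R J I = {r \<in> carrier R. r \<otimes> a \<in> J}"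
  proof (intro equalityI subsetI)
    fix r assume r: "r \<in> {r \<in> carrier R. r \<otimes> a \<in> J}"
    have "r \<otimes> x \<in> J" if x: "x \<in> I" for x
    proof -
      obtain j s where js: "x = j \<oplus> s \<otimes> a" "j \<in> J" "s \<in> carrier R" using x[unfolded J(4)] by blast
      have "r \<otimes> x = r \<otimes> j \<oplus> s \<otimes> (r \<otimes> a)"
        using r a js J.a_Hcarr[OF js(2)] by (simp add: r_distr m_lcomm)
      moreover have "\<dots> \<in> J" using r js J.I_l_closed J.a_closed by simp
      ultimately show ?thesis by simp
    qed
    then show "r \<in> colon_ideal R J I" using r by (simp add: colon_ideal_def)
  qed (use aI in \<open>auto simp: colon_ideal_def\<close>)
  ultimately show "\<exists>J\<in>\<F>. J \<subset> I \<and> (\<exists>a\<in>I. I = J <+> PIdl a) \<and> colon_ideal R J I \<in> \<F>"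
    using J(1,3,5) aI by (intro bexI[of _ J] conjI) auto
qed (use graded zero linear irrelevant_filtration filtration_ideal in blast)+

theorem theorem5p10:
  fixes E :: "'a set" and indep :: "'a set \<Rightarrow> bool"
  assumes "simple_matroid E indep"
  shows "(\<exists>\<F>. koszul_filtration (augmented_chow_ring E indep) (chow_grading E indep) \<F>) \<and>
    (\<exists>P. is_poincare_series (augmented_chow_ring E indep) (chow_grading E indep) P \<and>
         rational_fps P)"
proof -
  interpret C: chow_ring E indep by (rule chow_ring.intro) fact
  \<comment> \<open>Any numbering serves; the ideals of the filtration depend on the choice.\<close>
  obtain pos :: "'a \<Rightarrow> nat" where "inj_on pos E" using finite_imp_inj_to_nat_seg[OF C.finite_E] by blast
  then interpret C: ordered_chow_ring E indep pos
    by (intro ordered_chow_ring.intro ordered_chow_ring_axioms.intro C.chow_ring_axioms)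
  interpret F: strong_koszul_filtration "augmented_chow_ring E indep" "chow_grading E indep" "(`) C.proj ` C.family"
    by (rule C.strong_filtration)
  have "koszul_filtration (augmented_chow_ring E indep) (chow_grading E indep) ((`) C.proj ` C.family)"
  proof (rule F.koszul_filtration)
    have "C.proj ` C.RI = {\<zero>\<^bsub>augmented_chow_ring E indep\<^esub>}"
      using C.proj_eq_zero ideal.subspace_0[OF C.subspace_RI] by blast
    then show "{\<zero>\<^bsub>augmented_chow_ring E indep\<^esub>} \<in> (`) C.proj ` C.family" using C.RI_family by (metis image_eqI)
    fix I assume "I \<in> (`) C.proj ` C.family"
    then obtain K where K: "K \<in> C.family" "I = C.proj ` K" by blast
    then obtain A where A: "\<forall>a\<in>A. homogeneous (Suc 0) a" "K = ideal.span (C.rels \<union> A)"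
      using C.family_generated by blast
    have "C.proj ` A \<subseteq> chow_grading E indep 1" unfolding C.chow_grading_proj using A(1) by auto
    moreover have "I = Idl\<^bsub>augmented_chow_ring E indep\<^esub> (C.proj ` A)" unfolding C.Idl_image K(2) A(2) ..
    ultimately show "\<exists>S\<subseteq>chow_grading E indep 1. I = Idl\<^bsub>augmented_chow_ring E indep\<^esub> S" by blast
  qed
  then show ?thesis using F.rational_poincare_series by blast
qed

end
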